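(* Let $p,q\in L^1(\mathbb{T})$ be real-valued and let $\mu_n$ denote the eigenvalues of the operator $H$. For all sufficiently large $n\in\mathbb{N}$ the eigenvalue $\mu_n$ is real and has algebraic multiplicity one. Moreover, $$\mu_n=\Big(\frac{\pi}{2}+\pi n\Big)^4+\Big(\frac{\pi}{2}+\pi n\Big)^2\big(\widehat{p}_{cn}-p_0\big)+\mathcal{O}(n)\qquad\text{as } n\to+\infty .$$ If, in addition, $p''',q'\in L^1(\mathbb{T})$, then $$\mu_n=\Big(\frac{\pi}{2}+\pi n\Big)^4+\Big(\frac{\pi}{2}+\pi n\Big)^2\big(\widehat{p}_{cn}-p_0\big)+\frac{p_0^2-\|p\|^2}{8}+q_0+\widehat{q}_{cn}+\mathcal{O}(n^{-2})\qquad\text{as } n\to+\infty .$$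
   Context: $\mathbb{T}=\mathbb{R}/\mathbb{Z}$; functions on $\mathbb{T}$ are $1$-periodic functions on $\mathbb{R}$. The assumption $f^{(k)}\in L^1(\mathbb{T})$ means that $f$ is $1$-periodic, $f,\dots,f^{(k-1)}$ are absolutely continuous and $1$-periodic, and $f^{(k)}\in L^1(\mathbb{T})$. $\|p\|^2=\int_0^1p(x)^2\,dx$. The self-adjoint operator $H$ acts in $L^2(0,1)$ by $Hy=y^{(4)}+(py')'+qy$ on the domain of all $y\in L^2(0,1)$ with $y',y'',y'''+py'\in L^1(0,1)$, $y^{(4)}+(py')'+qy\in L^2(0,1)$ and $y'(0)=y'''(0)+p(0)y'(0)=y(1)=y''(1)=0$. Here $y^{(4)}+(py')'=(y'''+py')'$, and $y'''(0)+p(0)y'(0)$ is the value at $0$ of the (absolutely continuous) quasi-derivative $y'''+py'$. Let $\varphi_j(x,\lambda)$, $j=1,2,3,4$, be the solutions of $y^{(4)}+(py')'+qy=\lambda y$ with $\varphi_j^{(k-1)}(0,\lambda)=\delta_{jk}$ for $k=1,2,3$ and $(\varphi_j'''+p\varphi_j')(0,\lambda)=\delta_{j4}$. The spectrum of $H$ is the zero set of the entire function $$D(\lambda)=-\det\begin{pmatrix}\varphi_1(1,\lambda)&\varphi_3(1,\lambda)\\ \varphi_1''(1,\lambda)&\varphi_3''(1,\lambda)\end{pmatrix},$$ and eigenvalues are counted with multiplicity as zeros of $D$ (algebraic multiplicity = order of the zero). Labelling: put $z=\lambda^{1/4}$ with $\arg z\in(-\frac{\pi}{4},\frac{\pi}{4}]$,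 and $\mathcal{D}_n=\{\lambda\in\mathbb{C}:|z-\frac{\pi}{2}-\pi n|<\frac{\pi}{4}\}$ for integers $n\ge 0$. For every sufficiently large integer $N$, $D$ has exactly $N+1$ zeros (with multiplicity) in the disk $\{|\lambda|<(\frac{\pi}{2}+\pi(N+\frac12))^4\}$ and exactly one zero in $\mathcal{D}_n$ for each $n>N$. The zero in $\mathcal{D}_n$, $n>N$, is denoted by $\mu_n$; the zeros in the disk are labelled $\mu_0,\dots,\mu_N$ in order of non-decreasing real part. Fourier coefficients: $f_0=\int_0^1f(x)\,dx$, $\widehat{f}_{cn}=\int_0^1f(x)\cos(\pi(2n+1)x)\,dx$. *)

theory Defs
  imports "HOL-Complex_Analysis.Complex_Analysis" "HOL-Library.Landau_Symbols"
begin

(* F is absolutely continuous on [a,b] with almost-everywhere derivative f in L^1(a,b). *)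
definition AC_with_deriv ::
    "real \<Rightarrow> real \<Rightarrow> (real \<Rightarrow> 'a::euclidean_space) \<Rightarrow> (real \<Rightarrow> 'a) \<Rightarrow> bool" where
  "AC_with_deriv a b F f \<longleftrightarrow>
     f absolutely_integrable_on {a..b} \<and> (\<forall>x\<in>{a..b}. F x = F a + integral {a..x} f)"

(* The k-th derivative of f belongs to L^1(R/Z); g j is the j-th derivative of f.
   For k = 0 this says that f itself is a (1-periodic) L^1 function. *)
definition deriv_in_L1_torus :: "nat \<Rightarrow> (real \<Rightarrow> real) \<Rightarrow> bool" where
  "deriv_in_L1_torus k f \<longleftrightarrow>
     (\<exists>g :: nat \<Rightarrow> real \<Rightarrow> real. g 0 = f \<and>
        (\<forall>j\<le>k. \<forall>x. g j (x + 1) = g j x) \<and>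
        g k absolutely_integrable_on {0..1} \<and>
        (\<forall>j<k. \<forall>a b. a \<le> b \<longrightarrow> AC_with_deriv a b (g j) (g (Suc j))))"

definition in_L2 :: "(real \<Rightarrow> complex) \<Rightarrow> bool" where
  "in_L2 v \<longleftrightarrow> set_borel_measurable lebesgue {0..1} v \<and>
     set_integrable lebesgue {0..1} (\<lambda>x. (cmod (v x))\<^sup>2)"

(* Y 0, ..., Y 3 are y, y', y'', y''' + p y' on [0,1], all absolutely continuous,
   and g = (y''' + p y')' = y'''' + (p y')'. *)
definition quasi_derivs ::
    "(real \<Rightarrow> real) \<Rightarrow> (nat \<Rightarrow> real \<Rightarrow> complex) \<Rightarrow> (real \<Rightarrow> complex) \<Rightarrow> bool" where
  "quasi_derivs p Y g \<longleftrightarrow>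
     AC_with_deriv 0 1 (Y 0) (Y 1) \<and>
     AC_with_deriv 0 1 (Y 1) (Y 2) \<and>
     AC_with_deriv 0 1 (Y 2) (\<lambda>x. Y 3 x - of_real (p x) * Y 1 x) \<and>
     AC_with_deriv 0 1 (Y 3) g"

(* The graph of H: y lies in the domain of H, and H y = v as elements of L^2(0,1). *)
definition H_maps ::
    "(real \<Rightarrow> real) \<Rightarrow> (real \<Rightarrow> real) \<Rightarrow> (real \<Rightarrow> complex) \<Rightarrow> (real \<Rightarrow> complex) \<Rightarrow> bool" where
  "H_maps p q y v \<longleftrightarrow>
     (\<exists>Y g. Y 0 = y \<and> quasi_derivs p Y g \<and> in_L2 y \<and> in_L2 v \<and>
        (AE x\<in>{0..1} in lebesgue. v x = g x + of_real (q x) * y x) \<and>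
        Y 1 0 = 0 \<and> Y 3 0 = 0 \<and> Y 0 1 = 0 \<and> Y 2 1 = 0)"

definition H_eigenvalue :: "(real \<Rightarrow> real) \<Rightarrow> (real \<Rightarrow> real) \<Rightarrow> complex \<Rightarrow> bool" where
  "H_eigenvalue p q lam \<longleftrightarrow>
     (\<exists>y. H_maps p q y (\<lambda>x. lam * y x) \<and> \<not> (AE x\<in>{0..1} in lebesgue. y x = 0))"

definition solves_ode ::
    "(real \<Rightarrow> real) \<Rightarrow> (real \<Rightarrow> real) \<Rightarrow> complex \<Rightarrow> (nat \<Rightarrow> real \<Rightarrow> complex) \<Rightarrow> bool" where
  "solves_ode p q lam Y \<longleftrightarrow> quasi_derivs p Y (\<lambda>x. (lam - of_real (q x)) * Y 0 x)"

(* phi p q lam j k is the k-th quasi-derivative of the fundamental solution phi_j (j = 1, ..., 4);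
   it is uniquely determined on [0,1] for k = 0, ..., 3. *)
definition phi ::
    "(real \<Rightarrow> real) \<Rightarrow> (real \<Rightarrow> real) \<Rightarrow> complex \<Rightarrow> nat \<Rightarrow> nat \<Rightarrow> real \<Rightarrow> complex" where
  "phi p q lam j =
     (SOME Y. solves_ode p q lam Y \<and> (\<forall>k\<in>{1..4}. Y (k - 1) 0 = (if j = k then 1 else 0)))"

definition char_fun :: "(real \<Rightarrow> real) \<Rightarrow> (real \<Rightarrow> real) \<Rightarrow> complex \<Rightarrow> complex" where
  "char_fun p q lam =
     - (phi p q lam 1 0 1 * phi p q lam 3 2 1 - phi p q lam 3 0 1 * phi p q lam 1 2 1)"

definition alg_mult :: "(real \<Rightarrow> real) \<Rightarrow> (real \<Rightarrow> real) \<Rightarrow> complex \<Rightarrow> nat" where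
  "alg_mult p q lam = nat (zorder (char_fun p q) lam)"

(* Number of eigenvalues in S counted with multiplicity (0 if there are infinitely many). *)
definition eig_count :: "(real \<Rightarrow> real) \<Rightarrow> (real \<Rightarrow> real) \<Rightarrow> complex set \<Rightarrow> nat" where
  "eig_count p q S = (\<Sum>lam\<in>{lam\<in>S. H_eigenvalue p q lam}. alg_mult p q lam)"

definition big_disk :: "nat \<Rightarrow> complex set" where
  "big_disk N = {lam. cmod lam < (pi / 2 + pi * (real N + 1 / 2)) ^ 4}"

(* The principal power lam powr (1/4) has argument in (-pi/4, pi/4]. *)
definition Dset :: "nat \<Rightarrow> complex set" where
  "Dset n = {lam. cmod (lam powr (1 / 4) - of_real (pi / 2 + pi * real n)) < pi / 4}"

definition eig_labelling :: "(real \<Rightarrow> real) \<Rightarrow> (real \<Rightarrow> real) \<Rightarrow> (nat \<Rightarrow> complex) \<Rightarrow> bool" where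
  "eig_labelling p q m \<longleftrightarrow>
     (\<forall>\<^sub>F N in sequentially.
        eig_count p q (big_disk N) = N + 1 \<and>
        (\<forall>n>N. eig_count p q (Dset n) = 1 \<and> m n \<in> Dset n \<and> H_eigenvalue p q (m n)) \<and>
        (\<forall>n\<le>N. m n \<in> big_disk N \<and> H_eigenvalue p q (m n)) \<and>
        (\<forall>lam\<in>big_disk N. H_eigenvalue p q lam \<longrightarrow>
            card {n. n \<le> N \<and> m n = lam} = alg_mult p q lam) \<and>
        (\<forall>i j. i \<le> j \<and> j \<le> N \<longrightarrow> Re (m i) \<le> Re (m j)))"

(* A labelling is unique up to the order of finitely many eigenvalues with equal real part. *)
definition mu :: "(real \<Rightarrow> real) \<Rightarrow> (real \<Rightarrow> real) \<Rightarrow> nat \<Rightarrow> complex" where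
  "mu p q = (SOME m. eig_labelling p q m)"

definition fourier0 :: "(real \<Rightarrow> real) \<Rightarrow> real" where
  "fourier0 f = integral {0..1} f"

definition fourier_c :: "(real \<Rightarrow> real) \<Rightarrow> nat \<Rightarrow> real" where
  "fourier_c f n = integral {0..1} (\<lambda>x. f x * cos (pi * (2 * real n + 1) * x))"

definition norm_sq :: "(real \<Rightarrow> real) \<Rightarrow> real" where
  "norm_sq f = integral {0..1} (\<lambda>x. (f x)\<^sup>2)"

end

theory Submission
  imports Defs "HOL-Library.Multiset"
begin

text \<open>Write \<open>\<lambda> = z\<^sup>4\<close>. The \<open>2 \<times> 2\<close> minors of the pair \<open>\<phi>\<^sub>1, \<phi>\<^sub>3\<close> satisfy a linear system
  whose unperturbed exponents are \<open>z (\<plusminus>1 \<plusminus> \<i>)\<close> and \<open>0\<close>; variation of constants compares \<open>D\<close> with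
  \<open>- cosh z cos z\<close>, and Rouche's theorem puts exactly one zero into each annulus between consecutive disks.
  The problem is invariant under conjugation, so this zero is real.

  For the expansions, an eigenfunction \<open>y\<close> with real \<open>z\<close> is split into \<open>B = - y'' - (p/2) y + z\<^sup>2 y\<close>, which oscillates,
  and \<open>A = - y'' - (p/2) y - z\<^sup>2 y\<close>, which the exponential dichotomy and the boundary conditions make small.
  For integrable coefficients a first-order comparison of \<open>y\<close> with \<open>cos (z x)\<close> suffices. For smooth ones \<open>B\<close> solves a
  Schroedinger equation up to a small error; its Wronskian with a Liouville--Green function whose phase is \<open>\<theta>\<close>
  gives \<open>sin (2 \<theta>(1))\<close> up to \<open>O(z\<^sup>-\<^sup>5)\<close>, and inverting
  \<open>\<theta>(1) = z + p\<^sub>0 / (4 z) + 3 \<parallel>p\<parallel>\<^sup>2 / (64 z\<^sup>3) + O(z\<^sup>-\<^sup>5)\<close> yields \<open>z\<^sup>4\<close>.\<close>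

section \<open>Absolutely continuous functions\<close>

text \<open>With merely integrable coefficients nothing can be differentiated pointwise. A function
  therefore travels together with its derivative as a pair satisfying an integral identity
  (\<open>AC_with_deriv\<close>), and product rule, integration by parts and variation of constants
  are carried out on such pairs.

  The estimates for large \<open>z\<close> are closed by one device. The maximum of the solution in
  a weighted norm is inserted on the right-hand side, variation of constants returns it with a
  factor of order \<open>1/z\<close>, and for large \<open>z\<close> this is absorbed on the left.

  The accuracy needed in the phase is dictated by the fourth power. An error \<open>e\<close> in
  \<open>z\<close> costs about \<open>4 z^3 e\<close> in \<open>z^4\<close>, so the remainder
  \<open>O(n)\<close> asks for the phase up to \<open>O(z^-2)\<close>, and \<open>O(n^-2)\<close>
  asks for it up to \<open>O(z^-5)\<close>. The latter forces an amplitude correction in the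
  comparison function and one more integration by parts against its residual potential
  \<open>W\<close>.\<close>

lemma absolutely_integrable_mult_continuous:
  fixes f g :: "real \<Rightarrow> 'a::{euclidean_space,real_normed_field}"
  assumes "f absolutely_integrable_on {a..b}" and "continuous_on {a..b} g"
  shows "(\<lambda>x. f x * g x) absolutely_integrable_on {a..b}"
proof -
  have "bounded (g ` {a..b})"
    using assms(2) compact_continuous_image compact_imp_bounded compact_Icc by blast
  moreover have "g \<in> borel_measurable (lebesgue_on {a..b})"
    using assms(2) by (simp add: continuous_imp_measurable_on_sets_lebesgue)
  ultimately have "(\<lambda>x. g x * f x) absolutely_integrable_on {a..b}"
    using absolutely_integrable_bounded_measurable_product[OF bilinear_times, where f=g and g=f] assms(1) by auto
  then show ?thesis by (simp add: mult.commute)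
qed

lemma absolutely_integrable_continuous_mult:
  fixes f g :: "real \<Rightarrow> 'a::{euclidean_space,real_normed_field}"
  assumes "continuous_on {a..b} f" and "g absolutely_integrable_on {a..b}"
  shows "(\<lambda>x. f x * g x) absolutely_integrable_on {a..b}"
  using absolutely_integrable_mult_continuous[OF assms(2,1)] by (simp add: mult.commute)

lemma absolutely_integrable_of_real:
  assumes "p absolutely_integrable_on {a..b::real}"
  shows "(\<lambda>x. complex_of_real (p x)) absolutely_integrable_on {a..b}"
  using absolutely_integrable_linear[OF assms bounded_linear_of_real] by (simp add: o_def)

lemma abs_int_norm:
  fixes f :: "real \<Rightarrow> 'a::euclidean_space"
  assumes "f absolutely_integrable_on S"
  shows "(\<lambda>x. norm (f x)) integrable_on S" "f integrable_on S"
  using assms by (auto simp: absolutely_integrable_on_def)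

lemma absolutely_integrable_imp_integrable_subinterval:
  fixes f :: "real \<Rightarrow> 'a::euclidean_space"
  assumes "f absolutely_integrable_on {a..b}" "a \<le> x" "y \<le> b"
  shows "f integrable_on {x..y}"
proof -
  have "f absolutely_integrable_on {x..y}"
    by (rule absolutely_integrable_on_subinterval[OF assms(1)]) (use assms in auto)
  then show ?thesis by (rule abs_int_norm)
qed

lemma AC_integrable: "AC_with_deriv a b F f \<Longrightarrow> f absolutely_integrable_on {a..b}"
  unfolding AC_with_deriv_def by blast

lemma AC_eq: "AC_with_deriv a b F f \<Longrightarrow> x \<in> {a..b} \<Longrightarrow> F x = F a + integral {a..x} f"
  unfolding AC_with_deriv_def by blast

lemma AC_increment:
  assumes "AC_with_deriv a b F f" "a \<le> x" "x \<le> y" "y \<le> b"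
  shows "F y - F x = integral {x..y} f"
proof -
  have i: "f integrable_on {a..y}"
    by (rule absolutely_integrable_imp_integrable_subinterval[OF AC_integrable[OF assms(1)]]) (use assms in auto)
  have "F y = F a + integral {a..y} f" "F x = F a + integral {a..x} f"
    using AC_eq[OF assms(1), of y] AC_eq[OF assms(1), of x] assms by simp_all
  moreover have "integral {a..y} f = integral {a..x} f + integral {x..y} f"
    using Henstock_Kurzweil_Integration.integral_combine[OF assms(2,3) i] by simp
  ultimately show ?thesis by simp
qed

lemma AC_continuous:
  assumes "AC_with_deriv a b F f"
  shows "continuous_on {a..b} F"
proof -
  have "continuous_on {a..b} (\<lambda>x. F a + integral {a..x} f)"
    by (intro continuous_intros indefinite_integral_continuous_1 abs_int_norm(2) AC_integrable[OF assms])
  then show ?thesis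
    by (rule continuous_on_eq) (rule AC_eq[OF assms, symmetric])
qed

lemma AC_indefinite_integral:
  assumes "f absolutely_integrable_on {a..b}"
  shows "AC_with_deriv a b (\<lambda>x. c + integral {a..x} f) f"
  using assms by (auto simp: AC_with_deriv_def)

lemma AC_of_has_derivative:
  assumes "\<And>x. x \<in> {a..b} \<Longrightarrow> (F has_vector_derivative f x) (at x within {a..b})"
    and "continuous_on {a..b} f"
  shows "AC_with_deriv a b F f"
  unfolding AC_with_deriv_def
proof (intro conjI ballI)
  show "f absolutely_integrable_on {a..b}"
    by (rule absolutely_integrable_continuous_real[OF assms(2)])
  fix x assume x: "x \<in> {a..b}"
  have "(f has_integral (F x - F a)) {a..x}"
    using x by (intro fundamental_theorem_of_calculus)
      (auto intro!: has_vector_derivative_within_subset[OF assms(1)])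
  then show "F x = F a + integral {a..x} f"
    by (simp add: integral_unique)
qed

lemma AC_has_derivative:
  assumes "AC_with_deriv a b F f" "continuous_on {a..b} f" "x \<in> {a..b}"
  shows "(F has_vector_derivative f x) (at x within {a..b})"
proof -
  have "((\<lambda>x. F a + integral {a..x} f) has_vector_derivative f x) (at x within {a..b})"
    using integral_has_vector_derivative[OF assms(2,3)]
    by (auto intro!: derivative_eq_intros)
  then show ?thesis
    by (rule has_vector_derivative_transform[OF assms(3), rotated]) (rule AC_eq[OF assms(1)])
qed

lemma AC_cong:
  assumes "AC_with_deriv a b F f" "\<And>x. x \<in> {a..b} \<Longrightarrow> F x = G x" "\<And>x. x \<in> {a..b} \<Longrightarrow> f x = g x"
  shows "AC_with_deriv a b G g"
  unfolding AC_with_deriv_def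
proof (intro conjI ballI)
  show "g absolutely_integrable_on {a..b}"
    using AC_integrable[OF assms(1)] assms(3) set_integrable_cong[of lebesgue lebesgue "{a..b}" "{a..b}" f g] by auto
  fix x assume x: "x \<in> {a..b}"
  have "integral {a..x} f = integral {a..x} g"
    using x assms(3) by (intro Henstock_Kurzweil_Integration.integral_cong) auto
  moreover note AC_eq[OF assms(1) x]
  ultimately show "G x = G a + integral {a..x} g"
    using assms(2)[OF x] assms(2)[of a] x by simp
qed

text \<open>The operator determines its image only almost everywhere. Altering a derivative on a
  null set changes no integral, so an eigenfunction in the sense of \<open>H_maps\<close> becomes a
  solution in the sense of \<open>solves_ode\<close>.\<close>

lemma AC_cong_AE:
  assumes "AC_with_deriv a b F f" "AE x\<in>{a..b} in lebesgue. f x = g x"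
  shows "AC_with_deriv a b F g"
proof -
  obtain N where N: "N \<in> null_sets lebesgue" "{x. \<not> (x \<in> {a..b} \<longrightarrow> f x = g x)} \<subseteq> N"
    using assms(2) unfolding completion.AE_iff_null_sets by auto
  then have neg: "negligible N" by (simp add: negligible_iff_null_sets)
  show ?thesis
    unfolding AC_with_deriv_def
  proof (intro conjI ballI)
    show "g absolutely_integrable_on {a..b}"
      using N by (intro absolutely_integrable_spike[OF AC_integrable[OF assms(1)] neg]) auto
    fix x assume x: "x \<in> {a..b}"
    have "integral {a..x} f = integral {a..x} g"
      using N x by (intro integral_spike[OF neg]) auto
    then show "F x = F a + integral {a..x} g"
      using AC_eq[OF assms(1) x] by simp
  qed
qed

lemma AC_linear:
  assumes "AC_with_deriv a b F f" "bounded_linear h"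
  shows "AC_with_deriv a b (\<lambda>x. h (F x)) (\<lambda>x. h (f x))"
  unfolding AC_with_deriv_def
proof (intro conjI ballI)
  show "(\<lambda>x. h (f x)) absolutely_integrable_on {a..b}"
    using absolutely_integrable_linear[OF AC_integrable[OF assms(1)] assms(2)] by (simp add: o_def)
  fix x assume x: "x \<in> {a..b}"
  have i: "f integrable_on {a..x}"
    by (rule absolutely_integrable_imp_integrable_subinterval[OF AC_integrable[OF assms(1)]]) (use x in auto)
  show "h (F x) = h (F a) + integral {a..x} (\<lambda>x. h (f x))"
    using integral_linear[OF i assms(2)] linear_add[OF bounded_linear.linear[OF assms(2)]]
    by (subst AC_eq[OF assms(1) x]) (simp add: o_def)
qed

lemma AC_add:
  assumes "AC_with_deriv a b F f" "AC_with_deriv a b G g"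
  shows "AC_with_deriv a b (\<lambda>x. F x + G x) (\<lambda>x. f x + g x)"
  unfolding AC_with_deriv_def
proof (intro conjI ballI)
  show "(\<lambda>x. f x + g x) absolutely_integrable_on {a..b}"
    using assms by (intro set_integral_add(1) AC_integrable)
  fix x assume x: "x \<in> {a..b}"
  have "f integrable_on {a..x}" "g integrable_on {a..x}"
    using absolutely_integrable_imp_integrable_subinterval[OF AC_integrable[OF assms(1)], of a x]
      absolutely_integrable_imp_integrable_subinterval[OF AC_integrable[OF assms(2)], of a x] x by auto
  then show "F x + G x = F a + G a + integral {a..x} (\<lambda>x. f x + g x)"
    by (subst AC_eq[OF assms(1) x], subst AC_eq[OF assms(2) x]) (simp add: Henstock_Kurzweil_Integration.integral_add)
qed

lemma AC_minus: "AC_with_deriv a b F f \<Longrightarrow> AC_with_deriv a b (\<lambda>x. - F x) (\<lambda>x. - f x)"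
  using AC_linear[of a b F f uminus] by (simp add: bounded_linear_minus)

lemma AC_diff:
  assumes "AC_with_deriv a b F f" "AC_with_deriv a b G g"
  shows "AC_with_deriv a b (\<lambda>x. F x - G x) (\<lambda>x. f x - g x)"
  using AC_add[OF assms(1) AC_minus[OF assms(2)]] by simp

lemma AC_const: "AC_with_deriv a b (\<lambda>x. c) (\<lambda>x. 0)"
  by (simp add: AC_with_deriv_def)

lemma AC_cmult:
  fixes F :: "real \<Rightarrow> 'a::{euclidean_space,real_normed_field}"
  assumes "AC_with_deriv a b F f"
  shows "AC_with_deriv a b (\<lambda>x. c * F x) (\<lambda>x. c * f x)"
  using AC_linear[OF assms bounded_linear_mult_right] by simp

lemma AC_of_real:
  "AC_with_deriv a b F f \<Longrightarrow> AC_with_deriv a b (\<lambda>x. complex_of_real (F x)) (\<lambda>x. complex_of_real (f x))"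
  using AC_linear[OF _ bounded_linear_of_real] by blast

text \<open>A local modulus bound with arbitrarily small constant forces the increment to vanish.\<close>

lemma increment_bound_uniform_partition:
  fixes Phi :: "real \<Rightarrow> 'a::real_normed_vector" and K :: "real \<Rightarrow> real"
  assumes "a \<le> b" "0 < d"
    and loc: "\<And>x y. a \<le> x \<Longrightarrow> x \<le> y \<Longrightarrow> y \<le> b \<Longrightarrow> y - x < d \<Longrightarrow> norm (Phi y - Phi x) \<le> K y - K x"
  shows "norm (Phi b - Phi a) \<le> K b - K a"
proof -
  obtain n :: nat where n: "(b - a) / d < n" using reals_Archimedean2 by blast
  have n0: "n > 0" using n assms by (metis diff_ge_0_iff_ge divide_nonneg_pos leD of_nat_0 gr0I)
  define t where "t i = a + (b - a) * real i / n" for i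
  have step: "t (Suc i) - t i < d" for i
  proof -
    have "(b - a) / n < d" using n n0 assms(2) by (simp add: field_simps)
    moreover have "t (Suc i) - t i = (b - a) / n" using n0 by (simp add: t_def field_simps)
    ultimately show ?thesis by simp
  qed
  have mono: "t i \<le> t (Suc i)" for i
    using assms(1) n0 by (simp add: t_def field_simps mult_left_mono)
  have "i \<le> n \<Longrightarrow> norm (Phi (t i) - Phi a) \<le> K (t i) - K a" for i
  proof (induction i)
    case 0
    then show ?case by (simp add: t_def)
  next
    case (Suc i)
    have le: "t (Suc i) \<le> b"
    proof -
      have "(b - a) * real (Suc i) \<le> (b - a) * n"
        using Suc.prems assms(1) by (intro mult_left_mono) auto
      then have "(b - a) * real (Suc i) / n \<le> b - a"
        using n0 by (simp add: field_simps)
      then show ?thesis by (simp add: t_def)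
    qed
    have ge: "a \<le> t i" using assms(1) by (simp add: t_def)
    have "norm (Phi (t (Suc i)) - Phi (t i)) \<le> K (t (Suc i)) - K (t i)"
      by (rule loc[OF ge mono le step])
    moreover have "norm (Phi (t (Suc i)) - Phi a) \<le> norm (Phi (t (Suc i)) - Phi (t i)) + norm (Phi (t i) - Phi a)"
      by (metis diff_add_cancel add_diff_eq norm_triangle_ineq)
    ultimately show ?case using Suc by auto
  qed
  from this[of n] show ?thesis using n0 by (simp add: t_def)
qed

text \<open>Almost-everywhere differentiation is bypassed. The difference \<open>Phi\<close> between
  the product and the integral of the expected derivative has increments at most \<open>e\<close>
  times the integral of \<open>norm f + norm g\<close> on every sufficiently short interval, by
  uniform continuity of both factors; adding up over a partition and letting \<open>e\<close> tend
  to 0 makes \<open>Phi\<close> constant.\<close>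

lemma AC_mult:
  fixes F G :: "real \<Rightarrow> 'a::{euclidean_space,real_normed_field}"
  assumes F: "AC_with_deriv a b F f" and G: "AC_with_deriv a b G g"
  shows "AC_with_deriv a b (\<lambda>x. F x * G x) (\<lambda>x. f x * G x + F x * g x)"
proof -
  define h where "h x = f x * G x + F x * g x" for x
  note cF = AC_continuous[OF F] and cG = AC_continuous[OF G]
  note fG = absolutely_integrable_mult_continuous[OF AC_integrable[OF F] cG]
    and Fg = absolutely_integrable_continuous_mult[OF cF AC_integrable[OF G]]
  have h: "h absolutely_integrable_on {a..b}"
    unfolding h_def using fG Fg by (rule set_integral_add)
  define Phi where "Phi x = F x * G x - integral {a..x} h" for x
  define k where "k x = norm (f x) + norm (g x)" for x
  have k: "k integrable_on {a..b}"
    unfolding k_def using AC_integrable[OF F] AC_integrable[OF G] by (intro integrable_add abs_int_norm)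
  have incr: "norm (Phi y - Phi x) \<le> e * integral {x..y} k"
    if xy: "a \<le> x" "x \<le> y" "y \<le> b" and e: "0 < e"
      and oF: "\<And>t. t \<in> {x..y} \<Longrightarrow> norm (F x - F t) \<le> e"
      and oG: "\<And>t. t \<in> {x..y} \<Longrightarrow> norm (G y - G t) \<le> e" for x y e
  proof -
    have sub: "{x..y} \<subseteq> {a..b}" using xy by auto
    have int: "f integrable_on {x..y}" "g integrable_on {x..y}" "(\<lambda>x. f x * G x) integrable_on {x..y}"
      "(\<lambda>x. F x * g x) integrable_on {x..y}"
      "k integrable_on {x..y}"
      using absolutely_integrable_imp_integrable_subinterval[of a b _ x y] AC_integrable[OF F] AC_integrable[OF G]
        fG Fg xy integrable_on_subinterval[OF k sub] by auto
    have "integral {a..y} h = integral {a..x} h + integral {x..y} h"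
      using xy absolutely_integrable_imp_integrable_subinterval[OF h, of a y]
      by (intro Henstock_Kurzweil_Integration.integral_combine[symmetric]) auto
    \<comment> \<open>Freezing \<open>G\<close> at the right end and \<open>F\<close> at the left
      end makes the split exact, so that only oscillations over \<open>{x..y}\<close> remain to be
      estimated.\<close>
    then have "Phi y - Phi x = (F y - F x) * G y + F x * (G y - G x) - integral {x..y} h"
      by (simp add: Phi_def algebra_simps)
    also have "\<dots> = integral {x..y} f * G y + F x * integral {x..y} g - integral {x..y} h"
      using AC_increment[OF F xy] AC_increment[OF G xy] by simp
    also have "\<dots> = integral {x..y} (\<lambda>t. (f t * G y + F x * g t) - h t)"
      unfolding h_def using int
      by (subst Henstock_Kurzweil_Integration.integral_diff)
        (auto simp: Henstock_Kurzweil_Integration.integral_add integrable_add integrable_on_mult_right integrable_on_mult_left)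
    finally have eq: "Phi y - Phi x = integral {x..y} (\<lambda>t. (f t * G y + F x * g t) - h t)" .
    have "norm (integral {x..y} (\<lambda>t. (f t * G y + F x * g t) - h t)) \<le> integral {x..y} (\<lambda>t. e * k t)"
    proof (rule integral_norm_bound_integral)
      show "(\<lambda>t. (f t * G y + F x * g t) - h t) integrable_on {x..y}"
        unfolding h_def using int by (auto intro!: integrable_diff integrable_add integrable_on_mult_right integrable_on_mult_left)
      show "(\<lambda>t. e * k t) integrable_on {x..y}" using int by (simp add: integrable_on_mult_right)
      fix t assume t: "t \<in> {x..y}"
      have "(f t * G y + F x * g t) - h t = f t * (G y - G t) + (F x - F t) * g t"
        by (simp add: h_def algebra_simps)
      also have "norm \<dots> \<le> norm (f t) * e + e * norm (g t)"
        using oF[OF t] oG[OF t] e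
        by (intro order_trans[OF norm_triangle_ineq]) (auto simp: norm_mult intro!: add_mono mult_mono)
      finally show "norm (f t * G y + F x * g t - h t) \<le> e * k t"
        by (simp add: k_def algebra_simps)
    qed
    then show ?thesis using eq by simp
  qed
  have const: "Phi x = Phi a" if x: "x \<in> {a..b}" for x
  proof -
    have sub: "{a..x} \<subseteq> {a..b}" using x by auto
    have k': "k integrable_on {a..x}" using k sub integrable_on_subinterval by blast
    have "norm (Phi x - Phi a) \<le> e * integral {a..x} k" if e: "0 < e" for e
    proof -
      have "uniformly_continuous_on {a..b} F" "uniformly_continuous_on {a..b} G"
        using cF cG by (auto intro: compact_uniformly_continuous)
      then obtain d1 d2 where d: "0 < d1" "0 < d2"
        and d1: "\<And>s t. s \<in> {a..b} \<Longrightarrow> t \<in> {a..b} \<Longrightarrow> dist s t < d1 \<Longrightarrow> dist (F s) (F t) < e"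
        and d2: "\<And>s t. s \<in> {a..b} \<Longrightarrow> t \<in> {a..b} \<Longrightarrow> dist s t < d2 \<Longrightarrow> dist (G s) (G t) < e"
        using e unfolding uniformly_continuous_on_def by metis
      have "norm (Phi x - Phi a) \<le> e * integral {a..x} k - e * integral {a..a} k"
      proof (rule increment_bound_uniform_partition[where d="min d1 d2"])
        fix s t assume st: "a \<le> s" "s \<le> t" "t \<le> x" "t - s < min d1 d2"
        have "integral {a..t} k = integral {a..s} k + integral {s..t} k"
          using st k' x by (intro Henstock_Kurzweil_Integration.integral_combine[symmetric])
           (auto intro: integrable_on_subinterval)
        moreover have "norm (Phi t - Phi s) \<le> e * integral {s..t} k"
        proof (rule incr)
          show "norm (F s - F r) \<le> e" "norm (G t - G r) \<le> e" if "r \<in> {s..t}" for r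
            using d1[of s r] d2[of t r] st x that by (auto simp: dist_norm less_imp_le)
        qed (use st x e in auto)
        ultimately show "norm (Phi t - Phi s) \<le> e * integral {a..t} k - e * integral {a..s} k"
          by (simp add: algebra_simps)
      qed (use d x in auto)
      then show ?thesis by simp
    qed note b = this
    have nn: "integral {a..x} k \<ge> 0"
      by (rule Henstock_Kurzweil_Integration.integral_nonneg[OF k']) (simp add: k_def)
    have "norm (Phi x - Phi a) \<le> 0"
    proof (rule field_le_epsilon)
      fix e :: real assume e: "0 < e"
      have "norm (Phi x - Phi a) \<le> e / (integral {a..x} k + 1) * integral {a..x} k"
        using e nn by (intro b) auto
      also have "\<dots> \<le> e" using e nn by (simp add: field_simps)
      finally show "norm (Phi x - Phi a) \<le> 0 + e" by simp
    qed
    then show ?thesis by simp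
  qed
  have "F x * G x = F a * G a + integral {a..x} h" if "x \<in> {a..b}" for x
    using const[OF that] by (simp add: Phi_def algebra_simps)
  then show ?thesis using h unfolding AC_with_deriv_def h_def by blast
qed

section \<open>The initial value problem\<close>

definition Jint :: "(real \<Rightarrow> 'a::euclidean_space) \<Rightarrow> real \<Rightarrow> 'a" where
  "Jint f x = integral {0..x} f"

lemma Jint_0 [simp]: "Jint f 0 = 0"
  by (simp add: Jint_def)

lemma Jint_AC: "f absolutely_integrable_on {0..1} \<Longrightarrow> AC_with_deriv 0 1 (Jint f) f"
  using AC_indefinite_integral[of 0 1 f 0] by (simp add: Jint_def[abs_def])

lemma Jint_continuous: "f absolutely_integrable_on {0..1} \<Longrightarrow> continuous_on {0..1} (Jint f)"
  by (rule AC_continuous[OF Jint_AC])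

lemma Jint_cong:
  assumes "\<And>t. t \<in> {0..1} \<Longrightarrow> f t = g t" "x \<in> {0..1}"
  shows "Jint f x = Jint g x"
  unfolding Jint_def using assms by (intro Henstock_Kurzweil_Integration.integral_cong) auto

lemma AC_eq_Jint:
  assumes "AC_with_deriv 0 1 F f" "x \<in> {0..1}"
  shows "F x = F 0 + Jint f x"
  using AC_eq[OF assms] by (simp add: Jint_def)

lemma AC_unique:
  assumes "AC_with_deriv 0 1 F f" "AC_with_deriv 0 1 G f" "F 0 = G 0" "x \<in> {0..1}"
  shows "F x = G x"
  using AC_eq_Jint[OF assms(1,4)] AC_eq_Jint[OF assms(2,4)] assms(3) by simp

lemma norm_Jint_le:
  fixes f :: "real \<Rightarrow> 'a::euclidean_space"
  assumes "f absolutely_integrable_on {0..1}" "g absolutely_integrable_on {0..1}"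
    and "\<And>t. t \<in> {0..1} \<Longrightarrow> norm (f t) \<le> g t" "x \<in> {0..1}"
  shows "norm (Jint f x) \<le> Jint g x"
  unfolding Jint_def
  using assms by (intro integral_norm_bound_integral absolutely_integrable_imp_integrable_subinterval[where a=0 and b=1]) auto

lemma Jint_mono:
  fixes f g :: "real \<Rightarrow> real"
  assumes "f absolutely_integrable_on {0..1}" "g absolutely_integrable_on {0..1}"
    and "\<And>t. t \<in> {0..x} \<Longrightarrow> f t \<le> g t" "x \<in> {0..1}"
  shows "Jint f x \<le> Jint g x"
  unfolding Jint_def
  using assms by (intro integral_le absolutely_integrable_imp_integrable_subinterval[where a=0 and b=1]) auto

lemma Jint_incr:
  fixes f :: "real \<Rightarrow> real"
  assumes "f absolutely_integrable_on {0..1}" "\<And>t. t \<in> {0..1} \<Longrightarrow> 0 \<le> f t" "0 \<le> x" "x \<le> y" "y \<le> 1"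
  shows "Jint f x \<le> Jint f y"
proof -
  have "Jint f y - Jint f x = integral {x..y} f"
    by (rule AC_increment[OF Jint_AC[OF assms(1)]]) (use assms in auto)
  moreover have "integral {x..y} f \<ge> 0"
    using assms by (intro Henstock_Kurzweil_Integration.integral_nonneg absolutely_integrable_imp_integrable_subinterval[where a=0 and b=1]) auto
  ultimately show ?thesis by simp
qed

lemma Jint_nonneg:
  fixes f :: "real \<Rightarrow> real"
  assumes "f absolutely_integrable_on {0..1}" "\<And>t. t \<in> {0..1} \<Longrightarrow> 0 \<le> f t" "x \<in> {0..1}"
  shows "0 \<le> Jint f x"
  using Jint_incr[OF assms(1,2), of 0 x] assms(3) by simp

text \<open>On the unit interval an integration does not enlarge an increasing nonnegative majorant.
  In \<open>Lop_bound\<close> this discards all integrations in excess of one, so that the three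
  terms of \<open>Lop\<close> receive majorants of the same form.\<close>

lemma Jint_increasing_le:
  fixes m :: "real \<Rightarrow> real"
  assumes m: "continuous_on {0..1} m" "\<And>s t. 0 \<le> s \<Longrightarrow> s \<le> t \<Longrightarrow> t \<le> 1 \<Longrightarrow> m s \<le> m t"
    "\<And>t. t \<in> {0..1} \<Longrightarrow> 0 \<le> m t" and x: "x \<in> {0..1}"
  shows "Jint m x \<le> m x"
proof -
  have "Jint m x \<le> Jint (\<lambda>t. m x) x"
    using m x by (intro Jint_mono absolutely_integrable_continuous_real) auto
  also have "\<dots> = x * m x" using x by (simp add: Jint_def)
  also have "\<dots> \<le> m x" using x m(3)[OF x] by (simp add: mult_left_le_one_le)
  finally show ?thesis .
qed

lemma AC_power:
  fixes H :: "real \<Rightarrow> real"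
  assumes "AC_with_deriv a b H h"
  shows "AC_with_deriv a b (\<lambda>x. H x ^ Suc k) (\<lambda>x. real (Suc k) * (H x ^ k * h x))"
proof (induction k)
  case 0
  then show ?case using assms by simp
next
  case (Suc k)
  show ?case
    by (rule AC_cong[OF AC_mult[OF assms Suc]]) (auto simp: algebra_simps)
qed

text \<open>Integrating \<open>h\<close> against the \<open>k\<close>-th term of an exponential
  series in \<open>Jint h\<close> yields the next term. This is the source of the factorials in the
  Picard bounds.\<close>

lemma Jint_power:
  fixes h :: "real \<Rightarrow> real"
  assumes h: "h absolutely_integrable_on {0..1}" and x: "x \<in> {0..1}"
  shows "Jint (\<lambda>t. h t * (C * Jint h t ^ k / fact k)) x = C * Jint h x ^ Suc k / fact (Suc k)"
proof -
  have "AC_with_deriv 0 1 (\<lambda>x. (C / fact (Suc k)) * Jint h x ^ Suc k)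
     (\<lambda>x. (C / fact (Suc k)) * (real (Suc k) * (Jint h x ^ k * h x)))"
    by (intro AC_cmult AC_power Jint_AC h)
  then have "AC_with_deriv 0 1 (\<lambda>x. (C / fact (Suc k)) * Jint h x ^ Suc k) (\<lambda>t. h t * (C * Jint h t ^ k / fact k))"
  proof (rule AC_cong)
    fix t :: real
    have "fact (Suc k) = real (Suc k) * fact k" by simp
    then show "C / fact (Suc k) * (real (Suc k) * (Jint h t ^ k * h t)) = h t * (C * Jint h t ^ k / fact k)"
      by (simp add: field_simps del: of_nat_Suc fact_Suc)
  qed simp
  from AC_eq_Jint[OF this x] show ?thesis by simp
qed

text \<open>The Picard iterates stay polynomial in the spectral parameter, so their locally uniform limit is entire.\<close>

inductive polyfam :: "(complex \<Rightarrow> real \<Rightarrow> complex) \<Rightarrow> bool" where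
  polyfam_mono: "continuous_on {0..1} c \<Longrightarrow> polyfam (\<lambda>l x. c x * l ^ j)"
| polyfam_add: "polyfam G \<Longrightarrow> polyfam G' \<Longrightarrow> polyfam (\<lambda>l x. G l x + G' l x)"
| polyfam_cong: "polyfam G \<Longrightarrow> (\<And>l x. x \<in> {0..1} \<Longrightarrow> G l x = G' l x) \<Longrightarrow> polyfam G'"

lemma polyfam_const: "continuous_on {0..1} c \<Longrightarrow> polyfam (\<lambda>l. c)"
  using polyfam_mono[of c 0] by simp

lemma polyfam_continuous: "polyfam G \<Longrightarrow> continuous_on {0..1} (G l)"
proof (induction rule: polyfam.induct)
  case (polyfam_cong G G')
  then show ?case using continuous_on_eq by blast
qed (auto intro!: continuous_intros)

lemma polyfam_holomorphic: "polyfam G \<Longrightarrow> x \<in> {0..1} \<Longrightarrow> (\<lambda>l. G l x) holomorphic_on S"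
proof (induction rule: polyfam.induct)
  case (polyfam_cong G G')
  then show ?case using holomorphic_cong[of S S "\<lambda>l. G l x" "\<lambda>l. G' l x"] by auto
qed (auto intro!: holomorphic_intros)

lemma polyfam_times: "polyfam G \<Longrightarrow> polyfam (\<lambda>l x. l * G l x)"
proof (induction rule: polyfam.induct)
  case (polyfam_mono c j)
  then show ?case using polyfam.polyfam_mono[of c "Suc j"] by (simp add: algebra_simps)
next
  case (polyfam_add G G')
  then show ?case using polyfam.polyfam_add[of "\<lambda>l x. l * G l x" "\<lambda>l x. l * G' l x"] by (simp add: algebra_simps)
next
  case (polyfam_cong G G')
  show ?case by (rule polyfam.polyfam_cong[OF polyfam_cong(3)]) (use polyfam_cong in auto)
qed

lemma polyfam_cmult: "polyfam G \<Longrightarrow> polyfam (\<lambda>l x. c * G l x)"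
proof (induction rule: polyfam.induct)
  case (polyfam_mono d j)
  have "continuous_on {0..1} (\<lambda>x. c * d x)" by (intro continuous_intros polyfam_mono)
  from polyfam.polyfam_mono[OF this, of j] show ?case by (simp add: algebra_simps)
next
  case (polyfam_add G G')
  then show ?case using polyfam.polyfam_add[of "\<lambda>l x. c * G l x" "\<lambda>l x. c * G' l x"] by (simp add: algebra_simps)
next
  case (polyfam_cong G G')
  show ?case by (rule polyfam.polyfam_cong[OF polyfam_cong(3)]) (use polyfam_cong in auto)
qed

lemma polyfam_Jint:
  assumes w: "w absolutely_integrable_on {0..1}"
  shows "polyfam G \<Longrightarrow> polyfam (\<lambda>l. Jint (\<lambda>t. w t * G l t))"
proof (induction rule: polyfam.induct)
  case (polyfam_mono c j)
  have i: "(\<lambda>t. w t * c t) absolutely_integrable_on {0..1}"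
    by (rule absolutely_integrable_mult_continuous[OF w polyfam_mono])
  have "polyfam (\<lambda>l x. Jint (\<lambda>t. w t * c t) x * l ^ j)"
    by (rule polyfam.polyfam_mono[OF Jint_continuous[OF i]])
  then show ?case
  proof (rule polyfam.polyfam_cong)
    fix l :: complex and x :: real assume x: "x \<in> {0..1}"
    have "Jint (\<lambda>t. w t * (c t * l ^ j)) x = Jint (\<lambda>t. (w t * c t) * l ^ j) x"
      by (simp add: mult.assoc)
    also have "\<dots> = Jint (\<lambda>t. w t * c t) x * l ^ j"
      by (simp add: Jint_def)
    finally show "Jint (\<lambda>t. w t * c t) x * l ^ j = Jint (\<lambda>t. w t * (c t * l ^ j)) x" by simp
  qed
next
  case (polyfam_add G G')
  have "polyfam (\<lambda>l x. Jint (\<lambda>t. w t * G l t) x + Jint (\<lambda>t. w t * G' l t) x)"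
    by (rule polyfam.polyfam_add[OF polyfam_add.IH])
  then show ?case
  proof (rule polyfam.polyfam_cong)
    fix l :: complex and x :: real assume x: "x \<in> {0..1}"
    have "AC_with_deriv 0 1 (\<lambda>x. Jint (\<lambda>t. w t * G l t) x + Jint (\<lambda>t. w t * G' l t) x) (\<lambda>t. w t * (G l t + G' l t))"
      using AC_add[OF Jint_AC Jint_AC, OF absolutely_integrable_mult_continuous absolutely_integrable_mult_continuous,
        OF w polyfam_continuous w polyfam_continuous, OF polyfam_add.hyps]
      by (simp add: algebra_simps)
    from AC_eq_Jint[OF this x]
    show "Jint (\<lambda>t. w t * G l t) x + Jint (\<lambda>t. w t * G' l t) x = Jint (\<lambda>t. w t * (G l t + G' l t)) x" by simp
  qed
next
  case (polyfam_cong G G')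
  show ?case by (rule polyfam.polyfam_cong[OF polyfam_cong(3)]) (use polyfam_cong in \<open>auto intro!: Jint_cong\<close>)
qed

lemma polyfam_Jint1: "polyfam G \<Longrightarrow> polyfam (\<lambda>l. Jint (G l))"
  using polyfam_Jint[of "\<lambda>_. 1" G] by (simp add: absolutely_integrable_continuous_real)

section \<open>Picard iteration for the fourth-order equation\<close>

locale quartic =
  fixes p q :: "real \<Rightarrow> real"
  assumes p_int: "p absolutely_integrable_on {0..1}" and q_int: "q absolutely_integrable_on {0..1}"
begin

definition "P x = complex_of_real (p x)"
definition "Q x = complex_of_real (q x)"

lemma P_int: "P absolutely_integrable_on {0..1}" and Q_int: "Q absolutely_integrable_on {0..1}"
  unfolding P_def[abs_def] Q_def[abs_def] using p_int q_int by (auto intro: absolutely_integrable_of_real)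

text \<open>The unknown of the fixed-point equation is \<open>f = y''\<close>: with \<open>y(0) = c0\<close>, \<open>y'(0) = 0\<close>, \<open>y''(0) = c2\<close> and vanishing third
  quasi-derivative at \<open>0\<close>, the equation is \<open>y = Y0op c0 f\<close>, \<open>f = c2 + Lop l y f\<close>.\<close>

definition "Y0op c0 f x = c0 + Jint (Jint f) x" for c0 :: complex
definition "Lop l y f x = l * Jint (Jint y) x - Jint (Jint (\<lambda>t. Q t * y t)) x - Jint (\<lambda>t. P t * Jint f t) x"
  for l :: complex and y f :: "real \<Rightarrow> complex"

lemma Jint_aint: "f absolutely_integrable_on {0..1} \<Longrightarrow> Jint f absolutely_integrable_on {0..1}"
  by (rule absolutely_integrable_continuous_real[OF Jint_continuous])

lemma Lop_AC:
  assumes "continuous_on {0..1} y" "continuous_on {0..1} f"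
  shows "AC_with_deriv 0 1 (Lop l y f) (\<lambda>x. l * Jint y x - Jint (\<lambda>t. Q t * y t) x - P x * Jint f x)"
  unfolding Lop_def[abs_def]
  by (intro AC_diff AC_cmult Jint_AC Jint_aint absolutely_integrable_continuous_real assms
      absolutely_integrable_mult_continuous P_int Q_int Jint_continuous)

text \<open>Integrable weight dominating one Picard step when \<open>norm l\<close> is at most
  \<open>r\<close>. With \<open>r = 0\<close> its integral over the unit interval is the sum of the
  \<open>L^1\<close> norms of \<open>p\<close> and \<open>q\<close>, through which integrable
  coefficients enter the constants \<open>H\<close> of the later estimates.\<close>

definition "hb r t = r + norm (Q t) + norm (P t)" for r :: real

lemma hb_int: "hb r absolutely_integrable_on {0..1}"
proof -
  have "(\<lambda>t. norm (Q t)) absolutely_integrable_on {0..1}" "(\<lambda>t. norm (P t)) absolutely_integrable_on {0..1}"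
    using absolutely_integrable_norm[OF Q_int] absolutely_integrable_norm[OF P_int] by (auto simp: o_def)
  then show ?thesis
    unfolding hb_def[abs_def] by (intro set_integral_add(1)) (auto intro: absolutely_integrable_continuous_real)
qed

lemma hb_nonneg: "0 \<le> r \<Longrightarrow> 0 \<le> hb r t"
  by (simp add: hb_def)

text \<open>The bound \<open>m\<close> is increasing, so \<open>f\<close> integrated once, twice or
  three times is still bounded by \<open>m\<close>. Each term of \<open>Lop\<close> is then at most
  one integral of \<open>m\<close> against a part of \<open>hb r\<close>, and
  \<open>Jint_power\<close> evaluates the sum.\<close>

lemma Lop_bound:
  assumes f: "continuous_on {0..1} f" and r: "norm l \<le> r" and C: "0 \<le> C"
    and b: "\<And>t. t \<in> {0..1} \<Longrightarrow> norm (f t) \<le> C * Jint (hb r) t ^ k / fact k"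
    and x: "x \<in> {0..1}"
  shows "norm (Lop l (Jint (Jint f)) f x) \<le> C * Jint (hb r) x ^ Suc k / fact (Suc k)"
proof -
  have r0: "0 \<le> r" using r norm_ge_zero order_trans by blast
  define m where "m t = C * Jint (hb r) t ^ k / fact k" for t
  have mc: "continuous_on {0..1} m"
    unfolding m_def[abs_def] by (intro continuous_intros Jint_continuous hb_int) auto
  have m0: "0 \<le> m t" if "t \<in> {0..1}" for t
    unfolding m_def using that C by (intro divide_nonneg_nonneg mult_nonneg_nonneg zero_le_power Jint_nonneg hb_int hb_nonneg r0) auto
  have mm: "m s \<le> m t" if "0 \<le> s" "s \<le> t" "t \<le> 1" for s t
    unfolding m_def using that C
    by (intro divide_right_mono mult_left_mono power_mono Jint_incr Jint_nonneg hb_int hb_nonneg r0) auto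
  have mi: "m absolutely_integrable_on {0..1}" by (rule absolutely_integrable_continuous_real[OF mc])
  have fi: "f absolutely_integrable_on {0..1}" by (rule absolutely_integrable_continuous_real[OF f])
  have Jm: "Jint m t \<le> m t" if "t \<in> {0..1}" for t
    by (rule Jint_increasing_le[OF mc mm m0 that])
  have J1: "norm (Jint f t) \<le> m t" if "t \<in> {0..1}" for t
    using norm_Jint_le[OF fi mi _ that] b Jm[OF that] by (fastforce simp: m_def)
  have J2: "norm (Jint (Jint f) t) \<le> m t" if "t \<in> {0..1}" for t
    using norm_Jint_le[OF Jint_aint[OF fi] mi J1 that] Jm[OF that] by linarith
  have J2i: "Jint (Jint f) absolutely_integrable_on {0..1}" and J2c: "continuous_on {0..1} (Jint (Jint f))"
    and J1c: "continuous_on {0..1} (Jint f)"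
    by (intro Jint_aint fi Jint_continuous)+
  have J3: "norm (Jint (Jint (Jint f)) t) \<le> m t" if "t \<in> {0..1}" for t
    using norm_Jint_le[OF J2i mi J2 that] Jm[OF that] by linarith
  have T1: "norm (Jint (Jint (Jint (Jint f))) x) \<le> Jint m x"
    by (rule norm_Jint_le[OF Jint_aint[OF J2i] mi J3 x])
  have Qm: "(\<lambda>t. norm (Q t) * m t) absolutely_integrable_on {0..1}" and Pm: "(\<lambda>t. norm (P t) * m t) absolutely_integrable_on {0..1}"
    using absolutely_integrable_norm[OF Q_int] absolutely_integrable_norm[OF P_int] mc
    by (auto simp: o_def intro: absolutely_integrable_mult_continuous)
  have QJ: "(\<lambda>t. Q t * Jint (Jint f) t) absolutely_integrable_on {0..1}"
    by (rule absolutely_integrable_mult_continuous[OF Q_int J2c])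
  have PJ: "(\<lambda>t. P t * Jint f t) absolutely_integrable_on {0..1}"
    by (rule absolutely_integrable_mult_continuous[OF P_int J1c])
  have Q1: "norm (Jint (\<lambda>t. Q t * Jint (Jint f) t) s) \<le> Jint (\<lambda>t. norm (Q t) * m t) s" if "s \<in> {0..1}" for s
    using that J2 by (intro norm_Jint_le QJ Qm) (auto simp: norm_mult intro!: mult_left_mono)
  have "norm (Jint (Jint (\<lambda>t. Q t * Jint (Jint f) t)) x) \<le> Jint (Jint (\<lambda>t. norm (Q t) * m t)) x"
    by (rule norm_Jint_le[OF Jint_aint[OF QJ] Jint_aint[OF Qm] Q1 x])
  also have "\<dots> \<le> Jint (\<lambda>t. norm (Q t) * m t) x"
    using m0 by (intro Jint_increasing_le Jint_continuous Qm x Jint_incr Jint_nonneg) auto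
  finally have T2: "norm (Jint (Jint (\<lambda>t. Q t * Jint (Jint f) t)) x) \<le> Jint (\<lambda>t. norm (Q t) * m t) x" .
  have T3: "norm (Jint (\<lambda>t. P t * Jint f t) x) \<le> Jint (\<lambda>t. norm (P t) * m t) x"
    using x J1 by (intro norm_Jint_le PJ Pm) (auto simp: norm_mult intro!: mult_left_mono)
  have "norm (Lop l (Jint (Jint f)) f x) \<le> norm (l * Jint (Jint (Jint (Jint f))) x) + norm (Jint (Jint (\<lambda>t. Q t * Jint (Jint f) t)) x)
      + norm (Jint (\<lambda>t. P t * Jint f t) x)"
    unfolding Lop_def by (meson norm_triangle_ineq4 order_trans add_right_mono)
  also have "\<dots> \<le> r * Jint m x + Jint (\<lambda>t. norm (Q t) * m t) x + Jint (\<lambda>t. norm (P t) * m t) x"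
    using T1 T2 T3 r r0 by (intro add_mono) (auto simp: norm_mult intro!: mult_mono)
  also have "\<dots> = Jint (\<lambda>t. hb r t * m t) x"
  proof -
    have "AC_with_deriv 0 1 (\<lambda>x. r * Jint m x + Jint (\<lambda>t. norm (Q t) * m t) x + Jint (\<lambda>t. norm (P t) * m t) x)
       (\<lambda>t. r * m t + norm (Q t) * m t + norm (P t) * m t)"
      by (intro AC_add AC_cmult Jint_AC mi Qm Pm)
    then have "AC_with_deriv 0 1 (\<lambda>x. r * Jint m x + Jint (\<lambda>t. norm (Q t) * m t) x + Jint (\<lambda>t. norm (P t) * m t) x)
       (\<lambda>t. hb r t * m t)" by (simp add: hb_def algebra_simps)
    from AC_eq_Jint[OF this x] show ?thesis by simp
  qed
  also have "\<dots> = C * Jint (hb r) x ^ Suc k / fact (Suc k)"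
    unfolding m_def by (rule Jint_power[OF hb_int x])
  finally show ?thesis .
qed

text \<open>Picard iterates for \<open>y''\<close>. The start at 0 makes the partial sums of their
  differences equal to the iterates themselves, so the limit can be written as the series
  \<open>Gs\<close>.\<close>

fun F :: "complex \<Rightarrow> complex \<Rightarrow> nat \<Rightarrow> complex \<Rightarrow> real \<Rightarrow> complex" where
  "F c0 c2 0 l x = 0"
| "F c0 c2 (Suc k) l x = c2 + Lop l (Y0op c0 (F c0 c2 k l)) (F c0 c2 k l) x"

lemma F_polyfam: "polyfam (F c0 c2 k)"
proof (induction k)
  case 0
  have "F c0 c2 0 = (\<lambda>l x. 0)" by (intro ext) simp
  then show ?case using polyfam_const[of "\<lambda>_. 0"] by simp
next
  case (Suc k)
  let ?Y = "\<lambda>l. Y0op c0 (F c0 c2 k l)"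
  have Y: "polyfam ?Y"
    unfolding Y0op_def[abs_def] by (intro polyfam_add polyfam_const polyfam_Jint1 Suc continuous_intros)
  have "polyfam (\<lambda>l x. c2 + (l * Jint (Jint (?Y l)) x + ((-1) * Jint (Jint (\<lambda>t. Q t * ?Y l t)) x
      + (-1) * Jint (\<lambda>t. P t * Jint (F c0 c2 k l) t) x)))"
    by (intro polyfam_add polyfam_const polyfam_times polyfam_cmult polyfam_Jint1 polyfam_Jint P_int Q_int Suc Y continuous_intros)
  then show ?case
    by (rule polyfam_cong) (simp add: Lop_def)
qed

lemma F_continuous: "continuous_on {0..1} (F c0 c2 k l)"
  by (rule polyfam_continuous[OF F_polyfam])

lemma Jint_diff:
  assumes "f absolutely_integrable_on {0..1}" "g absolutely_integrable_on {0..1}" "x \<in> {0..1}"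
  shows "Jint (\<lambda>t. f t - g t) x = Jint f x - Jint g x"
  using AC_eq_Jint[OF AC_diff[OF Jint_AC[OF assms(1)] Jint_AC[OF assms(2)]] assms(3)] by simp

lemma Y0op_continuous: "continuous_on {0..1} f \<Longrightarrow> continuous_on {0..1} (Y0op c0 f)"
  unfolding Y0op_def[abs_def]
  by (intro continuous_intros Jint_continuous absolutely_integrable_continuous_real)

lemma Y0op_diff:
  assumes f: "continuous_on {0..1} f" and g: "continuous_on {0..1} g" and x: "x \<in> {0..1}"
  shows "Y0op c0 f x - Y0op c0 g x = Jint (Jint (\<lambda>t. f t - g t)) x"
proof -
  have "Jint (Jint (\<lambda>t. f t - g t)) x = Jint (\<lambda>t. Jint f t - Jint g t) x"
    using f g x by (intro Jint_cong Jint_diff absolutely_integrable_continuous_real) auto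
  also have "\<dots> = Jint (Jint f) x - Jint (Jint g) x"
    using f g x by (intro Jint_diff Jint_aint absolutely_integrable_continuous_real) auto
  finally show ?thesis by (simp add: Y0op_def)
qed

text \<open>\<open>Lop\<close> combined with \<open>Y0op\<close> is affine in \<open>f\<close>: the
  constant \<open>c0\<close> drops out of the difference, which brings differences of iterates into
  the scope of \<open>Lop_bound\<close>.\<close>

lemma Lop_diff:
  assumes f: "continuous_on {0..1} f" and g: "continuous_on {0..1} g" and x: "x \<in> {0..1}"
  shows "Lop l (Y0op c0 f) f x - Lop l (Y0op c0 g) g x = Lop l (Jint (Jint (\<lambda>t. f t - g t))) (\<lambda>t. f t - g t) x"
proof -
  have d: "continuous_on {0..1} (\<lambda>t. f t - g t)" by (intro continuous_intros f g)
  have d2: "continuous_on {0..1} (Jint (Jint (\<lambda>t. f t - g t)))"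
    by (intro Jint_continuous Jint_aint absolutely_integrable_continuous_real d)
  note A = AC_diff[OF Lop_AC[OF Y0op_continuous[OF f, of c0] f, of l] Lop_AC[OF Y0op_continuous[OF g, of c0] g, of l]]
  have "AC_with_deriv 0 1 (\<lambda>x. Lop l (Y0op c0 f) f x - Lop l (Y0op c0 g) g x)
     (\<lambda>x. l * Jint (Jint (Jint (\<lambda>t. f t - g t))) x - Jint (\<lambda>t. Q t * Jint (Jint (\<lambda>t. f t - g t)) t) x - P x * Jint (\<lambda>t. f t - g t) x)"
  proof (rule AC_cong[OF A])
    fix x :: real assume x: "x \<in> {0..1}"
    have 1: "Jint (Jint (Jint (\<lambda>t. f t - g t))) x = Jint (Y0op c0 f) x - Jint (Y0op c0 g) x"
      using x by (subst Jint_diff[symmetric])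
       (auto intro!: absolutely_integrable_continuous_real Y0op_continuous f g x Jint_cong simp: Y0op_diff[OF f g])
    have "Jint (\<lambda>t. Q t * Jint (Jint (\<lambda>t. f t - g t)) t) x = Jint (\<lambda>t. Q t * Y0op c0 f t - Q t * Y0op c0 g t) x"
      using x by (intro Jint_cong) (auto simp: Y0op_diff[OF f g, symmetric, of _ c0] algebra_simps)
    also have "\<dots> = Jint (\<lambda>t. Q t * Y0op c0 f t) x - Jint (\<lambda>t. Q t * Y0op c0 g t) x"
      by (intro Jint_diff absolutely_integrable_mult_continuous Q_int Y0op_continuous f g x)
    finally have 2: "Jint (\<lambda>t. Q t * Jint (Jint (\<lambda>t. f t - g t)) t) x = Jint (\<lambda>t. Q t * Y0op c0 f t) x - Jint (\<lambda>t. Q t * Y0op c0 g t) x" .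
    have 3: "Jint (\<lambda>t. f t - g t) x = Jint f x - Jint g x"
      by (intro Jint_diff absolutely_integrable_continuous_real f g x)
    show "l * Jint (Y0op c0 f) x - Jint (\<lambda>t. Q t * Y0op c0 f t) x - P x * Jint f x -
         (l * Jint (Y0op c0 g) x - Jint (\<lambda>t. Q t * Y0op c0 g t) x - P x * Jint g x)
       = l * Jint (Jint (Jint (\<lambda>t. f t - g t))) x - Jint (\<lambda>t. Q t * Jint (Jint (\<lambda>t. f t - g t)) t) x - P x * Jint (\<lambda>t. f t - g t) x"
      unfolding 1 2 3 by (simp add: algebra_simps)
  qed simp
  from AC_unique[OF this Lop_AC[OF d2 d] _ x] show ?thesis by (simp add: Lop_def)
qed

end

lemma norm_Jint_le_const:
  fixes f :: "real \<Rightarrow> 'a::euclidean_space"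
  assumes "f absolutely_integrable_on {0..1}" "\<And>t. t \<in> {0..1} \<Longrightarrow> norm (f t) \<le> e" "x \<in> {0..1}"
  shows "norm (Jint f x) \<le> e"
proof -
  have "norm (Jint f x) \<le> Jint (\<lambda>t. e) x"
    by (rule norm_Jint_le[OF assms(1) _ assms(2,3)]) (auto intro: absolutely_integrable_continuous_real)
  also have "\<dots> \<le> e"
  proof -
    have "0 \<le> e" using assms(2)[OF assms(3)] norm_ge_zero order_trans by blast
    then show ?thesis using assms(3) by (simp add: Jint_def mult_left_le_one_le)
  qed
  finally show ?thesis .
qed

lemma continuous_on_unit_interval_bound:
  fixes f :: "real \<Rightarrow> 'a::real_normed_vector"
  assumes "continuous_on {0..1} f"
  obtains C where "0 \<le> C" "\<And>x. x \<in> {0..1} \<Longrightarrow> norm (f x) \<le> C"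
proof -
  have "bounded (f ` {0..1})"
    by (rule compact_imp_bounded[OF compact_continuous_image[OF assms compact_Icc]])
  then obtain C where "\<forall>y\<in>f ` {0..1}. norm y \<le> C" unfolding bounded_iff by blast
  then have C: "norm (f x) \<le> C" if "x \<in> {0..1}" for x using that by blast
  show ?thesis
    by (rule that[of C]) (use C order_trans[OF norm_ge_zero C[of 0]] in auto)
qed

lemma AC_deriv_unique:
  fixes F :: "real \<Rightarrow> 'a::euclidean_space"
  assumes "AC_with_deriv 0 1 F f" "AC_with_deriv 0 1 F g" "continuous_on {0..1} f" "continuous_on {0..1} g" "x \<in> {0..1}"
  shows "f x = g x"
  by (rule vector_derivative_unique_within_closed_interval[of 0 1 x F])
    (use AC_has_derivative[OF assms(1,3,5)] AC_has_derivative[OF assms(2,4,5)] assms(5) in auto)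

lemma solves_ode_lincomb:
  assumes "solves_ode p q l Y" "solves_ode p q l Z"
  shows "solves_ode p q l (\<lambda>k x. a * Y k x + b * Z k x)"
proof -
  have "AC_with_deriv 0 1 (\<lambda>x. a * Y 0 x + b * Z 0 x) (\<lambda>x. a * Y 1 x + b * Z 1 x)"
       "AC_with_deriv 0 1 (\<lambda>x. a * Y 1 x + b * Z 1 x) (\<lambda>x. a * Y 2 x + b * Z 2 x)"
    using assms by (auto simp: solves_ode_def quasi_derivs_def intro!: AC_add AC_cmult)
  moreover have "AC_with_deriv 0 1 (\<lambda>x. a * Y 2 x + b * Z 2 x) (\<lambda>x. a * (Y 3 x - of_real (p x) * Y 1 x) + b * (Z 3 x - of_real (p x) * Z 1 x))"
    "AC_with_deriv 0 1 (\<lambda>x. a * Y 3 x + b * Z 3 x) (\<lambda>x. a * ((l - of_real (q x)) * Y 0 x) + b * ((l - of_real (q x)) * Z 0 x))"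
    using assms by (auto simp: solves_ode_def quasi_derivs_def intro!: AC_add AC_cmult)
  ultimately show ?thesis
    by (simp add: solves_ode_def quasi_derivs_def algebra_simps)
qed

lemma in_L2_continuous:
  assumes "continuous_on {0..1} v"
  shows "in_L2 v"
proof -
  have "v absolutely_integrable_on {0..1}"
    by (rule absolutely_integrable_continuous_real[OF assms])
  then have "set_borel_measurable lebesgue {0..1} v"
    by (auto simp: set_integrable_def set_borel_measurable_def)
  moreover have "(\<lambda>x. (cmod (v x))\<^sup>2) absolutely_integrable_on {0..1}"
    by (intro absolutely_integrable_continuous_real continuous_intros assms)
  ultimately show ?thesis by (simp add: in_L2_def)
qed

lemma const_power_over_fact_tendsto_0: "(\<lambda>k. C * (H::real) ^ k / fact k) \<longlonglongrightarrow> 0"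
  using tendsto_mult[OF tendsto_const[of C] summable_LIMSEQ_zero[OF summable_exp[of H]]]
  by (simp add: field_simps)

context quartic begin

definition "Gs c0 c2 l x = (\<Sum>k. F c0 c2 (Suc k) l x - F c0 c2 k l x)"

text \<open>Uniformity over a disk in \<open>l\<close> times the interval in \<open>x\<close> serves
  two ends: continuity of the limit in \<open>x\<close> and holomorphy in \<open>l\<close>. The
  summable majorant is the exponential series in \<open>Jint (hb r) 1\<close>.\<close>

lemma F_uniform_limit:
  assumes r: "0 \<le> r"
  shows "uniform_limit (cball 0 r \<times> {0..1}) (\<lambda>n (l, x). F c0 c2 n l x) (\<lambda>(l, x). Gs c0 c2 l x) sequentially"
proof -
  let ?H = "Jint (hb r)"
  have a1: "continuous_on {0..1} (Jint (Jint (\<lambda>_. c0)))"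
    by (intro Jint_continuous Jint_aint absolutely_integrable_continuous_real continuous_intros)
  have a2: "continuous_on {0..1} (Jint (Jint (\<lambda>t. Q t * c0)))"
    by (intro Jint_continuous Jint_aint absolutely_integrable_mult_continuous Q_int continuous_intros)
  obtain B1 where B1: "\<And>x. x \<in> {0..1} \<Longrightarrow> norm (Jint (Jint (\<lambda>_. c0)) x) \<le> B1"
    using continuous_on_unit_interval_bound[OF a1] by blast
  obtain B2 where B2: "\<And>x. x \<in> {0..1} \<Longrightarrow> norm (Jint (Jint (\<lambda>t. Q t * c0)) x) \<le> B2"
    using continuous_on_unit_interval_bound[OF a2] by blast
  \<comment> \<open>Size of the first iterate, which arises from \<open>f = 0\<close>: the constant
    \<open>c2\<close> plus the two contributions of the constant function \<open>c0\<close>.\<close>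
  define C where "C = norm c2 + r * B1 + B2"
  have z: "Jint (\<lambda>_. 0::complex) = (\<lambda>_. 0)" by (auto simp: Jint_def)
  have d0: "norm (F c0 c2 (Suc 0) l x - F c0 c2 0 l x) \<le> C" if "norm l \<le> r" "x \<in> {0..1}" for l x
  proof -
    have "F c0 c2 (Suc 0) l x - F c0 c2 0 l x = c2 + (l * Jint (Jint (\<lambda>_. c0)) x - Jint (Jint (\<lambda>t. Q t * c0)) x)"
    proof -
      have "F c0 c2 0 l = (\<lambda>_. 0)" by (intro ext) simp
      then have "Y0op c0 (F c0 c2 0 l) = (\<lambda>_. c0)" "Jint (F c0 c2 0 l) = (\<lambda>_. 0)"
        by (simp_all add: Y0op_def[abs_def] z)
      then show ?thesis by (simp add: Lop_def z)
    qed
    also have "norm \<dots> \<le> norm c2 + (norm (l * Jint (Jint (\<lambda>_. c0)) x) + norm (Jint (Jint (\<lambda>t. Q t * c0)) x))"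
      by (meson norm_triangle_ineq norm_triangle_ineq4 order_trans add_left_mono)
    also have "\<dots> \<le> C"
      unfolding C_def using that B1[of x] B2[of x] r by (auto simp: norm_mult intro!: add_mono mult_mono)
    finally show ?thesis .
  qed
  have C0: "0 \<le> C" using order_trans[OF norm_ge_zero d0[of 0 0]] r by simp
  have dk: "norm (F c0 c2 (Suc k) l x - F c0 c2 k l x) \<le> C * ?H x ^ k / fact k"
    if l: "norm l \<le> r" and x: "x \<in> {0..1}" for l x k
    using x
  proof (induction k arbitrary: x)
    case 0
    then show ?case using d0[OF l] by simp
  next
    case (Suc k)
    have "F c0 c2 (Suc (Suc k)) l x - F c0 c2 (Suc k) l x =
      Lop l (Y0op c0 (F c0 c2 (Suc k) l)) (F c0 c2 (Suc k) l) x - Lop l (Y0op c0 (F c0 c2 k l)) (F c0 c2 k l) x"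
      by simp
    also have "\<dots> = Lop l (Jint (Jint (\<lambda>t. F c0 c2 (Suc k) l t - F c0 c2 k l t))) (\<lambda>t. F c0 c2 (Suc k) l t - F c0 c2 k l t) x"
      by (rule Lop_diff[OF F_continuous F_continuous Suc.prems])
    finally show ?case
      using Lop_bound[OF _ l C0 Suc.IH Suc.prems] by (auto intro!: continuous_intros F_continuous simp del: F.simps)
  qed
  have "uniform_limit (cball 0 r \<times> {0..1}) (\<lambda>n y. \<Sum>k<n. (case y of (l, x) \<Rightarrow> F c0 c2 (Suc k) l x - F c0 c2 k l x))
     (\<lambda>y. suminf (\<lambda>k. case y of (l, x) \<Rightarrow> F c0 c2 (Suc k) l x - F c0 c2 k l x)) sequentially"
  proof (rule Weierstrass_m_test)
    show "summable (\<lambda>k. C * ?H 1 ^ k / fact k)"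
      using summable_mult[OF summable_exp[of "?H 1"], of C] by (simp add: field_simps)
    fix k y assume "y \<in> cball (0::complex) r \<times> {0..1::real}"
    then obtain l x where y: "y = (l, x)" "norm l \<le> r" "x \<in> {0..1}" by auto
    have "C * ?H x ^ k / fact k \<le> C * ?H 1 ^ k / fact k"
      using y C0 by (intro divide_right_mono mult_left_mono power_mono Jint_incr Jint_nonneg hb_int hb_nonneg r) auto
    with dk[OF y(2,3), of k] show "norm (case y of (l, x) \<Rightarrow> F c0 c2 (Suc k) l x - F c0 c2 k l x) \<le> C * ?H 1 ^ k / fact k"
      using y by (simp del: F.simps)
  qed
  moreover have "(\<Sum>k<n. F c0 c2 (Suc k) l x - F c0 c2 k l x) = F c0 c2 n l x" for n l x
    using sum_lessThan_telescope[of "\<lambda>k. F c0 c2 k l x" n] by (simp add: F.simps(1) del: F.simps(2))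
  ultimately show ?thesis
    by (simp add: case_prod_beta' Gs_def del: F.simps)
qed

lemma F_uniform_limit_x: "uniform_limit {0..1} (\<lambda>n. F c0 c2 n l) (Gs c0 c2 l) sequentially"
  unfolding uniform_limit_iff
proof (intro allI impI)
  fix e :: real assume "0 < e"
  with F_uniform_limit[of "norm l" c0 c2]
  have "\<forall>\<^sub>F n in sequentially. \<forall>y\<in>cball 0 (norm l) \<times> {0..1}. dist (case y of (l, x) \<Rightarrow> F c0 c2 n l x) (case y of (l, x) \<Rightarrow> Gs c0 c2 l x) < e"
    unfolding uniform_limit_iff by simp
  then show "\<forall>\<^sub>F n in sequentially. \<forall>x\<in>{0..1}. dist (F c0 c2 n l x) (Gs c0 c2 l x) < e"
  proof (rule eventually_mono)
    fix n assume *: "\<forall>y\<in>cball 0 (norm l) \<times> {0..1}. dist (case y of (l, x) \<Rightarrow> F c0 c2 n l x) (case y of (l, x) \<Rightarrow> Gs c0 c2 l x) < e"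
    show "\<forall>x\<in>{0..1}. dist (F c0 c2 n l x) (Gs c0 c2 l x) < e"
    proof
      fix x :: real assume "x \<in> {0..1}"
      then have "(l, x) \<in> cball 0 (norm l) \<times> {0..1}" by auto
      from bspec[OF * this] show "dist (F c0 c2 n l x) (Gs c0 c2 l x) < e" by simp
    qed
  qed
qed

lemma Gs_continuous: "continuous_on {0..1} (Gs c0 c2 l)"
  by (rule uniform_limit_theorem[OF _ F_uniform_limit_x]) (auto intro: always_eventually F_continuous)

text \<open>The limit is passed through the fixed-point equation quantitatively: an iterate within
  \<open>e\<close> of the limit changes the right-hand side by at most \<open>e\<close> times
  \<open>Jint (hb (norm l)) x\<close>, which is \<open>Lop_bound\<close> with
  \<open>k = 0\<close>.\<close>

lemma Gs_eq:
  assumes x: "x \<in> {0..1}"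
  shows "Gs c0 c2 l x = c2 + Lop l (Y0op c0 (Gs c0 c2 l)) (Gs c0 c2 l) x"
proof -
  let ?H = "Jint (hb (norm l))"
  let ?G = "Gs c0 c2 l"
  have H0: "0 \<le> ?H x" using x by (intro Jint_nonneg hb_int hb_nonneg) auto
  have b: "norm (?G x - (c2 + Lop l (Y0op c0 ?G) ?G x)) \<le> e * (1 + ?H x)" if e: "0 < e" for e
  proof -
    obtain N where N: "\<And>n y. n \<ge> N \<Longrightarrow> y \<in> {0..1} \<Longrightarrow> dist (F c0 c2 n l y) (?G y) < e"
      using F_uniform_limit_x[of c0 c2 l] e unfolding uniform_limit_sequentially_iff by metis
    have "norm (F c0 c2 (Suc N) l x - (c2 + Lop l (Y0op c0 ?G) ?G x)) =
       norm (Lop l (Y0op c0 (F c0 c2 N l)) (F c0 c2 N l) x - Lop l (Y0op c0 ?G) ?G x)" by simp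
    also have "\<dots> = norm (Lop l (Jint (Jint (\<lambda>t. F c0 c2 N l t - ?G t))) (\<lambda>t. F c0 c2 N l t - ?G t) x)"
      by (simp only: Lop_diff[OF F_continuous Gs_continuous x])
    also have "\<dots> \<le> e * ?H x ^ Suc 0 / fact (Suc 0)"
    proof (rule Lop_bound[OF _ order_refl _ _ x])
      show "continuous_on {0..1} (\<lambda>t. F c0 c2 N l t - ?G t)"
        by (intro continuous_intros F_continuous Gs_continuous)
      show "norm (F c0 c2 N l t - ?G t) \<le> e * ?H t ^ 0 / fact 0" if "t \<in> {0..1}" for t
        using N[of N t] that by (simp add: dist_norm)
    qed (use e in auto)
    finally have "norm (F c0 c2 (Suc N) l x - (c2 + Lop l (Y0op c0 ?G) ?G x)) \<le> e * ?H x" by simp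
    moreover have "norm (?G x - F c0 c2 (Suc N) l x) \<le> e"
      using N[of "Suc N" x] x by (simp add: dist_norm norm_minus_commute del: F.simps)
    ultimately have "norm (?G x - F c0 c2 (Suc N) l x) + norm (F c0 c2 (Suc N) l x - (c2 + Lop l (Y0op c0 ?G) ?G x)) \<le> e * (1 + ?H x)"
      by (simp add: algebra_simps del: F.simps)
    then show ?thesis
      by (rule order_trans[rotated]) (metis diff_add_cancel add_diff_eq norm_triangle_ineq)
  qed
  have "norm (?G x - (c2 + Lop l (Y0op c0 ?G) ?G x)) \<le> 0"
  proof (rule field_le_epsilon)
    fix e :: real assume "0 < e"
    moreover have "e / (1 + ?H x) * (1 + ?H x) = e" using H0 by simp
    ultimately show "norm (?G x - (c2 + Lop l (Y0op c0 ?G) ?G x)) \<le> 0 + e"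
      using b[of "e / (1 + ?H x)"] H0 by simp
  qed
  then show ?thesis by simp
qed

definition "Ysol c0 c2 l k =
  (if k = 0 then Y0op c0 (Gs c0 c2 l)
   else if k = 1 then Jint (Gs c0 c2 l)
   else if k = 2 then Gs c0 c2 l
   else (\<lambda>x. l * Jint (Y0op c0 (Gs c0 c2 l)) x - Jint (\<lambda>t. Q t * Y0op c0 (Gs c0 c2 l) t) x))" for k :: nat

lemma Jint_third_quasi_deriv_AC:
  assumes "continuous_on {0..1} y"
  shows "AC_with_deriv 0 1 (\<lambda>x. l * Jint y x - Jint (\<lambda>t. Q t * y t) x) (\<lambda>x. (l - of_real (q x)) * y x)"
proof -
  have "AC_with_deriv 0 1 (\<lambda>x. l * Jint y x - Jint (\<lambda>t. Q t * y t) x) (\<lambda>x. l * y x - Q x * y x)"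
    by (intro AC_diff AC_cmult Jint_AC absolutely_integrable_mult_continuous Q_int assms absolutely_integrable_continuous_real)
  then show ?thesis by (simp add: Q_def algebra_simps)
qed

lemma Ysol_solves: "solves_ode p q l (Ysol c0 c2 l)"
proof -
  let ?G = "Gs c0 c2 l"
  have Gi: "?G absolutely_integrable_on {0..1}" by (rule absolutely_integrable_continuous_real[OF Gs_continuous])
  have "AC_with_deriv 0 1 (Y0op c0 ?G) (Jint ?G)"
    unfolding Y0op_def[abs_def] using AC_add[OF AC_const[of 0 1 c0] Jint_AC[OF Jint_aint[OF Gi]]] by simp
  moreover have "AC_with_deriv 0 1 (Jint ?G) ?G" by (rule Jint_AC[OF Gi])
  moreover have "AC_with_deriv 0 1 ?G (\<lambda>x. (l * Jint (Y0op c0 ?G) x - Jint (\<lambda>t. Q t * Y0op c0 ?G t) x) - of_real (p x) * Jint ?G x)"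
  proof (rule AC_cong)
    show "AC_with_deriv 0 1 (\<lambda>x. c2 + Lop l (Y0op c0 ?G) ?G x) (\<lambda>x. 0 + (l * Jint (Y0op c0 ?G) x - Jint (\<lambda>t. Q t * Y0op c0 ?G t) x - P x * Jint ?G x))"
      by (intro AC_add AC_const Lop_AC Y0op_continuous Gs_continuous)
    show "c2 + Lop l (Y0op c0 ?G) ?G x = ?G x" if "x \<in> {0..1}" for x
      using Gs_eq[OF that] by simp
  qed (simp add: P_def)
  moreover have "AC_with_deriv 0 1 (\<lambda>x. l * Jint (Y0op c0 ?G) x - Jint (\<lambda>t. Q t * Y0op c0 ?G t) x) (\<lambda>x. (l - of_real (q x)) * Y0op c0 ?G x)"
    by (rule Jint_third_quasi_deriv_AC[OF Y0op_continuous[OF Gs_continuous]])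
  ultimately show ?thesis
    by (simp add: solves_ode_def quasi_derivs_def Ysol_def)
qed

lemma Ysol_init: "Ysol c0 c2 l 0 0 = c0" "Ysol c0 c2 l 1 0 = 0" "Ysol c0 c2 l 2 0 = c2" "Ysol c0 c2 l 3 0 = 0"
proof -
  have "Lop l (Y0op c0 (Gs c0 c2 l)) (Gs c0 c2 l) 0 = 0" by (simp add: Lop_def)
  then have "Gs c0 c2 l 0 = c2" by (subst Gs_eq) auto
  then show "Ysol c0 c2 l 0 0 = c0" "Ysol c0 c2 l 1 0 = 0" "Ysol c0 c2 l 2 0 = c2" "Ysol c0 c2 l 3 0 = 0"
    by (simp_all add: Ysol_def Y0op_def)
qed

lemma solves_ode_continuous:
  assumes "solves_ode p q l Y"
  shows "continuous_on {0..1} (Y 0)" "continuous_on {0..1} (Y 1)" "continuous_on {0..1} (Y 2)" "continuous_on {0..1} (Y 3)"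
  using AC_continuous[of 0 1 "Y 0" "Y 1"] AC_continuous[of 0 1 "Y 1" "Y 2"]
    AC_continuous[of 0 1 "Y 2" "\<lambda>x. Y 3 x - of_real (p x) * Y 1 x"]
    AC_continuous[of 0 1 "Y 3" "\<lambda>x. (l - of_real (q x)) * Y 0 x"] assms
  by (simp_all add: solves_ode_def quasi_derivs_def)

text \<open>Zero initial data make \<open>Y 2\<close> a fixed point of the homogeneous map, so
  \<open>Lop_bound\<close> can be applied any number of times; the resulting bound tends to 0
  because of the factorial.\<close>

lemma solves_ode_zero:
  assumes s: "solves_ode p q l Y" and i: "Y 0 0 = 0" "Y 1 0 = 0" "Y 2 0 = 0" "Y 3 0 = 0" and x: "x \<in> {0..1}"
  shows "Y 0 x = 0" "Y 2 x = 0"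
proof -
  note ode = s[unfolded solves_ode_def quasi_derivs_def]
  note c = solves_ode_continuous[OF s]
  have Y1: "Y 1 x = Jint (Y 2) x" if "x \<in> {0..1}" for x
    using AC_eq_Jint[of "Y 1" "Y 2" x] ode i that by simp
  have Y0: "Y 0 x = Jint (Jint (Y 2)) x" if x: "x \<in> {0..1}" for x
    using AC_eq_Jint[of "Y 0" "Y 1" x] ode i x Jint_cong[OF Y1 x] by simp
  have Y3: "Y 3 x = l * Jint (Y 0) x - Jint (\<lambda>t. Q t * Y 0 t) x" if x: "x \<in> {0..1}" for x
  proof (rule AC_unique[OF _ _ _ x])
    show "AC_with_deriv 0 1 (Y 3) (\<lambda>x. (l - of_real (q x)) * Y 0 x)" using ode by blast
    show "AC_with_deriv 0 1 (\<lambda>x. l * Jint (Y 0) x - Jint (\<lambda>t. Q t * Y 0 t) x) (\<lambda>x. (l - of_real (q x)) * Y 0 x)"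
      by (rule Jint_third_quasi_deriv_AC[OF c(1)])
  qed (use i in auto)
  have Y2: "Y 2 x = Lop l (Y 0) (Y 2) x" if x: "x \<in> {0..1}" for x
  proof (rule AC_unique[OF _ _ _ x])
    show "AC_with_deriv 0 1 (Y 2) (\<lambda>x. Y 3 x - of_real (p x) * Y 1 x)" using ode by blast
    show "AC_with_deriv 0 1 (Lop l (Y 0) (Y 2)) (\<lambda>x. Y 3 x - of_real (p x) * Y 1 x)"
      by (rule AC_cong[OF Lop_AC[OF c(1,3), of l]]) (simp_all add: Y3 Y1 P_def del: One_nat_def)
  qed (use i in \<open>auto simp: Lop_def\<close>)
  have Y2': "Y 2 x = Lop l (Jint (Jint (Y 2))) (Y 2) x" if x: "x \<in> {0..1}" for x
  proof -
    have "Jint (Jint (Y 0)) x = Jint (Jint (Jint (Jint (Y 2)))) x"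
      using x Y0 by (intro Jint_cong) auto
    moreover have "Jint (Jint (\<lambda>t. Q t * Y 0 t)) x = Jint (Jint (\<lambda>t. Q t * Jint (Jint (Y 2)) t)) x"
      using x Y0 by (intro Jint_cong) auto
    ultimately show ?thesis using Y2[OF x] by (simp add: Lop_def)
  qed
  obtain C where C0: "0 \<le> C" and C: "\<And>x. x \<in> {0..1} \<Longrightarrow> norm (Y 2 x) \<le> C"
    using continuous_on_unit_interval_bound[OF c(3)] by blast
  have b: "norm (Y 2 t) \<le> C * Jint (hb (norm l)) t ^ k / fact k" if "t \<in> {0..1}" for t k
    using that
  proof (induction k arbitrary: t)
    case 0
    then show ?case using C by simp
  next
    case (Suc k)
    show ?case
      using Lop_bound[OF c(3) order_refl C0 Suc.IH Suc.prems] Y2'[OF Suc.prems] by simp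
  qed
  have zero: "Y 2 t = 0" if t: "t \<in> {0..1}" for t
  proof -
    have "norm (Y 2 t) \<le> 0"
      by (rule LIMSEQ_le_const[OF const_power_over_fact_tendsto_0]) (use b[OF t] in blast)
    then show ?thesis by simp
  qed
  show "Y 2 x = 0" by (rule zero[OF x])
  have "Jint (Jint (Y 2)) x = Jint (Jint (\<lambda>_. 0)) x"
    using x zero by (intro Jint_cong) auto
  moreover have "Jint (\<lambda>_. 0::complex) = (\<lambda>_. 0)" by (auto simp: Jint_def)
  ultimately show "Y 0 x = 0" using Y0[OF x] by simp
qed

text \<open>The conditions at 0 remove the second and fourth fundamental solutions, and the
  remaining two-dimensional family is the one for which \<open>Ysol\<close> provides
  existence.\<close>

lemma solves_ode_rep:
  assumes s: "solves_ode p q l Y" and i: "Y 1 0 = 0" "Y 3 0 = 0"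
    and A: "solves_ode p q l A" "A 0 0 = 1" "A 1 0 = 0" "A 2 0 = 0" "A 3 0 = 0"
    and B: "solves_ode p q l B" "B 0 0 = 0" "B 1 0 = 0" "B 2 0 = 1" "B 3 0 = 0"
    and x: "x \<in> {0..1}"
  shows "Y 0 x = Y 0 0 * A 0 x + Y 2 0 * B 0 x" "Y 2 x = Y 0 0 * A 2 x + Y 2 0 * B 2 x"
proof -
  define Z where "Z k x = 1 * Y k x + (-1) * (Y 0 0 * A k x + Y 2 0 * B k x)" for k x
  have "solves_ode p q l Z"
    unfolding Z_def[abs_def] by (intro solves_ode_lincomb s A B)
  from solves_ode_zero[OF this _ _ _ _ x] have "Z 0 x = 0" "Z 2 x = 0"
    using A B i by (simp_all add: Z_def)
  then show "Y 0 x = Y 0 0 * A 0 x + Y 2 0 * B 0 x" "Y 2 x = Y 0 0 * A 2 x + Y 2 0 * B 2 x"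
    by (simp_all add: Z_def algebra_simps)
qed

lemma phi_props:
  shows "solves_ode p q l (phi p q l 1)" "phi p q l 1 0 0 = 1" "phi p q l 1 1 0 = 0" "phi p q l 1 2 0 = 0" "phi p q l 1 3 0 = 0"
    "solves_ode p q l (phi p q l 3)" "phi p q l 3 0 0 = 0" "phi p q l 3 1 0 = 0" "phi p q l 3 2 0 = 1" "phi p q l 3 3 0 = 0"
proof -
  have S: "{1..4} = {1, 2, 3, 4::nat}" by auto
  have n: "3 - Suc 0 = 2" "4 - Suc 0 = 3" "2 - Suc 0 = 1" by auto
  have "\<exists>Y. solves_ode p q l Y \<and> (\<forall>k\<in>{1..4}. Y (k - 1) 0 = (if (1::nat) = k then 1 else 0))"
    using Ysol_init[of 1 0 l] by (intro exI[of _ "Ysol 1 0 l"] conjI Ysol_solves, unfold S) (simp add: n)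
  from someI_ex[OF this, folded phi_def, unfolded S]
  show "solves_ode p q l (phi p q l 1)" "phi p q l 1 0 0 = 1" "phi p q l 1 1 0 = 0" "phi p q l 1 2 0 = 0" "phi p q l 1 3 0 = 0"
    by (simp_all add: n)
  have "\<exists>Y. solves_ode p q l Y \<and> (\<forall>k\<in>{1..4}. Y (k - 1) 0 = (if (3::nat) = k then 1 else 0))"
    using Ysol_init[of 0 1 l] by (intro exI[of _ "Ysol 0 1 l"] conjI Ysol_solves, unfold S) (simp add: n)
  from someI_ex[OF this, folded phi_def, unfolded S]
  show "solves_ode p q l (phi p q l 3)" "phi p q l 3 0 0 = 0" "phi p q l 3 1 0 = 0" "phi p q l 3 2 0 = 1" "phi p q l 3 3 0 = 0"
    by (simp_all add: n)
qed

text \<open>\<open>phi\<close> is chosen separately for each \<open>l\<close>, so its definition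
  says nothing about the dependence on \<open>l\<close>; agreement with the Picard solution supplies
  the analyticity.\<close>

lemma phi_eq_Ysol:
  assumes "x \<in> {0..1}"
  shows "phi p q l 1 0 x = Ysol 1 0 l 0 x" "phi p q l 1 2 x = Ysol 1 0 l 2 x"
    "phi p q l 3 0 x = Ysol 0 1 l 0 x" "phi p q l 3 2 x = Ysol 0 1 l 2 x"
  using solves_ode_rep[OF Ysol_solves Ysol_init(2,4) phi_props assms, of 1 0]
    solves_ode_rep[OF Ysol_solves Ysol_init(2,4) phi_props assms, of 0 1]
    Ysol_init[of 1 0 l] Ysol_init[of 0 1 l] by simp_all

section \<open>Analyticity in the spectral parameter\<close>

lemma Gs_holomorphic:
  assumes x: "x \<in> {0..1}"
  shows "(\<lambda>l. Gs c0 c2 l x) holomorphic_on UNIV"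
proof (rule holomorphic_uniform_sequence[where f="\<lambda>n l. F c0 c2 n l x"])
  show "(\<lambda>l. F c0 c2 n l x) holomorphic_on UNIV" for n
    by (rule polyfam_holomorphic[OF F_polyfam x])
  fix l0 :: complex
  have "uniform_limit (cball l0 1) (\<lambda>n l. F c0 c2 n l x) (\<lambda>l. Gs c0 c2 l x) sequentially"
    unfolding uniform_limit_iff
  proof (intro allI impI)
    fix e :: real assume "0 < e"
    with F_uniform_limit[of "norm l0 + 1" c0 c2]
    have "\<forall>\<^sub>F n in sequentially. \<forall>y\<in>cball 0 (norm l0 + 1) \<times> {0..1}. dist (case y of (l, x) \<Rightarrow> F c0 c2 n l x) (case y of (l, x) \<Rightarrow> Gs c0 c2 l x) < e"
      unfolding uniform_limit_iff by simp
    then show "\<forall>\<^sub>F n in sequentially. \<forall>l\<in>cball l0 1. dist (F c0 c2 n l x) (Gs c0 c2 l x) < e"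
    proof (rule eventually_mono)
      fix n assume *: "\<forall>y\<in>cball 0 (norm l0 + 1) \<times> {0..1}. dist (case y of (l, x) \<Rightarrow> F c0 c2 n l x) (case y of (l, x) \<Rightarrow> Gs c0 c2 l x) < e"
      show "\<forall>l\<in>cball l0 1. dist (F c0 c2 n l x) (Gs c0 c2 l x) < e"
      proof
        fix l assume "l \<in> cball l0 1"
        then have "norm l \<le> norm l0 + 1"
          using norm_triangle_ineq2[of l l0] by (simp add: dist_norm norm_minus_commute)
        then have "(l, x) \<in> cball 0 (norm l0 + 1) \<times> {0..1}" using x by auto
        from bspec[OF * this] show "dist (F c0 c2 n l x) (Gs c0 c2 l x) < e" by simp
      qed
    qed
  qed
  then show "\<exists>d>0. cball l0 d \<subseteq> UNIV \<and> uniform_limit (cball l0 d) (\<lambda>n l. F c0 c2 n l x) (\<lambda>l. Gs c0 c2 l x) sequentially"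
    by (intro exI[of _ 1]) auto
qed auto

lemma Y0op_holomorphic:
  assumes x: "x \<in> {0..1}"
  shows "(\<lambda>l. Y0op c0 (Gs c0 c2 l) x) holomorphic_on UNIV"
proof (rule holomorphic_uniform_sequence[where f="\<lambda>n l. Y0op c0 (F c0 c2 n l) x"])
  have "polyfam (\<lambda>l. Y0op c0 (F c0 c2 n l))" for n
    unfolding Y0op_def[abs_def] by (intro polyfam_add polyfam_const polyfam_Jint1 F_polyfam continuous_intros)
  then show "(\<lambda>l. Y0op c0 (F c0 c2 n l) x) holomorphic_on UNIV" for n
    using polyfam_holomorphic x by blast
  fix l0 :: complex
  have "uniform_limit (cball l0 1) (\<lambda>n l. Y0op c0 (F c0 c2 n l) x) (\<lambda>l. Y0op c0 (Gs c0 c2 l) x) sequentially"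
    unfolding uniform_limit_iff
  proof (intro allI impI)
    fix e :: real assume e: "0 < e"
    then have e2: "0 < e/2" by simp
    have r: "0 \<le> norm l0 + 1" by simp
    from F_uniform_limit[OF r, of c0 c2, unfolded uniform_limit_iff, THEN spec, THEN mp, OF e2]
    have "\<forall>\<^sub>F n in sequentially. \<forall>y\<in>cball 0 (norm l0 + 1) \<times> {0..1}. dist (case y of (l, x) \<Rightarrow> F c0 c2 n l x) (case y of (l, x) \<Rightarrow> Gs c0 c2 l x) < e/2" .
    then show "\<forall>\<^sub>F n in sequentially. \<forall>l\<in>cball l0 1. dist (Y0op c0 (F c0 c2 n l) x) (Y0op c0 (Gs c0 c2 l) x) < e"
    proof (rule eventually_mono)
      fix n assume *: "\<forall>y\<in>cball 0 (norm l0 + 1) \<times> {0..1}. dist (case y of (l, x) \<Rightarrow> F c0 c2 n l x) (case y of (l, x) \<Rightarrow> Gs c0 c2 l x) < e/2"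
      show "\<forall>l\<in>cball l0 1. dist (Y0op c0 (F c0 c2 n l) x) (Y0op c0 (Gs c0 c2 l) x) < e"
      proof
        fix l assume "l \<in> cball l0 1"
        then have "norm l \<le> norm l0 + 1"
          using norm_triangle_ineq2[of l l0] by (simp add: dist_norm norm_minus_commute)
        then have le: "norm (F c0 c2 n l t - Gs c0 c2 l t) \<le> e/2" if "t \<in> {0..1}" for t
          using bspec[OF *, of "(l, t)"] that by (auto simp: dist_norm)
        have i: "(\<lambda>t. F c0 c2 n l t - Gs c0 c2 l t) absolutely_integrable_on {0..1}"
          by (intro absolutely_integrable_continuous_real continuous_intros F_continuous Gs_continuous)
        have "norm (Jint (Jint (\<lambda>t. F c0 c2 n l t - Gs c0 c2 l t)) x) \<le> e/2"
          by (intro norm_Jint_le_const Jint_aint i le x)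
        then show "dist (Y0op c0 (F c0 c2 n l) x) (Y0op c0 (Gs c0 c2 l) x) < e"
          using Y0op_diff[OF F_continuous Gs_continuous x, of c0 c0 c2 n l c0 c2 l] e by (simp add: dist_norm)
      qed
    qed
  qed
  then show "\<exists>d>0. cball l0 d \<subseteq> UNIV \<and> uniform_limit (cball l0 d) (\<lambda>n l. Y0op c0 (F c0 c2 n l) x) (\<lambda>l. Y0op c0 (Gs c0 c2 l) x) sequentially"
    by (intro exI[of _ 1]) auto
qed auto

lemma char_fun_holomorphic: "char_fun p q holomorphic_on UNIV"
proof -
  have "char_fun p q = (\<lambda>l. - (Y0op 1 (Gs 1 0 l) 1 * Gs 0 1 l 1 - Y0op 0 (Gs 0 1 l) 1 * Gs 1 0 l 1))"
    by (intro ext) (simp add: char_fun_def phi_eq_Ysol[of 1, simplified] Ysol_def)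
  then show ?thesis
    by (auto intro!: holomorphic_intros Gs_holomorphic Y0op_holomorphic)
qed

section \<open>Eigenvalues as zeros of the characteristic function\<close>

text \<open>Since the first and third quasi-derivatives vanish at 0, nontriviality is recorded by
  the two remaining initial values; these are the coefficients of the solution with respect to the
  first and third fundamental solution.\<close>

definition "eigsol l Y \<longleftrightarrow> solves_ode p q l Y \<and> Y 1 0 = 0 \<and> Y 3 0 = 0 \<and> Y 0 1 = 0 \<and> Y 2 1 = 0 \<and> (Y 0 0 \<noteq> 0 \<or> Y 2 0 \<noteq> 0)"

lemma eigsol_imp_char_fun:
  assumes "eigsol l Y"
  shows "char_fun p q l = 0"
proof -
  note e = assms[unfolded eigsol_def]
  have "Y 0 1 = Y 0 0 * phi p q l 1 0 1 + Y 2 0 * phi p q l 3 0 1"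
    "Y 2 1 = Y 0 0 * phi p q l 1 2 1 + Y 2 0 * phi p q l 3 2 1"
    using solves_ode_rep[OF _ _ _ phi_props, of l Y 1] e by auto
  then have 1: "Y 0 0 * phi p q l 1 0 1 + Y 2 0 * phi p q l 3 0 1 = 0"
    "Y 0 0 * phi p q l 1 2 1 + Y 2 0 * phi p q l 3 2 1 = 0" using e by auto
  \<comment> \<open>Cramer's rule: the adjugate matrix is applied to the two boundary
    equations.\<close>
  have "Y 0 0 * char_fun p q l = 0 \<and> Y 2 0 * char_fun p q l = 0"
    unfolding char_fun_def using 1 by algebra
  then show ?thesis using e by auto
qed

lemma char_fun_imp_eigsol:
  assumes "char_fun p q l = 0"
  shows "\<exists>Y. eigsol l Y"
proof -
  have D: "phi p q l 1 0 1 * phi p q l 3 2 1 = phi p q l 3 0 1 * phi p q l 1 2 1"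
    using assms by (simp add: char_fun_def)
  have "\<exists>a b. (a \<noteq> 0 \<or> b \<noteq> 0) \<and> a * phi p q l 1 0 1 + b * phi p q l 3 0 1 = 0 \<and> a * phi p q l 1 2 1 + b * phi p q l 3 2 1 = 0"
  \<comment> \<open>A nonzero row \<open>(u, v)\<close> of the singular matrix has the kernel vector
    \<open>(v, -u)\<close>, and the vanishing determinant makes it annihilate the other row as
    well.\<close>
  proof (cases "phi p q l 1 0 1 = 0 \<and> phi p q l 3 0 1 = 0")
    case True
    show ?thesis
    proof (cases "phi p q l 1 2 1 = 0 \<and> phi p q l 3 2 1 = 0")
      case True': True
      show ?thesis by (rule exI[of _ 1], rule exI[of _ 0]) (use True True' in auto)
    next
      case False
      show ?thesis by (rule exI[of _ "phi p q l 3 2 1"], rule exI[of _ "- phi p q l 1 2 1"]) (use True False in auto)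
    qed
  next
    case False
    show ?thesis by (rule exI[of _ "phi p q l 3 0 1"], rule exI[of _ "- phi p q l 1 0 1"]) (use False D in \<open>auto simp: algebra_simps\<close>)
  qed
  then obtain a b where ab: "a \<noteq> 0 \<or> b \<noteq> 0" "a * phi p q l 1 0 1 + b * phi p q l 3 0 1 = 0" "a * phi p q l 1 2 1 + b * phi p q l 3 2 1 = 0"
    by blast
  have "eigsol l (\<lambda>k x. a * phi p q l 1 k x + b * phi p q l 3 k x)"
    unfolding eigsol_def using ab phi_props[of l] by (auto intro!: solves_ode_lincomb)
  then show ?thesis by blast
qed

text \<open>If \<open>Y 0\<close> vanishes almost everywhere, it is an almost-everywhere derivative
  of the zero function; continuity then makes it vanish everywhere. Repeating this with
  \<open>Y 1\<close> and \<open>Y 2\<close> contradicts the initial values.\<close>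

lemma eigsol_nonzero:
  assumes "eigsol l Y"
  shows "\<not> (AE x\<in>{0..1} in lebesgue. Y 0 x = 0)"
proof
  note e = assms[unfolded eigsol_def] and o = assms[unfolded eigsol_def solves_ode_def quasi_derivs_def]
  have c: "continuous_on {0..1} (Y 0)" "continuous_on {0..1} (Y 1)" "continuous_on {0..1} (Y 2)"
    using solves_ode_continuous[of l Y] e by simp_all
  have z: "AC_with_deriv 0 1 (\<lambda>_. 0::complex) (\<lambda>_. 0)" by (rule AC_const)
  assume "AE x\<in>{0..1} in lebesgue. Y 0 x = 0"
  then have "AC_with_deriv 0 1 (\<lambda>_. 0) (Y 0)"
    by (intro AC_cong_AE[OF z]) auto
  then have 0: "Y 0 x = 0" if "x \<in> {0..1}" for x
    using AC_deriv_unique[OF _ z c(1) _ that] by auto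
  have "AC_with_deriv 0 1 (\<lambda>_. 0) (Y 1)"
    by (rule AC_cong[of 0 1 "Y 0" "Y 1"]) (use o 0 in auto)
  then have 1: "Y 1 x = 0" if "x \<in> {0..1}" for x
    using AC_deriv_unique[OF _ z c(2) _ that] by auto
  have "AC_with_deriv 0 1 (\<lambda>_. 0) (Y 2)"
    by (rule AC_cong[of 0 1 "Y 1" "Y 2"]) (use o 1 in auto)
  then have 2: "Y 2 x = 0" if "x \<in> {0..1}" for x
    using AC_deriv_unique[OF _ z c(3) _ that] by auto
  from 0[of 0] 2[of 0] e show False by auto
qed

lemma H_eigenvalue_iff_eigsol: "H_eigenvalue p q l \<longleftrightarrow> (\<exists>Y. eigsol l Y)"
proof
  assume "H_eigenvalue p q l"
  then obtain Y g where Y: "quasi_derivs p Y g" "AE x\<in>{0..1} in lebesgue. l * Y 0 x = g x + of_real (q x) * Y 0 x"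
      "Y 1 0 = 0" "Y 3 0 = 0" "Y 0 1 = 0" "Y 2 1 = 0" and nz: "\<not> (AE x\<in>{0..1} in lebesgue. Y 0 x = 0)"
    unfolding H_eigenvalue_def H_maps_def by blast
  have "AE x\<in>{0..1} in lebesgue. g x = (l - of_real (q x)) * Y 0 x"
    using Y(2) by eventually_elim (auto simp: algebra_simps)
  moreover have "AC_with_deriv 0 1 (Y 3) g" using Y(1) unfolding quasi_derivs_def by blast
  ultimately have "AC_with_deriv 0 1 (Y 3) (\<lambda>x. (l - of_real (q x)) * Y 0 x)"
    by (rule AC_cong_AE[rotated])
  then have s: "solves_ode p q l Y"
    using Y(1) by (simp add: solves_ode_def quasi_derivs_def)
  have "Y 0 0 \<noteq> 0 \<or> Y 2 0 \<noteq> 0"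
  proof (rule ccontr)
    assume "\<not> ?thesis"
    then have "Y 0 x = 0" if "x \<in> {0..1}" for x
      using solves_ode_zero(1)[OF s _ _ _ _ that] Y by auto
    then show False using nz by auto
  qed
  then show "\<exists>Y. eigsol l Y" using s Y unfolding eigsol_def by blast
next
  assume "\<exists>Y. eigsol l Y"
  then obtain Y where Y: "eigsol l Y" by blast
  note e = Y[unfolded eigsol_def]
  have c: "continuous_on {0..1} (Y 0)" using e solves_ode_continuous(1)[of l Y] by simp
  have "H_maps p q (Y 0) (\<lambda>x. l * Y 0 x)"
    unfolding H_maps_def
    by (rule exI[of _ Y], rule exI[of _ "\<lambda>x. (l - of_real (q x)) * Y 0 x"])
      (use e in \<open>auto simp: solves_ode_def algebra_simps intro!: in_L2_continuous continuous_intros c\<close>)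
  then show "H_eigenvalue p q l"
    unfolding H_eigenvalue_def using eigsol_nonzero[OF Y] by blast
qed

lemma H_eigenvalue_iff: "H_eigenvalue p q l \<longleftrightarrow> char_fun p q l = 0"
  using H_eigenvalue_iff_eigsol eigsol_imp_char_fun char_fun_imp_eigsol by blast

text \<open>Because \<open>p\<close> and \<open>q\<close> are real, conjugating a solution gives one
  for \<open>cnj l\<close>. Together with uniqueness in an annulus, this symmetry is what makes the
  large eigenvalues real.\<close>

lemma H_eigenvalue_cnj:
  assumes "H_eigenvalue p q l"
  shows "H_eigenvalue p q (cnj l)"
proof -
  obtain Y where Y: "eigsol l Y" using assms H_eigenvalue_iff_eigsol by blast
  note o = Y[unfolded eigsol_def solves_ode_def quasi_derivs_def]
  have "AC_with_deriv 0 1 (\<lambda>x. cnj (Y 0 x)) (\<lambda>x. cnj (Y 1 x))" "AC_with_deriv 0 1 (\<lambda>x. cnj (Y 1 x)) (\<lambda>x. cnj (Y 2 x))"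
    "AC_with_deriv 0 1 (\<lambda>x. cnj (Y 2 x)) (\<lambda>x. cnj (Y 3 x - of_real (p x) * Y 1 x))"
    "AC_with_deriv 0 1 (\<lambda>x. cnj (Y 3 x)) (\<lambda>x. cnj ((l - of_real (q x)) * Y 0 x))"
    using o by (auto intro!: AC_linear[OF _ bounded_linear_cnj] simp del: complex_cnj_diff complex_cnj_mult)
  then have "solves_ode p q (cnj l) (\<lambda>k x. cnj (Y k x))"
    by (simp add: solves_ode_def quasi_derivs_def)
  then have "eigsol (cnj l) (\<lambda>k x. cnj (Y k x))"
    using Y by (auto simp: eigsol_def)
  then show ?thesis using H_eigenvalue_iff_eigsol by blast
qed

end

section \<open>Variation of constants\<close>

lemma norm_Jint_le_upto:
  fixes f :: "real \<Rightarrow> 'a::euclidean_space"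
  assumes "f absolutely_integrable_on {0..1}" "g absolutely_integrable_on {0..1}"
    and "\<And>t. t \<in> {0..x} \<Longrightarrow> norm (f t) \<le> g t" "x \<in> {0..1}"
  shows "norm (Jint f x) \<le> Jint g x"
  unfolding Jint_def
proof (rule integral_norm_bound_integral)
  show "f integrable_on {0..x}"
    by (rule absolutely_integrable_imp_integrable_subinterval[OF assms(1)]) (use assms(4) in auto)
  show "g integrable_on {0..x}"
    by (rule absolutely_integrable_imp_integrable_subinterval[OF assms(2)]) (use assms(4) in auto)
qed (rule assms(3))

lemma norm_add4_le:
  fixes a b c d :: "'a::real_normed_vector"
  shows "norm (a + b + c + d) \<le> norm a + norm b + norm c + norm d"
  using norm_triangle_ineq[of "a + b + c" d] norm_triangle_ineq[of "a + b" c] norm_triangle_ineq[of a b] by linarith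

lemma AC_exp_mult:
  fixes r :: "real \<Rightarrow> complex"
  assumes r: "AC_with_deriv 0 1 r (\<lambda>x. c * r x + g x)"
  shows "AC_with_deriv 0 1 (\<lambda>x. exp (- c * of_real x) * r x) (\<lambda>x. exp (- c * of_real x) * g x)"
proof -
  have "AC_with_deriv 0 1 (\<lambda>x. exp (- c * of_real x)) (\<lambda>x. - c * exp (- c * of_real x))"
  proof (rule AC_of_has_derivative)
    fix x :: real
    have "((\<lambda>z. exp (- c * z)) has_field_derivative (- c * exp (- c * of_real x))) (at (of_real x))"
      by (auto intro!: derivative_eq_intros)
    from has_vector_derivative_real_field[OF this]
    show "((\<lambda>x. exp (- c * of_real x)) has_vector_derivative (- c * exp (- c * of_real x))) (at x within {0..1})" .
  next
    show "continuous_on {0..1} (\<lambda>x. - c * exp (- c * of_real x))"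
      by (intro continuous_on_mult continuous_on_exp continuous_on_of_real continuous_on_id continuous_on_const)
  qed
  from AC_mult[OF this r] show ?thesis
    by (rule AC_cong) (auto simp: algebra_simps)
qed

text \<open>Normalising by the common rate \<open>exp (G * x)\<close> lets one weight
  \<open>h\<close> serve several exponents \<open>c\<close>: since \<open>Re c \<le> G\<close>, the
  factor \<open>exp ((G - Re c) * t)\<close> increases in \<open>t\<close> and is estimated by its
  value at \<open>x\<close>.\<close>

lemma variation_of_constants_bound:
  fixes r :: "real \<Rightarrow> complex"
  assumes r: "AC_with_deriv 0 1 r (\<lambda>x. c * r x + g x)"
    and h: "h absolutely_integrable_on {0..1}" "\<And>t. t \<in> {0..1} \<Longrightarrow> norm (g t) \<le> h t * exp (G * t)"
      and c: "Re c \<le> G" and x: "x \<in> {0..1}"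
  shows "norm (r x - exp (c * of_real x) * r 0) \<le> Jint h x * exp (G * x)"
proof -
  note A = AC_exp_mult[OF r]
  have "exp (- c * of_real x) * r x - r 0 = Jint (\<lambda>t. exp (- c * of_real t) * g t) x"
    using AC_eq_Jint[OF A x] by simp
  also have "norm \<dots> \<le> Jint (\<lambda>t. exp ((G - Re c) * x) * h t) x"
  proof (rule norm_Jint_le_upto[OF _ _ _ x])
    show "(\<lambda>t. exp (- c * of_real t) * g t) absolutely_integrable_on {0..1}" by (rule AC_integrable[OF A])
    show "(\<lambda>t. exp ((G - Re c) * x) * h t) absolutely_integrable_on {0..1}" using h(1) by simp
    fix t assume t: "t \<in> {0..x}"
    have h0: "0 \<le> h t"
      using h(2)[of t] t x by (smt (verit, ccfv_SIG) atLeastAtMost_iff exp_gt_zero norm_ge_zero zero_le_mult_iff)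
    have "norm (exp (- c * of_real t) * g t) \<le> exp (- Re c * t) * (h t * exp (G * t))"
      using h(2)[of t] t x by (auto simp: norm_mult intro!: mult_left_mono)
    also have "\<dots> = exp ((G - Re c) * t) * h t"
      by (simp add: exp_add[symmetric] algebra_simps)
    also have "\<dots> \<le> exp ((G - Re c) * x) * h t"
      using t c h0 by (intro mult_right_mono) (auto intro: mult_left_mono)
    finally show "norm (exp (- c * of_real t) * g t) \<le> exp ((G - Re c) * x) * h t" .
  qed
  also have "\<dots> = exp ((G - Re c) * x) * Jint h x" by (simp add: Jint_def)
  finally have "norm (exp (c * of_real x)) * norm (exp (- c * of_real x) * r x - r 0) \<le> exp (Re c * x) * (exp ((G - Re c) * x) * Jint h x)"
    by (intro mult_mono) auto
  also have "\<dots> = Jint h x * exp (G * x)"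
    by (simp add: mult.assoc[symmetric] exp_add[symmetric] algebra_simps)
  finally show ?thesis
    unfolding norm_mult[symmetric]
    by (simp add: right_diff_distrib mult.assoc[symmetric] exp_add[symmetric])
qed

text \<open>A growing exponential is integrated from the right endpoint, where the propagator from 1
  back to \<open>x\<close> has norm at most 1 and errors are not amplified.\<close>

lemma variation_of_constants_bound_backward:
  fixes r :: "real \<Rightarrow> complex"
  assumes r: "AC_with_deriv 0 1 r (\<lambda>x. c * r x + g x)"
    and h: "h absolutely_integrable_on {0..1}" "\<And>t. t \<in> {0..1} \<Longrightarrow> norm (g t) \<le> h t"
      and c: "0 \<le> Re c" and x: "x \<in> {0..1}"
  shows "norm (r x - exp (c * of_real (x - 1)) * r 1) \<le> Jint h 1"
proof -
  note A = AC_exp_mult[OF r]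
  have h0: "0 \<le> h t" if "t \<in> {0..1}" for t using h(2)[OF that] norm_ge_zero order_trans by blast
  have hx: "h integrable_on {x..1}" using absolutely_integrable_imp_integrable_subinterval[OF h(1), of x 1] x by auto
  have "exp (- c * of_real 1) * r 1 - exp (- c * of_real x) * r x = integral {x..1} (\<lambda>t. exp (- c * of_real t) * g t)"
    using AC_increment[OF A, of x 1] x by simp
  also have "norm \<dots> \<le> integral {x..1} (\<lambda>t. exp (- Re c * x) * h t)"
  proof (rule integral_norm_bound_integral)
    show "(\<lambda>t. exp (- c * of_real t) * g t) integrable_on {x..1}"
      using absolutely_integrable_imp_integrable_subinterval[OF AC_integrable[OF A], of x 1] x by auto
    show "(\<lambda>t. exp (- Re c * x) * h t) integrable_on {x..1}"
      using hx by (simp add: integrable_on_mult_right)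
    fix t assume t: "t \<in> {x..1}"
    have "Re c * x \<le> Re c * t" using t c by (intro mult_left_mono) auto
    then show "norm (exp (- c * of_real t) * g t) \<le> exp (- Re c * x) * h t"
      using h(2)[of t] t x h0[of t] by (auto simp: norm_mult intro!: mult_mono)
  qed
  also have "\<dots> = exp (- Re c * x) * integral {x..1} h" by simp
  also have "\<dots> \<le> exp (- Re c * x) * Jint h 1"
  proof -
    have "Jint h 1 - Jint h x = integral {x..1} h" using AC_increment[OF Jint_AC[OF h(1)], of x 1] x by simp
    then show ?thesis using Jint_nonneg[OF h(1) h0 x] by simp
  qed
  finally have "norm (exp (c * of_real x)) * norm (exp (- c * of_real 1) * r 1 - exp (- c * of_real x) * r x)
     \<le> exp (Re c * x) * (exp (- Re c * x) * Jint h 1)"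
    by (intro mult_mono) auto
  then have "norm (exp (c * of_real x) * (exp (- c * of_real 1) * r 1 - exp (- c * of_real x) * r x)) \<le> Jint h 1"
    unfolding norm_mult by (simp add: mult.assoc[symmetric] exp_add[symmetric])
  moreover have "exp (c * of_real x) * exp (- c * of_real 1) = exp (c * of_real (x - 1))"
    unfolding exp_add[symmetric] by (simp add: algebra_simps)
  moreover have "exp (c * of_real x) * exp (- c * of_real x) = 1"
    unfolding exp_add[symmetric] by simp
  ultimately have "norm (exp (c * of_real (x - 1)) * r 1 - r x) \<le> Jint h 1"
    by (simp only: right_diff_distrib mult.assoc[symmetric] mult_1)
  then show ?thesis by (simp only: norm_minus_commute)
qed

section \<open>Asymptotics of the characteristic function\<close>

text \<open>These are the nonzero sums of two distinct fourth roots of unity: a minor of two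
  solutions \<open>exp (a z x)\<close> and \<open>exp (b z x)\<close> of the free equation has the
  rate \<open>(a + b) z\<close>.\<close>

definition zeta1 :: complex where "zeta1 = 1 + \<i>"
definition zeta2 :: complex where "zeta2 = 1 - \<i>"
definition zeta3 :: complex where "zeta3 = -1 + \<i>"
definition zeta4 :: complex where "zeta4 = -1 - \<i>"
lemmas zeta_defs = zeta1_def zeta2_def zeta3_def zeta4_def

lemma zeta_squares: "zeta1\<^sup>2 = 2 * \<i>" "zeta2\<^sup>2 = -2 * \<i>" "zeta3\<^sup>2 = -2 * \<i>" "zeta4\<^sup>2 = 2 * \<i>"
proof -
  show "zeta1\<^sup>2 = 2 * \<i>" unfolding zeta_defs by (rule complex_eqI; simp add: power2_eq_square)
  show "zeta2\<^sup>2 = -2 * \<i>" unfolding zeta_defs by (rule complex_eqI; simp add: power2_eq_square)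
  show "zeta3\<^sup>2 = -2 * \<i>" unfolding zeta_defs by (rule complex_eqI; simp add: power2_eq_square)
  show "zeta4\<^sup>2 = 2 * \<i>" unfolding zeta_defs by (rule complex_eqI; simp add: power2_eq_square)
qed

lemma zeta_cubes: "zeta1 ^ 3 = -2 + 2 * \<i>" "zeta2 ^ 3 = -2 - 2 * \<i>" "zeta3 ^ 3 = 2 + 2 * \<i>" "zeta4 ^ 3 = 2 - 2 * \<i>"
proof -
  show "zeta1 ^ 3 = -2 + 2 * \<i>" unfolding zeta_defs by (rule complex_eqI; simp add: power3_eq_cube)
  show "zeta2 ^ 3 = -2 - 2 * \<i>" unfolding zeta_defs by (rule complex_eqI; simp add: power3_eq_cube)
  show "zeta3 ^ 3 = 2 + 2 * \<i>" unfolding zeta_defs by (rule complex_eqI; simp add: power3_eq_cube)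
  show "zeta4 ^ 3 = 2 - 2 * \<i>" unfolding zeta_defs by (rule complex_eqI; simp add: power3_eq_cube)
qed

lemma zeta_fourth: 
  assumes "zeta \<in> {zeta1, zeta2, zeta3, zeta4}"
  shows "zeta ^ 4 = -4"
proof -
  have "zeta ^ 4 = zeta\<^sup>2 * zeta\<^sup>2" by (simp add: power2_eq_square power4_eq_xxxx)
  moreover obtain s where s: "zeta\<^sup>2 = s" "s = 2 * \<i> \<or> s = - 2 * \<i>" using assms zeta_squares by auto
  moreover have "s * s = -4" using s(2) by auto
  ultimately show ?thesis by (simp only:)
qed

lemma zeta_norms:
  assumes "zeta \<in> {zeta1, zeta2, zeta3, zeta4}"
  shows "norm zeta \<le> 2" "norm (zeta\<^sup>2) = 2" "norm (zeta ^ 3) \<le> 4" "Re (z * zeta) \<le> \<bar>Re z\<bar> + \<bar>Im z\<bar>"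
proof -
  show "norm zeta \<le> 2"
    using assms norm_triangle_ineq[of 1 \<i>] norm_triangle_ineq4[of 1 \<i>] norm_triangle_ineq[of "-1" \<i>] norm_triangle_ineq4[of "-1" \<i>]
    by (auto simp: zeta_defs)
  show n2: "norm (zeta\<^sup>2) = 2"
    using assms zeta_squares by (auto simp: norm_mult)
  have "norm (zeta ^ 3) = norm (zeta\<^sup>2) * norm zeta" by (simp add: norm_mult power3_eq_cube power2_eq_square)
  then show "norm (zeta ^ 3) \<le> 4" using n2 \<open>norm zeta \<le> 2\<close> by simp
  show "Re (z * zeta) \<le> \<bar>Re z\<bar> + \<bar>Im z\<bar>"
    using assms by (auto simp: zeta_defs)
qed

lemma cosh_mult_cos:
  fixes z :: complex
  shows "(exp (z * zeta1) + exp (z * zeta2) + exp (z * zeta3) + exp (z * zeta4)) / 4 = cosh z * cos z"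
proof -
  have "exp (z * zeta1) = exp z * exp (\<i> * z)" "exp (z * zeta2) = exp z * exp (- (\<i> * z))"
    "exp (z * zeta3) = exp (- z) * exp (\<i> * z)" "exp (z * zeta4) = exp (- z) * exp (- (\<i> * z))"
    unfolding exp_add[symmetric] by (simp_all add: zeta_defs algebra_simps)
  then show ?thesis by (simp add: cos_exp_eq cosh_field_def field_simps)
qed

context quartic begin

text \<open>Estimating minors instead of the single solutions avoids the cancellation of the dominant exponentials in the determinant.\<close>

definition "wedge i j l x = phi p q l 1 i x * phi p q l 3 j x - phi p q l 1 j x * phi p q l 3 i x" for i j :: nat

lemma char_fun_wedge: "char_fun p q l = - wedge 0 2 l 1"
  unfolding char_fun_def wedge_def by (simp only: mult.commute)

text \<open>The minors are the Pluecker coordinates of the plane spanned by the first and third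
  fundamental solution, so they obey the second compound of the first-order system. The
  quasi-derivatives keep \<open>p\<close> undifferentiated.\<close>

lemma wedge_AC:
  shows "AC_with_deriv 0 1 (wedge 0 1 l) (wedge 0 2 l)"
    and "AC_with_deriv 0 1 (wedge 0 2 l) (\<lambda>x. wedge 0 3 l x + wedge 1 2 l x - P x * wedge 0 1 l x)"
    and "AC_with_deriv 0 1 (wedge 0 3 l) (wedge 1 3 l)"
    and "AC_with_deriv 0 1 (wedge 1 2 l) (wedge 1 3 l)"
    and "AC_with_deriv 0 1 (wedge 1 3 l) (\<lambda>x. wedge 2 3 l x - (l - Q x) * wedge 0 1 l x)"
    and "AC_with_deriv 0 1 (wedge 2 3 l) (\<lambda>x. - P x * wedge 1 3 l x - (l - Q x) * wedge 0 2 l x)"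
proof -
  have o: "AC_with_deriv 0 1 (phi p q l i 0) (phi p q l i 1)" "AC_with_deriv 0 1 (phi p q l i 1) (phi p q l i 2)"
    "AC_with_deriv 0 1 (phi p q l i 2) (\<lambda>x. phi p q l i 3 x - P x * phi p q l i 1 x)"
    "AC_with_deriv 0 1 (phi p q l i 3) (\<lambda>x. (l - Q x) * phi p q l i 0 x)" if "i \<in> {1, 3}" for i
    using phi_props[of l] that by (auto simp: solves_ode_def quasi_derivs_def P_def Q_def)
  note A = o[of 1, simplified] and B = o[of 3, simplified]
  have w: "wedge i j l = (\<lambda>x. phi p q l 1 i x * phi p q l 3 j x - phi p q l 1 j x * phi p q l 3 i x)" for i j
    by (intro ext) (simp add: wedge_def)
  show "AC_with_deriv 0 1 (wedge 0 1 l) (wedge 0 2 l)" unfolding w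
    using AC_diff[OF AC_mult[OF A(1) B(2)] AC_mult[OF A(2) B(1)]] by (rule AC_cong) (auto simp: algebra_simps)
  show "AC_with_deriv 0 1 (wedge 0 2 l) (\<lambda>x. wedge 0 3 l x + wedge 1 2 l x - P x * wedge 0 1 l x)" unfolding w
    using AC_diff[OF AC_mult[OF A(1) B(3)] AC_mult[OF A(3) B(1)]] by (rule AC_cong) (auto simp: algebra_simps)
  show "AC_with_deriv 0 1 (wedge 0 3 l) (wedge 1 3 l)" unfolding w
    using AC_diff[OF AC_mult[OF A(1) B(4)] AC_mult[OF A(4) B(1)]] by (rule AC_cong) (auto simp: algebra_simps)
  show "AC_with_deriv 0 1 (wedge 1 2 l) (wedge 1 3 l)" unfolding w
    using AC_diff[OF AC_mult[OF A(2) B(3)] AC_mult[OF A(3) B(2)]] by (rule AC_cong) (auto simp: algebra_simps)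
  show "AC_with_deriv 0 1 (wedge 1 3 l) (\<lambda>x. wedge 2 3 l x - (l - Q x) * wedge 0 1 l x)" unfolding w
    using AC_diff[OF AC_mult[OF A(2) B(4)] AC_mult[OF A(4) B(2)]] by (rule AC_cong) (auto simp: algebra_simps)
  show "AC_with_deriv 0 1 (wedge 2 3 l) (\<lambda>x. - P x * wedge 1 3 l x - (l - Q x) * wedge 0 2 l x)" unfolding w
    using AC_diff[OF AC_mult[OF A(3) B(4)] AC_mult[OF A(4) B(3)]] by (rule AC_cong) (auto simp: algebra_simps)
qed

lemma wedge_init: "wedge 0 1 l 0 = 0" "wedge 0 2 l 0 = 1" "wedge 0 3 l 0 = 0" "wedge 1 2 l 0 = 0" "wedge 1 3 l 0 = 0" "wedge 2 3 l 0 = 0"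
proof -
  show "wedge 0 1 l 0 = 0" unfolding wedge_def by (simp only: phi_props mult_zero_left mult_zero_right diff_self)
  show "wedge 0 2 l 0 = 1" unfolding wedge_def by (simp only: phi_props mult_zero_left mult_zero_right mult_1 diff_0_right diff_self)
  show "wedge 0 3 l 0 = 0" unfolding wedge_def by (simp only: phi_props mult_zero_left mult_zero_right diff_self)
  show "wedge 1 2 l 0 = 0" unfolding wedge_def by (simp only: phi_props mult_zero_left mult_zero_right diff_self)
  show "wedge 1 3 l 0 = 0" unfolding wedge_def by (simp only: phi_props mult_zero_left mult_zero_right diff_self)
  show "wedge 2 3 l 0 = 0" unfolding wedge_def by (simp only: phi_props mult_zero_left mult_zero_right diff_self)
qed

text \<open>The difference of the two sides is the Lagrange bracket of the formally symmetric
  equation; it is constant and zero at 0. The relation reduces the six minors to five, matching the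
  four exponents \<open>z * zeta\<close> and the exponent 0.\<close>

lemma wedge_12: "x \<in> {0..1} \<Longrightarrow> wedge 1 2 l x = wedge 0 3 l x"
proof -
  assume x: "x \<in> {0..1}"
  have "wedge 1 2 l 0 = wedge 0 3 l 0" by (simp only: wedge_init)
  from AC_unique[OF wedge_AC(4,3) this x] show ?thesis .
qed

text \<open>Coordinates diagonalising the unperturbed system of minors; \<open>sz\<close> belongs to the exponent \<open>0\<close>.\<close>

definition "rz zeta z x = wedge 0 2 (z ^ 4) x - zeta ^ 3 / (2 * z) * wedge 0 3 (z ^ 4) x - zeta\<^sup>2 / (2 * z\<^sup>2) * wedge 1 3 (z ^ 4) x
   - zeta / 2 * (1 / z ^ 3 * wedge 2 3 (z ^ 4) x - z * wedge 0 1 (z ^ 4) x)" for zeta z :: complex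
definition "sz z x = z * wedge 0 1 (z ^ 4) x + 1 / z ^ 3 * wedge 2 3 (z ^ 4) x" for z :: complex

definition "pert zeta z x = - P x * wedge 0 1 (z ^ 4) x - zeta\<^sup>2 / (2 * z\<^sup>2) * (Q x * wedge 0 1 (z ^ 4) x)
   + zeta / (2 * z ^ 3) * (P x * wedge 1 3 (z ^ 4) x - Q x * wedge 0 2 (z ^ 4) x)" for zeta z :: complex

lemma rz_AC:
  assumes z: "z \<noteq> 0" and zeta: "zeta ^ 4 = -4"
  shows "AC_with_deriv 0 1 (rz zeta z) (\<lambda>x. (z * zeta) * rz zeta z x + pert zeta z x)"
proof -
  let ?l = "z ^ 4"
  have "AC_with_deriv 0 1 (rz zeta z) (\<lambda>x. (wedge 0 3 ?l x + wedge 1 2 ?l x - P x * wedge 0 1 ?l x) - zeta ^ 3 / (2 * z) * wedge 1 3 ?l x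
     - zeta\<^sup>2 / (2 * z\<^sup>2) * (wedge 2 3 ?l x - (?l - Q x) * wedge 0 1 ?l x)
     - zeta / 2 * (1 / z ^ 3 * (- P x * wedge 1 3 ?l x - (?l - Q x) * wedge 0 2 ?l x) - z * wedge 0 2 ?l x))"
    unfolding rz_def[abs_def] by (intro AC_diff AC_cmult wedge_AC)
  then show ?thesis
  proof (rule AC_cong)
    fix x :: real assume x: "x \<in> {0..1}"
    define a b u v w where "a = wedge 0 1 ?l x" and "b = wedge 0 2 ?l x" and "u = wedge 0 3 ?l x" and "v = wedge 1 3 ?l x" and "w = wedge 2 3 ?l x"
    have "z * zeta * (b - zeta ^ 3 / (2 * z) * u - zeta\<^sup>2 / (2 * z\<^sup>2) * v - zeta / 2 * (1 / z ^ 3 * w - z * a))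
      = z * zeta * b - zeta ^ 4 / 2 * u - zeta ^ 3 / (2 * z) * v - zeta\<^sup>2 / 2 * (w / z\<^sup>2 - z\<^sup>2 * a)"
      using z by (simp add: field_simps power2_eq_square power3_eq_cube power4_eq_xxxx)
    \<comment> \<open>The relation \<open>zeta ^ 4 = -4\<close> produces exactly the term
      \<open>2 * u\<close>, which is the sum of \<open>wedge 0 3\<close> and
      \<open>wedge 1 2\<close>.\<close>
    also have "\<dots> = z * zeta * b + 2 * u - zeta ^ 3 / (2 * z) * v - zeta\<^sup>2 / 2 * (w / z\<^sup>2 - z\<^sup>2 * a)"
      unfolding zeta by simp
    finally have 1: "z * zeta * (b - zeta ^ 3 / (2 * z) * u - zeta\<^sup>2 / (2 * z\<^sup>2) * v - zeta / 2 * (1 / z ^ 3 * w - z * a)) = \<dots>" .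
    have 2: "zeta\<^sup>2 / (2 * z\<^sup>2) * (w - (?l - Q x) * a) = zeta\<^sup>2 / 2 * (w / z\<^sup>2 - z\<^sup>2 * a) + zeta\<^sup>2 / (2 * z\<^sup>2) * (Q x * a)"
      using z by (simp add: field_simps power2_eq_square power3_eq_cube power4_eq_xxxx)
    have 3: "zeta / 2 * (1 / z ^ 3 * (- P x * v - (?l - Q x) * b) - z * b) = - (z * zeta * b) - zeta / (2 * z ^ 3) * (P x * v - Q x * b)"
      using z by (simp add: field_simps power2_eq_square power3_eq_cube power4_eq_xxxx)
    show "(wedge 0 3 ?l x + wedge 1 2 ?l x - P x * wedge 0 1 ?l x) - zeta ^ 3 / (2 * z) * wedge 1 3 ?l x
     - zeta\<^sup>2 / (2 * z\<^sup>2) * (wedge 2 3 ?l x - (?l - Q x) * wedge 0 1 ?l x)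
     - zeta / 2 * (1 / z ^ 3 * (- P x * wedge 1 3 ?l x - (?l - Q x) * wedge 0 2 ?l x) - z * wedge 0 2 ?l x)
     = z * zeta * rz zeta z x + pert zeta z x"
      unfolding rz_def pert_def wedge_12[OF x] a_def[symmetric] b_def[symmetric] u_def[symmetric] v_def[symmetric] w_def[symmetric]
      unfolding 1 2 3 by (simp add: algebra_simps)
  qed simp
qed

lemma sz_AC:
  assumes z: "z \<noteq> 0"
  shows "AC_with_deriv 0 1 (sz z) (\<lambda>x. 0 * sz z x + 1 / z ^ 3 * (Q x * wedge 0 2 (z ^ 4) x - P x * wedge 1 3 (z ^ 4) x))"
proof -
  have "AC_with_deriv 0 1 (sz z) (\<lambda>x. z * wedge 0 2 (z ^ 4) x + 1 / z ^ 3 * (- P x * wedge 1 3 (z ^ 4) x - (z ^ 4 - Q x) * wedge 0 2 (z ^ 4) x))"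
    unfolding sz_def[abs_def] by (intro AC_add AC_cmult wedge_AC)
  then show ?thesis
    by (rule AC_cong) (use z in \<open>auto simp: field_simps power3_eq_cube power4_eq_xxxx\<close>)
qed

definition "msum z x = norm (rz zeta1 z x) + norm (rz zeta2 z x) + norm (rz zeta3 z x) + norm (rz zeta4 z x) + norm (sz z x)"

text \<open>The passage to the \<open>rz\<close> is a discrete Fourier transform: the sum of
  \<open>zeta ^ k\<close> over the four values vanishes unless 4 divides \<open>k\<close>. Weighting
  with 1, \<open>zeta\<^sup>2 / (2 * \<i>)\<close> and \<open>zeta ^ 3\<close> therefore isolates
  one term each.\<close>

lemma rz_components:
  defines "U z x \<equiv> wedge 0 3 (z ^ 4) x / (2 * z)" and "V z x \<equiv> wedge 1 3 (z ^ 4) x / (2 * z\<^sup>2)"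
    and "E z x \<equiv> 1 / z ^ 3 * wedge 2 3 (z ^ 4) x - z * wedge 0 1 (z ^ 4) x"
  shows "rz zeta1 z x + rz zeta2 z x + rz zeta3 z x + rz zeta4 z x = 4 * wedge 0 2 (z ^ 4) x"
    "rz zeta1 z x - rz zeta2 z x - rz zeta3 z x + rz zeta4 z x = - 8 * \<i> * V z x"
    "zeta1 ^ 3 * rz zeta1 z x + zeta2 ^ 3 * rz zeta2 z x + zeta3 ^ 3 * rz zeta3 z x + zeta4 ^ 3 * rz zeta4 z x = 8 * E z x"
proof -
  define F where "F = E z x / 2"
  have "rz zeta z x = wedge 0 2 (z ^ 4) x - zeta ^ 3 * U z x - zeta\<^sup>2 * V z x - zeta * F" for zeta
    by (simp add: rz_def U_def V_def E_def F_def)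
  note r = this[of zeta1, unfolded zeta_cubes zeta_squares, unfolded zeta_defs]
    this[of zeta2, unfolded zeta_cubes zeta_squares, unfolded zeta_defs]
    this[of zeta3, unfolded zeta_cubes zeta_squares, unfolded zeta_defs]
    this[of zeta4, unfolded zeta_cubes zeta_squares, unfolded zeta_defs]
  show "rz zeta1 z x + rz zeta2 z x + rz zeta3 z x + rz zeta4 z x = 4 * wedge 0 2 (z ^ 4) x"
    "rz zeta1 z x - rz zeta2 z x - rz zeta3 z x + rz zeta4 z x = - 8 * \<i> * V z x"
    unfolding zeta_defs r by (simp_all add: algebra_simps)
  show "zeta1 ^ 3 * rz zeta1 z x + zeta2 ^ 3 * rz zeta2 z x + zeta3 ^ 3 * rz zeta3 z x + zeta4 ^ 3 * rz zeta4 z x = 8 * E z x"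
    unfolding zeta_cubes unfolding zeta_defs r by (simp add: algebra_simps F_def)
qed

lemma wedge_bounds:
  assumes z: "z \<noteq> 0"
  shows "norm (wedge 0 2 (z ^ 4) x) \<le> msum z x" "norm (wedge 1 3 (z ^ 4) x) \<le> (norm z)\<^sup>2 * msum z x"
    "norm (wedge 0 1 (z ^ 4) x) \<le> msum z x / norm z"
proof -
  define a b u v w where "a = wedge 0 1 (z ^ 4) x" and "b = wedge 0 2 (z ^ 4) x" and "u = wedge 0 3 (z ^ 4) x" and "v = wedge 1 3 (z ^ 4) x" and "w = wedge 2 3 (z ^ 4) x"
  note d = a_def[symmetric] b_def[symmetric] u_def[symmetric] v_def[symmetric] w_def[symmetric]
  define r1 r2 r3 r4 where "r1 = rz zeta1 z x" and "r2 = rz zeta2 z x" and "r3 = rz zeta3 z x" and "r4 = rz zeta4 z x"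
  note rd = r1_def r2_def r3_def r4_def
  have b: "b = (r1 + r2 + r3 + r4) / 4"
    using rz_components(1)[of z x, unfolded d] by (simp add: rd)
  have "r1 - r2 - r3 + r4 = - 8 * \<i> * (v / (2 * z\<^sup>2))"
    using rz_components(2)[of z x, unfolded d] by (simp add: rd)
  then have v: "v = z\<^sup>2 * (\<i> * (r1 - r2 - r3 + r4) / 4)"
    using z by simp
  have "norm (r1 + r2 + r3 + r4) \<le> norm r1 + norm r2 + norm r3 + norm r4"
    by (rule norm_add4_le)
  then show "norm (wedge 0 2 (z ^ 4) x) \<le> msum z x"
    unfolding d b msum_def rd[symmetric] using norm_ge_zero[of "sz z x"] norm_ge_zero[of r1] norm_ge_zero[of r2] norm_ge_zero[of r3] norm_ge_zero[of r4]
    unfolding norm_divide norm_numeral by linarith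
  have n: "norm (r1 - r2 - r3 + r4) \<le> norm r1 + norm r2 + norm r3 + norm r4"
    using norm_add4_le[of r1 "- r2" "- r3" r4] by simp
  have "norm (\<i> * (r1 - r2 - r3 + r4) / 4) \<le> msum z x"
    unfolding msum_def rd[symmetric] using norm_ge_zero[of "sz z x"] norm_ge_zero[of r1] norm_ge_zero[of r2] norm_ge_zero[of r3] norm_ge_zero[of r4] n
    unfolding norm_divide norm_mult norm_numeral norm_ii by linarith
  then show "norm (wedge 1 3 (z ^ 4) x) \<le> (norm z)\<^sup>2 * msum z x"
    unfolding d v norm_mult[of "z\<^sup>2"] norm_power by (rule mult_left_mono) auto
  define e where "e = 1 / z ^ 3 * w - z * a"
  have "zeta1 ^ 3 * r1 + zeta2 ^ 3 * r2 + zeta3 ^ 3 * r3 + zeta4 ^ 3 * r4 = 8 * e"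
    unfolding rd e_def a_def w_def by (rule rz_components(3))
  then have e: "e = (zeta1 ^ 3 * r1 + zeta2 ^ 3 * r2 + zeta3 ^ 3 * r3 + zeta4 ^ 3 * r4) / 8" by simp
  have "norm (zeta1 ^ 3 * r1 + zeta2 ^ 3 * r2 + zeta3 ^ 3 * r3 + zeta4 ^ 3 * r4) \<le> norm (zeta1 ^ 3 * r1) + norm (zeta2 ^ 3 * r2) + norm (zeta3 ^ 3 * r3) + norm (zeta4 ^ 3 * r4)"
    by (rule norm_add4_le)
  also have "\<dots> \<le> 4 * norm r1 + 4 * norm r2 + 4 * norm r3 + 4 * norm r4"
    unfolding norm_mult by (intro add_mono mult_right_mono zeta_norms) auto
  finally have ne: "norm e \<le> norm r1 + norm r2 + norm r3 + norm r4"
    unfolding e using norm_ge_zero[of r1] norm_ge_zero[of r2] norm_ge_zero[of r3] norm_ge_zero[of r4] unfolding norm_divide norm_numeral by linarith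
  \<comment> \<open>The fifth coordinate \<open>sz\<close> carries the same two minors as
    \<open>e\<close> with the opposite relative sign, so the pair determines
    \<open>wedge 0 1\<close>.\<close>
  have "2 * z * a = sz z x - e" unfolding sz_def e_def a_def w_def by (simp add: algebra_simps)
  then have "norm (2 * z * a) = norm (sz z x - e)" by (rule arg_cong)
  then have "2 * norm z * norm a = norm (sz z x - e)" unfolding norm_mult norm_numeral .
  also have "\<dots> \<le> msum z x"
    unfolding msum_def rd[symmetric] using ne norm_triangle_ineq4[of "sz z x" e] by linarith
  finally have 2: "2 * norm z * norm a \<le> msum z x" .
  have "0 \<le> norm z * norm a" by (intro mult_nonneg_nonneg norm_ge_zero)
  with 2 have "norm z * norm a \<le> msum z x" by linarith
  then have "norm a * norm z \<le> msum z x" by (subst mult.commute)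
  then show "norm (wedge 0 1 (z ^ 4) x) \<le> msum z x / norm z"
    unfolding d using z by (subst pos_le_divide_eq) simp_all
qed

text \<open>In the diagonal coordinates every perturbing term carries at least one factor
  \<open>1 / norm z\<close>, even after the growth \<open>(norm z)\<^sup>2\<close> of
  \<open>wedge 1 3\<close> is taken into account; higher negative powers are weakened by
  \<open>norm z \<ge> 1\<close>.\<close>

lemma pert_bounds:
  assumes z: "norm z \<ge> 1" and zeta: "zeta \<in> {zeta1, zeta2, zeta3, zeta4}"
  shows "norm (pert zeta z x) \<le> 2 / norm z * hb 0 x * msum z x"
    "norm (1 / z ^ 3 * (Q x * wedge 0 2 (z ^ 4) x - P x * wedge 1 3 (z ^ 4) x)) \<le> 2 / norm z * hb 0 x * msum z x"
proof -
  have z0: "z \<noteq> 0" "norm z > 0" using z by auto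
  define n where "n = norm z"
  define m where "m = msum z x"
  define P' where "P' = norm (P x)"
  define Q' where "Q' = norm (Q x)"
  have n1: "n \<ge> 1" "n > 0" using z by (auto simp: n_def)
  have m0: "m \<ge> 0" by (simp add: m_def msum_def)
  have pq: "P' \<ge> 0" "Q' \<ge> 0" by (auto simp: P'_def Q'_def)
  note b = wedge_bounds[OF z0(1), of x, folded m_def n_def]
  note zn = zeta_norms[OF zeta]
  have n3: "1 / n ^ 3 \<le> 1 / n" using n1 by (simp add: field_simps power3_eq_cube mult_ge1_I)
  have n2: "1 / n\<^sup>2 \<le> 1" using n1 by (simp add: field_simps power2_eq_square mult_ge1_I)
  have T1: "norm (P x * wedge 0 1 (z ^ 4) x) \<le> P' * (m / n)"
    unfolding norm_mult P'_def by (intro mult_left_mono b) auto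
  have "norm (zeta\<^sup>2 / (2 * z\<^sup>2) * (Q x * wedge 0 1 (z ^ 4) x)) = 1 / n\<^sup>2 * (Q' * norm (wedge 0 1 (z ^ 4) x))"
    using zn(2) by (simp add: norm_mult norm_divide norm_power n_def Q'_def)
  also have "\<dots> \<le> 1 * (Q' * (m / n))"
    using n2 pq m0 n1 b by (intro mult_mono) auto
  finally have T2: "norm (zeta\<^sup>2 / (2 * z\<^sup>2) * (Q x * wedge 0 1 (z ^ 4) x)) \<le> Q' * (m / n)" by simp
  have "norm (Q x * wedge 0 2 (z ^ 4) x - P x * wedge 1 3 (z ^ 4) x) \<le> norm (Q x * wedge 0 2 (z ^ 4) x) + norm (P x * wedge 1 3 (z ^ 4) x)"
    by (rule norm_triangle_ineq4)
  also have "\<dots> \<le> Q' * m + P' * (n\<^sup>2 * m)"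
    unfolding norm_mult P'_def Q'_def by (intro add_mono mult_left_mono b) auto
  finally have T3: "norm (Q x * wedge 0 2 (z ^ 4) x - P x * wedge 1 3 (z ^ 4) x) \<le> Q' * m + P' * (n\<^sup>2 * m)" .
  have "norm (1 / z ^ 3 * (Q x * wedge 0 2 (z ^ 4) x - P x * wedge 1 3 (z ^ 4) x)) \<le> 1 / n ^ 3 * (Q' * m + P' * (n\<^sup>2 * m))"
    using T3 n1 by (simp add: norm_mult norm_divide norm_power n_def divide_right_mono)
  also have "\<dots> = 1 / n ^ 3 * (Q' * m) + P' * (m / n)"
    using n1 by (simp add: field_simps power2_eq_square power3_eq_cube)
  also have "\<dots> \<le> 1 / n * (Q' * m) + P' * (m / n)"
    using n3 pq m0 by (intro add_right_mono mult_right_mono) auto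
  finally have T4: "norm (1 / z ^ 3 * (Q x * wedge 0 2 (z ^ 4) x - P x * wedge 1 3 (z ^ 4) x)) \<le> (Q' + P') * m / n"
    by (simp add: add_divide_distrib algebra_simps)
  have hb: "2 / norm z * hb 0 x * msum z x = 2 * ((Q' + P') * m / n)"
    by (simp add: hb_def P'_def Q'_def m_def n_def field_simps)
  have pos: "(Q' + P') * m / n \<ge> 0" using pq m0 n1 by auto
  show "norm (1 / z ^ 3 * (Q x * wedge 0 2 (z ^ 4) x - P x * wedge 1 3 (z ^ 4) x)) \<le> 2 / norm z * hb 0 x * msum z x"
    using T4 pos unfolding hb by linarith
  have "zeta / (2 * z ^ 3) * (P x * wedge 1 3 (z ^ 4) x - Q x * wedge 0 2 (z ^ 4) x)
    = (- zeta / 2) * (1 / z ^ 3 * (Q x * wedge 0 2 (z ^ 4) x - P x * wedge 1 3 (z ^ 4) x))"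
    using z0(1) by (simp add: divide_simps) (simp add: algebra_simps)
  from arg_cong[OF this, of norm] have "norm (zeta / (2 * z ^ 3) * (P x * wedge 1 3 (z ^ 4) x - Q x * wedge 0 2 (z ^ 4) x))
    = norm zeta / 2 * norm (1 / z ^ 3 * (Q x * wedge 0 2 (z ^ 4) x - P x * wedge 1 3 (z ^ 4) x))"
    by (simp add: norm_divide norm_mult)
  also have "\<dots> \<le> 1 * ((Q' + P') * m / n)"
    using zn(1) T4 by (intro mult_mono) auto
  finally have T5: "norm (zeta / (2 * z ^ 3) * (P x * wedge 1 3 (z ^ 4) x - Q x * wedge 0 2 (z ^ 4) x)) \<le> (Q' + P') * m / n" by simp
  have "norm (pert zeta z x) \<le> norm (P x * wedge 0 1 (z ^ 4) x) + norm (zeta\<^sup>2 / (2 * z\<^sup>2) * (Q x * wedge 0 1 (z ^ 4) x))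
     + norm (zeta / (2 * z ^ 3) * (P x * wedge 1 3 (z ^ 4) x - Q x * wedge 0 2 (z ^ 4) x))"
  proof -
    have "norm (- A - B + C) \<le> norm A + norm B + norm C" for A B C :: complex
      using norm_triangle_ineq[of "- A - B" C] norm_triangle_ineq4[of "- A" B] by simp
    then show ?thesis unfolding pert_def mult_minus_left by blast
  qed
  also have "\<dots> \<le> P' * (m / n) + Q' * (m / n) + (Q' + P') * m / n"
    by (intro add_mono T1 T2 T5)
  also have "\<dots> = 2 * ((Q' + P') * m / n)" using n1 by (simp add: field_simps)
  finally show "norm (pert zeta z x) \<le> 2 / norm z * hb 0 x * msum z x" unfolding hb .
qed

text \<open>Let \<open>S\<close> be the maximum of \<open>msum\<close> divided by
  \<open>exp (G * x)\<close>. Variation of constants determines each of the five coordinates up to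
  \<open>K * H\<close> with \<open>K = 2 / n * S\<close>, four of them starting from 1, whence
  \<open>S \<le> 4 + 5 * (K * H)\<close>. The condition \<open>n \<ge> 20 * H\<close> makes the last
  term at most \<open>S / 2\<close>, so \<open>S \<le> 8\<close> and the error \<open>K * H\<close>
  is at most \<open>16 * H / n\<close>.\<close>

lemma char_fun_estimate:
  assumes z: "norm z \<ge> 1" "norm z \<ge> 20 * Jint (hb 0) 1"
  shows "norm (char_fun p q (z ^ 4) + cosh z * cos z) \<le> 16 * Jint (hb 0) 1 / norm z * exp (\<bar>Re z\<bar> + \<bar>Im z\<bar>)"
proof -
  define G where "G = \<bar>Re z\<bar> + \<bar>Im z\<bar>"
  define n where "n = norm z"
  define H where "H = Jint (hb 0) 1"
  have n1: "n \<ge> 1" "n \<ge> 20 * H" using z by (auto simp: n_def H_def)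
  have z0: "z \<noteq> 0" using z by auto
  have H0: "H \<ge> 0" unfolding H_def by (intro Jint_nonneg hb_int hb_nonneg) auto
  have rc: "continuous_on {0..1} (rz zeta z)" if "zeta \<in> {zeta1, zeta2, zeta3, zeta4}" for zeta
    by (rule AC_continuous[OF rz_AC[OF z0 zeta_fourth[OF that]]])
  have sc: "continuous_on {0..1} (sz z)" by (rule AC_continuous[OF sz_AC[OF z0]])
  have "continuous_on {0..1} (\<lambda>x. exp (- G * x) * msum z x)"
    unfolding msum_def by (intro continuous_intros rc sc) auto
  then obtain x0 where x0: "x0 \<in> {0..1}" and x0max: "\<And>x. x \<in> {0..1} \<Longrightarrow> exp (- G * x) * msum z x \<le> exp (- G * x0) * msum z x0"
    using continuous_attains_sup[of "{0..1::real}" "\<lambda>x. exp (- G * x) * msum z x"] by auto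
  define S where "S = exp (- G * x0) * msum z x0"
  have S0: "S \<ge> 0" by (simp add: S_def msum_def)
  have mS: "msum z x \<le> S * exp (G * x)" if "x \<in> {0..1}" for x
  proof -
    have "exp (G * x) * (exp (- G * x) * msum z x) \<le> exp (G * x) * S"
      using x0max[OF that] unfolding S_def by (intro mult_left_mono) auto
    then show ?thesis by (simp add: mult.assoc[symmetric] exp_add[symmetric] mult.commute)
  qed
  define K where "K = 2 / n * S"
  have K0: "K \<ge> 0" using n1 S0 by (simp add: K_def)
  define h where "h t = K * hb 0 t" for t
  have h: "h absolutely_integrable_on {0..1}" unfolding h_def[abs_def] using hb_int by simp
  have le: "2 / norm z * hb 0 x * msum z x \<le> h x * exp (G * x)" if "x \<in> {0..1}" for x
  proof -
    have "2 / n * hb 0 x * msum z x \<le> 2 / n * hb 0 x * (S * exp (G * x))"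
      using mS[OF that] n1 hb_nonneg[of 0 x] by (intro mult_left_mono) auto
    then show ?thesis by (simp add: h_def K_def n_def mult_ac)
  qed
  have hK: "Jint h x \<le> K * H" if "x \<in> {0..1}" for x
  proof -
    have "Jint h x = K * Jint (hb 0) x" by (simp add: h_def[abs_def] Jint_def)
    moreover have "Jint (hb 0) x \<le> H" unfolding H_def using that by (intro Jint_incr hb_int hb_nonneg) auto
    ultimately show ?thesis using K0 by (simp add: mult_left_mono)
  qed
  have r: "norm (rz zeta z x - exp (z * zeta * of_real x)) \<le> K * H * exp (G * x)"
    if zeta: "zeta \<in> {zeta1, zeta2, zeta3, zeta4}" and x: "x \<in> {0..1}" for zeta x
  proof -
    have "rz zeta z 0 = 1" using wedge_init[of "z^4"] by (simp add: rz_def)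
    moreover have "norm (rz zeta z x - exp (z * zeta * of_real x) * rz zeta z 0) \<le> Jint h x * exp (G * x)"
      by (rule variation_of_constants_bound[OF rz_AC[OF z0 zeta_fourth[OF zeta]] h])
        (use pert_bounds(1)[OF z(1) zeta] le zeta_norms(4)[OF zeta] x in \<open>auto intro: order_trans simp: G_def\<close>)
    ultimately show ?thesis using hK[OF x] by (auto intro: order_trans mult_right_mono)
  qed
  have s: "norm (sz z x) \<le> K * H * exp (G * x)" if x: "x \<in> {0..1}" for x
  proof -
    have "sz z 0 = 0" using wedge_init[of "z^4"] by (simp add: sz_def)
    moreover have "norm (sz z x - exp (0 * of_real x) * sz z 0) \<le> Jint h x * exp (G * x)"
      by (rule variation_of_constants_bound[OF sz_AC[OF z0] h])
        (use pert_bounds(2)[OF z(1), of zeta1] le x in \<open>auto intro: order_trans simp: G_def\<close>)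
    ultimately show ?thesis using hK[OF x] by (auto intro: order_trans mult_right_mono)
  qed
  have rn: "norm (rz zeta z x0) \<le> (1 + K * H) * exp (G * x0)" if zeta: "zeta \<in> {zeta1, zeta2, zeta3, zeta4}" for zeta
  proof -
    have "norm (exp (z * zeta * of_real x0)) \<le> exp (G * x0)"
      using zeta_norms(4)[OF zeta, of z] x0 by (auto simp: G_def intro!: mult_right_mono)
    moreover have "norm (rz zeta z x0) \<le> norm (rz zeta z x0 - exp (z * zeta * of_real x0)) + norm (exp (z * zeta * of_real x0))"
      using norm_triangle_ineq[of "rz zeta z x0 - exp (z * zeta * of_real x0)" "exp (z * zeta * of_real x0)"] by (simp only: diff_add_cancel)
    ultimately have "norm (rz zeta z x0) \<le> K * H * exp (G * x0) + exp (G * x0)"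
      using r[OF zeta x0] by linarith
    then show ?thesis by (simp add: algebra_simps)
  qed
  have "msum z x0 \<le> (4 + 5 * (K * H)) * exp (G * x0)"
    unfolding msum_def using rn[of zeta1] rn[of zeta2] rn[of zeta3] rn[of zeta4] s[OF x0] by (simp add: algebra_simps)
  then have "S \<le> exp (- G * x0) * ((4 + 5 * (K * H)) * exp (G * x0))"
    unfolding S_def by (intro mult_left_mono) auto
  also have "\<dots> = 4 + 5 * (K * H)"
    by (simp add: mult.left_commute exp_add[symmetric])
  also have "5 * (K * H) \<le> S / 2"
  proof -
    have "5 * (K * H) = (10 * H / n) * S" using n1 by (simp add: K_def)
    also have "\<dots> \<le> (1 / 2) * S" using n1 S0 by (intro mult_right_mono) (auto simp: field_simps)
    finally show ?thesis by simp
  qed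
  finally have S8: "S \<le> 8" by simp
  define R where "R zeta = rz zeta z 1 - exp (z * zeta)" for zeta
  have R: "norm (R zeta) \<le> K * H * exp G" if "zeta \<in> {zeta1, zeta2, zeta3, zeta4}" for zeta
    using r[OF that, of 1] by (simp add: R_def)
  have b: "wedge 0 2 (z ^ 4) 1 = (rz zeta1 z 1 + rz zeta2 z 1 + rz zeta3 z 1 + rz zeta4 z 1) / 4"
    using rz_components(1)[of z 1] by simp
  have "char_fun p q (z ^ 4) + cosh z * cos z = - ((R zeta1 + R zeta2 + R zeta3 + R zeta4) / 4)"
    unfolding char_fun_wedge b cosh_mult_cos[symmetric] R_def by (simp add: field_simps)
  then have "norm (char_fun p q (z ^ 4) + cosh z * cos z) = norm (R zeta1 + R zeta2 + R zeta3 + R zeta4) / 4"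
    by (simp add: norm_divide)
  also have "norm (R zeta1 + R zeta2 + R zeta3 + R zeta4) \<le> norm (R zeta1) + norm (R zeta2) + norm (R zeta3) + norm (R zeta4)"
    by (rule norm_add4_le)
  also have "\<dots> \<le> 4 * (K * H * exp G)"
    using R[of zeta1] R[of zeta2] R[of zeta3] R[of zeta4] by simp
  finally have "norm (char_fun p q (z ^ 4) + cosh z * cos z) \<le> K * H * exp G" by simp
  also have "\<dots> \<le> 16 * H / n * exp G"
  proof -
    have "K \<le> 16 / n" unfolding K_def using S8 n1 by (simp add: field_simps)
    then have "K * H * exp G \<le> 16 / n * H * exp G" using H0 by (intro mult_right_mono) auto
    then show ?thesis by simp
  qed
  finally show ?thesis by (simp add: G_def n_def H_def)
qed

end

section \<open>Localization and labelling of the eigenvalues\<close>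

definition nu :: "nat \<Rightarrow> real" where "nu n = pi / 2 + pi * real n"

lemma nu_pos: "nu n > 0"
  using pi_gt_zero by (simp add: nu_def add_pos_nonneg)

lemma nu_inj: "nu m = nu n \<Longrightarrow> m = n"
  by (simp add: nu_def)

lemma cos_nu: "cos (nu n) = 0"
  by (simp add: nu_def cos_add)

lemma sin_nu_sq: "(sin (nu n))\<^sup>2 = 1"
  using sin_cos_squared_add[of "nu n"] by (simp add: cos_nu)

lemma fourth_root_sector:
  assumes "l \<noteq> 0" and "z = l powr (1/4)"
  shows "z ^ 4 = l" "norm z ^ 4 = norm l" "\<bar>Im z\<bar> \<le> Re z"
proof -
  define r t where "r = Re (Ln l / 4)" and "t = Im (Ln l / 4)"
  have z: "z = exp (Ln l / 4)" using assms by (simp add: powr_def)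
  have "z ^ 4 = exp (of_nat 4 * (Ln l / 4))" unfolding z by (simp only: exp_of_nat_mult)
  then show *: "z ^ 4 = l" using assms(1) by simp
  show "norm z ^ 4 = norm l" using * by (metis norm_power)
  have t: "- (pi / 4) \<le> t" "t \<le> pi / 4"
    using mpi_less_Im_Ln[OF assms(1)] Im_Ln_le_pi[OF assms(1)] by (simp_all add: t_def)
  have c0: "cos t \<ge> 0" using t pi_gt_zero by (intro cos_ge_zero) linarith+
  have "cos (2 * t) \<ge> 0" using t by (intro cos_ge_zero) linarith+
  then have "(sin t)\<^sup>2 \<le> (cos t)\<^sup>2" by (simp add: cos_double)
  then have "\<bar>sin t\<bar> \<le> cos t" using c0 by (simp add: abs_le_square_iff[symmetric])
  then have "exp r * \<bar>sin t\<bar> \<le> exp r * cos t" by (intro mult_left_mono) auto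
  moreover have "Re z = exp r * cos t" "Im z = exp r * sin t"
    unfolding z by (simp_all add: Re_exp Im_exp r_def t_def)
  ultimately show "\<bar>Im z\<bar> \<le> Re z" by (simp add: abs_mult)
qed

lemma abs_sin_minus_self_le: "\<bar>sin t - t\<bar> \<le> \<bar>t\<bar> ^ 3 / (6::real)"
proof -
  have "\<bar>sin t - t\<bar> \<le> inverse (fact 3) * \<bar>t\<bar> ^ 3"
    using Maclaurin_sin_bound[of t 3] by (simp add: eval_nat_numeral sin_coeff_def)
  then show ?thesis by (simp add: eval_nat_numeral field_simps)
qed

lemma abs_sin_lower:
  fixes t :: real
  assumes t: "\<bar>t\<bar> \<le> pi / 2"
  shows "\<bar>t / 3\<bar> \<le> \<bar>sin t\<bar>"
proof -
  \<comment> \<open>For \<open>\<bar>t\<bar> \<le> 2\<close> the cubic remainder of the sine is at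
    most two thirds of \<open>\<bar>t\<bar>\<close>.\<close>
  have "\<bar>t\<bar> ^ 2 \<le> 2 ^ 2" using t pi_less_4 by (intro power_mono) auto
  then have "\<bar>t\<bar> * \<bar>t\<bar>\<^sup>2 \<le> \<bar>t\<bar> * 4" by (intro mult_left_mono) auto
  then have "\<bar>t\<bar> ^ 3 \<le> 4 * \<bar>t\<bar>" by (simp add: power3_eq_cube power2_eq_square)
  then show ?thesis using abs_sin_minus_self_le[of t] by (simp add: abs_if split: if_splits)
qed

text \<open>The squared modulus is the squared cosine of the real part plus the squared hyperbolic
  sine of the imaginary part. For \<open>\<bar>Im z\<bar> \<ge> 1\<close> the latter suffices.
  Otherwise a zero within \<open>pi / 2\<close> of \<open>Re z\<close> is at distance at least
  \<open>pi / 4\<close> from \<open>z\<close>, which gives the lower bound \<open>pi / 12\<close>,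
  to be compared with \<open>exp \<bar>Im z\<bar> \<le> 3\<close>.\<close>

lemma norm_cos_lower:
  fixes z :: complex
  assumes x0: "0 \<le> Re z" and far: "\<And>n. pi / 4 \<le> norm (z - of_real (nu n))"
  shows "exp \<bar>Im z\<bar> / 32 \<le> norm (cos z)"
proof -
  define y where "y = Im z"
  define x where "x = Re z"
  have N: "(norm (cos z))\<^sup>2 = (cos x)\<^sup>2 + ((exp y - inverse (exp y)) / 2)\<^sup>2"
    by (simp add: norm_cos_squared x_def y_def power_divide)
  have ey: "\<bar>exp y - inverse (exp y)\<bar> = exp \<bar>y\<bar> - exp (- \<bar>y\<bar>)"
  proof -
    have "exp y - inverse (exp y) = exp y - exp (- y)" by (simp add: exp_minus)
    then show ?thesis by (simp add: abs_if)
  qed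
  show ?thesis
  proof (cases "\<bar>y\<bar> \<ge> 1")
    case True
    have 2: "exp \<bar>y\<bar> \<ge> 2" using exp_ge_add_one_self[of "\<bar>y\<bar>"] True by linarith
    have "exp (- \<bar>y\<bar>) \<le> 1" by simp
    moreover have "F \<le> 1 \<Longrightarrow> E \<ge> 2 \<Longrightarrow> E / 4 \<le> (E - F) / 2" for E F :: real by simp
    ultimately have "exp \<bar>y\<bar> / 4 \<le> (exp \<bar>y\<bar> - exp (- \<bar>y\<bar>)) / 2" using 2 by blast
    also have "\<dots> = \<bar>(exp y - inverse (exp y)) / 2\<bar>" using ey by simp
    also have "\<dots> \<le> \<bar>norm (cos z)\<bar>"
      unfolding abs_le_square_iff N by simp
    finally have "exp \<bar>y\<bar> / 4 \<le> norm (cos z)" by simp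
    moreover have "exp \<bar>y\<bar> / 32 \<le> exp \<bar>y\<bar> / 4" by simp
    ultimately show ?thesis unfolding y_def by linarith
  next
    case False
    define n where "n = nat \<lfloor>x / pi\<rfloor>"
    define t where "t = x - nu n"
    have "0 \<le> x / pi" using x0 by (simp add: x_def)
    then have "real n \<le> x / pi" "x / pi \<le> real n + 1" unfolding n_def by linarith+
    then have "real n * pi \<le> x" "x \<le> (real n + 1) * pi" by (simp_all add: field_simps)
    then have "x - nu n \<le> pi / 2" "nu n - x \<le> pi / 2" by (simp_all add: nu_def algebra_simps)
    then have t: "\<bar>t\<bar> \<le> pi / 2" unfolding t_def by linarith
    have "cos x = cos (t + nu n)" by (simp add: t_def)
    then have cx: "(cos x)\<^sup>2 = (sin t)\<^sup>2" by (simp add: cos_add cos_nu power_mult_distrib sin_nu_sq)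
    have "\<bar>t / 3\<bar> \<le> \<bar>sin t\<bar>" by (rule abs_sin_lower[OF t])
    then have "(t / 3)\<^sup>2 \<le> (sin t)\<^sup>2" by (simp only: abs_le_square_iff)
    moreover have "y\<^sup>2 \<le> ((exp y - inverse (exp y)) / 2)\<^sup>2"
      using real_le_abs_sinh[of y] by (simp only: abs_le_square_iff)
    ultimately have "t\<^sup>2 / 9 + y\<^sup>2 \<le> (norm (cos z))\<^sup>2" unfolding N cx by (simp add: power_divide)
    moreover have "(pi / 4)\<^sup>2 \<le> t\<^sup>2 + y\<^sup>2"
    proof -
      have "(pi / 4)\<^sup>2 \<le> (norm (z - of_real (nu n)))\<^sup>2" using far[of n] by (intro power_mono) auto
      then show ?thesis by (simp add: cmod_power2 t_def x_def y_def)
    qed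
    moreover have "0 \<le> y\<^sup>2" by simp
    ultimately have "(pi / 4)\<^sup>2 / 9 \<le> (norm (cos z))\<^sup>2" by linarith
    then have "(pi / 12)\<^sup>2 \<le> (norm (cos z))\<^sup>2" by (simp add: power_divide)
    then have "\<bar>pi / 12\<bar> \<le> \<bar>norm (cos z)\<bar>" by (simp only: abs_le_square_iff)
    then have "pi / 12 \<le> norm (cos z)" by simp
    moreover have "exp \<bar>y\<bar> \<le> 3" using False exp_le order_trans[of "exp \<bar>y\<bar>" "exp 1" 3] by simp
    ultimately show ?thesis using pi_ge_two unfolding y_def by linarith
  qed
qed

lemma norm_cosh_lower:
  fixes z :: complex
  assumes "1 \<le> Re z"
  shows "exp (Re z) / 4 \<le> norm (cosh z)"
proof -
  have "norm (cosh z) = norm (exp z + exp (- z)) / 2" unfolding cosh_field_def norm_divide by simp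
  moreover have "norm (exp z) - norm (exp (- z)) \<le> norm (exp z + exp (- z))"
    by (rule norm_diff_ineq)
  moreover have "norm (exp z) = exp (Re z)" "norm (exp (- z)) = exp (- Re z)" by simp_all
  moreover have "exp (- Re z) \<le> 1" "exp (Re z) \<ge> 2"
    using assms exp_ge_add_one_self[of "Re z"] by (simp, linarith)
  ultimately show ?thesis by linarith
qed

section \<open>Rouche's theorem on disks\<close>

lemma sum_winding_zorder_circlepath:
  assumes R: "0 < R" and nz: "\<And>p. norm p = R \<Longrightarrow> f p \<noteq> 0" and fin: "finite {p \<in> ball 0 (R + 1). f p = 0}"
  shows "(\<Sum>p\<in>{p \<in> ball 0 (R + 1). f p = 0}. winding_number (circlepath 0 R) p * of_int (zorder f p))
    = of_int (\<Sum>p\<in>{p. norm p < R \<and> f p = 0}. zorder f p)"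
proof -
  have "(\<Sum>p\<in>{p \<in> ball 0 (R + 1). f p = 0}. winding_number (circlepath 0 R) p * of_int (zorder f p))
    = (\<Sum>p\<in>{p. norm p < R \<and> f p = 0}. of_int (zorder f p))"
  proof (rule sum.mono_neutral_cong_right[OF fin])
    show "{p. norm p < R \<and> f p = 0} \<subseteq> {p \<in> ball 0 (R + 1). f p = 0}" by auto
    show "\<forall>p\<in>{p \<in> ball 0 (R + 1). f p = 0} - {p. norm p < R \<and> f p = 0}. winding_number (circlepath 0 R) p * of_int (zorder f p) = 0"
    proof
      fix p assume p: "p \<in> {p \<in> ball 0 (R + 1). f p = 0} - {p. norm p < R \<and> f p = 0}"
      then have "norm p > R" using nz[of p] by (cases "norm p = R") auto
      then have "winding_number (circlepath 0 R) p = 0"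
        by (intro winding_number_zero_outside[of _ "cball 0 R"]) (use R in auto)
      then show "winding_number (circlepath 0 R) p * of_int (zorder f p) = 0" by simp
    qed
    show "winding_number (circlepath 0 R) p * of_int (zorder f p) = of_int (zorder f p)" if "p \<in> {p. norm p < R \<and> f p = 0}" for p
      using that winding_number_circlepath[of p 0 R] by simp
  qed
  then show ?thesis by simp
qed

text \<open>The winding-number form is applied on a larger ball; zeros outside the circle have
  winding number 0 and drop out. Both functions are nonzero on the circle, so neither vanishes
  identically and their zeros in the ball are finite in number.\<close>

lemma rouche_disk:
  fixes f h :: "complex \<Rightarrow> complex"
  assumes R: "0 < R" and f: "f holomorphic_on UNIV" and h: "h holomorphic_on UNIV"
    and less: "\<And>p. norm p = R \<Longrightarrow> norm (h p - f p) < norm (f p)"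
  shows "finite {p. norm p < R \<and> h p = 0}"
    "(\<Sum>p\<in>{p. norm p < R \<and> h p = 0}. zorder h p) = (\<Sum>p\<in>{p. norm p < R \<and> f p = 0}. zorder f p)"
proof -
  have nzf: "f p \<noteq> 0" and nzh: "h p \<noteq> 0" if "norm p = R" for p
    using less[OF that] by auto
  have pR: "norm (of_real R :: complex) = R" using R by simp
  have fin1: "finite {p \<in> ball 0 (R + 1). g p = 0}" if g: "g holomorphic_on UNIV" and nz: "\<And>p. norm p = R \<Longrightarrow> g p \<noteq> 0" and "\<exists>p. g p = 0" for g :: "complex \<Rightarrow> complex"
  proof -
    have "\<not> g constant_on UNIV"
    proof
      assume "g constant_on UNIV"
      then obtain c where "\<And>x. g x = c" unfolding constant_on_def by blast
      then show False using that(3) nz[OF pR] by auto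
    qed
    then have "finite {p \<in> cball 0 (R + 1). g p = 0}"
      by (intro holomorphic_compact_finite_zeros[OF g]) auto
    then show ?thesis by (rule rev_finite_subset) auto
  qed
  have fin: "finite {p \<in> ball 0 (R + 1). g p = 0}" if g: "g holomorphic_on UNIV" and nz: "\<And>p. norm p = R \<Longrightarrow> g p \<noteq> 0" for g :: "complex \<Rightarrow> complex"
  proof (cases "\<exists>p. g p = 0")
    case False
    then have "{p \<in> ball 0 (R + 1). g p = 0} = {}" by auto
    then show ?thesis by (simp only: finite.emptyI)
  next
    case True
    from g nz True show ?thesis by (rule fin1)
  qed
  note finf = fin[OF f nzf] and finh = fin[OF h nzh]
  show "finite {p. norm p < R \<and> h p = 0}"
    by (rule rev_finite_subset[OF finh]) auto
  have "(\<Sum>p\<in>{p \<in> ball 0 (R + 1). f p + (h p - f p) = 0}. winding_number (circlepath 0 R) p * of_int (zorder (\<lambda>p. f p + (h p - f p)) p))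
      = (\<Sum>p\<in>{p \<in> ball 0 (R + 1). f p = 0}. winding_number (circlepath 0 R) p * of_int (zorder f p))"
  proof (rule Rouche_theorem)
    show "f holomorphic_on ball 0 (R + 1)" "(\<lambda>p. h p - f p) holomorphic_on ball 0 (R + 1)"
      using f h by (auto intro!: holomorphic_intros intro: holomorphic_on_subset)
    show "path_image (circlepath 0 R) \<subseteq> ball 0 (R + 1)" using R by auto
    show "\<forall>z\<in>path_image (circlepath 0 R). norm (h z - f z) < norm (f z)" using R less by (auto simp: dist_norm)
    show "\<forall>z. z \<notin> ball 0 (R + 1) \<longrightarrow> winding_number (circlepath 0 R) z = 0"
      by (intro allI impI winding_number_zero_outside[of _ "cball 0 R"]) (use R in auto)
  qed (use finf finh in auto)
  then have eq: "(\<Sum>p\<in>{p \<in> ball 0 (R + 1). h p = 0}. winding_number (circlepath 0 R) p * of_int (zorder h p))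
      = (\<Sum>p\<in>{p \<in> ball 0 (R + 1). f p = 0}. winding_number (circlepath 0 R) p * of_int (zorder f p))"
    by simp
  have "complex_of_int (\<Sum>p\<in>{p. norm p < R \<and> h p = 0}. zorder h p)
      = (\<Sum>p\<in>{p \<in> ball 0 (R + 1). h p = 0}. winding_number (circlepath 0 R) p * of_int (zorder h p))"
    by (rule sum_winding_zorder_circlepath[OF R nzh finh, symmetric])
  also note eq
  also have "(\<Sum>p\<in>{p \<in> ball 0 (R + 1). f p = 0}. winding_number (circlepath 0 R) p * of_int (zorder f p))
      = complex_of_int (\<Sum>p\<in>{p. norm p < R \<and> f p = 0}. zorder f p)"
    by (rule sum_winding_zorder_circlepath[OF R nzf finf])
  finally have "complex_of_int (\<Sum>p\<in>{p. norm p < R \<and> h p = 0}. zorder h p)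
    = complex_of_int (\<Sum>p\<in>{p. norm p < R \<and> f p = 0}. zorder f p)" .
  then show "(\<Sum>p\<in>{p. norm p < R \<and> h p = 0}. zorder h p) = (\<Sum>p\<in>{p. norm p < R \<and> f p = 0}. zorder f p)"
    by (simp only: of_int_eq_iff)
qed

section \<open>The free problem\<close>

definition D0 :: "complex \<Rightarrow> complex" where "D0 = char_fun (\<lambda>_. 0) (\<lambda>_. 0)"

interpretation free: quartic "\<lambda>_. 0" "\<lambda>_. 0"
  by unfold_locales auto

lemma D0_holomorphic: "D0 holomorphic_on UNIV"
  unfolding D0_def by (rule free.char_fun_holomorphic)

text \<open>With vanishing coefficients the error in \<open>char_fun_estimate\<close> is zero, which
  gives the identity for \<open>norm z > 1\<close>; analytic continuation extends it to the whole
  plane.\<close>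

lemma D0_fourth_power: "D0 (z ^ 4) = - (cosh z * cos z)"
proof -
  have J: "Jint (free.hb 0) 1 = 0"
    by (simp add: free.hb_def[abs_def] free.P_def free.Q_def Jint_def)
  have eq: "D0 (z ^ 4) = - (cosh z * cos z)" if "norm z > 1" for z
  proof -
    have "norm (char_fun (\<lambda>_. 0) (\<lambda>_. 0) (z ^ 4) + cosh z * cos z) \<le> 16 * Jint (free.hb 0) 1 / norm z * exp (\<bar>Re z\<bar> + \<bar>Im z\<bar>)"
      using that by (intro free.char_fun_estimate) (auto simp: J)
    then have "D0 (z ^ 4) + cosh z * cos z = 0" by (simp add: J D0_def)
    then show ?thesis by (simp add: add_eq_0_iff)
  qed
  have op: "open {z :: complex. norm z > 1}"
    by (intro open_Collect_less) (auto intro!: continuous_intros)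
  have h1: "(\<lambda>z. D0 (z ^ 4)) holomorphic_on UNIV"
  proof -
    have "(\<lambda>z::complex. z ^ 4) holomorphic_on UNIV" by (intro holomorphic_on_power holomorphic_on_ident)
    from holomorphic_on_compose_gen[OF this D0_holomorphic] show ?thesis by (simp add: o_def)
  qed
  have h2: "(\<lambda>z. - (cosh z * cos z)) holomorphic_on (UNIV :: complex set)"
    unfolding cosh_field_def by (intro holomorphic_intros) auto
  have ne: "{z :: complex. norm z > 1} \<noteq> {}" by (auto intro!: exI[of _ 2])
  show ?thesis
    by (rule analytic_continuation_open[of "{z. norm z > 1}" UNIV "\<lambda>z. D0 (z ^ 4)" "\<lambda>z. - (cosh z * cos z)"])
      (use op h1 h2 ne eq in auto)
qed

lemma D0_zero_iff: "D0 l = 0 \<longleftrightarrow> (\<exists>n. l = of_real (nu n ^ 4))"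
proof
  assume D: "D0 l = 0"
  obtain z where z: "z ^ 4 = l"
  proof (cases "l = 0")
    case True then show ?thesis using that[of 0] by simp
  next
    case False then show ?thesis using that[OF fourth_root_sector(1)[OF False refl]] by simp
  qed
  have "cosh z = 0 \<or> cos z = 0" using D D0_fourth_power[of z] z by auto
  \<comment> \<open>The zeros of \<open>cosh\<close> are those of \<open>cos\<close> rotated by a
    quarter turn, and this rotation is invisible in the fourth power.\<close>
  then obtain w where w: "cos w = 0" "w ^ 4 = z ^ 4"
  proof
    assume "cosh z = 0"
    then show ?thesis using that[of "\<i> * z"] by (simp add: cosh_conv_cos power_mult_distrib)
  qed (use that in auto)
  obtain k :: int where k: "w = complex_of_real (k * pi) + of_real pi / 2" using w(1) unfolding cos_eq_0 by blast
  then have wr: "w = of_real (pi / 2 + pi * k)" by simp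
  \<comment> \<open>A negative index \<open>k\<close> is reflected to \<open>- k - 1\<close>, which
    only changes the sign of \<open>pi / 2 + pi * k\<close>.\<close>
  have "(pi / 2 + pi * k) ^ 4 = nu (nat (if k \<ge> 0 then k else - k - 1)) ^ 4"
  proof (cases "k \<ge> 0")
    case False
    have "nu (nat (- k - 1)) = - (pi / 2 + pi * k)" using False by (simp add: nu_def field_simps)
    then have "nu (nat (- k - 1)) ^ 4 = (pi / 2 + pi * k) ^ 4" by (simp only: power_minus_even even_numeral)
    then show ?thesis using False by simp
  qed (simp add: nu_def)
  then have "l = of_real (nu (nat (if k \<ge> 0 then k else - k - 1)) ^ 4)"
    using w(2) z unfolding wr by (simp only: of_real_power[symmetric])
  then show "\<exists>n. l = of_real (nu n ^ 4)" by blast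
next
  assume "\<exists>n. l = of_real (nu n ^ 4)"
  then obtain n where "l = of_real (nu n) ^ 4" by auto
  then show "D0 l = 0" using D0_fourth_power[of "of_real (nu n)"] by (simp add: cos_of_real cos_nu)
qed

text \<open>Differentiating both sides of \<open>D0_fourth_power\<close> at \<open>nu n\<close>
  leaves the product of \<open>cosh (nu n)\<close> and \<open>sin (nu n)\<close>, which is nonzero;
  by the chain rule the derivative of \<open>D0\<close> cannot vanish at the fourth power.\<close>

lemma D0_zorder: "zorder D0 (of_real (nu n ^ 4)) = 1"
proof (rule zorder_zero_eqI[OF D0_holomorphic])
  let ?v = "complex_of_real (nu n)"
  have d: "(D0 has_field_derivative deriv D0 (?v ^ 4)) (at (?v ^ 4))"
    using D0_holomorphic by (intro holomorphic_derivI[of _ UNIV]) auto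
  have "((\<lambda>z. D0 (z ^ 4)) has_field_derivative deriv D0 (?v ^ 4) * (4 * ?v ^ 3)) (at ?v)"
    by (rule DERIV_chain2[where f=D0 and g="\<lambda>z. z ^ 4", OF d]) (auto intro!: derivative_eq_intros)
  moreover have "((\<lambda>z. - (cosh z * cos z)) has_field_derivative - (sinh ?v * cos ?v - cosh ?v * sin ?v)) (at ?v)"
    by (auto intro!: derivative_eq_intros)
  ultimately have eq: "deriv D0 (?v ^ 4) * (4 * ?v ^ 3) = - (sinh ?v * cos ?v - cosh ?v * sin ?v)"
    unfolding D0_fourth_power by (rule DERIV_unique)
  have "sin (nu n) \<noteq> 0" using sin_nu_sq[of n] by auto
  moreover have "cosh ?v = of_real (cosh (nu n))"
    by (simp add: cosh_field_def exp_of_real[symmetric])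
  moreover have "cosh (nu n) \<noteq> 0" using cosh_real_pos[of "nu n"] by simp
  ultimately have "- (sinh ?v * cos ?v - cosh ?v * sin ?v) \<noteq> 0"
    by (simp add: cos_of_real sin_of_real cos_nu)
  then have "deriv D0 (?v ^ 4) \<noteq> 0" using eq by auto
  then show "(deriv ^^ nat 1) D0 (of_real (nu n ^ 4)) \<noteq> 0" by simp
  show "(deriv ^^ i) D0 (of_real (nu n ^ 4)) = 0" if "i < nat 1" for i
    using that D0_zero_iff by auto
qed auto

text \<open>The radius \<open>pi * (N + 1)\<close> lies midway between \<open>nu N\<close> and
  \<open>nu (N + 1)\<close>, so the disk of its fourth power holds exactly the first
  \<open>N + 1\<close> zeros, all simple.\<close>

lemma D0_zeros_in_disk:
  assumes N: "R = pi * (real N + 1)"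
  shows "(\<Sum>p\<in>{p. norm p < R ^ 4 \<and> D0 p = 0}. zorder D0 p) = int (N + 1)"
proof -
  have lt: "nu n ^ 4 < R ^ 4 \<longleftrightarrow> n \<le> N" for n
  proof -
    have "nu n ^ 4 < R ^ 4 \<longleftrightarrow> nu n < R"
      using nu_pos[of n] N by (simp add: not_le[symmetric] power_mono_iff)
    also have "\<dots> \<longleftrightarrow> pi * (1 / 2 + real n) < pi * (real N + 1)" unfolding N nu_def by (simp add: algebra_simps)
    also have "\<dots> \<longleftrightarrow> n \<le> N" by auto
    finally show ?thesis .
  qed
  have set: "{p. norm p < R ^ 4 \<and> D0 p = 0} = (\<lambda>n. of_real (nu n ^ 4)) ` {..N}"
    using lt nu_pos by (auto simp: D0_zero_iff abs_of_pos norm_power)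
  have inj: "inj_on (\<lambda>n. complex_of_real (nu n ^ 4)) {..N}"
  proof (rule inj_onI)
    fix m n assume "complex_of_real (nu m ^ 4) = of_real (nu n ^ 4)"
    then have "nu m ^ 4 = nu n ^ 4" by (simp only: of_real_eq_iff)
    then have "nu m = nu n" using nu_pos[of m] nu_pos[of n] by (rule_tac power_eq_imp_eq_base[of _ 4]) auto
    then show "m = n" by (rule nu_inj)
  qed
  have "(\<Sum>p\<in>{p. norm p < R ^ 4 \<and> D0 p = 0}. zorder D0 p) = (\<Sum>n\<le>N. 1)"
    unfolding set by (subst sum.reindex[OF inj]) (simp add: D0_zorder o_def del: of_real_power)
  then show ?thesis by simp
qed

section \<open>Comparison with the free problem\<close>

context quartic begin

abbreviation "D \<equiv> char_fun p q"
text \<open>The first entry yields \<open>Re z \<ge> 1\<close> in the sector, the second is a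
  hypothesis of \<open>char_fun_estimate\<close>. In the third, \<open>2048 = 16 * 128\<close>: the
  16 stems from that estimate and \<open>128 = 4 * 32\<close> from the lower bounds for
  \<open>cosh\<close> and \<open>cos\<close>.\<close>

definition "Rbig = max 2 (max (20 * Jint (hb 0) 1) (2048 * Jint (hb 0) 1 + 1))"

lemma char_fun_close:
  assumes z: "norm z \<ge> Rbig" "\<bar>Im z\<bar> \<le> Re z" and far: "\<And>n. pi / 4 \<le> norm (z - of_real (nu n))"
  shows "norm (D (z ^ 4) - D0 (z ^ 4)) < norm (D0 (z ^ 4))"
proof -
  let ?H = "Jint (hb 0) 1"
  have H0: "?H \<ge> 0" by (intro Jint_nonneg hb_int hb_nonneg) auto
  have zb: "norm z \<ge> 2" "norm z \<ge> 20 * ?H" "norm z > 2048 * ?H" using z(1) by (auto simp: Rbig_def)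
  have "norm z \<le> \<bar>Re z\<bar> + \<bar>Im z\<bar>" by (rule cmod_le)
  then have re1: "Re z \<ge> 1" using zb z(2) by linarith
  have lower: "exp (\<bar>Re z\<bar> + \<bar>Im z\<bar>) / 128 \<le> norm (cosh z * cos z)"
  proof -
    have "exp (Re z) / 4 * (exp \<bar>Im z\<bar> / 32) \<le> norm (cosh z) * norm (cos z)"
      using re1 by (intro mult_mono norm_cosh_lower norm_cos_lower far) auto
    then show ?thesis using re1 by (simp add: norm_mult exp_add)
  qed
  have "norm (D (z ^ 4) - D0 (z ^ 4)) \<le> 16 * ?H / norm z * exp (\<bar>Re z\<bar> + \<bar>Im z\<bar>)"
    using char_fun_estimate[of z] zb by (simp add: D0_fourth_power)
  also have "\<dots> < exp (\<bar>Re z\<bar> + \<bar>Im z\<bar>) / 128"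
  proof -
    have "norm z > 0" using zb by linarith
    then have "16 * ?H / norm z < 1 / 128" using zb(3) by (subst pos_divide_less_eq) auto
    then have "16 * ?H / norm z * exp (\<bar>Re z\<bar> + \<bar>Im z\<bar>) < 1 / 128 * exp (\<bar>Re z\<bar> + \<bar>Im z\<bar>)"
      by (rule mult_strict_right_mono) simp
    then show ?thesis by simp
  qed
  also have "\<dots> \<le> norm (D0 (z ^ 4))" using lower by (simp add: D0_fourth_power)
  finally show ?thesis .
qed

lemma zeros_in_disk:
  assumes R: "R = pi * (real N + 1)" "R \<ge> Rbig"
  shows "finite {p. norm p < R ^ 4 \<and> D p = 0}" "(\<Sum>p\<in>{p. norm p < R ^ 4 \<and> D p = 0}. zorder D p) = int (N + 1)"
proof -
  have R0: "0 < R" using R(1) by simp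
  have "norm (D l - D0 l) < norm (D0 l)" if l: "norm l = R ^ 4" for l
  proof -
    define z where "z = l powr (1/4)"
    have "l \<noteq> 0" using l R0 by auto
    note f = fourth_root_sector[OF this z_def]
    have "norm z ^ 4 = R ^ 4" using f l by simp
    then have nz: "norm z = R" using R0 by (rule_tac power_eq_imp_eq_base[of _ 4]) auto
    have "pi / 4 \<le> norm (z - of_real (nu n))" for n
    proof -
      have "\<bar>R - nu n\<bar> \<le> norm (z - of_real (nu n))"
        using norm_triangle_ineq3[of z "of_real (nu n)"] nz nu_pos[of n] by (simp add: abs_of_pos)
      moreover have "R - nu n = pi * (real N - real n + 1 / 2)" by (simp add: R nu_def algebra_simps)
      then have "\<bar>R - nu n\<bar> = pi * \<bar>real N - real n + 1 / 2\<bar>" by (simp add: abs_mult)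
      moreover have "\<bar>real N - real n + 1 / 2\<bar> \<ge> 1 / 4" by (cases "n \<le> N") auto
      then have "pi * \<bar>real N - real n + 1 / 2\<bar> \<ge> pi * (1 / 4)" by (intro mult_left_mono) auto
      ultimately show ?thesis by linarith
    qed
    from char_fun_close[OF _ f(3) this] nz R(2) f(1) show ?thesis by simp
  qed
  from rouche_disk[OF _ D0_holomorphic char_fun_holomorphic this] R0
  show "finite {p. norm p < R ^ 4 \<and> D p = 0}" "(\<Sum>p\<in>{p. norm p < R ^ 4 \<and> D p = 0}. zorder D p) = int (N + 1)"
    using D0_zeros_in_disk[OF R(1)] by auto
qed

end

lemma big_disk_eq: "big_disk N = {lam. cmod lam < (pi * (real N + 1)) ^ 4}"
proof -
  have "pi / 2 + pi * (real N + 1 / 2) = pi * (real N + 1)" by (simp add: algebra_simps)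
  then show ?thesis by (simp add: big_disk_def)
qed

lemma fourth_power_le_iff: "0 \<le> a \<Longrightarrow> 0 \<le> b \<Longrightarrow> a ^ 4 \<le> b ^ 4 \<longleftrightarrow> a \<le> (b::real)"
  by (rule power_mono_iff) auto

lemma fourth_power_less_iff: "0 \<le> a \<Longrightarrow> 0 \<le> b \<Longrightarrow> a ^ 4 < b ^ 4 \<longleftrightarrow> a < (b::real)"
  by (simp add: not_le[symmetric] fourth_power_le_iff)

lemma Dset_iff: "l \<in> Dset n \<longleftrightarrow> cmod (l powr (1 / 4) - of_real (nu n)) < pi / 4"
  by (simp add: Dset_def nu_def)

lemma Dset_annulus:
  assumes "l \<in> Dset n"
  shows "(pi * real n) ^ 4 \<le> cmod l" "cmod l < (pi * (real n + 1)) ^ 4"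
proof -
  define z where "z = l powr (1 / 4)"
  have d: "cmod (z - of_real (nu n)) < pi / 4" using assms by (simp add: Dset_iff z_def)
  have nn: "nu n = pi * real n + pi / 2" "nu n > 0" using nu_pos by (auto simp: nu_def)
  have l0: "l \<noteq> 0"
  proof
    assume "l = 0"
    then have "z = 0" by (simp add: z_def)
    then have "cmod (of_real (nu n) :: complex) < pi / 4" using d by simp
    then have "nu n < pi / 4" using nn(2) by (simp only: norm_of_real abs_of_pos)
    moreover have "pi / 2 \<le> nu n" by (simp add: nu_def)
    ultimately show False using pi_gt_zero by linarith
  qed
  have "\<bar>cmod z - nu n\<bar> < pi / 4"
    using norm_triangle_ineq3[of z "of_real (nu n)"] d nn(2) by (simp add: abs_of_pos)
  moreover have "pi * (real n + 1) = pi * real n + pi" by (simp add: algebra_simps)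
  ultimately have b: "pi * real n \<le> cmod z" "cmod z < pi * (real n + 1)"
    using nn(1) pi_gt_zero by linarith+
  have lz: "cmod l = cmod z ^ 4" using fourth_root_sector(2)[OF l0 z_def] by simp
  have p: "0 \<le> pi * real n" "0 \<le> pi * (real n + 1)" by auto
  show "(pi * real n) ^ 4 \<le> cmod l" unfolding lz using b p by (subst fourth_power_le_iff) auto
  show "cmod l < (pi * (real n + 1)) ^ 4" unfolding lz using b p by (subst fourth_power_less_iff) auto
qed

lemma Dset_subset_annulus:
  assumes "l \<in> Dset n" "0 < n"
  shows "l \<in> big_disk n - big_disk (n - 1)"
proof -
  have "real (n - 1) + 1 = real n" using assms(2) by simp
  then show ?thesis using Dset_annulus[OF assms(1)] by (simp add: big_disk_eq not_less)
qed

context quartic begin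

text \<open>The order of a zero is positive once \<open>D\<close> is known not to vanish identically
  near it. By the identity theorem a single nonzero value suffices, and the Rouche circle provides
  one at \<open>R ^ 4\<close>.\<close>

lemma D_zero_zorder:
  assumes R: "R = pi * (real N + 1)" "R \<ge> Rbig" and l: "D l = 0"
  shows "zorder D l > 0"
proof -
  have "R ^ 4 \<noteq> 0" using R(1) by simp
  have "D (of_real (R ^ 4)) \<noteq> 0"
  proof -
    have z: "of_real (R ^ 4) = (of_real R :: complex) ^ 4" by simp
    have R0: "R > 0" using R(1) by simp
    have "pi / 4 \<le> norm (of_real R - of_real (nu n) :: complex)" for n
    proof -
      have "R - nu n = pi * (real N - real n + 1 / 2)" by (simp add: R nu_def algebra_simps)
      then have "\<bar>R - nu n\<bar> = pi * \<bar>real N - real n + 1 / 2\<bar>" by (simp add: abs_mult)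
      moreover have "\<bar>real N - real n + 1 / 2\<bar> \<ge> 1 / 4" by (cases "n \<le> N") auto
      then have "pi * \<bar>real N - real n + 1 / 2\<bar> \<ge> pi * (1 / 4)" by (intro mult_left_mono) auto
      moreover have "norm (of_real R - of_real (nu n) :: complex) = \<bar>R - nu n\<bar>"
        by (metis norm_of_real of_real_diff)
      ultimately show ?thesis by linarith
    qed
    note far = this
    have r1: "Rbig \<le> norm (of_real R :: complex)" using R(2) R0 by (simp only: norm_of_real abs_of_pos)
    have r2: "\<bar>Im (of_real R)\<bar> \<le> Re (of_real R :: complex)" using R0 by simp
    show ?thesis
    proof
      assume "D (of_real (R ^ 4)) = 0"
      then have "D ((of_real R) ^ 4) = 0" unfolding z .
      then show False using char_fun_close[OF r1 r2 far] by simp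
    qed
  qed
  then have "eventually (\<lambda>w. D w \<noteq> 0 \<and> w \<in> UNIV) (at l)"
    by (intro non_zero_neighbour_alt[OF char_fun_holomorphic]) auto
  then have "frequently (\<lambda>w. D w \<noteq> 0) (at l)"
    by (intro eventually_frequently) (auto elim: eventually_mono)
  from zorder_pos_iff[OF char_fun_holomorphic _ _ this] l show ?thesis by auto
qed

context
  fixes N0 :: nat
  assumes N0: "pi * (real N0 + 1) \<ge> Rbig"
begin

lemma R_ge: "N \<ge> N0 \<Longrightarrow> pi * (real N + 1) \<ge> Rbig"
  using N0 by (rule order_trans) simp

lemma alg_mult_zorder: "D l = 0 \<Longrightarrow> int (alg_mult p q l) = zorder D l" "D l = 0 \<Longrightarrow> alg_mult p q l > 0"
  using D_zero_zorder[OF refl N0, of l] by (simp_all add: alg_mult_def)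

lemma finite_eigs: "N \<ge> N0 \<Longrightarrow> finite {l \<in> big_disk N. H_eigenvalue p q l}"
  using zeros_in_disk(1)[OF refl R_ge] by (simp add: big_disk_eq H_eigenvalue_iff)

lemma eig_count_big_disk:
  assumes "N \<ge> N0"
  shows "eig_count p q (big_disk N) = N + 1"
proof -
  have "int (eig_count p q (big_disk N)) = (\<Sum>l\<in>{l \<in> big_disk N. H_eigenvalue p q l}. zorder D l)"
    by (simp add: eig_count_def alg_mult_zorder H_eigenvalue_iff)
  also have "\<dots> = int (N + 1)"
    using zeros_in_disk(2)[OF refl R_ge[OF assms]] by (simp add: big_disk_eq H_eigenvalue_iff)
  finally show ?thesis by simp
qed

lemma big_disk_mono: "M \<le> N \<Longrightarrow> big_disk M \<subseteq> big_disk N"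
proof -
  assume "M \<le> N"
  then have "(pi * (real M + 1)) ^ 4 \<le> (pi * (real N + 1)) ^ 4" by (intro power_mono mult_left_mono) auto
  then show ?thesis unfolding big_disk_eq by (auto intro: less_le_trans)
qed

text \<open>The counts for consecutive disks leave total multiplicity one, hence a single simple
  eigenvalue. Its root \<open>z\<close> is within \<open>pi / 4\<close> of some \<open>nu k\<close>,
  since \<open>char_fun_close\<close> excludes zeros elsewhere, and its modulus forces
  \<open>k = n\<close>. The annulus is stable under conjugation, so the eigenvalue is real.\<close>

lemma eig_in_annulus:
  assumes n: "n > N0"
  shows "\<exists>a. \<bar>a - nu n\<bar> < pi / 4 \<and> {l \<in> big_disk n - big_disk (n - 1). H_eigenvalue p q l} = {of_real (a ^ 4)} \<and>
    alg_mult p q (of_real (a ^ 4)) = 1 \<and> of_real (a ^ 4) \<in> Dset n \<and> eig_count p q (Dset n) = 1"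
proof -
  let ?E = "\<lambda>N. {l \<in> big_disk N. H_eigenvalue p q l}"
  let ?A = "{l \<in> big_disk n - big_disk (n - 1). H_eigenvalue p q l}"
  have sub: "?E (n - 1) \<subseteq> ?E n" using big_disk_mono[of "n - 1" n] by auto
  have A: "?A = ?E n - ?E (n - 1)" by auto
  have "(\<Sum>l\<in>?E n. alg_mult p q l) = (\<Sum>l\<in>?A. alg_mult p q l) + (\<Sum>l\<in>?E (n - 1). alg_mult p q l)"
    unfolding A by (rule sum.subset_diff[OF sub finite_eigs]) (use n in auto)
  then have sum1: "(\<Sum>l\<in>?A. alg_mult p q l) = 1"
    using eig_count_big_disk[of n] eig_count_big_disk[of "n - 1"] n by (simp add: eig_count_def)
  have finA: "finite ?A" unfolding A using finite_eigs[of n] n by auto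
  have "\<exists>a\<in>?A. alg_mult p q a = 1 \<and> (\<forall>b\<in>?A. a \<noteq> b \<longrightarrow> alg_mult p q b = 0)"
    using sum1 unfolding sum_eq_1_iff[OF finA] .
  then obtain m where m: "m \<in> ?A" "alg_mult p q m = 1" "\<And>b. b \<in> ?A \<Longrightarrow> m \<noteq> b \<Longrightarrow> alg_mult p q b = 0"
    by blast
  have "b = m" if "b \<in> ?A" for b
  proof (rule ccontr)
    assume "b \<noteq> m"
    then have "alg_mult p q b = 0" using m(3)[OF that] by simp
    moreover have "alg_mult p q b > 0" using that by (intro alg_mult_zorder(2)) (simp add: H_eigenvalue_iff)
    ultimately show False by simp
  qed
  with m(1) have Am: "?A = {m}" by blast
  have bd: "cmod m < (pi * (real n + 1)) ^ 4" "(pi * real n) ^ 4 \<le> cmod m"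
    using m(1) n by (auto simp: big_disk_eq not_less of_nat_diff)
  have Dm: "D m = 0" and Hm: "H_eigenvalue p q m" using m(1) by (auto simp: H_eigenvalue_iff)
  have m0: "m \<noteq> 0" using bd(2) n by auto
  define z where "z = m powr (1 / 4)"
  note f = fourth_root_sector[OF m0 z_def]
  have zb: "cmod z < pi * (real n + 1)" "pi * real n \<le> cmod z"
    using bd unfolding f(2)[symmetric] by (auto simp: fourth_power_le_iff fourth_power_less_iff)
  have "cmod z \<ge> Rbig"
  proof -
    have "N0 \<le> n - 1" using n by simp
    from R_ge[OF this] have "Rbig \<le> pi * (real (n - 1) + 1)" .
    moreover have "real (n - 1) + 1 = real n" using n by simp
    ultimately show ?thesis using zb(2) by simp
  qed
  have "\<exists>k. cmod (z - of_real (nu k)) < pi / 4"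
  proof (rule ccontr)
    assume "\<not> ?thesis"
    then have "\<And>k. pi / 4 \<le> cmod (z - of_real (nu k))" by (simp add: not_less)
    from char_fun_close[OF \<open>cmod z \<ge> Rbig\<close> f(3) this] show False using Dm f(1) by simp
  qed
  then obtain k where k: "cmod (z - of_real (nu k)) < pi / 4" by blast
  have "\<bar>cmod z - nu k\<bar> < pi / 4"
    using norm_triangle_ineq3[of z "of_real (nu k)"] k nu_pos[of k] by (simp add: abs_of_pos)
  moreover have "nu k = pi * real k + pi / 2" "pi * (real n + 1) = pi * real n + pi"
    "pi * (real n + 3 / 4) = pi * real n + 3 / 4 * pi" "pi * (real k + 3 / 4) = pi * real k + 3 / 4 * pi"
    by (simp_all add: nu_def algebra_simps)
  ultimately have "pi * real k < pi * (real n + 3 / 4)" "pi * real n < pi * (real k + 3 / 4)"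
    using zb by linarith+
  then have "real k < real n + 3 / 4" "real n < real k + 3 / 4" by simp_all
  then have kn: "k = n" by linarith
  have mD: "m \<in> Dset n" using k unfolding kn Dset_iff z_def .
  have cE: "{l \<in> Dset n. H_eigenvalue p q l} = {m}"
  proof -
    have "Dset n \<subseteq> big_disk n - big_disk (n - 1)"
      using Dset_subset_annulus n by blast
    then show ?thesis using Am mD Hm by blast
  qed
  have "cnj m \<in> ?A" using m(1) H_eigenvalue_cnj by (auto simp: big_disk_eq)
  then have "cnj m = m" using Am by auto
  then have "Im (z ^ 4) = 0" using f(1) by (simp add: complex_eq_iff)
  moreover have "Im (z ^ 4) = 4 * (Re z * Im z * ((Re z)\<^sup>2 - (Im z)\<^sup>2))"
    by (simp add: power4_eq_xxxx power2_eq_square algebra_simps)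
  \<comment> \<open>Of the three ways in which \<open>z ^ 4\<close> can be real, the imaginary axis
    and the two diagonals are incompatible with \<open>z\<close> being within \<open>pi / 4\<close>
    of \<open>nu n\<close>.\<close>
  ultimately have or: "Re z = 0 \<or> Im z = 0 \<or> (Re z)\<^sup>2 = (Im z)\<^sup>2" by auto
  have k': "\<bar>Re z - nu n\<bar> < pi / 4" "\<bar>Im z\<bar> < pi / 4"
    using abs_Re_le_cmod[of "z - of_real (nu n)"] abs_Im_le_cmod[of "z - of_real (nu n)"] k kn by auto
  have re: "pi / 4 < Re z" 
  proof -
    have "pi / 2 \<le> nu n" by (simp add: nu_def)
    then show ?thesis using k'(1) by linarith
  qed
  have "(Re z)\<^sup>2 \<noteq> (Im z)\<^sup>2"
  proof
    assume "(Re z)\<^sup>2 = (Im z)\<^sup>2"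
    then have "\<bar>Re z\<bar> = \<bar>Im z\<bar>" by (simp only: power2_eq_iff abs_eq_iff)
    then show False using re k'(2) by linarith
  qed
  then have im: "Im z = 0" using or re pi_gt_zero by auto
  then have "z = of_real (Re z)" by (simp add: complex_eq_iff)
  then have "m = (of_real (Re z)) ^ 4" using f(1) by simp
  then have ma: "m = of_real (Re z ^ 4)" by simp
  show ?thesis
    using k'(1) Am m(2) mD cE unfolding ma by (intro exI[of _ "Re z"]) (auto simp: eig_count_def)
qed

text \<open>\<open>mu\<close> is chosen by \<open>SOME\<close>, so a labelling must be exhibited:
  the eigenvalues of the first disk are listed with multiplicity and sorted by real part, followed
  by one eigenvalue per annulus. Monotonicity beyond the first disk holds because the later
  eigenvalues are positive and lie outside all earlier disks.\<close>

lemma labelling_exists: "\<exists>m. eig_labelling p q m"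
proof -
  have "\<forall>n\<in>{N0<..}. \<exists>a. \<bar>a - nu n\<bar> < pi / 4 \<and> {l \<in> big_disk n - big_disk (n - 1). H_eigenvalue p q l} = {of_real (a ^ 4)} \<and>
    alg_mult p q (of_real (a ^ 4)) = 1 \<and> of_real (a ^ 4) \<in> Dset n \<and> eig_count p q (Dset n) = 1"
    using eig_in_annulus by auto
  from bchoice[OF this] obtain a where "\<forall>n\<in>{N0<..}. \<bar>a n - nu n\<bar> < pi / 4 \<and> {l \<in> big_disk n - big_disk (n - 1). H_eigenvalue p q l} = {of_real (a n ^ 4)} \<and>
    alg_mult p q (of_real (a n ^ 4)) = 1 \<and> of_real (a n ^ 4) \<in> Dset n \<and> eig_count p q (Dset n) = 1" by blast
  then have a: "\<And>n. n > N0 \<Longrightarrow> \<bar>a n - nu n\<bar> < pi / 4" 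
    "\<And>n. n > N0 \<Longrightarrow> {l \<in> big_disk n - big_disk (n - 1). H_eigenvalue p q l} = {complex_of_real (a n ^ 4)}"
    "\<And>n. n > N0 \<Longrightarrow> alg_mult p q (of_real (a n ^ 4)) = 1" "\<And>n. n > N0 \<Longrightarrow> of_real (a n ^ 4) \<in> Dset n"
    "\<And>n. n > N0 \<Longrightarrow> eig_count p q (Dset n) = 1"
    by (simp_all only: greaterThan_iff)
  let ?E = "{l \<in> big_disk N0. H_eigenvalue p q l}"
  define M where "M = (\<Sum>l\<in>?E. replicate_mset (alg_mult p q l) l)"
  have finE: "finite ?E" by (rule finite_eigs) simp
  have cM: "count M l = (if l \<in> ?E then alg_mult p q l else 0)" for l
    using finE by (simp add: M_def count_sum sum.delta sum.delta')
  obtain ys where ys: "mset ys = M" using ex_mset by blast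
  define xs where "xs = sort_key Re ys"
  have mx: "mset xs = M" by (simp add: xs_def ys)
  have setx: "set xs = ?E"
  proof -
    have "set xs = set_mset M" unfolding mx[symmetric] by simp
    also have "\<dots> = {l. count M l > 0}" by auto
    also have "\<dots> = ?E" using alg_mult_zorder(2) by (auto simp: cM H_eigenvalue_iff)
    finally show ?thesis .
  qed
  have len: "length xs = N0 + 1"
  proof -
    have "length xs = size M" unfolding mx[symmetric] by simp
    also have "\<dots> = (\<Sum>l\<in>set_mset M. count M l)" by (rule size_multiset_overloaded_eq)
    also have "set_mset M = ?E" unfolding setx[symmetric] mx[symmetric] by simp
    also have "(\<Sum>l\<in>?E. count M l) = (\<Sum>l\<in>?E. alg_mult p q l)" by (intro sum.cong) (auto simp: cM)
    also have "\<dots> = N0 + 1" using eig_count_big_disk[of N0] by (simp add: eig_count_def)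
    finally show ?thesis .
  qed
  have cnt: "card {i. i < length xs \<and> xs ! i = l} = count M l" for l
    unfolding mx[symmetric] count_mset count_list_eq_length_filter length_filter_conv_card
    by (rule arg_cong[where f=card]) auto
  have srt: "sorted (map Re xs)" by (simp add: xs_def)
  define m where "m n = (if n \<le> N0 then xs ! n else of_real (a n ^ 4))" for n
  have mE: "m n \<in> ?E" if "n \<le> N0" for n
    using setx nth_mem[of n xs] that by (auto simp: m_def len)
  have mA: "m n \<in> {l \<in> big_disk n - big_disk (n - 1). H_eigenvalue p q l}" if "n > N0" for n
    using a(2)[OF that] that by (simp add: m_def)
  have apos: "a n > 0" if "n > N0" for n
  proof -
    have "pi / 2 \<le> nu n" by (simp add: nu_def)
    then show ?thesis using a(1)[OF that] pi_gt_zero by linarith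
  qed
  have Re_m: "Re (m n) = cmod (m n)" if "n > N0" for n
    using apos[OF that] that by (simp add: m_def norm_power)
  have le: "Re (m i) \<le> Re (m j)" if ij: "i \<le> j" for i j
  proof (cases "j \<le> N0")
    case True
    then show ?thesis using sorted_nth_mono[OF srt, of i j] ij by (simp add: m_def len)
  next
    case False
    show ?thesis
    proof (cases "i = j")
      case False': False
      have "m i \<in> big_disk (j - 1)"
      proof (cases "i \<le> N0")
        case True
        have "N0 \<le> j - 1" using False by simp
        from subsetD[OF big_disk_mono[OF this]] show ?thesis using mE[OF True] by blast
      next
        case i: False
        have "i \<le> j - 1" using False' ij by simp
        from subsetD[OF big_disk_mono[OF this]] show ?thesis using mA[of i] i by simp
      qed
      moreover have "m j \<notin> big_disk (j - 1)" using mA[of j] False by auto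
      ultimately have "cmod (m i) \<le> cmod (m j)" by (simp add: big_disk_eq)
      then show ?thesis using Re_m[of j] False complex_Re_le_cmod[of "m i"] by simp
    qed simp
  qed
  have "eig_labelling p q m"
    unfolding eig_labelling_def eventually_sequentially
  proof (intro exI[of _ N0] allI impI conjI ballI)
    fix N assume N: "N0 \<le> N"
    show "eig_count p q (big_disk N) = N + 1" by (rule eig_count_big_disk[OF N])
    { fix n assume "N < n"
      then have n: "N0 < n" using N by simp
      show "eig_count p q (Dset n) = 1" by (rule a(5)[OF n])
      show "m n \<in> Dset n" using a(4)[OF n] n by (simp add: m_def)
      show "H_eigenvalue p q (m n)" using mA[OF n] by simp }
    { fix n assume n: "n \<le> N"
      show "m n \<in> big_disk N"
        using mE[of n] mA[of n] big_disk_mono[of N0 N] big_disk_mono[of n N] n N by (cases "n \<le> N0") auto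
      show "H_eigenvalue p q (m n)" using mE[of n] mA[of n] by (cases "n \<le> N0") auto }
    { fix i j assume "i \<le> j \<and> j \<le> N"
      then show "Re (m i) \<le> Re (m j)" using le by blast }
    fix l assume l: "l \<in> big_disk N" and Hl: "H_eigenvalue p q l"
    show "card {n. n \<le> N \<and> m n = l} = alg_mult p q l"
    proof (cases "l \<in> big_disk N0")
      case True
      have nN0: "n \<le> N0" if "m n = l" for n
      proof (rule ccontr)
        assume "\<not> n \<le> N0"
        then have "m n \<notin> big_disk (n - 1)" "N0 \<le> n - 1" using mA[of n] by auto
        then show False using big_disk_mono[of N0 "n - 1"] True that by auto
      qed
      have "n \<le> N \<and> m n = l \<longleftrightarrow> n < length xs \<and> xs ! n = l" for n
      proof (cases "n \<le> N0")
        case True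
        then show ?thesis using N by (simp add: m_def len)
      next
        case False
        then show ?thesis using nN0[of n] by (auto simp: len)
      qed
      then have "{n. n \<le> N \<and> m n = l} = {i. i < length xs \<and> xs ! i = l}" by simp
      then show ?thesis using cnt[of l] cM[of l] True Hl by simp
    next
      case False
      \<comment> \<open>The index of the annulus that contains \<open>l\<close>; \<open>k\<close> is
        the only label that can carry \<open>l\<close>.\<close>
      define k where "k = (LEAST k. l \<in> big_disk k)"
      have k: "l \<in> big_disk k" "k \<le> N" using l LeastI[of "\<lambda>k. l \<in> big_disk k" N] Least_le[of "\<lambda>k. l \<in> big_disk k" N] by (auto simp: k_def)
      have kN0: "k > N0"
      proof (rule ccontr)
        assume "\<not> k > N0"
        then have "k \<le> N0" by simp
        from subsetD[OF big_disk_mono[OF this] k(1)] False show False by simp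
      qed
      have "l \<notin> big_disk (k - 1)" using not_less_Least[of "k - 1" "\<lambda>k. l \<in> big_disk k"] kN0 by (simp add: k_def[symmetric])
      then have "l \<in> {l \<in> big_disk k - big_disk (k - 1). H_eigenvalue p q l}" using k(1) Hl by blast
      then have lk: "l = of_real (a k ^ 4)" unfolding a(2)[OF kN0] by blast
      have "n = k" if "m n = l" for n
      proof -
        have "n > N0"
        proof (rule ccontr)
          assume "\<not> n > N0"
          then have "m n \<in> ?E" by (intro mE) simp
          then show False using that False by simp
        qed
        then have n: "l \<in> big_disk n" "l \<notin> big_disk (n - 1)" using mA[of n] that by auto
        have "n \<ge> k" using n(1) unfolding k_def by (rule Least_le)
        moreover have "\<not> k \<le> n - 1" using n(2) k(1) big_disk_mono[of k "n - 1"] by auto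
        ultimately show ?thesis by linarith
      qed
      moreover have "m k = l" using kN0 lk by (simp add: m_def)
      ultimately have "{n. n \<le> N \<and> m n = l} = {k}" using k(2) by blast
      then show ?thesis using a(3)[OF kN0] lk by simp
    qed
  qed
  then show ?thesis by blast
qed

end

text \<open>The arbitrary choice in \<open>mu\<close> is harmless: for large \<open>n\<close> every
  labelling puts its \<open>n\<close>-th entry into \<open>Dset n\<close>, and the annulus around
  this set contains a single eigenvalue.\<close>

lemma mu_location:
  "\<forall>\<^sub>F n in sequentially. \<exists>a. \<bar>a - nu n\<bar> < pi / 4 \<and> mu p q n = of_real (a ^ 4) \<and> H_eigenvalue p q (mu p q n) \<and> alg_mult p q (mu p q n) = 1"
proof -
  obtain N0 :: nat where "real N0 \<ge> Rbig / pi" using real_arch_simple by blast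
  then have "Rbig \<le> pi * real N0" using pi_gt_zero by (simp add: field_simps)
  moreover have "pi * real N0 \<le> pi * (real N0 + 1)" by simp
  ultimately have N0: "pi * (real N0 + 1) \<ge> Rbig" by linarith
  have "eig_labelling p q (mu p q)"
    unfolding mu_def using labelling_exists[OF N0] by (rule someI_ex)
  then have "\<forall>\<^sub>F N in sequentially. \<forall>n>N. mu p q n \<in> Dset n \<and> H_eigenvalue p q (mu p q n)"
    unfolding eig_labelling_def by (rule eventually_mono) blast
  then obtain N1 where "\<And>N. N1 \<le> N \<Longrightarrow> \<forall>n>N. mu p q n \<in> Dset n \<and> H_eigenvalue p q (mu p q n)"
    unfolding eventually_sequentially by blast
  from this[OF order_refl] have N1: "\<And>n. n > N1 \<Longrightarrow> mu p q n \<in> Dset n \<and> H_eigenvalue p q (mu p q n)" by blast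
  show ?thesis
    unfolding eventually_sequentially
  proof (intro exI[of _ "Suc (max N0 N1)"] allI impI)
    fix n assume "Suc (max N0 N1) \<le> n"
    then have n: "n > N0" "n > N1" by auto
    obtain a where a: "\<bar>a - nu n\<bar> < pi / 4" "{l \<in> big_disk n - big_disk (n - 1). H_eigenvalue p q l} = {of_real (a ^ 4)}"
      "alg_mult p q (of_real (a ^ 4)) = 1"
      using eig_in_annulus[OF N0 n(1)] by blast
    have "mu p q n \<in> {l \<in> big_disk n - big_disk (n - 1). H_eigenvalue p q l}"
      using N1[OF n(2)] Dset_subset_annulus[of "mu p q n" n] n by simp
    then have "mu p q n = of_real (a ^ 4)" using a(2) by blast
    then show "\<exists>a. \<bar>a - nu n\<bar> < pi / 4 \<and> mu p q n = of_real (a ^ 4) \<and> H_eigenvalue p q (mu p q n) \<and> alg_mult p q (mu p q n) = 1"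
      using a N1[OF n(2)] by auto
  qed
qed

end

section \<open>Integrable coefficients\<close>

lemma AC_exp_real:
  "AC_with_deriv 0 1 (\<lambda>x. complex_of_real (cos (z * x))) (\<lambda>x. complex_of_real (- z * sin (z * x)))"
  "AC_with_deriv 0 1 (\<lambda>x. complex_of_real (sin (z * x))) (\<lambda>x. complex_of_real (z * cos (z * x)))"
proof -
  have "AC_with_deriv 0 1 (\<lambda>x. cos (z * x)) (\<lambda>x. - z * sin (z * x))"
    by (rule AC_of_has_derivative)
      (auto intro!: derivative_eq_intros continuous_on_minus continuous_on_mult continuous_on_sin continuous_on_const continuous_on_id
        simp: has_real_derivative_iff_has_vector_derivative[symmetric])
  then show "AC_with_deriv 0 1 (\<lambda>x. complex_of_real (cos (z * x))) (\<lambda>x. complex_of_real (- z * sin (z * x)))"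
    by (rule AC_of_real)
  have "AC_with_deriv 0 1 (\<lambda>x. sin (z * x)) (\<lambda>x. z * cos (z * x))"
    by (rule AC_of_has_derivative)
      (auto intro!: derivative_eq_intros continuous_on_mult continuous_on_cos continuous_on_const continuous_on_id
        simp: has_real_derivative_iff_has_vector_derivative[symmetric])
  then show "AC_with_deriv 0 1 (\<lambda>x. complex_of_real (sin (z * x))) (\<lambda>x. complex_of_real (z * cos (z * x)))"
    by (rule AC_of_real)
qed

text \<open>The boundary conditions couple the growing and the decaying factor.\<close>

lemma two_point_bound:
  fixes S T :: "real \<Rightarrow> complex"
  assumes S: "\<And>x. x \<in> {0..1} \<Longrightarrow> norm (S x - exp (of_real z * of_real (x - 1)) * S 1) \<le> K"
    and T: "\<And>x. x \<in> {0..1} \<Longrightarrow> norm (T x - exp (- of_real z * of_real x) * T 0) \<le> K"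
    and z: "1 \<le> z" and bc: "norm (S 0) \<le> norm (T 0) + c" "norm (T 0) \<le> norm (S 0) + c" "norm (S 1) = norm (T 1)"
    and x: "x \<in> {0..1}"
  shows "norm (S x) \<le> 3 * K + 3 * c" "norm (T x) \<le> 3 * K + 3 * c"
proof -
  have e: "exp (- z) \<le> 1 / 2"
  proof -
    have "2 \<le> exp z" using exp_ge_add_one_self[of z] z by linarith
    then show ?thesis by (simp add: exp_minus inverse_eq_divide field_simps)
  qed
  have K0: "0 \<le> K" using order_trans[OF norm_ge_zero S[of 0]] by simp
  have c0: "0 \<le> c" using bc by linarith
  have s0: "norm (S 0) \<le> exp (- z) * norm (S 1) + K"
  proof -
    have "norm (S 0) \<le> norm (S 0 - exp (of_real z * of_real (0 - 1)) * S 1) + norm (exp (of_real z * of_real (0 - 1)) * S 1)"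
      using norm_triangle_ineq[of "S 0 - exp (of_real z * of_real (0 - 1)) * S 1" "exp (of_real z * of_real (0 - 1)) * S 1"] by simp
    moreover have "norm (exp (of_real z * of_real (0 - 1)) * S 1) = exp (- z) * norm (S 1)" by (simp add: norm_mult)
    ultimately show ?thesis using S[of 0] by simp
  qed
  have t1: "norm (T 1) \<le> exp (- z) * norm (T 0) + K"
  proof -
    have "norm (T 1) \<le> norm (T 1 - exp (- of_real z * of_real 1) * T 0) + norm (exp (- of_real z * of_real 1) * T 0)"
      using norm_triangle_ineq[of "T 1 - exp (- of_real z * of_real 1) * T 0" "exp (- of_real z * of_real 1) * T 0"] by simp
    moreover have "norm (exp (- of_real z * of_real 1) * T 0) = exp (- z) * norm (T 0)" by (simp add: norm_mult)
    ultimately show ?thesis using T[of 1] by simp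
  qed
  have s0': "norm (S 0) \<le> 1 / 2 * norm (S 1) + K" using s0 mult_right_mono[OF e, of "norm (S 1)"] by simp
  have t1': "norm (T 1) \<le> 1 / 2 * norm (T 0) + K" using t1 mult_right_mono[OF e, of "norm (T 0)"] by simp
  have b1: "norm (S 1) \<le> 2 * K + 2 * c" "norm (T 0) \<le> 2 * K + 2 * c" using s0' t1' bc c0 by linarith+
  show "norm (S x) \<le> 3 * K + 3 * c"
  proof -
    have "norm (S x) \<le> norm (S x - exp (of_real z * of_real (x - 1)) * S 1) + norm (exp (of_real z * of_real (x - 1)) * S 1)"
      using norm_triangle_ineq[of "S x - exp (of_real z * of_real (x - 1)) * S 1" "exp (of_real z * of_real (x - 1)) * S 1"] by simp
    moreover have "norm (exp (of_real z * of_real (x - 1)) * S 1) \<le> 1 * norm (S 1)"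
      unfolding norm_mult using x z by (intro mult_right_mono) (auto simp: mult_nonneg_nonpos)
    ultimately show ?thesis using S[OF x] b1 c0 by linarith
  qed
  show "norm (T x) \<le> 3 * K + 3 * c"
  proof -
    have "norm (T x) \<le> norm (T x - exp (- of_real z * of_real x) * T 0) + norm (exp (- of_real z * of_real x) * T 0)"
      using norm_triangle_ineq[of "T x - exp (- of_real z * of_real x) * T 0" "exp (- of_real z * of_real x) * T 0"] by simp
    moreover have "norm (exp (- of_real z * of_real x) * T 0) \<le> 1 * norm (T 0)"
      unfolding norm_mult using x z by (intro mult_right_mono) auto
    ultimately show ?thesis using T[OF x] b1 c0 by linarith
  qed
qed

context quartic begin

text \<open>Here \<open>A = y'' + z\<^sup>2 y\<close> obeys \<open>A'' = z\<^sup>2 A\<close> and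
  \<open>B = y'' - z\<^sup>2 y\<close> obeys \<open>B'' = - z\<^sup>2 B\<close> up to terms with
  \<open>p\<close> and \<open>q\<close>. Hence \<open>y = (A - B) / (2 z\<^sup>2)\<close> is a
  multiple of a cosine up to \<open>2 M H / z\<close>, where \<open>M\<close> is the maximum of
  \<open>norm y + norm y' / z\<close>. The condition \<open>8 H \<le> z\<close> absorbs
  \<open>M\<close> and gives \<open>M \<le> 4 norm b\<close>.\<close>

lemma eigsol_estimates:
  fixes z :: real
  defines "H \<equiv> Jint (hb 0) 1"
  assumes z: "1 \<le> z" "8 * H \<le> z" and Y: "eigsol (of_real z ^ 4) Y"
  obtains b where "b \<noteq> 0"
    "\<And>x. x \<in> {0..1} \<Longrightarrow> norm (Y 0 x - b * of_real (cos (z * x))) \<le> 8 * H * norm b / z"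
    "\<And>x. x \<in> {0..1} \<Longrightarrow> norm (Y 1 x + b * of_real (z * sin (z * x))) \<le> 8 * H * norm b"
    "\<And>x. x \<in> {0..1} \<Longrightarrow> norm (Y 0 x) \<le> 4 * norm b"
    "norm (Y 3 1 - (of_real z)\<^sup>2 * Y 1 1 - 2 * of_real z ^ 3 * b * of_real (sin z)) \<le> 4 * norm b * z\<^sup>2 * H"
proof -
  let ?z = "complex_of_real z"
  note o = Y[unfolded eigsol_def solves_ode_def quasi_derivs_def]
  have AC: "AC_with_deriv 0 1 (Y 0) (Y 1)" "AC_with_deriv 0 1 (Y 1) (Y 2)" "AC_with_deriv 0 1 (Y 2) (\<lambda>x. Y 3 x - P x * Y 1 x)"
    "AC_with_deriv 0 1 (Y 3) (\<lambda>x. (?z ^ 4 - Q x) * Y 0 x)"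
    using o unfolding P_def Q_def by blast+
  have bc: "Y 1 0 = 0" "Y 3 0 = 0" "Y 0 1 = 0" "Y 2 1 = 0" "Y 0 0 \<noteq> 0 \<or> Y 2 0 \<noteq> 0" using o by blast+
  have z0: "z > 0" "?z \<noteq> 0" using z by auto
  have z2: "2 * z\<^sup>2 > 0" using z0 by simp
  have H0: "H \<ge> 0" unfolding H_def by (intro Jint_nonneg hb_int hb_nonneg) auto
  note cY = AC_continuous[OF AC(1)] AC_continuous[OF AC(2)]
  have "continuous_on {0..1} (\<lambda>x. norm (Y 0 x) + norm (Y 1 x) / z)"
    using z0 by (intro continuous_on_add continuous_on_norm continuous_on_divide cY continuous_on_const) auto
  then obtain x0 where x0: "x0 \<in> {0..1}" "\<And>x. x \<in> {0..1} \<Longrightarrow> norm (Y 0 x) + norm (Y 1 x) / z \<le> norm (Y 0 x0) + norm (Y 1 x0) / z"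
    using continuous_attains_sup[of "{0..1::real}" "\<lambda>x. norm (Y 0 x) + norm (Y 1 x) / z"] by auto
  define M where "M = norm (Y 0 x0) + norm (Y 1 x0) / z"
  have M0: "M \<ge> 0" using z0 by (simp add: M_def)
  have M: "norm (Y 0 x) \<le> M" "norm (Y 1 x) \<le> z * M" if "x \<in> {0..1}" for x
  proof -
    have *: "norm (Y 0 x) + norm (Y 1 x) / z \<le> M" using x0(2)[OF that] by (simp add: M_def)
    moreover have "norm (Y 1 x) / z \<ge> 0" using z0 by simp
    ultimately show "norm (Y 0 x) \<le> M" by linarith
    have "norm (Y 1 x) / z \<le> M" using * norm_ge_zero[of "Y 0 x"] by linarith
    then show "norm (Y 1 x) \<le> z * M" using z0 by (simp add: field_simps)
  qed
  define h where "h t = z\<^sup>2 * M * hb 0 t" for t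
  have h: "h absolutely_integrable_on {0..1}" unfolding h_def[abs_def] using hb_int by simp
  define K where "K = z\<^sup>2 * M * H"
  have K0: "K \<ge> 0" using M0 H0 by (simp add: K_def)
  have hK: "Jint h x \<le> K" if "x \<in> {0..1}" for x
  proof -
    have "Jint h x = z\<^sup>2 * M * Jint (hb 0) x" by (simp add: h_def[abs_def] Jint_def)
    moreover have "Jint (hb 0) x \<le> H" unfolding H_def using that by (intro Jint_incr hb_int hb_nonneg) auto
    ultimately show ?thesis using M0 by (simp add: K_def mult_left_mono)
  qed
  have inh: "norm (c * (P x * Y 1 x) - Q x * Y 0 x) \<le> h x" if "norm c = z" "x \<in> {0..1}" for c x
  proof -
    have "norm (c * (P x * Y 1 x) - Q x * Y 0 x) \<le> norm (c * (P x * Y 1 x)) + norm (Q x * Y 0 x)" by (rule norm_triangle_ineq4)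
    also have "\<dots> \<le> z * (norm (P x) * (z * M)) + norm (Q x) * M"
      unfolding norm_mult that(1) using M[OF that(2)] z0 by (intro add_mono mult_left_mono) auto
    also have "norm (Q x) * M \<le> z\<^sup>2 * (norm (Q x) * M)"
    proof -
      have "1 \<le> z\<^sup>2" using z by (simp add: one_le_power)
      then show ?thesis using mult_right_mono[of 1 "z\<^sup>2" "norm (Q x) * M"] M0 by simp
    qed
    finally show ?thesis by (simp add: h_def hb_def algebra_simps power2_eq_square)
  qed
  define A A1 B B1 where "A x = Y 2 x + ?z\<^sup>2 * Y 0 x" and "A1 x = Y 3 x + ?z\<^sup>2 * Y 1 x"
    and "B x = Y 2 x - ?z\<^sup>2 * Y 0 x" and "B1 x = Y 3 x - ?z\<^sup>2 * Y 1 x" for x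
  note defs = A_def A1_def B_def B1_def
  define G where "G x = P x * Y 1 x" for x
  have aA: "AC_with_deriv 0 1 A (\<lambda>x. A1 x - G x)"
    unfolding A_def[abs_def] using AC_add[OF AC(3) AC_cmult[OF AC(1)]] by (rule AC_cong) (auto simp: defs G_def algebra_simps)
  have aA1: "AC_with_deriv 0 1 A1 (\<lambda>x. ?z\<^sup>2 * A x - Q x * Y 0 x)"
    unfolding A1_def[abs_def] using AC_add[OF AC(4) AC_cmult[OF AC(2)]]
    by (rule AC_cong) (auto simp: defs algebra_simps power2_eq_square power4_eq_xxxx)
  have aB: "AC_with_deriv 0 1 B (\<lambda>x. B1 x - G x)"
    unfolding B_def[abs_def] using AC_diff[OF AC(3) AC_cmult[OF AC(1)]] by (rule AC_cong) (auto simp: defs G_def algebra_simps)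
  have aB1: "AC_with_deriv 0 1 B1 (\<lambda>x. - ?z\<^sup>2 * B x - Q x * Y 0 x)"
    unfolding B1_def[abs_def] using AC_diff[OF AC(4) AC_cmult[OF AC(2)]]
    by (rule AC_cong) (auto simp: defs algebra_simps power2_eq_square power4_eq_xxxx)
  define S T where "S x = A1 x + ?z * A x" and "T x = A1 x - ?z * A x" for x
  define R R' where "R x = B1 x + \<i> * ?z * B x" and "R' x = B1 x - \<i> * ?z * B x" for x
  have aS: "AC_with_deriv 0 1 S (\<lambda>x. ?z * S x + (- ?z * G x - Q x * Y 0 x))"
    unfolding S_def[abs_def] using AC_add[OF aA1 AC_cmult[OF aA, of ?z]] by (rule AC_cong) (auto simp: algebra_simps power2_eq_square)
  have aT: "AC_with_deriv 0 1 T (\<lambda>x. - ?z * T x + (?z * G x - Q x * Y 0 x))"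
    unfolding T_def[abs_def] using AC_diff[OF aA1 AC_cmult[OF aA, of ?z]] by (rule AC_cong) (auto simp: algebra_simps power2_eq_square)
  have aR: "AC_with_deriv 0 1 R (\<lambda>x. \<i> * ?z * R x + (- (\<i> * ?z) * G x - Q x * Y 0 x))"
    unfolding R_def[abs_def] using AC_add[OF aB1 AC_cmult[OF aB, of "\<i> * ?z"]] by (rule AC_cong) (auto simp: algebra_simps power2_eq_square)
  have aR': "AC_with_deriv 0 1 R' (\<lambda>x. - (\<i> * ?z) * R' x + ((\<i> * ?z) * G x - Q x * Y 0 x))"
    unfolding R'_def[abs_def] using AC_diff[OF aB1 AC_cmult[OF aB, of "\<i> * ?z"]] by (rule AC_cong) (auto simp: algebra_simps power2_eq_square)
  have g: "norm (- ?z * G x - Q x * Y 0 x) \<le> h x" "norm (?z * G x - Q x * Y 0 x) \<le> h x * exp (0 * x)"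
    "norm (- (\<i> * ?z) * G x - Q x * Y 0 x) \<le> h x * exp (0 * x)" "norm (\<i> * ?z * G x - Q x * Y 0 x) \<le> h x * exp (0 * x)" if "x \<in> {0..1}" for x
    using inh[of "- ?z" x] inh[of ?z x] inh[of "- (\<i> * ?z)" x] inh[of "\<i> * ?z" x] that z0 by (simp_all add: G_def norm_mult)
  have Sb: "norm (S x - exp (?z * of_real (x - 1)) * S 1) \<le> K" if x: "x \<in> {0..1}" for x
    by (rule order_trans[OF variation_of_constants_bound_backward[OF aS h g(1) _ x] hK]) (use z0 in auto)
  have Tb: "norm (T x - exp (- ?z * of_real x) * T 0) \<le> K" if x: "x \<in> {0..1}" for x
    by (rule order_trans[OF variation_of_constants_bound[OF aT h g(2) _ x]]) (use hK[OF x] z0 in auto)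
  have Rb: "norm (R x - exp (\<i> * ?z * of_real x) * R 0) \<le> K" if x: "x \<in> {0..1}" for x
    by (rule order_trans[OF variation_of_constants_bound[OF aR h g(3) _ x]]) (use hK[OF x] in auto)
  have R'b: "norm (R' x - exp (- (\<i> * ?z) * of_real x) * R' 0) \<le> K" if x: "x \<in> {0..1}" for x
    by (rule order_trans[OF variation_of_constants_bound[OF aR' h g(4) _ x]]) (use hK[OF x] in auto)
  \<comment> \<open>At 0 the odd quasi-derivatives vanish, so \<open>A1 0 = 0\<close>; at 1 the even
    ones vanish, so \<open>A 1 = 0\<close>.\<close>
  have ST: "norm (S 0) = norm (T 0)" "norm (S 1) = norm (T 1)"
    using bc by (simp_all add: S_def T_def defs)
  have S3: "norm (S x) \<le> 3 * K" and T3: "norm (T x) \<le> 3 * K" if x: "x \<in> {0..1}" for x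
    using two_point_bound[of S z K T 0 x, OF Sb Tb z(1) _ _ ST(2) x] ST(1) by simp_all
  have A: "norm (A x) \<le> 3 * K / z" and A1: "norm (A1 x) \<le> 3 * K" if x: "x \<in> {0..1}" for x
  proof -
    have "2 * ?z * A x = S x - T x" by (simp add: S_def T_def)
    then have "norm (2 * ?z * A x) = norm (S x - T x)" by (rule arg_cong)
    then have "2 * z * norm (A x) = norm (S x - T x)" using z0 by (simp add: norm_mult)
    also have "\<dots> \<le> 6 * K" using norm_triangle_ineq4[of "S x" "T x"] S3[OF x] T3[OF x] by linarith
    finally show "norm (A x) \<le> 3 * K / z" using z0 by (simp add: field_simps)
    have "2 * A1 x = S x + T x" by (simp add: S_def T_def)
    then have "norm (2 * A1 x) = norm (S x + T x)" by (rule arg_cong)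
    then have "2 * norm (A1 x) = norm (S x + T x)" by (simp add: norm_mult)
    also have "\<dots> \<le> 6 * K" using norm_triangle_ineq[of "S x" "T x"] S3[OF x] T3[OF x] by linarith
    finally show "norm (A1 x) \<le> 3 * K" by simp
  qed
  have R0: "R 0 = \<i> * ?z * B 0" "R' 0 = - (\<i> * ?z * B 0)" using bc by (simp_all add: R_def R'_def defs)
  have ex: "exp (\<i> * ?z * of_real x) = of_real (cos (z * x)) + \<i> * of_real (sin (z * x))"
    "exp (- (\<i> * ?z) * of_real x) = of_real (cos (z * x)) - \<i> * of_real (sin (z * x))" for x
  proof -
    have 1: "\<i> * ?z * of_real x = \<i> * of_real (z * x)" and 2: "- (\<i> * ?z) * of_real x = \<i> * of_real (- (z * x))" by simp_all
    show "exp (\<i> * ?z * of_real x) = of_real (cos (z * x)) + \<i> * of_real (sin (z * x))"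
      by (simp only: 1 exp_Euler cos_of_real sin_of_real)
    show "exp (- (\<i> * ?z) * of_real x) = of_real (cos (z * x)) - \<i> * of_real (sin (z * x))"
      unfolding 2 exp_Euler cos_of_real sin_of_real cos_minus sin_minus by simp
  qed
  have B: "norm (B x - B 0 * of_real (cos (z * x))) \<le> K / z" and B1: "norm (B1 x + B 0 * of_real (z * sin (z * x))) \<le> K" if x: "x \<in> {0..1}" for x
  proof -
    have "2 * \<i> * ?z * (B x - B 0 * of_real (cos (z * x))) = (R x - exp (\<i> * ?z * of_real x) * R 0) - (R' x - exp (- (\<i> * ?z) * of_real x) * R' 0)"
      unfolding R0 ex by (simp add: R_def R'_def algebra_simps)
    then have "norm (2 * \<i> * ?z * (B x - B 0 * of_real (cos (z * x)))) = norm ((R x - exp (\<i> * ?z * of_real x) * R 0) - (R' x - exp (- (\<i> * ?z) * of_real x) * R' 0))"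
      by (rule arg_cong)
    then have "2 * z * norm (B x - B 0 * of_real (cos (z * x))) = norm ((R x - exp (\<i> * ?z * of_real x) * R 0) - (R' x - exp (- (\<i> * ?z) * of_real x) * R' 0))"
      using z0 by (simp add: norm_mult)
    also have "\<dots> \<le> 2 * K"
      using norm_triangle_ineq4[of "R x - exp (\<i> * ?z * of_real x) * R 0" "R' x - exp (- (\<i> * ?z) * of_real x) * R' 0"] Rb[OF x] R'b[OF x] by linarith
    finally show "norm (B x - B 0 * of_real (cos (z * x))) \<le> K / z" using z0 by (simp add: field_simps)
    have "2 * (B1 x + B 0 * of_real (z * sin (z * x))) = (R x - exp (\<i> * ?z * of_real x) * R 0) + (R' x - exp (- (\<i> * ?z) * of_real x) * R' 0)"
      unfolding R0 ex by (simp add: R_def R'_def algebra_simps)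
    then have "norm (2 * (B1 x + B 0 * of_real (z * sin (z * x)))) = norm ((R x - exp (\<i> * ?z * of_real x) * R 0) + (R' x - exp (- (\<i> * ?z) * of_real x) * R' 0))"
      by (rule arg_cong)
    then have "2 * norm (B1 x + B 0 * of_real (z * sin (z * x))) = norm ((R x - exp (\<i> * ?z * of_real x) * R 0) + (R' x - exp (- (\<i> * ?z) * of_real x) * R' 0))"
      by (simp only: norm_mult norm_numeral)
    also have "\<dots> \<le> 2 * K"
      using norm_triangle_ineq[of "R x - exp (\<i> * ?z * of_real x) * R 0" "R' x - exp (- (\<i> * ?z) * of_real x) * R' 0"] Rb[OF x] R'b[OF x] by linarith
    finally show "norm (B1 x + B 0 * of_real (z * sin (z * x))) \<le> K" by simp
  qed
  \<comment> \<open>The amplitude is read off from \<open>B 0\<close>, since \<open>B\<close>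
    behaves like \<open>- 2 z\<^sup>2 b cos (z x)\<close>.\<close>
  define b where "b = - B 0 / (2 * ?z\<^sup>2)"
  have B0: "B 0 = - 2 * ?z\<^sup>2 * b" using z0 by (simp add: b_def)
  have y0: "norm (Y 0 x - b * of_real (cos (z * x))) \<le> 2 * (M * H) / z" if x: "x \<in> {0..1}" for x
  proof -
    have "2 * ?z\<^sup>2 * (Y 0 x - b * of_real (cos (z * x))) = A x - (B x - B 0 * of_real (cos (z * x)))"
      unfolding B0 by (simp add: defs algebra_simps)
    then have "norm (2 * ?z\<^sup>2 * (Y 0 x - b * of_real (cos (z * x)))) = norm (A x - (B x - B 0 * of_real (cos (z * x))))" by (rule arg_cong)
    then have "2 * z\<^sup>2 * norm (Y 0 x - b * of_real (cos (z * x))) = norm (A x - (B x - B 0 * of_real (cos (z * x))))"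
      by (simp add: norm_mult norm_power)
    also have "\<dots> \<le> 3 * K / z + K / z" using norm_triangle_ineq4[of "A x" "B x - B 0 * of_real (cos (z * x))"] A[OF x] B[OF x] by linarith
    also have "\<dots> = 2 * z\<^sup>2 * (2 * (M * H) / z)" using z0 by (simp add: K_def field_simps)
    finally show ?thesis using z2 by (rule mult_left_le_imp_le)
  qed
  have y1: "norm (Y 1 x + b * of_real (z * sin (z * x))) \<le> 2 * (M * H)" if x: "x \<in> {0..1}" for x
  proof -
    have "2 * ?z\<^sup>2 * (Y 1 x + b * of_real (z * sin (z * x))) = A1 x - (B1 x + B 0 * of_real (z * sin (z * x)))"
      unfolding B0 by (simp add: defs algebra_simps)
    then have "norm (2 * ?z\<^sup>2 * (Y 1 x + b * of_real (z * sin (z * x)))) = norm (A1 x - (B1 x + B 0 * of_real (z * sin (z * x))))" by (rule arg_cong)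
    then have "2 * z\<^sup>2 * norm (Y 1 x + b * of_real (z * sin (z * x))) = norm (A1 x - (B1 x + B 0 * of_real (z * sin (z * x))))"
      by (simp only: norm_mult norm_power norm_numeral norm_of_real abs_of_pos[OF z0(1)])
    also have "\<dots> \<le> 3 * K + K" using norm_triangle_ineq4[of "A1 x" "B1 x + B 0 * of_real (z * sin (z * x))"] A1[OF x] B1[OF x] by linarith
    also have "\<dots> = 2 * z\<^sup>2 * (2 * (M * H))" by (simp add: K_def)
    finally show ?thesis using z2 by (rule mult_left_le_imp_le)
  qed
  have Mb: "M \<le> 4 * norm b"
  proof -
    have 0: "norm (Y 0 x0) \<le> norm b + 2 * (M * H) / z"
    proof -
      have "norm (b * of_real (cos (z * x0))) \<le> norm b * 1" unfolding norm_mult by (intro mult_left_mono) auto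
      then show ?thesis using y0[OF x0(1)] norm_triangle_ineq[of "Y 0 x0 - b * of_real (cos (z * x0))" "b * of_real (cos (z * x0))"] by simp
    qed
    have 1: "norm (Y 1 x0) \<le> z * norm b + 2 * (M * H)"
    proof -
      have "norm (b * of_real (z * sin (z * x0))) \<le> norm b * (z * 1)"
        unfolding norm_mult norm_of_real abs_mult using z0 by (intro mult_left_mono mult_mono) auto
      then show ?thesis using y1[OF x0(1)] norm_triangle_ineq4[of "Y 1 x0 + b * of_real (z * sin (z * x0))" "b * of_real (z * sin (z * x0))"] by (simp add: mult.commute)
    qed
    have "norm (Y 1 x0) / z \<le> norm b + 2 * (M * H) / z" using 1 z0 by (simp add: field_simps)
    moreover have "M = norm (Y 0 x0) + norm (Y 1 x0) / z" by (rule M_def)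
    moreover have "4 * (M * H) / z = 2 * (M * H) / z + 2 * (M * H) / z" by simp
    moreover have "m \<le> 2 * \<beta> + w" if "y1 \<le> \<beta> + x" "m = y0 + y1" "w = x + x" "y0 \<le> \<beta> + x" for m w x y0 y1 \<beta> :: real
      using that by linarith
    ultimately have "M \<le> 2 * norm b + 4 * (M * H) / z" using 0 by blast
    moreover have "4 * (M * H) / z \<le> M / 2"
      using mult_left_mono[OF z(2) M0] z0 by (simp add: field_simps)
    ultimately show ?thesis by linarith
  qed
  have MH: "2 * (M * H) \<le> 8 * H * norm b" using mult_right_mono[OF Mb H0] by (simp add: algebra_simps)
  show ?thesis
  proof (rule that[of b])
    \<comment> \<open>A vanishing amplitude would force \<open>M = 0\<close> and
      \<open>B 0 = 0\<close>, hence \<open>Y 0 0 = Y 2 0 = 0\<close>.\<close>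
    show "b \<noteq> 0"
    proof
      assume "b = 0"
      then have "M = 0" using Mb M0 by simp
      then have "Y 0 0 = 0" using M(1)[of 0] by simp
      moreover have "B 0 = 0" using \<open>b = 0\<close> B0 by simp
      ultimately show False using bc(5) by (simp add: B_def)
    qed
    show "norm (Y 0 x - b * of_real (cos (z * x))) \<le> 8 * H * norm b / z" if "x \<in> {0..1}" for x
      using y0[OF that] divide_right_mono[OF MH, of z] z0 by linarith
    show "norm (Y 1 x + b * of_real (z * sin (z * x))) \<le> 8 * H * norm b" if "x \<in> {0..1}" for x
      using y1[OF that] MH by linarith
    show "norm (Y 0 x) \<le> 4 * norm b" if "x \<in> {0..1}" for x using M(1)[OF that] Mb by linarith
    have "norm (B1 1 + B 0 * of_real (z * sin (z * 1))) \<le> K" by (rule B1) simp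
    moreover have "B1 1 + B 0 * of_real (z * sin (z * 1)) = Y 3 1 - (of_real z)\<^sup>2 * Y 1 1 - 2 * of_real z ^ 3 * b * of_real (sin z)"
      unfolding B0 by (simp add: B1_def power2_eq_square power3_eq_cube)
    moreover have "K \<le> 4 * norm b * z\<^sup>2 * H"
    proof -
      have "M * (z\<^sup>2 * H) \<le> 4 * norm b * (z\<^sup>2 * H)" using Mb H0 by (intro mult_right_mono) auto
      then show ?thesis by (simp add: K_def algebra_simps)
    qed
    ultimately show "norm (Y 3 1 - (of_real z)\<^sup>2 * Y 1 1 - 2 * of_real z ^ 3 * b * of_real (sin z)) \<le> 4 * norm b * z\<^sup>2 * H" by simp
  qed
qed

lemma Jint_of_real:
  assumes "f absolutely_integrable_on {0..1}" "x \<in> {0..1}"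
  shows "Jint (\<lambda>x. complex_of_real (f x)) x = of_real (Jint f x)"
  using AC_eq_Jint[OF AC_of_real[OF Jint_AC[OF assms(1)]] assms(2)] by simp

text \<open>\<open>B1 cos (z x) + z B sin (z x)\<close> is the Wronskian of \<open>B\<close> with
  the cosine; its derivative is \<open>- q y cos (z x) - z p y' sin (z x)\<close>. Inserting the
  approximation of \<open>y'\<close> produces the integral of \<open>p sin\<^sup>2 (z x)\<close>.
  The end value is \<open>B1 1 * cos z\<close> because \<open>B 1 = 0\<close>, and
  \<open>B1 1\<close> is about \<open>2 z\<^sup>3 b sin z\<close>.\<close>

lemma eigenvalue_equation:
  fixes z :: real
  defines "H \<equiv> Jint (hb 0) 1"
  assumes z: "1 \<le> z" "8 * H \<le> z" and Y: "eigsol (of_real z ^ 4) Y"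
  shows "\<bar>cos z\<bar> \<le> 8 * H / z"
    and "\<bar>2 * z * sin z * cos z - Jint (\<lambda>x. p x * (sin (z * x))\<^sup>2) 1\<bar> \<le> (40 * H\<^sup>2 + 4 * H) / z"
proof -
  let ?z = "complex_of_real z"
  obtain b where b: "b \<noteq> 0"
    "\<And>x. x \<in> {0..1} \<Longrightarrow> norm (Y 0 x - b * of_real (cos (z * x))) \<le> 8 * H * norm b / z"
    "\<And>x. x \<in> {0..1} \<Longrightarrow> norm (Y 1 x + b * of_real (z * sin (z * x))) \<le> 8 * H * norm b"
    "\<And>x. x \<in> {0..1} \<Longrightarrow> norm (Y 0 x) \<le> 4 * norm b"
    "norm (Y 3 1 - (of_real z)\<^sup>2 * Y 1 1 - 2 * of_real z ^ 3 * b * of_real (sin z)) \<le> 4 * norm b * z\<^sup>2 * H"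
    using eigsol_estimates[OF z[unfolded H_def] Y] unfolding H_def by blast
  have z0: "z > 0" using z by simp
  have nb: "norm b > 0" using b(1) by simp
  have H0: "H \<ge> 0" unfolding H_def by (intro Jint_nonneg hb_int hb_nonneg) auto
  note o = Y[unfolded eigsol_def solves_ode_def quasi_derivs_def]
  have AC: "AC_with_deriv 0 1 (Y 0) (Y 1)" "AC_with_deriv 0 1 (Y 1) (Y 2)" "AC_with_deriv 0 1 (Y 2) (\<lambda>x. Y 3 x - P x * Y 1 x)"
    "AC_with_deriv 0 1 (Y 3) (\<lambda>x. (?z ^ 4 - Q x) * Y 0 x)"
    using o unfolding P_def Q_def by blast+
  have bc: "Y 1 0 = 0" "Y 3 0 = 0" "Y 0 1 = 0" "Y 2 1 = 0" using o by blast+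
  have "norm b * \<bar>cos z\<bar> \<le> 8 * H * norm b / z"
    using b(2)[of 1] bc by (simp add: norm_mult)
  then have "norm b * \<bar>cos z\<bar> \<le> norm b * (8 * H / z)" by (simp add: field_simps)
  then show cosz: "\<bar>cos z\<bar> \<le> 8 * H / z" using nb by (rule mult_left_le_imp_le)
  define B B1 where "B x = Y 2 x - ?z\<^sup>2 * Y 0 x" and "B1 x = Y 3 x - ?z\<^sup>2 * Y 1 x" for x
  define c s where "c x = complex_of_real (cos (z * x))" and "s x = complex_of_real (sin (z * x))" for x
  have aB: "AC_with_deriv 0 1 B (\<lambda>x. B1 x - P x * Y 1 x)"
    unfolding B_def[abs_def] using AC_diff[OF AC(3) AC_cmult[OF AC(1)]] by (rule AC_cong) (auto simp: B1_def algebra_simps)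
  have aB1: "AC_with_deriv 0 1 B1 (\<lambda>x. - ?z\<^sup>2 * B x - Q x * Y 0 x)"
    unfolding B1_def[abs_def] using AC_diff[OF AC(4) AC_cmult[OF AC(2)]]
    by (rule AC_cong) (auto simp: B_def algebra_simps power2_eq_square power4_eq_xxxx)
  have ac: "AC_with_deriv 0 1 c (\<lambda>x. - ?z * s x)" and as: "AC_with_deriv 0 1 s (\<lambda>x. ?z * c x)"
    using AC_exp_real[of z] by (simp_all add: c_def[abs_def] s_def[abs_def])
  have Ps: "(\<lambda>x. P x * (s x * s x)) absolutely_integrable_on {0..1}"
    by (intro absolutely_integrable_mult_continuous P_int continuous_on_mult AC_continuous[OF as])
  define I where "I = Jint (\<lambda>x. p x * (sin (z * x))\<^sup>2) 1"
  have JI: "Jint (\<lambda>x. P x * (s x * s x)) 1 = of_real I"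
  proof -
    have "(\<lambda>x. p x * (sin (z * x))\<^sup>2) absolutely_integrable_on {0..1}"
      by (intro absolutely_integrable_mult_continuous p_int continuous_on_power continuous_on_sin continuous_on_mult continuous_on_const continuous_on_id)
    from Jint_of_real[OF this, of 1] show ?thesis by (simp add: I_def P_def s_def power2_eq_square)
  qed
  define e where "e x = - (Q x * Y 0 x * c x) - ?z * (P x * (Y 1 x + b * of_real (z * sin (z * x))) * s x)" for x
  define W where "W x = (B1 x * c x + ?z * (B x * s x)) - (?z\<^sup>2 * b) * Jint (\<lambda>x. P x * (s x * s x)) x" for x
  have aW: "AC_with_deriv 0 1 W e"
    unfolding W_def[abs_def]
    using AC_diff[OF AC_add[OF AC_mult[OF aB1 ac] AC_cmult[OF AC_mult[OF aB as], of ?z]] AC_cmult[OF Jint_AC[OF Ps], of "?z\<^sup>2 * b"]]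
    by (rule AC_cong) (auto simp: e_def s_def algebra_simps power2_eq_square)
  define g where "g x = (4 * norm b + 8 * z * H * norm b) * hb 0 x" for x
  have gi: "g absolutely_integrable_on {0..1}" unfolding g_def[abs_def] using hb_int by simp
  have le: "norm (e x) \<le> g x" if x: "x \<in> {0..1}" for x
  proof -
    have cs: "norm (c x) \<le> 1" "norm (s x) \<le> 1" by (auto simp: c_def s_def)
    have "norm (e x) \<le> norm (Q x * Y 0 x * c x) + norm (?z * (P x * (Y 1 x + b * of_real (z * sin (z * x))) * s x))"
      unfolding e_def by (metis norm_minus_cancel norm_triangle_ineq4)
    also have "\<dots> \<le> norm (Q x) * (4 * norm b) * 1 + z * (norm (P x) * (8 * H * norm b) * 1)"
      unfolding norm_mult using b(3,4)[OF x] cs z0 H0 by (intro add_mono mult_mono mult_nonneg_nonneg) auto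
    also have "\<dots> \<le> g x"
    proof -
      have "0 \<le> norm (P x) * (4 * norm b)" "0 \<le> norm (Q x) * (8 * z * H * norm b)" using z0 H0 by auto
      then show ?thesis by (simp add: g_def hb_def algebra_simps)
    qed
    finally show ?thesis .
  qed
  have "W 1 - W 0 = Jint e 1" using AC_eq_Jint[OF aW, of 1] by simp
  moreover have "W 0 = 0" using bc by (simp add: W_def B1_def s_def)
  moreover have "W 1 = B1 1 * of_real (cos z) - ?z\<^sup>2 * b * of_real I" using bc JI by (simp add: W_def B_def c_def)
  moreover have "norm (Jint e 1) \<le> Jint g 1" by (rule norm_Jint_le[OF AC_integrable[OF aW] gi le]) auto
  moreover have "Jint g 1 = (4 * norm b + 8 * z * H * norm b) * H" by (simp add: g_def[abs_def] Jint_def H_def)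
  ultimately have W1: "norm (B1 1 * of_real (cos z) - ?z\<^sup>2 * b * of_real I) \<le> (4 * norm b + 8 * z * H * norm b) * H" by simp
  define d where "d = B1 1 - 2 * ?z ^ 3 * b * of_real (sin z)"
  have "norm (d * of_real (cos z)) \<le> (4 * norm b * z\<^sup>2 * H) * (8 * H / z)"
    unfolding norm_mult using b(5) cosz H0 by (intro mult_mono) (auto simp: d_def B1_def)
  also have "\<dots> = 32 * z * H\<^sup>2 * norm b" using z0 by (simp add: field_simps power2_eq_square)
  finally have d: "norm (d * of_real (cos z)) \<le> 32 * z * H\<^sup>2 * norm b" .
  have "of_real (z\<^sup>2 * (2 * z * sin z * cos z - I)) * b = (B1 1 * of_real (cos z) - ?z\<^sup>2 * b * of_real I) - d * of_real (cos z)"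
    by (simp add: d_def algebra_simps power2_eq_square power3_eq_cube)
  then have "norm (of_real (z\<^sup>2 * (2 * z * sin z * cos z - I)) * b) = norm ((B1 1 * of_real (cos z) - ?z\<^sup>2 * b * of_real I) - d * of_real (cos z))"
    by (rule arg_cong)
  then have "z\<^sup>2 * \<bar>2 * z * sin z * cos z - I\<bar> * norm b = norm ((B1 1 * of_real (cos z) - ?z\<^sup>2 * b * of_real I) - d * of_real (cos z))"
    by (simp only: norm_mult norm_of_real abs_mult abs_power2)
  also have "\<dots> \<le> (4 * norm b + 8 * z * H * norm b) * H + 32 * z * H\<^sup>2 * norm b"
    using norm_triangle_ineq4[of "B1 1 * of_real (cos z) - ?z\<^sup>2 * b * of_real I" "d * of_real (cos z)"] W1 d by linarith
  also have "\<dots> = (40 * z * H\<^sup>2 + 4 * H) * norm b" by (simp add: algebra_simps power2_eq_square)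
  also have "\<dots> \<le> (z * (40 * H\<^sup>2 + 4 * H)) * norm b"
    using H0 z(1) mult_right_mono[of 1 z "4 * H"] by (intro mult_right_mono) (auto simp: algebra_simps)
  finally have "z\<^sup>2 * \<bar>2 * z * sin z * cos z - I\<bar> \<le> z * (40 * H\<^sup>2 + 4 * H)" using nb by (rule mult_right_le_imp_le)
  then have "z * (z * \<bar>2 * z * sin z * cos z - I\<bar>) \<le> z * (40 * H\<^sup>2 + 4 * H)" by (simp add: power2_eq_square mult.assoc)
  then have "z * \<bar>2 * z * sin z * cos z - I\<bar> \<le> 40 * H\<^sup>2 + 4 * H" using z0 by (rule mult_left_le_imp_le)
  then show "\<bar>2 * z * sin z * cos z - Jint (\<lambda>x. p x * (sin (z * x))\<^sup>2) 1\<bar> \<le> (40 * H\<^sup>2 + 4 * H) / z"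
    using z0 unfolding I_def by (simp add: field_simps)
qed

lemma abs_cos_diff_le: "\<bar>cos a - cos b\<bar> \<le> \<bar>a - b :: real\<bar>"
proof -
  have "cos a - cos b = 2 * sin ((a + b) / 2) * sin ((b - a) / 2)" by (rule cos_diff_cos)
  then have "\<bar>cos a - cos b\<bar> = 2 * (\<bar>sin ((a + b) / 2)\<bar> * \<bar>sin ((b - a) / 2)\<bar>)" by (simp add: abs_mult)
  also have "\<dots> \<le> 2 * (1 * \<bar>(b - a) / 2\<bar>)" by (intro mult_left_mono mult_mono abs_sin_x_le_abs_x) auto
  finally show ?thesis by simp
qed

lemma fourier0_Jint: "fourier0 f = Jint f 1" and fourier_c_Jint: "fourier_c f n = Jint (\<lambda>x. f x * cos (2 * nu n * x)) 1"
proof -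
  have "pi * (2 * real n + 1) = 2 * nu n" by (simp add: nu_def algebra_simps)
  then show "fourier_c f n = Jint (\<lambda>x. f x * cos (2 * nu n * x)) 1" by (simp add: fourier_c_def Jint_def)
qed (simp add: fourier0_def Jint_def)

text \<open>With \<open>z = nu n + eta\<close> one has
  \<open>\<bar>cos z\<bar> = \<bar>sin eta\<bar>\<close> and
  \<open>sin (2 z) = - sin (2 eta)\<close>, so the eigenvalue equation becomes one for
  \<open>eta\<close>. The constant \<open>24 = 3 * 8\<close> uses \<open>abs_sin_lower\<close>;
  \<open>20000\<close> rounds up \<open>48 ^ 3 / 6 = 18432\<close>; and 64 adds to 40 the cost 24 of
  replacing \<open>z\<close> by \<open>nu n\<close> in the Fourier integral.\<close>

lemma phase_estimate:
  fixes z :: real and n :: nat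
  defines "H \<equiv> Jint (hb 0) 1" and "eta \<equiv> z - nu n"
  assumes z: "1 \<le> z" "8 * H \<le> z" and Y: "eigsol (of_real z ^ 4) Y" and near: "\<bar>z - nu n\<bar> < pi / 4"
  shows "\<bar>eta\<bar> \<le> 24 * H / z"
    and "\<bar>2 * z * eta + (fourier0 p - fourier_c p n) / 2\<bar> \<le> (20000 * H ^ 3 + 64 * H\<^sup>2 + 4 * H) / z"
proof -
  have z0: "z > 0" using z by simp
  have H0: "H \<ge> 0" unfolding H_def by (intro Jint_nonneg hb_int hb_nonneg) auto
  note E = eigenvalue_equation[OF z[unfolded H_def] Y, folded H_def]
  have zn: "z = nu n + eta" by (simp add: eta_def)
  have near': "\<bar>eta\<bar> \<le> pi / 2" using near pi_gt_zero unfolding eta_def by linarith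
  have "cos z = - sin (nu n) * sin eta" unfolding zn by (simp add: cos_add cos_nu)
  moreover have "\<bar>sin (nu n)\<bar> = 1" using sin_nu_sq[of n] by (auto simp: power2_eq_1_iff)
  ultimately have "\<bar>cos z\<bar> = \<bar>sin eta\<bar>" by (simp add: abs_mult)
  then have "\<bar>eta / 3\<bar> \<le> 8 * H / z" using abs_sin_lower[OF near'] E(1) by linarith
  then show eta: "\<bar>eta\<bar> \<le> 24 * H / z" by (simp add: field_simps)
  have sin2: "2 * z * sin z * cos z = - z * sin (2 * eta)"
  proof -
    have "2 * sin z * cos z = sin (2 * z)" by (rule sin_double[symmetric])
    also have "2 * z = 2 * nu n + 2 * eta" by (simp add: eta_def)
    also have "sin (2 * nu n + 2 * eta) = - sin (2 * eta)"
      unfolding sin_add by (simp add: sin_double[of "nu n"] cos_double_cos[of "nu n"] cos_nu)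
    finally show ?thesis by (simp add: algebra_simps)
  qed
  define J where "J = Jint (\<lambda>x. p x * cos (2 * z * x)) 1"
  have pc: "(\<lambda>x. p x * cos (w * x)) absolutely_integrable_on {0..1}" for w
    by (intro absolutely_integrable_mult_continuous p_int continuous_on_cos continuous_on_mult continuous_on_const continuous_on_id)
  have I: "Jint (\<lambda>x. p x * (sin (z * x))\<^sup>2) 1 = (fourier0 p - J) / 2"
  proof -
    have sq: "(sin (z * x))\<^sup>2 = (1 - cos (2 * z * x)) / 2" for x
      using cos_double_sin[of "z * x"] by (simp add: mult.assoc)
    then have eq: "(\<lambda>x. p x * (sin (z * x))\<^sup>2) = (\<lambda>x. 1 / 2 * p x - 1 / 2 * (p x * cos (2 * z * x)))"
      unfolding sq by (intro ext) (simp add: field_simps)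
    have "AC_with_deriv 0 1 (\<lambda>x. 1 / 2 * Jint p x - 1 / 2 * Jint (\<lambda>x. p x * cos (2 * z * x)) x) (\<lambda>x. p x * (sin (z * x))\<^sup>2)"
      unfolding eq by (intro AC_diff AC_cmult Jint_AC p_int pc)
    from AC_eq_Jint[OF this, of 1] show ?thesis by (simp add: fourier0_Jint J_def)
  qed
  have J: "\<bar>J - fourier_c p n\<bar> \<le> 2 * \<bar>eta\<bar> * H"
  proof -
    have "AC_with_deriv 0 1 (\<lambda>x. Jint (\<lambda>x. p x * cos (2 * z * x)) x - Jint (\<lambda>x. p x * cos (2 * nu n * x)) x)
       (\<lambda>x. p x * cos (2 * z * x) - p x * cos (2 * nu n * x))"
      by (intro AC_diff Jint_AC pc)
    from AC_eq_Jint[OF this, of 1] have "J - fourier_c p n = Jint (\<lambda>x. p x * cos (2 * z * x) - p x * cos (2 * nu n * x)) 1"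
      by (simp add: J_def fourier_c_Jint)
    moreover have "norm (Jint (\<lambda>x. p x * cos (2 * z * x) - p x * cos (2 * nu n * x)) 1) \<le> Jint (\<lambda>x. 2 * \<bar>eta\<bar> * hb 0 x) 1"
    proof (rule norm_Jint_le)
      show "(\<lambda>x. p x * cos (2 * z * x) - p x * cos (2 * nu n * x)) absolutely_integrable_on {0..1}"
        by (intro set_integral_diff(1) pc)
      show "(\<lambda>x. 2 * \<bar>eta\<bar> * hb 0 x) absolutely_integrable_on {0..1}" using hb_int by simp
      fix t :: real assume t: "t \<in> {0..1}"
      have "\<bar>cos (2 * z * t) - cos (2 * nu n * t)\<bar> \<le> \<bar>2 * z * t - 2 * nu n * t\<bar>" by (rule abs_cos_diff_le)
      also have "\<dots> = 2 * \<bar>eta\<bar> * t" 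
      proof -
        have "2 * z * t - 2 * nu n * t = 2 * (eta * t)" by (simp add: eta_def algebra_simps)
        then show ?thesis using t by (simp add: abs_mult)
      qed
      also have "\<dots> \<le> 2 * \<bar>eta\<bar>" using t by (simp add: mult_left_le)
      finally have "\<bar>p t\<bar> * \<bar>cos (2 * z * t) - cos (2 * nu n * t)\<bar> \<le> \<bar>p t\<bar> * (2 * \<bar>eta\<bar>)" by (intro mult_left_mono) auto
      also have "\<dots> \<le> 2 * \<bar>eta\<bar> * hb 0 t" by (simp add: hb_def P_def algebra_simps)
      finally show "norm (p t * cos (2 * z * t) - p t * cos (2 * nu n * t)) \<le> 2 * \<bar>eta\<bar> * hb 0 t"
        unfolding real_norm_def right_diff_distrib[symmetric] abs_mult .
    qed simp
    moreover have "Jint (\<lambda>x. 2 * \<bar>eta\<bar> * hb 0 x) 1 = 2 * \<bar>eta\<bar> * H" by (simp add: Jint_def H_def)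
    ultimately show ?thesis by simp
  qed
  have s3: "\<bar>z * (2 * eta - sin (2 * eta))\<bar> \<le> 20000 * H ^ 3 / z"
  proof -
    have "\<bar>2 * eta - sin (2 * eta)\<bar> \<le> \<bar>2 * eta\<bar> ^ 3 / 6" using abs_sin_minus_self_le[of "2 * eta"] by (simp only: abs_minus_commute)
    also have "\<dots> \<le> (2 * (24 * H / z)) ^ 3 / 6" using eta by (intro divide_right_mono power_mono) auto
    also have "\<dots> = 18432 * H ^ 3 / z ^ 3" by (simp add: power_mult_distrib power_divide)
    finally have "z * \<bar>2 * eta - sin (2 * eta)\<bar> \<le> z * (18432 * H ^ 3 / z ^ 3)" using z0 by (intro mult_left_mono) auto
    also have "\<dots> = 18432 * H ^ 3 / z * (1 / z)" using z0 by (simp add: power3_eq_cube)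
    also have "\<dots> \<le> 18432 * H ^ 3 / z * 1" using z H0 by (intro mult_left_mono) auto
    also have "\<dots> \<le> 20000 * H ^ 3 / z" using z0 H0 by (simp add: divide_right_mono)
    finally show ?thesis using z0 by (simp add: abs_mult)
  qed
  have "\<bar>J - fourier_c p n\<bar> / 2 \<le> 24 * H\<^sup>2 / z"
  proof -
    have "\<bar>eta\<bar> * H \<le> 24 * H / z * H" using eta H0 by (intro mult_right_mono) auto
    then show ?thesis using J by (simp add: power2_eq_square)
  qed
  then have J2: "\<bar>J - fourier_c p n\<bar> / 2 \<le> 24 * H\<^sup>2 / z" .
  have dec: "2 * z * eta + (fourier0 p - fourier_c p n) / 2 =
      z * (2 * eta - sin (2 * eta)) - (2 * z * sin z * cos z - (fourier0 p - J) / 2) + (J - fourier_c p n) / 2"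
    unfolding sin2 by (simp add: field_simps)
  have "\<bar>2 * z * eta + (fourier0 p - fourier_c p n) / 2\<bar> \<le> 20000 * H ^ 3 / z + (40 * H\<^sup>2 + 4 * H) / z + 24 * H\<^sup>2 / z"
  proof -
    have "\<bar>j\<bar> / 2 \<le> D \<Longrightarrow> L = a - b + j / 2 \<Longrightarrow> \<bar>a\<bar> \<le> A \<Longrightarrow> \<bar>b\<bar> \<le> B \<Longrightarrow> \<bar>L\<bar> \<le> A + B + D" for L a b j A B D :: real
      by linarith
    then show ?thesis using J2 dec s3 E(2)[unfolded I] by blast
  qed
  also have "\<dots> = (20000 * H ^ 3 + 64 * H\<^sup>2 + 4 * H) / z" by (simp add: add_divide_distrib[symmetric])
  finally show "\<bar>2 * z * eta + (fourier0 p - fourier_c p n) / 2\<bar> \<le> (20000 * H ^ 3 + 64 * H\<^sup>2 + 4 * H) / z" .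
qed

end

context quartic begin

lemma eigenvalue_parameter:
  "\<forall>\<^sub>F n in sequentially. \<exists>z Y. c \<le> z \<and> nu n \<le> 2 * z \<and> \<bar>z - nu n\<bar> < pi / 4 \<and> mu p q n = of_real (z ^ 4) \<and> eigsol (of_real z ^ 4) Y"
proof -
  have "eventually (\<lambda>n. real n \<ge> max 0 c) sequentially"
  proof -
    obtain N :: nat where "max 0 c \<le> real N" using real_arch_simple by blast
    then show ?thesis unfolding eventually_sequentially by (intro exI[of _ N]) (auto intro: order_trans)
  qed
  then show ?thesis
    using mu_location
  proof eventually_elim
    case (elim n)
    then obtain z where z: "\<bar>z - nu n\<bar> < pi / 4" "mu p q n = of_real (z ^ 4)" "H_eigenvalue p q (mu p q n)" by blast
    have "of_real (z ^ 4) = (of_real z :: complex) ^ 4" by simp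
    then obtain Y where Y: "eigsol (of_real z ^ 4) Y" using z H_eigenvalue_iff_eigsol by auto
    have "1 * real n \<le> pi * real n" using pi_gt3 by (intro mult_right_mono) auto
    then have "c \<le> z" using elim z(1) pi_gt_zero unfolding nu_def abs_less_iff by linarith
    moreover have "nu n \<le> 2 * z" using z(1) pi_gt_zero \<open>1 * real n \<le> pi * real n\<close> unfolding nu_def abs_less_iff by linarith
    ultimately show ?case using z Y by blast
  qed
qed

lemma nu_le: "n \<ge> 1 \<Longrightarrow> nu n \<le> 6 * real n" and nu_ge: "real n \<le> nu n" and nu_ge_1: "1 \<le> nu n"
proof -
  have "pi * real n \<le> 4 * real n" using pi_less_4 by (intro mult_right_mono) auto
  then show "nu n \<le> 6 * real n" if "n \<ge> 1"
  proof -
    have "1 \<le> real n" using that by simp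
    then show ?thesis using \<open>pi * real n \<le> 4 * real n\<close> pi_less_4 unfolding nu_def by linarith
  qed
  have "1 * real n \<le> pi * real n" using pi_gt3 by (intro mult_right_mono) auto
  then show "real n \<le> nu n" "1 \<le> nu n" using pi_gt3 unfolding nu_def by linarith+
qed

lemma asymptotics_L1:
  "(\<lambda>n. mu p q n - of_real ((pi / 2 + pi * real n) ^ 4 + (pi / 2 + pi * real n)\<^sup>2 * (fourier_c p n - fourier0 p)))
    \<in> O(\<lambda>n. of_nat n)"
proof -
  define H where "H = Jint (hb 0) 1"
  have H0: "H \<ge> 0" unfolding H_def by (intro Jint_nonneg hb_int hb_nonneg) auto
  define C where "C = 2 * (20000 * H ^ 3 + 64 * H\<^sup>2 + 4 * H + 24 * H)"
  have C0: "C \<ge> 0" "20000 * H ^ 3 + 64 * H\<^sup>2 + 4 * H \<ge> 0" using H0 by (simp_all add: C_def)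
  show ?thesis
  proof (rule bigoI)
    show "\<forall>\<^sub>F n in sequentially. norm (mu p q n - of_real ((pi / 2 + pi * real n) ^ 4 + (pi / 2 + pi * real n)\<^sup>2 * (fourier_c p n - fourier0 p)))
       \<le> (6 * (2 * C + 2 * C\<^sup>2 + 4 * C ^ 3 + C ^ 4)) * norm (of_nat n :: complex)"
      using eigenvalue_parameter[of "max 1 (8 * H)"] eventually_ge_at_top[of 1]
    proof eventually_elim
      case (elim n)
      then obtain z Y where z: "1 \<le> z" "8 * H \<le> z" "nu n \<le> 2 * z" "\<bar>z - nu n\<bar> < pi / 4" "mu p q n = of_real (z ^ 4)" and Y: "eigsol (of_real z ^ 4) Y"
        by auto
      define eta where "eta = z - nu n"
      define v where "v = nu n"
      define s where "s = fourier0 p - fourier_c p n"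
      define E where "E = 2 * z * eta + s / 2"
      have v1: "v \<ge> 1" unfolding v_def by (rule nu_ge_1)
      have inv: "1 / z \<le> 2 / v" using z(1,3) v1 by (simp add: v_def field_simps)
      note ph = phase_estimate[OF z(1) z(2)[unfolded H_def] Y z(4), folded H_def eta_def s_def E_def]
      have "\<bar>eta\<bar> \<le> 24 * H * (1 / z)" using ph(1) by simp
      also have "\<dots> \<le> 24 * H * (2 / v)" using inv H0 by (intro mult_left_mono) auto
      also have "\<dots> \<le> C / v" using v1 C0(2) by (simp add: C_def divide_right_mono)
      finally have eta: "\<bar>eta\<bar> \<le> C / v" .
      have "\<bar>E\<bar> \<le> (20000 * H ^ 3 + 64 * H\<^sup>2 + 4 * H) * (1 / z)" using ph(2) by (simp add: E_def)
      also have "\<dots> \<le> (20000 * H ^ 3 + 64 * H\<^sup>2 + 4 * H) * (2 / v)" using inv C0(2) by (intro mult_left_mono) auto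
      also have "\<dots> = 2 * (20000 * H ^ 3 + 64 * H\<^sup>2 + 4 * H) / v" by simp
      also have "\<dots> \<le> C / v" using v1 H0 unfolding C_def by (intro divide_right_mono) auto
      finally have E: "\<bar>E\<bar> \<le> C / v" .
      \<comment> \<open>Writing \<open>4 v\<^sup>3 eta\<close> as
        \<open>2 v\<^sup>2 (2 z eta) - 4 v\<^sup>2 eta\<^sup>2\<close> brings in \<open>E\<close>.
        Only \<open>2 v\<^sup>2 E\<close> is of order \<open>v\<close>; the other terms stay
        bounded.\<close>
      have "z ^ 4 - (v ^ 4 + v\<^sup>2 * (fourier_c p n - fourier0 p)) = (v + eta) ^ 4 - v ^ 4 + v\<^sup>2 * s"
        by (simp add: v_def eta_def s_def algebra_simps)
      also have "\<dots> = 2 * v\<^sup>2 * E + 2 * v\<^sup>2 * eta\<^sup>2 + 4 * v * eta ^ 3 + eta ^ 4"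
        unfolding E_def by (simp add: v_def eta_def algebra_simps power2_eq_square power3_eq_cube power4_eq_xxxx)
      finally have id: "z ^ 4 - (v ^ 4 + v\<^sup>2 * (fourier_c p n - fourier0 p)) = \<dots>" .
      have ve: "v * \<bar>eta\<bar> \<le> C" using eta v1 by (simp add: field_simps)
      have e1: "\<bar>eta\<bar> \<le> C" using ve v1 mult_right_mono[of 1 v "\<bar>eta\<bar>"] by simp
      have "\<bar>2 * v\<^sup>2 * E\<bar> \<le> 2 * v\<^sup>2 * (C / v)" unfolding abs_mult using E by (intro mult_mono) auto
      then have 1: "\<bar>2 * v\<^sup>2 * E\<bar> \<le> 2 * C * v" using v1 by (simp add: power2_eq_square mult_ac)
      have "\<bar>2 * v\<^sup>2 * eta\<^sup>2\<bar> = 2 * (v * \<bar>eta\<bar>)\<^sup>2" by (simp add: power_mult_distrib)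
      also have "\<dots> \<le> 2 * C\<^sup>2" using ve v1 by (intro mult_left_mono power_mono) auto
      also have "\<dots> \<le> 2 * C\<^sup>2 * v" using v1 by (simp add: mult_le_cancel_left1)
      finally have 2: "\<bar>2 * v\<^sup>2 * eta\<^sup>2\<bar> \<le> 2 * C\<^sup>2 * v" .
      have "\<bar>4 * v * eta ^ 3\<bar> = 4 * ((v * \<bar>eta\<bar>) * \<bar>eta\<bar>\<^sup>2)" using v1 by (simp add: abs_mult power3_eq_cube power2_eq_square)
      also have "\<dots> \<le> 4 * (C * C\<^sup>2)" using ve e1 v1 C0 by (intro mult_left_mono mult_mono power_mono) auto
      also have "\<dots> \<le> 4 * C ^ 3 * v" using v1 C0 mult_left_mono[of 1 v "4 * C ^ 3"] by (simp add: power3_eq_cube power2_eq_square)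
      finally have 3: "\<bar>4 * v * eta ^ 3\<bar> \<le> 4 * C ^ 3 * v" .
      have "\<bar>eta ^ 4\<bar> = \<bar>eta\<bar> ^ 4" by (simp add: power_abs)
      also have "\<dots> \<le> C ^ 4" using e1 by (intro power_mono) auto
      also have "\<dots> \<le> C ^ 4 * v" using v1 C0 mult_left_mono[of 1 v "C ^ 4"] by simp
      finally have 4: "\<bar>eta ^ 4\<bar> \<le> C ^ 4 * v" .
      have "\<bar>z ^ 4 - (v ^ 4 + v\<^sup>2 * (fourier_c p n - fourier0 p))\<bar> \<le> 2 * C * v + 2 * C\<^sup>2 * v + 4 * C ^ 3 * v + C ^ 4 * v"
        unfolding id using 1 2 3 4 by linarith
      also have "\<dots> = (2 * C + 2 * C\<^sup>2 + 4 * C ^ 3 + C ^ 4) * v" by (simp add: algebra_simps)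
      also have "\<dots> \<le> (2 * C + 2 * C\<^sup>2 + 4 * C ^ 3 + C ^ 4) * (6 * real n)"
        using nu_le elim(2) C0 unfolding v_def by (intro mult_left_mono) auto
      finally have fin: "\<bar>z ^ 4 - (v ^ 4 + v\<^sup>2 * (fourier_c p n - fourier0 p))\<bar> \<le> (2 * C + 2 * C\<^sup>2 + 4 * C ^ 3 + C ^ 4) * (6 * real n)" .
      have "mu p q n - of_real ((pi / 2 + pi * real n) ^ 4 + (pi / 2 + pi * real n)\<^sup>2 * (fourier_c p n - fourier0 p))
        = of_real (z ^ 4 - (v ^ 4 + v\<^sup>2 * (fourier_c p n - fourier0 p)))"
        unfolding z(5) v_def nu_def by (simp only: of_real_diff)
      then have "norm (mu p q n - of_real ((pi / 2 + pi * real n) ^ 4 + (pi / 2 + pi * real n)\<^sup>2 * (fourier_c p n - fourier0 p)))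
        = \<bar>z ^ 4 - (v ^ 4 + v\<^sup>2 * (fourier_c p n - fourier0 p))\<bar>" by (simp only: norm_of_real)
      with fin show ?case by (simp add: algebra_simps)
    qed
  qed
qed

end

section \<open>Smooth coefficients\<close>

text \<open>The product of a power of \<open>1 - u\<close> with the truncated series of its inverse
  misses 1 by an explicit polynomial divisible by the first omitted power of \<open>u\<close>; the
  rest is a bound for the cofactor.\<close>

lemma inverse_power_expansions:
  fixes u :: real
  assumes u: "\<bar>u\<bar> \<le> 1 / 8"
  shows "\<bar>1 / (1 - u) ^ 4 - 1 - 4 * u - 10 * u\<^sup>2\<bar> \<le> 60 * \<bar>u\<bar> ^ 3"
    and "\<bar>1 / (1 - u)\<^sup>2 - 1 - 2 * u - 3 * u\<^sup>2\<bar> \<le> 8 * \<bar>u\<bar> ^ 3"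
    and "\<bar>1 / (1 - u)\<^sup>2 - 1\<bar> \<le> 3 * \<bar>u\<bar>"
    and "\<bar>1 / (1 - u) - 1\<bar> \<le> 2 * \<bar>u\<bar>"
    and "\<bar>1 / (1 - u)\<bar> \<le> 2"
proof -
  have a: "7 / 8 \<le> 1 - u" "1 - u \<noteq> 0" using u by auto
  have p2: "3 / 4 \<le> (1 - u)\<^sup>2"
    using power_mono[OF a(1), of 2] by (simp add: power2_eq_square)
  have p4: "1 / 2 \<le> (1 - u) ^ 4"
    using power_mono[OF a(1), of 4] by (simp add: power4_eq_xxxx)
  have u2: "\<bar>u\<bar>\<^sup>2 \<le> (1 / 8)\<^sup>2" "\<bar>u\<bar> ^ 3 \<le> (1 / 8) ^ 3" using u by (intro power_mono; simp)+
  then have u2': "\<bar>u\<^sup>2\<bar> \<le> 1 / 64" "\<bar>u ^ 3\<bar> \<le> 1 / 512" unfolding power_abs by (simp_all add: power_divide)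
  have "1 / (1 - u) ^ 4 - 1 - 4 * u - 10 * u\<^sup>2 = u ^ 3 * (20 - 45 * u + 36 * u\<^sup>2 - 10 * u ^ 3) / (1 - u) ^ 4"
  proof -
    have "(1 - u) ^ 4 * (1 + 4 * u + 10 * u\<^sup>2) + u ^ 3 * (20 - 45 * u + 36 * u\<^sup>2 - 10 * u ^ 3) = 1" by algebra
    then show ?thesis using a(2) by (simp add: field_simps)
  qed
  then have "\<bar>1 / (1 - u) ^ 4 - 1 - 4 * u - 10 * u\<^sup>2\<bar> = \<bar>u\<bar> ^ 3 * \<bar>20 - 45 * u + 36 * u\<^sup>2 - 10 * u ^ 3\<bar> / (1 - u) ^ 4"
    by (simp add: abs_mult power_abs)
  also have "\<dots> \<le> \<bar>u\<bar> ^ 3 * 30 / (1 / 2)"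
  proof (rule frac_le)
    have "\<bar>20 - 45 * u + 36 * u\<^sup>2 - 10 * u ^ 3\<bar> \<le> 30" using u u2' by linarith
    then show "\<bar>u\<bar> ^ 3 * \<bar>20 - 45 * u + 36 * u\<^sup>2 - 10 * u ^ 3\<bar> \<le> \<bar>u\<bar> ^ 3 * 30" by (intro mult_left_mono) auto
  qed (use p4 in auto)
  finally show "\<bar>1 / (1 - u) ^ 4 - 1 - 4 * u - 10 * u\<^sup>2\<bar> \<le> 60 * \<bar>u\<bar> ^ 3" by simp
  have "1 / (1 - u)\<^sup>2 - 1 - 2 * u - 3 * u\<^sup>2 = u ^ 3 * (4 - 3 * u) / (1 - u)\<^sup>2"
  proof -
    have "(1 - u)\<^sup>2 * (1 + 2 * u + 3 * u\<^sup>2) + u ^ 3 * (4 - 3 * u) = 1" by algebra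
    then show ?thesis using a(2) by (simp add: field_simps)
  qed
  then have "\<bar>1 / (1 - u)\<^sup>2 - 1 - 2 * u - 3 * u\<^sup>2\<bar> = \<bar>u\<bar> ^ 3 * \<bar>4 - 3 * u\<bar> / (1 - u)\<^sup>2"
    by (simp add: abs_mult power_abs)
  also have "\<dots> \<le> \<bar>u\<bar> ^ 3 * 6 / (3 / 4)"
  proof (rule frac_le)
    have "\<bar>4 - 3 * u\<bar> \<le> 6" using u by linarith
    then show "\<bar>u\<bar> ^ 3 * \<bar>4 - 3 * u\<bar> \<le> \<bar>u\<bar> ^ 3 * 6" by (intro mult_left_mono) auto
  qed (use p2 in auto)
  finally show "\<bar>1 / (1 - u)\<^sup>2 - 1 - 2 * u - 3 * u\<^sup>2\<bar> \<le> 8 * \<bar>u\<bar> ^ 3" by simp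
  have "1 / (1 - u)\<^sup>2 - 1 = u * (2 - u) / (1 - u)\<^sup>2"
  proof -
    have "(1 - u)\<^sup>2 + u * (2 - u) = 1" by algebra
    then show ?thesis using a(2) by (simp add: field_simps)
  qed
  then have "\<bar>1 / (1 - u)\<^sup>2 - 1\<bar> = \<bar>u\<bar> * \<bar>2 - u\<bar> / (1 - u)\<^sup>2" by (simp add: abs_mult)
  also have "\<dots> \<le> \<bar>u\<bar> * (9 / 4) / (3 / 4)"
  proof (rule frac_le)
    have "\<bar>2 - u\<bar> \<le> 9 / 4" using u by linarith
    then show "\<bar>u\<bar> * \<bar>2 - u\<bar> \<le> \<bar>u\<bar> * (9 / 4)" by (intro mult_left_mono) auto
  qed (use p2 in auto)
  finally show "\<bar>1 / (1 - u)\<^sup>2 - 1\<bar> \<le> 3 * \<bar>u\<bar>" by simp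
  have "1 / (1 - u) - 1 = u / (1 - u)" using a(2) by (simp add: field_simps)
  then have "\<bar>1 / (1 - u) - 1\<bar> = \<bar>u\<bar> / (1 - u)" using a(1) by simp
  also have "\<dots> \<le> \<bar>u\<bar> / (1 / 2)" by (rule frac_le) (use a in auto)
  finally show 1: "\<bar>1 / (1 - u) - 1\<bar> \<le> 2 * \<bar>u\<bar>" by simp
  show "\<bar>1 / (1 - u)\<bar> \<le> 2" using 1 u by linarith
qed

lemma AC_cos_sin:
  fixes T t :: "real \<Rightarrow> real"
  assumes T: "AC_with_deriv 0 1 T t" and t: "continuous_on {0..1} t"
  shows "AC_with_deriv 0 1 (\<lambda>x. cos (T x)) (\<lambda>x. - sin (T x) * t x)"
    and "AC_with_deriv 0 1 (\<lambda>x. sin (T x)) (\<lambda>x. cos (T x) * t x)"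
proof -
  have d: "(T has_real_derivative t x) (at x within {0..1})" if "x \<in> {0..1}" for x
    using AC_has_derivative[OF T t that] by (simp add: has_real_derivative_iff_has_vector_derivative)
  note c = AC_continuous[OF T]
  show "AC_with_deriv 0 1 (\<lambda>x. cos (T x)) (\<lambda>x. - sin (T x) * t x)"
  proof (rule AC_of_has_derivative)
    fix x :: real assume "x \<in> {0..1}"
    from d[OF this] show "((\<lambda>x. cos (T x)) has_vector_derivative - sin (T x) * t x) (at x within {0..1})"
      unfolding has_real_derivative_iff_has_vector_derivative[symmetric] by (auto intro!: derivative_eq_intros)
  qed (intro continuous_on_mult continuous_on_minus continuous_on_sin c t)
  show "AC_with_deriv 0 1 (\<lambda>x. sin (T x)) (\<lambda>x. cos (T x) * t x)"
  proof (rule AC_of_has_derivative)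
    fix x :: real assume "x \<in> {0..1}"
    from d[OF this] show "((\<lambda>x. sin (T x)) has_vector_derivative cos (T x) * t x) (at x within {0..1})"
      unfolding has_real_derivative_iff_has_vector_derivative[symmetric] by (auto intro!: derivative_eq_intros)
  qed (intro continuous_on_mult continuous_on_cos c t)
qed

text \<open>Equality of \<open>p1\<close> at the two ends makes the mean of \<open>p2\<close> vanish
  and merges the boundary terms of the integrations by parts into one multiple of
  \<open>p1 0\<close>.\<close>

locale quartic_smooth = quartic +
  fixes p1 p2 p3 q1 :: "real \<Rightarrow> real"
  assumes p_AC: "AC_with_deriv 0 1 p p1" and p1_AC: "AC_with_deriv 0 1 p1 p2" and p2_AC: "AC_with_deriv 0 1 p2 p3"
    and q_AC: "AC_with_deriv 0 1 q q1" and p1_per: "p1 1 = p1 0"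
begin

text \<open>\<open>V\<close> is the potential left over when the operator is written as \<open>(d\<^sup>2/dx\<^sup>2 + p/2)\<^sup>2 + V\<close>, and \<open>W\<close> is the limit of
  \<open>V - 2 z\<^sup>2 Vwkb z\<close> as \<open>z\<close> tends to infinity (\<open>Vwkb\<close> below).\<close>

definition "V x = q x - p2 x / 2 - (p x)\<^sup>2 / 4"
definition "W x = q x - p2 x / 4 + (p x)\<^sup>2 / 16"
definition "W1 x = q1 x - p3 x / 4 + p x * p1 x / 8"

lemma W_AC: "AC_with_deriv 0 1 W W1"
proof -
  have "AC_with_deriv 0 1 (\<lambda>x. q x + (-1/4) * p2 x + (1/16) * (p x * p x)) (\<lambda>x. q1 x + (-1/4) * p3 x + (1/16) * (p1 x * p x + p x * p1 x))"
    by (intro AC_add AC_cmult AC_mult q_AC p2_AC p_AC)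
  then show ?thesis by (rule AC_cong) (simp_all add: W_def W1_def power2_eq_square algebra_simps)
qed

lemma V_continuous: "continuous_on {0..1} V"
  unfolding V_def[abs_def]
  by (intro continuous_on_diff continuous_on_divide continuous_on_power continuous_on_const AC_continuous[OF q_AC] AC_continuous[OF p2_AC]
    AC_continuous[OF p_AC]) auto

text \<open>The Liouville--Green approximation of the solution of
  \<open>y'' + (z\<^sup>2 + p/2) y = 0\<close>, with a rational amplitude; \<open>Vwkb\<close> is its defect.\<close>

definition "uw z x = p x / (8 * z\<^sup>2)" for z :: real
definition "aw z x = 1 - uw z x" for z :: real
definition "Th z = Jint (\<lambda>x. z / (aw z x)\<^sup>2)" for z :: real
definition "fw z x = aw z x * cos (Th z x)" for z :: real
definition "fdw z x = - (p1 x / (8 * z\<^sup>2)) * cos (Th z x) - z * ((1 / aw z x) * sin (Th z x))" for z :: real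
definition "Vwkb z x = - (p2 x / (8 * z\<^sup>2)) / aw z x - z\<^sup>2 * (1 / (aw z x) ^ 4 - 1 - 4 * uw z x)" for z :: real

end

text \<open>A single constant \<open>c\<close>, at least 1, dominates all data, so that every error
  becomes a power of \<open>c\<close> over a power of \<open>z\<close> and one threshold
  \<open>100 * c ^ 3 \<le> z\<close> controls them all.\<close>

locale quartic_bounded = quartic_smooth +
  fixes c :: real
  assumes c1: "1 \<le> c" and bounds: "\<And>x. x \<in> {0..1} \<Longrightarrow> \<bar>p x\<bar> \<le> c \<and> \<bar>p1 x\<bar> \<le> c \<and> \<bar>p2 x\<bar> \<le> c \<and> \<bar>V x\<bar> \<le> c \<and> \<bar>W x\<bar> \<le> c"
    and W1_bound: "Jint (\<lambda>x. \<bar>W1 x\<bar>) 1 \<le> c"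
begin

lemma c_le_square: "c \<le> c\<^sup>2" "1 \<le> c\<^sup>2"
proof -
  have "c \<le> c * c" using c1 by simp
  with c1 show "c \<le> c\<^sup>2" "1 \<le> c\<^sup>2" unfolding power2_eq_square by linarith+
qed

context
  fixes z :: real
  assumes z: "100 * c ^ 3 \<le> z"
begin

lemma z_ge: "100 \<le> z" "c \<le> z" "0 < z" "c ^ 3 \<le> z" "c\<^sup>2 \<le> z" "100 * c \<le> z"
proof -
  have c3: "1 \<le> c ^ 3" "c \<le> c ^ 3" "c\<^sup>2 \<le> c ^ 3" using c1 by (auto intro: one_le_power power_increasing[of 1 3 c, simplified] power_increasing)
  then show "100 \<le> z" "c \<le> z" "0 < z" "c ^ 3 \<le> z" "c\<^sup>2 \<le> z" "100 * c \<le> z" using z c1 by linarith+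
qed

lemma uw_bound: "x \<in> {0..1} \<Longrightarrow> \<bar>uw z x\<bar> \<le> c / (8 * z\<^sup>2)" and uw_small: "x \<in> {0..1} \<Longrightarrow> \<bar>uw z x\<bar> \<le> 1 / 8"
proof -
  assume x: "x \<in> {0..1}"
  show b: "\<bar>uw z x\<bar> \<le> c / (8 * z\<^sup>2)" using bounds[OF x] z_ge(3) unfolding uw_def by (simp add: divide_right_mono)
  have "1 \<le> z" using z_ge(1) by linarith
  then have "c * 1 \<le> z * z" using z_ge c1 by (intro mult_mono) auto
  then have "c / (8 * z\<^sup>2) \<le> 1 / 8" using z_ge(3) by (simp add: field_simps power2_eq_square)
  with b show "\<bar>uw z x\<bar> \<le> 1 / 8" by linarith
qed

lemma aw_bounds: "x \<in> {0..1} \<Longrightarrow> 7 / 8 \<le> aw z x \<and> aw z x \<le> 9 / 8"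
  using uw_small[of x] unfolding aw_def by (auto simp: abs_le_iff)

lemma aw_AC: "AC_with_deriv 0 1 (aw z) (\<lambda>x. - (p1 x / (8 * z\<^sup>2)))"
proof -
  have "AC_with_deriv 0 1 (\<lambda>x. 1 - (1 / (8 * z\<^sup>2)) * p x) (\<lambda>x. 0 - (1 / (8 * z\<^sup>2)) * p1 x)"
    by (intro AC_diff AC_const AC_cmult p_AC)
  then show ?thesis by (rule AC_cong) (simp_all add: aw_def uw_def)
qed

lemma inverse_aw_AC: "AC_with_deriv 0 1 (\<lambda>x. 1 / aw z x) (\<lambda>x. (p1 x / (8 * z\<^sup>2)) / (aw z x)\<^sup>2)"
proof (rule AC_of_has_derivative)
  have cp1: "continuous_on {0..1} (\<lambda>x. - (p1 x / (8 * z\<^sup>2)))"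
    using z_ge(3) by (intro continuous_on_minus continuous_on_divide AC_continuous[OF p1_AC] continuous_on_const) auto
  have nz: "aw z x \<noteq> 0" if "x \<in> {0..1}" for x using aw_bounds[OF that] by auto
  fix x :: real assume x: "x \<in> {0..1}"
  have "(aw z has_real_derivative - (p1 x / (8 * z\<^sup>2))) (at x within {0..1})"
    using AC_has_derivative[OF aw_AC cp1 x] by (simp add: has_real_derivative_iff_has_vector_derivative)
  then have "((\<lambda>x. 1 / aw z x) has_real_derivative (0 * aw z x - 1 * (- (p1 x / (8 * z\<^sup>2)))) / (aw z x * aw z x)) (at x within {0..1})"
    by (intro DERIV_divide DERIV_const nz x)
  then show "((\<lambda>x. 1 / aw z x) has_vector_derivative (p1 x / (8 * z\<^sup>2)) / (aw z x)\<^sup>2) (at x within {0..1})"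
    by (simp add: has_real_derivative_iff_has_vector_derivative power2_eq_square)
next
  have nz: "aw z x \<noteq> 0" if "x \<in> {0..1}" for x using aw_bounds[OF that] by auto
  show "continuous_on {0..1} (\<lambda>x. (p1 x / (8 * z\<^sup>2)) / (aw z x)\<^sup>2)"
    using z_ge(3) nz by (intro continuous_on_divide continuous_on_power AC_continuous[OF p1_AC] AC_continuous[OF aw_AC] continuous_on_const) auto
qed

lemma Th_deriv_continuous: "continuous_on {0..1} (\<lambda>x. z / (aw z x)\<^sup>2)"
proof -
  have nz: "aw z x \<noteq> 0" if "x \<in> {0..1}" for x using aw_bounds[OF that] by auto
  then show ?thesis by (intro continuous_on_divide continuous_on_power AC_continuous[OF aw_AC] continuous_on_const) auto
qed

lemma Th_AC: "AC_with_deriv 0 1 (Th z) (\<lambda>x. z / (aw z x)\<^sup>2)"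
  unfolding Th_def by (rule Jint_AC[OF absolutely_integrable_continuous_real[OF Th_deriv_continuous]])

lemma fw_AC: "AC_with_deriv 0 1 (fw z) (fdw z)"
proof -
  show ?thesis
    unfolding fw_def[abs_def] using AC_mult[OF aw_AC AC_cos_sin(1)[OF Th_AC Th_deriv_continuous]]
  proof (rule AC_cong)
    fix x :: real assume "x \<in> {0..1}"
    then have "aw z x \<noteq> 0" using aw_bounds[of x] by auto
    then show "- (p1 x / (8 * z\<^sup>2)) * cos (Th z x) + aw z x * (- sin (Th z x) * (z / (aw z x)\<^sup>2)) = fdw z x"
      by (simp add: fdw_def power2_eq_square)
  qed simp
qed

text \<open>With phase derivative \<open>z / a\<^sup>2\<close> the sine terms cancel, and
  \<open>f = a cos \<theta>\<close> satisfies
  \<open>f'' = (a'' / a - z\<^sup>2 / a\<^sup>4) f\<close>. The amplitude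
  \<open>a = 1 - p / (8 z\<^sup>2)\<close> is the first-order truncation of
  \<open>(1 + p / (2 z\<^sup>2))\<close> to the power \<open>-1/4\<close>, so the bracket is
  \<open>- z\<^sup>2 - p / 2\<close> plus the small defect \<open>Vwkb\<close>.\<close>

lemma fdw_AC: "AC_with_deriv 0 1 (fdw z) (\<lambda>x. (Vwkb z x - z\<^sup>2 - p x / 2) * fw z x)"
proof -
  note cs = AC_cos_sin[OF Th_AC Th_deriv_continuous]
  have "AC_with_deriv 0 1 (\<lambda>x. (-1 / (8 * z\<^sup>2)) * (p1 x * cos (Th z x)) - z * ((1 / aw z x) * sin (Th z x)))
    (\<lambda>x. (-1 / (8 * z\<^sup>2)) * (p2 x * cos (Th z x) + p1 x * (- sin (Th z x) * (z / (aw z x)\<^sup>2)))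
      - z * ((p1 x / (8 * z\<^sup>2)) / (aw z x)\<^sup>2 * sin (Th z x) + (1 / aw z x) * (cos (Th z x) * (z / (aw z x)\<^sup>2))))"
    by (intro AC_diff AC_cmult AC_mult p1_AC cs inverse_aw_AC)
  then show ?thesis
  proof (rule AC_cong)
    fix x :: real assume "x \<in> {0..1}"
    then have a: "aw z x \<noteq> 0" using aw_bounds[of x] by auto
    have z0: "z \<noteq> 0" using z_ge(3) by simp
    have "4 * (z\<^sup>2 * uw z x) = p x / 2" using z0 by (simp add: uw_def)
    then have "(Vwkb z x - z\<^sup>2 - p x / 2) * fw z x = (- (p2 x / (8 * z\<^sup>2)) / aw z x - z\<^sup>2 / (aw z x) ^ 4) * (aw z x * cos (Th z x))"
      unfolding Vwkb_def fw_def by (simp add: algebra_simps)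
    also have "\<dots> = - (p2 x / (8 * z\<^sup>2)) * cos (Th z x) - z\<^sup>2 / (aw z x) ^ 3 * cos (Th z x)"
      using a by (simp add: left_diff_distrib power3_eq_cube power4_eq_xxxx)
    also have "\<dots> = (-1 / (8 * z\<^sup>2)) * (p2 x * cos (Th z x) + p1 x * (- sin (Th z x) * (z / (aw z x)\<^sup>2)))
      - z * ((p1 x / (8 * z\<^sup>2)) / (aw z x)\<^sup>2 * sin (Th z x) + (1 / aw z x) * (cos (Th z x) * (z / (aw z x)\<^sup>2)))"
      by (simp add: algebra_simps power2_eq_square power3_eq_cube)
    finally show "(-1 / (8 * z\<^sup>2)) * (p2 x * cos (Th z x) + p1 x * (- sin (Th z x) * (z / (aw z x)\<^sup>2)))
      - z * ((p1 x / (8 * z\<^sup>2)) / (aw z x)\<^sup>2 * sin (Th z x) + (1 / aw z x) * (cos (Th z x) * (z / (aw z x)\<^sup>2)))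
      = (Vwkb z x - z\<^sup>2 - p x / 2) * fw z x" by simp
  qed (simp add: fdw_def)
qed

text \<open>Expanding \<open>1 / (1 - u) ^ 4\<close> to second order with
  \<open>u = p / (8 z\<^sup>2)\<close> turns \<open>2 z\<^sup>2 Vwkb\<close> into
  \<open>- p'' / 4 - 5 p\<^sup>2 / 16\<close> at leading order; subtracted from \<open>V\<close>
  this leaves \<open>q - p'' / 4 + p\<^sup>2 / 16\<close>, which is \<open>W\<close>.\<close>

lemma Vwkb_bounds:
  assumes x: "x \<in> {0..1}"
  shows "\<bar>V x - 2 * z\<^sup>2 * Vwkb z x - W x\<bar> \<le> 2 * c ^ 3 / z\<^sup>2" "\<bar>2 * z\<^sup>2 * Vwkb z x\<bar> \<le> 2 * c\<^sup>2" "\<bar>Vwkb z x\<bar> \<le> c\<^sup>2 / z\<^sup>2"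
proof -
  define u where "u = uw z x"
  define k where "k = z\<^sup>2"
  have k0: "k > 0" using z_ge(3) by (simp add: k_def)
  note b = bounds[OF x]
  note ub = uw_bound[OF x, folded u_def k_def] and us = uw_small[OF x, folded u_def]
  note ex = inverse_power_expansions[OF us]
  have pu: "p x = 8 * k * u" using k0 by (simp add: u_def uw_def k_def)
  define R where "R = 1 / (1 - u) ^ 4 - 1 - 4 * u - 10 * u\<^sup>2"
  have "2 * k * (- (a / (8 * k)) / b) = - (a / 4) * (1 / b)" for a b using k0 by simp
  from this[of "p2 x" "1 - u"]
  have "2 * k * (- (p2 x / (8 * k)) / (1 - u)) = - (p2 x / 4) * (1 / (1 - u))" .
  moreover have "1 / (1 - u) ^ 4 - 1 - 4 * u = R + 10 * u\<^sup>2" by (simp add: R_def)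
  moreover have "2 * k * (x - k * w) = 2 * k * x - 2 * k\<^sup>2 * w" for x w by algebra
  ultimately have Vw: "2 * k * Vwkb z x = - (p2 x / 4) * (1 / (1 - u)) - 2 * k\<^sup>2 * (R + 10 * u\<^sup>2)"
    unfolding Vwkb_def aw_def u_def[symmetric] k_def[symmetric] by (simp only:)
  have id: "V x - 2 * k * Vwkb z x - W x = (p2 x / 4) * (1 / (1 - u) - 1) + 2 * k\<^sup>2 * R"
  proof -
    define w where "w = 1 / (1 - u)"
    show ?thesis unfolding Vw V_def W_def pu w_def[symmetric] by (simp add: field_simps power2_eq_square)
  qed
  have "\<bar>(p2 x / 4) * (1 / (1 - u) - 1)\<bar> \<le> c / 4 * (2 * (c / (8 * k)))"
    unfolding abs_mult using b ex(4) ub by (intro mult_mono) auto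
  also have "\<dots> \<le> c ^ 3 / k"
  proof -
    have "c * c \<le> c ^ 3" using c1 mult_right_mono[of 1 c "c * c"] by (simp add: power3_eq_cube mult.assoc)
    then have "c * c / 16 \<le> c ^ 3" using zero_le_square[of c] by linarith
    then show ?thesis using k0 divide_right_mono[of "c * c / 16" "c ^ 3" k] by (simp add: field_simps)
  qed
  finally have 1: "\<bar>(p2 x / 4) * (1 / (1 - u) - 1)\<bar> \<le> c ^ 3 / k" .
  have "\<bar>R\<bar> \<le> 60 * (c / (8 * k)) ^ 3"
    using ex(1) power_mono[OF ub, of 3] unfolding R_def by simp
  then have "\<bar>2 * k\<^sup>2 * R\<bar> \<le> 2 * k\<^sup>2 * (60 * (c / (8 * k)) ^ 3)"
    unfolding abs_mult by (intro mult_mono) auto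
  also have "\<dots> = 120 / 512 * (c ^ 3 / k)" using k0 by (simp add: power_divide power_mult_distrib power2_eq_square power3_eq_cube field_simps)
  also have "\<dots> \<le> 1 * (c ^ 3 / k)" using c1 k0 by (intro mult_right_mono) auto
  finally have 2: "\<bar>2 * k\<^sup>2 * R\<bar> \<le> c ^ 3 / k" by simp
  show d: "\<bar>V x - 2 * z\<^sup>2 * Vwkb z x - W x\<bar> \<le> 2 * c ^ 3 / z\<^sup>2"
    using 1 2 abs_triangle_ineq[of "(p2 x / 4) * (1 / (1 - u) - 1)" "2 * k\<^sup>2 * R"] unfolding k_def[symmetric] id by simp
  have px2: "(p x)\<^sup>2 \<le> c\<^sup>2" using b c1 by (simp add: abs_le_square_iff[symmetric])
  have VW: "\<bar>V x - W x\<bar> \<le> 9 / 16 * c\<^sup>2"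
  proof -
    have "V x - W x = - (p2 x / 4) - 5 / 16 * (p x)\<^sup>2" by (simp add: V_def W_def)
    then have "\<bar>V x - W x\<bar> \<le> c / 4 + 5 / 16 * c\<^sup>2" using b px2 zero_le_power2[of "p x"] by linarith
    then show ?thesis using c_le_square by linarith
  qed
  have "2 * c ^ 3 / z\<^sup>2 \<le> c\<^sup>2"
  proof -
    have "z * 1 \<le> z * z" using z_ge(1) by (intro mult_left_mono) auto
    then have "2 * c \<le> z\<^sup>2" using z_ge(6) c1 unfolding power2_eq_square by linarith
    then have "2 * c * c\<^sup>2 \<le> z\<^sup>2 * c\<^sup>2" by (intro mult_right_mono) auto
    then show ?thesis using z_ge(3) by (simp add: divide_le_eq power2_eq_square power3_eq_cube mult_ac)
  qed
  then show V2: "\<bar>2 * z\<^sup>2 * Vwkb z x\<bar> \<le> 2 * c\<^sup>2" using d VW c_le_square by linarith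
  then have "z\<^sup>2 * \<bar>Vwkb z x\<bar> \<le> c\<^sup>2" by (simp add: abs_mult)
  then show "\<bar>Vwkb z x\<bar> \<le> c\<^sup>2 / z\<^sup>2" using z_ge(3) by (simp add: field_simps)
qed

lemma fw_bound: "x \<in> {0..1} \<Longrightarrow> \<bar>fw z x\<bar> \<le> 2"
proof -
  assume x: "x \<in> {0..1}"
  have "\<bar>aw z x\<bar> * \<bar>cos (Th z x)\<bar> \<le> 2 * 1" using aw_bounds[OF x] by (intro mult_mono) auto
  then show ?thesis by (simp add: fw_def abs_mult)
qed

lemma wkb_at_0: "Th z 0 = 0" "fw z 0 = aw z 0" "fdw z 0 = - (p1 0 / (8 * z\<^sup>2))"
  by (simp_all add: Th_def fw_def fdw_def)

end
end

section \<open>Oscillating and hyperbolic equations with bounded forcing\<close>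

lemma oscillation_bound:
  fixes E E1 g :: "real \<Rightarrow> complex" and z K :: real
  assumes E: "AC_with_deriv 0 1 E E1" and E1: "AC_with_deriv 0 1 E1 (\<lambda>x. g x - (of_real z)\<^sup>2 * E x)"
    and g: "\<And>x. x \<in> {0..1} \<Longrightarrow> norm (g x) \<le> K" and z: "0 < z" and E0: "E 0 = 0" and x: "x \<in> {0..1}"
  shows "norm (E x) \<le> (norm (E1 0) + K) / z" "norm (E1 x) \<le> norm (E1 0) + K"
proof -
  let ?z = "complex_of_real z"
  \<comment> \<open>For an imaginary exponent the propagator has modulus 1, so both first-order
    combinations keep the size of their initial value up to the forcing.\<close>
  have bound: "norm (E1 x + c * E x) \<le> norm (E1 0) + K" if c: "c = \<i> * ?z \<or> c = - (\<i> * ?z)" for c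
  proof -
    have cc: "c * c = - (?z\<^sup>2)" using c by (auto simp: power2_eq_square algebra_simps)
    have Re: "Re c = 0" using c by auto
    have "AC_with_deriv 0 1 (\<lambda>x. E1 x + c * E x) (\<lambda>x. c * (E1 x + c * E x) + g x)"
      by (rule AC_cong[OF AC_add[OF E1 AC_cmult[OF E, of c]]])
        (auto simp: distrib_left mult.assoc[symmetric] cc)
    then have "norm (E1 x + c * E x - exp (c * of_real x) * (E1 0 + c * E 0)) \<le> Jint (\<lambda>x. K) x * exp (0 * x)"
      by (rule variation_of_constants_bound) (use g Re x in auto)
    also have "\<dots> \<le> K"
      using order_trans[OF norm_ge_zero g[of 0]] x mult_left_le_one_le[of K x] by (simp add: Jint_def mult.commute)
    finally have "norm (E1 x + c * E x - exp (c * of_real x) * E1 0) \<le> K" by (simp add: E0)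
    moreover have "norm (exp (c * of_real x) * E1 0) = norm (E1 0)" using Re by (simp add: norm_mult)
    ultimately show ?thesis using norm_triangle_sub[of "E1 x + c * E x" "exp (c * of_real x) * E1 0"] by linarith
  qed
  note b = bound[of "\<i> * ?z"] bound[of "- (\<i> * ?z)"]
  have "2 * norm (E1 x) = norm ((E1 x + \<i> * ?z * E x) + (E1 x + - (\<i> * ?z) * E x))" by (simp add: norm_mult[symmetric])
  also have "\<dots> \<le> 2 * (norm (E1 0) + K)"
    using norm_triangle_ineq[of "E1 x + \<i> * ?z * E x" "E1 x + - (\<i> * ?z) * E x"] b by simp
  finally show "norm (E1 x) \<le> norm (E1 0) + K" by simp
  have "(E1 x + \<i> * ?z * E x) - (E1 x + - (\<i> * ?z) * E x) = (2 * \<i> * ?z) * E x" by simp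
  then have "norm ((E1 x + \<i> * ?z * E x) - (E1 x + - (\<i> * ?z) * E x)) = 2 * z * norm (E x)"
    using z by (simp only: norm_mult norm_ii norm_of_real) simp
  then have "2 * z * norm (E x) \<le> 2 * (norm (E1 0) + K)"
    using norm_triangle_ineq4[of "E1 x + \<i> * ?z * E x" "E1 x + - (\<i> * ?z) * E x"] b by simp
  then show "norm (E x) \<le> (norm (E1 0) + K) / z" using z by (simp add: field_simps)
qed

text \<open>The first-order factors \<open>S\<close> and \<open>T\<close> grow and decay
  respectively. The end condition \<open>A 1 = 0\<close> equates them at 1 and
  \<open>S 0 + T 0 = 2 * A1 0\<close> couples them at 0, so no exponentially large constant
  survives.\<close>

lemma dichotomy_bound:
  fixes A A1 g :: "real \<Rightarrow> complex" and z K :: real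
  assumes A: "AC_with_deriv 0 1 A A1" and A1: "AC_with_deriv 0 1 A1 (\<lambda>x. g x + (of_real z)\<^sup>2 * A x)"
    and g: "\<And>x. x \<in> {0..1} \<Longrightarrow> norm (g x) \<le> K" and z: "1 \<le> z" and A_end: "A 1 = 0" and x: "x \<in> {0..1}"
  shows "norm (A x) \<le> (3 * K + 6 * norm (A1 0)) / z"
proof -
  let ?z = "complex_of_real z"
  have z0: "0 < z" using z by simp
  define S T where "S x = A1 x + ?z * A x" and "T x = A1 x - ?z * A x" for x
  have aS: "AC_with_deriv 0 1 S (\<lambda>x. ?z * S x + g x)"
    unfolding S_def[abs_def] by (rule AC_cong[OF AC_add[OF A1 AC_cmult[OF A, of ?z]]]) (auto simp: algebra_simps power2_eq_square)
  have aT: "AC_with_deriv 0 1 T (\<lambda>x. - ?z * T x + g x)"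
    unfolding T_def[abs_def] by (rule AC_cong[OF AC_diff[OF A1 AC_cmult[OF A, of ?z]]]) (auto simp: algebra_simps power2_eq_square)
  have JK: "Jint (\<lambda>x. K) y \<le> K" if "y \<in> {0..1}" for y
    using order_trans[OF norm_ge_zero g[of 0]] that mult_left_le_one_le[of K y] by (simp add: Jint_def mult.commute)
  have Sb: "norm (S y - exp (?z * of_real (y - 1)) * S 1) \<le> K" if y: "y \<in> {0..1}" for y
    by (rule order_trans[OF variation_of_constants_bound_backward[OF aS _ g _ y] JK]) (use z0 in auto)
  have Tb: "norm (T y - exp (- ?z * of_real y) * T 0) \<le> K" if y: "y \<in> {0..1}" for y
    by (rule order_trans[OF variation_of_constants_bound[OF aT, of "\<lambda>x. K" 0 y]]) (use z0 g y JK[OF y] in auto)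
  have "S 0 = 2 * A1 0 - T 0" "T 0 = 2 * A1 0 - S 0" "S 1 = T 1" by (simp_all add: S_def T_def A_end)
  then have ends: "norm (S 0) \<le> norm (T 0) + 2 * norm (A1 0)" "norm (T 0) \<le> norm (S 0) + 2 * norm (A1 0)" "norm (S 1) = norm (T 1)"
    using norm_triangle_ineq4[of "2 * A1 0" "T 0"] norm_triangle_ineq4[of "2 * A1 0" "S 0"] by (auto simp: norm_mult)
  have ST: "norm (S x) \<le> 3 * K + 3 * (2 * norm (A1 0))" "norm (T x) \<le> 3 * K + 3 * (2 * norm (A1 0))"
    by (rule two_point_bound[of S z K T, OF _ _ z ends x]; use Sb Tb in blast)+
  have "2 * ?z * A x = S x - T x" by (simp add: S_def T_def)
  then have "norm (2 * ?z * A x) = norm (S x - T x)" by (rule arg_cong)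
  then have "2 * z * norm (A x) = norm (S x - T x)" using z0 by (simp add: norm_mult)
  also have "\<dots> \<le> norm (S x) + norm (T x)" by (rule norm_triangle_ineq4)
  also have "\<dots> \<le> 2 * (3 * K + 6 * norm (A1 0))" using add_mono[OF ST] by (simp add: algebra_simps)
  finally show ?thesis using z0 by (simp add: field_simps)
qed

lemma Re_of_real_mult: "Re (of_real r * w) = r * Re w"
  by simp

lemma norm_attains_sup:
  fixes f :: "real \<Rightarrow> 'a::real_normed_vector"
  assumes "continuous_on {0..1} f"
  obtains x where "x \<in> {0..1}" "\<And>y. y \<in> {0..1} \<Longrightarrow> norm (f y) \<le> norm (f x)"
  using continuous_attains_sup[OF compact_Icc _ continuous_on_norm[OF assms]] by auto

context quartic_bounded
begin

context
  fixes z :: real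
  assumes z: "100 * c ^ 3 \<le> z"
begin

text \<open>Closes the circle of estimates between the maxima \<open>M\<close> of the eigenfunction,
  \<open>A\<close> of the hyperbolic part and \<open>E\<close> of the oscillating error, and the
  amplitude \<open>b\<close>. The hypotheses make \<open>A\<close> and \<open>E\<close> of order
  \<open>c\<^sup>2 (M + b) / z\<close>, and their share in \<open>2 z\<^sup>2 M\<close> is then
  small enough for \<open>M \<le> 3 b\<close>.\<close>

lemma wkb_constants:
  fixes M E A b :: real
  assumes M: "0 \<le> M" "0 \<le> b" "2 * z\<^sup>2 * M \<le> 4 * z\<^sup>2 * b + E + A"
    and A: "A \<le> (3 * (c * M + c / 2 * A) + 3 * c * M) / z"
    and E: "E \<le> (c / 2 * M + c / 4 * b + (c * M + 4 * c\<^sup>2 * b + c / 2 * E)) / z"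
  shows "M \<le> 3 * b" "E \<le> 10 * c\<^sup>2 * b / z" "E + A \<le> 50 * c\<^sup>2 * b / z" "E \<le> b"
proof -
  note zg = z_ge[OF z]
  have "z * A \<le> 6 * (c * M) + 3 / 2 * (c * A)" using A zg(3) by (simp add: field_simps)
  moreover have "3 / 2 * (c * A) \<le> 3 / 200 * (z * A)" if "0 \<le> A"
    using mult_right_mono[OF zg(6) that] by linarith
  ultimately have zA: "z * A \<le> 12 * (c * M)" 
  proof (cases "0 \<le> A")
    case False
    then have "z * A \<le> 0" using zg(3) by (simp add: mult_le_0_iff)
    moreover have "0 \<le> c * M" using M c1 by simp
    ultimately show ?thesis by linarith
  next
    case True
    have "0 \<le> c * M" using M c1 by simp
    with True \<open>z * A \<le> 6 * (c * M) + 3 / 2 * (c * A)\<close> \<open>0 \<le> A \<Longrightarrow> 3 / 2 * (c * A) \<le> 3 / 200 * (z * A)\<close> show ?thesis by linarith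
  qed
  have "z * E \<le> 3 / 2 * (c * M) + c * b / 4 + 4 * (c\<^sup>2 * b) + 1 / 2 * (c * E)" using E zg(3) by (simp add: field_simps)
  moreover have "c * b \<le> c\<^sup>2 * b" using c_le_square M by (intro mult_right_mono) auto
  moreover have "1 / 2 * (c * E) \<le> 1 / 200 * (z * E)" if "0 \<le> E"
    using mult_right_mono[OF zg(6) that] by linarith
  moreover have "0 \<le> c * M" "0 \<le> c\<^sup>2 * b" using M c1 by auto
  moreover have "z * E \<le> 0" if "\<not> 0 \<le> E" using that zg(3) by (simp add: mult_le_0_iff)
  ultimately have zE: "z * E \<le> 151 / 100 * (c * M) + 43 / 10 * (c\<^sup>2 * b)" by (cases "0 \<le> E") linarith+
  have c2z: "c\<^sup>2 * 10000 \<le> z\<^sup>2"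
  proof -
    have "(100 * c)\<^sup>2 \<le> z\<^sup>2" using zg(6) c1 by (intro power_mono) auto
    then show ?thesis by (simp add: power_mult_distrib)
  qed
  have cM: "c * M \<le> c\<^sup>2 * M" using c_le_square M by (intro mult_right_mono) auto
  have nn: "0 \<le> c * M" "0 \<le> c\<^sup>2 * M" "0 \<le> c\<^sup>2 * b" using M c1 by simp_all
  have EA: "z * (E + A) \<le> 15 * (c\<^sup>2 * M) + 5 * (c\<^sup>2 * b)"
    using zE zA cM nn unfolding distrib_left by linarith
  have "E + A \<le> 15 * (c\<^sup>2 * M) + 5 * (c\<^sup>2 * b)"
  proof (cases "0 \<le> E + A")
    case True
    then have "1 * (E + A) \<le> z * (E + A)" using zg(1) by (intro mult_right_mono) auto
    then have "E + A \<le> z * (E + A)" by simp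
    then show ?thesis using EA by (rule order_trans)
  qed (use nn in linarith)
  moreover have "c\<^sup>2 * M * 10000 \<le> z\<^sup>2 * M" "c\<^sup>2 * b * 10000 \<le> z\<^sup>2 * b"
    using mult_right_mono[OF c2z M(1)] mult_right_mono[OF c2z M(2)] by (simp_all add: mult_ac)
  ultimately have "z\<^sup>2 * M \<le> z\<^sup>2 * (3 * b)"
    using M(3) mult_nonneg_nonneg[OF zero_le_power2[of z] M(1)] mult_nonneg_nonneg[OF zero_le_power2[of z] M(2)] by linarith
  then show Mb: "M \<le> 3 * b" using zg(3) by (simp add: mult_le_cancel_left)
  have cMb: "c * M \<le> 3 * (c * b)" using mult_left_mono[OF Mb, of c] c1 by simp
  have zA': "z * A \<le> 36 * (c * b)" using zA cMb by linarith
  have cb: "c * b \<le> c\<^sup>2 * b" "0 \<le> c\<^sup>2 * b" using c_le_square M by (auto intro: mult_right_mono)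
  have zE': "z * E \<le> 10 * (c\<^sup>2 * b)" using zE cMb cb by linarith
  then show "E \<le> 10 * c\<^sup>2 * b / z" using zg(3) by (simp add: field_simps)
  have "z * (E + A) \<le> 50 * (c\<^sup>2 * b)" using zE' zA' cb by (simp add: distrib_left)
  then show "E + A \<le> 50 * c\<^sup>2 * b / z" using zg(3) by (simp add: field_simps)
  have "10 * c\<^sup>2 \<le> z"
  proof -
    have "c\<^sup>2 \<le> c ^ 3" using c1 by (simp add: power_increasing)
    then show ?thesis using z zero_le_power2[of c] by linarith
  qed
  then have "10 * c\<^sup>2 * b \<le> z * b" using M by (intro mult_right_mono) auto
  then have "z * E \<le> z * b" using zE' by linarith
  then show "E \<le> b" using zg(3) by (simp add: mult_le_cancel_left)
qed

text \<open>\<open>B\<close> is \<open>- y'' - (p/2) y + z\<^sup>2 y\<close>, and \<open>y\<close> is scaled so that \<open>B\<close> and \<open>2 z\<^sup>2 fw z\<close> agree at \<open>0\<close>.\<close>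

lemma eigsol_wkb:
  assumes Y: "eigsol (of_real z ^ 4) Y"
  obtains y B B1 :: "real \<Rightarrow> real" where
    "AC_with_deriv 0 1 B B1" "AC_with_deriv 0 1 B1 (\<lambda>x. V x * y x - (z\<^sup>2 + p x / 2) * B x)" "continuous_on {0..1} y"
    "B 0 = 2 * z\<^sup>2 * aw z 0" "B1 0 = - (p1 0 / 2) * y 0" "B 1 = 0"
    "\<And>x. x \<in> {0..1} \<Longrightarrow> \<bar>y x - fw z x\<bar> \<le> 25 * c\<^sup>2 / z ^ 3"
    "\<And>x. x \<in> {0..1} \<Longrightarrow> \<bar>B x - 2 * z\<^sup>2 * fw z x\<bar> \<le> 10 * c\<^sup>2 / z"
    "\<bar>B1 1 - 2 * z\<^sup>2 * fdw z 1\<bar> \<le> 10 * c\<^sup>2"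
    "\<bar>fw z 1\<bar> \<le> 25 * c\<^sup>2 / z ^ 3"
proof -
  note zg = z_ge[OF z]
  let ?k = "(complex_of_real z)\<^sup>2"
  have AC: "AC_with_deriv 0 1 (Y 0) (Y 1)" "AC_with_deriv 0 1 (Y 1) (Y 2)" "AC_with_deriv 0 1 (Y 2) (\<lambda>x. Y 3 x - P x * Y 1 x)"
    "AC_with_deriv 0 1 (Y 3) (\<lambda>x. (of_real z ^ 4 - Q x) * Y 0 x)"
    using Y unfolding eigsol_def solves_ode_def quasi_derivs_def P_def Q_def by blast+
  have bc: "Y 1 0 = 0" "Y 3 0 = 0" "Y 0 1 = 0" "Y 2 1 = 0" "Y 0 0 \<noteq> 0 \<or> Y 2 0 \<noteq> 0" using Y unfolding eigsol_def by blast+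
  have PA: "AC_with_deriv 0 1 P (\<lambda>x. of_real (p1 x))" unfolding P_def[abs_def] by (rule AC_of_real[OF p_AC])
  note PA1 = AC_of_real[OF p1_AC]
  define A A1 B B1 where "A x = - Y 2 x - P x * Y 0 x / 2 - ?k * Y 0 x"
    and "A1 x = - Y 3 x + P x * Y 1 x / 2 - of_real (p1 x) * Y 0 x / 2 - ?k * Y 1 x"
    and "B x = - Y 2 x - P x * Y 0 x / 2 + ?k * Y 0 x"
    and "B1 x = - Y 3 x + P x * Y 1 x / 2 - of_real (p1 x) * Y 0 x / 2 + ?k * Y 1 x" for x
  note defs = A_def A1_def B_def B1_def
  have V_c: "complex_of_real (V x) = Q x - of_real (p2 x) / 2 - (P x)\<^sup>2 / 4" for x by (simp add: V_def P_def Q_def)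
  have first: "AC_with_deriv 0 1 (\<lambda>x. (-1) * Y 2 x + (-1/2) * (P x * Y 0 x) + s * Y 0 x)
     (\<lambda>x. (-1) * (Y 3 x - P x * Y 1 x) + (-1/2) * (of_real (p1 x) * Y 0 x + P x * Y 1 x) + s * Y 1 x)" for s
    by (intro AC_add AC_cmult AC_mult AC PA)
  have second: "AC_with_deriv 0 1 (\<lambda>x. (-1) * Y 3 x + (1/2) * (P x * Y 1 x) + (-1/2) * (of_real (p1 x) * Y 0 x) + s * Y 1 x)
     (\<lambda>x. (-1) * ((of_real z ^ 4 - Q x) * Y 0 x) + (1/2) * (of_real (p1 x) * Y 1 x + P x * Y 2 x)
        + (-1/2) * (of_real (p2 x) * Y 0 x + of_real (p1 x) * Y 1 x) + s * Y 2 x)" for s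
    by (intro AC_add AC_cmult AC_mult AC PA PA1)
  have aA: "AC_with_deriv 0 1 A A1"
    by (rule AC_cong[OF first[of "- ?k"]]) (simp_all add: defs field_simps)
  have aB: "AC_with_deriv 0 1 B B1"
    by (rule AC_cong[OF first[of ?k]]) (simp_all add: defs field_simps)
  \<comment> \<open>In second-order form \<open>A'' = (z\<^sup>2 - p / 2) A + V y\<close> and
    \<open>B'' = - (z\<^sup>2 + p / 2) B + V y\<close>: the two components interact only through
    \<open>V y\<close>.\<close>
  have aA1: "AC_with_deriv 0 1 A1 (\<lambda>x. (of_real (V x) * Y 0 x - P x / 2 * A x) + ?k * A x)"
    by (rule AC_cong[OF second[of "- ?k"]])
      (simp_all add: defs V_c field_simps power2_eq_square power4_eq_xxxx)
  have aB1: "AC_with_deriv 0 1 B1 (\<lambda>x. of_real (V x) * Y 0 x - (?k + P x / 2) * B x)"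
    by (rule AC_cong[OF second[of ?k]])
      (simp_all add: defs V_c field_simps power2_eq_square power4_eq_xxxx)
  have nV: "norm (complex_of_real (V x)) \<le> c" and nP: "norm (P x) \<le> c" and np1: "norm (complex_of_real (p1 x)) \<le> c" if "x \<in> {0..1}" for x
    using bounds[OF that] by (simp_all add: P_def)
  obtain x0 where x0: "x0 \<in> {0..1}" "\<And>y. y \<in> {0..1} \<Longrightarrow> norm (Y 0 y) \<le> norm (Y 0 x0)"
    using norm_attains_sup[OF AC_continuous[OF AC(1)]] by blast
  obtain xA where xA: "xA \<in> {0..1}" "\<And>y. y \<in> {0..1} \<Longrightarrow> norm (A y) \<le> norm (A xA)"
    using norm_attains_sup[OF AC_continuous[OF aA]] by blast
  define M where "M = norm (Y 0 x0)"
  have M: "norm (Y 0 x) \<le> M" if "x \<in> {0..1}" for x using x0(2)[OF that] by (simp add: M_def)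
  have VY: "norm (of_real (V x) * Y 0 x) \<le> c * M" if "x \<in> {0..1}" for x
    unfolding norm_mult using nV[OF that] M[OF that] c1 by (intro mult_mono) auto
  have p1Y: "norm (of_real (p1 0) * Y 0 0) \<le> c * M"
    unfolding norm_mult using np1[of 0] M[of 0] c1 by (intro mult_mono) auto
  have PX: "norm (P x / 2 * w) \<le> c / 2 * n" if "x \<in> {0..1}" "norm w \<le> n" for x w n
    unfolding norm_mult using nP[OF that(1)] that(2) c1 by (intro mult_mono) (auto simp: norm_divide)
  have "norm (A xA) \<le> (3 * (c * M + c / 2 * norm (A xA)) + 6 * norm (A1 0)) / z"
  proof (rule dichotomy_bound[OF aA aA1 _ _ _ xA(1)])
    fix x :: real assume x: "x \<in> {0..1}"
    show "norm (of_real (V x) * Y 0 x - P x / 2 * A x) \<le> c * M + c / 2 * norm (A xA)"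
      using norm_triangle_ineq4[of "of_real (V x) * Y 0 x" "P x / 2 * A x"] VY[OF x] PX[OF x xA(2)[OF x]] by linarith
  qed (use zg(1) bc in \<open>auto simp: defs\<close>)
  moreover have "6 * norm (A1 0) \<le> 3 * c * M" using p1Y bc by (simp add: defs norm_divide)
  ultimately have Ab: "norm (A xA) \<le> (3 * (c * M + c / 2 * norm (A xA)) + 3 * c * M) / z"
    using zg(3) by (smt (verit) divide_right_mono)
  define f f1 where "f x = complex_of_real (fw z x)" and "f1 x = complex_of_real (fdw z x)" for x
  have af: "AC_with_deriv 0 1 f f1" unfolding f_def[abs_def] f1_def[abs_def] by (rule AC_of_real[OF fw_AC[OF z]])
  have af1: "AC_with_deriv 0 1 f1 (\<lambda>x. (of_real (Vwkb z x) - ?k - P x / 2) * f x)"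
    unfolding f1_def[abs_def] by (rule AC_cong[OF AC_of_real[OF fdw_AC[OF z]]]) (simp_all add: f_def P_def)
  have a0: "aw z 0 \<noteq> 0" using aw_bounds[OF z, of 0] by auto
  define \<beta> where "\<beta> = B 0 / (2 * ?k * of_real (aw z 0))"
  define E E1 where "E x = B x - 2 * ?k * \<beta> * f x" and "E1 x = B1 x - 2 * ?k * \<beta> * f1 x" for x
  have aE: "AC_with_deriv 0 1 E E1" unfolding E_def[abs_def] E1_def[abs_def] by (intro AC_diff AC_cmult aB af)
  define g where "g x = of_real (V x) * Y 0 x - \<beta> * (of_real (2 * z\<^sup>2 * Vwkb z x) * f x) - P x / 2 * E x" for x
  have aE1: "AC_with_deriv 0 1 E1 (\<lambda>x. g x - ?k * E x)"
    unfolding E1_def[abs_def] by (rule AC_cong[OF AC_diff[OF aB1 AC_cmult[OF af1, of "2 * ?k * \<beta>"]]])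
      (simp_all add: E_def g_def algebra_simps)
  have kz: "?k \<noteq> 0" using zg(3) by simp
  have E0: "E 0 = 0" using kz a0 by (simp add: E_def \<beta>_def f_def wkb_at_0[OF z])
  obtain xE where xE: "xE \<in> {0..1}" "\<And>y. y \<in> {0..1} \<Longrightarrow> norm (E y) \<le> norm (E xE)"
    using norm_attains_sup[OF AC_continuous[OF aE]] by blast
  define b where "b = norm \<beta>"
  have b0: "0 \<le> b" by (simp add: b_def)
  have f2: "norm (f x) \<le> 2" if "x \<in> {0..1}" for x using fw_bound[OF z that] by (simp add: f_def)
  have gb: "norm (g x) \<le> c * M + 4 * c\<^sup>2 * b + c / 2 * norm (E xE)" if x: "x \<in> {0..1}" for x
  proof -
    have "norm (\<beta> * (of_real (2 * z\<^sup>2 * Vwkb z x) * f x)) \<le> b * ((2 * c\<^sup>2) * 2)"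
      unfolding norm_mult b_def norm_of_real[of "2 * z\<^sup>2 * Vwkb z x"] using Vwkb_bounds(2)[OF z x] f2[OF x] by (intro mult_mono) auto
    then show ?thesis
      using norm_triangle_ineq4[of "of_real (V x) * Y 0 x" "\<beta> * (of_real (2 * z\<^sup>2 * Vwkb z x) * f x)"]
        norm_triangle_ineq4[of "of_real (V x) * Y 0 x - \<beta> * (of_real (2 * z\<^sup>2 * Vwkb z x) * f x)" "P x / 2 * E x"]
        VY[OF x] PX[OF x xE(2)[OF x]] unfolding g_def by (simp add: mult_ac)
  qed
  note osc = oscillation_bound[OF aE aE1 gb zg(3) E0]
  have "E1 0 = - (of_real (p1 0) * Y 0 0) / 2 + \<beta> * of_real (p1 0) / 4"
    using kz bc zg(3) by (simp add: E1_def B1_def f1_def wkb_at_0[OF z] field_simps)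
  moreover have "norm (- (of_real (p1 0) * Y 0 0) / 2) \<le> c / 2 * M" using p1Y by (simp add: norm_divide)
  moreover have "norm (\<beta> * of_real (p1 0) / 4) \<le> c / 4 * b"
    using mult_left_mono[OF np1[of 0] b0] by (simp add: norm_divide norm_mult b_def mult.commute)
  ultimately have E10: "norm (E1 0) \<le> c / 2 * M + c / 4 * b"
    using norm_triangle_ineq[of "- (of_real (p1 0) * Y 0 0) / 2" "\<beta> * of_real (p1 0) / 4"] by simp
  have Eb: "norm (E xE) \<le> (c / 2 * M + c / 4 * b + (c * M + 4 * c\<^sup>2 * b + c / 2 * norm (E xE))) / z"
    using E10 zg(3) by (intro order_trans[OF osc(1)[OF _ xE(1)]] divide_right_mono add_right_mono) auto
  \<comment> \<open>Since \<open>B - A = 2 z\<^sup>2 y\<close>, the distance of \<open>y\<close>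
    from its approximation is controlled by \<open>E\<close> and \<open>A\<close> with a gain of
    \<open>z\<^sup>2\<close>.\<close>
  have diff: "2 * ?k * (Y 0 x - \<beta> * f x) = E x - A x" for x by (simp add: E_def defs algebra_simps)
  have ndiff: "2 * z\<^sup>2 * norm (Y 0 x - \<beta> * f x) \<le> norm (E xE) + norm (A xA)" if x: "x \<in> {0..1}" for x
  proof -
    have "2 * z\<^sup>2 * norm (Y 0 x - \<beta> * f x) = norm (2 * ?k * (Y 0 x - \<beta> * f x))" by (simp add: norm_mult norm_power)
    also have "\<dots> \<le> norm (E x) + norm (A x)" unfolding diff by (rule norm_triangle_ineq4)
    finally show ?thesis using xE(2)[OF x] xA(2)[OF x] by linarith
  qed
  have "2 * z\<^sup>2 * M \<le> 4 * z\<^sup>2 * b + norm (E xE) + norm (A xA)"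
  proof -
    have "norm (\<beta> * f x0) \<le> b * 2" unfolding norm_mult b_def using f2[OF x0(1)] by (intro mult_left_mono) auto
    then have "M \<le> norm (Y 0 x0 - \<beta> * f x0) + 2 * b" unfolding M_def using norm_triangle_sub[of "Y 0 x0" "\<beta> * f x0"] by linarith
    then have "2 * z\<^sup>2 * M \<le> 2 * z\<^sup>2 * (norm (Y 0 x0 - \<beta> * f x0) + 2 * b)" by (intro mult_left_mono) auto
    then show ?thesis using ndiff[OF x0(1)] by (simp add: distrib_left)
  qed
  moreover have "0 \<le> M" by (simp add: M_def)
  ultimately have K: "M \<le> 3 * b" "norm (E xE) \<le> 10 * c\<^sup>2 * b / z" "norm (E xE) + norm (A xA) \<le> 50 * c\<^sup>2 * b / z" "norm (E xE) \<le> b"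
    using wkb_constants[OF _ b0 _ Ab Eb] by blast+
  \<comment> \<open>Otherwise \<open>M \<le> 3 * b\<close> makes \<open>Y 0\<close> vanish, and
    \<open>B 0 = 0\<close> then makes \<open>Y 2 0\<close> vanish, against nontriviality.\<close>
  have \<beta>0: "\<beta> \<noteq> 0"
  proof
    assume "\<beta> = 0"
    have "norm (Y 0 0) \<le> M" by (rule M) simp
    also have "M \<le> 3 * b" by (rule K(1))
    also have "3 * b = 0" using \<open>\<beta> = 0\<close> by (simp add: b_def)
    finally have "norm (Y 0 0) \<le> 0" .
    moreover have "B 0 = 0" using \<open>\<beta> = 0\<close> kz a0 by (simp add: \<beta>_def)
    ultimately have "Y 0 0 = 0" "B 0 = 0" by simp_all
    then show False using bc by (simp add: B_def)
  qed
  then have bp: "0 < b" by (simp add: b_def)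
  have e1: "norm (Y 0 x / \<beta> - f x) \<le> 25 * c\<^sup>2 / z ^ 3" if x: "x \<in> {0..1}" for x
  proof -
    have "2 * z\<^sup>2 * norm (Y 0 x - \<beta> * f x) \<le> 50 * c\<^sup>2 * b / z" using ndiff[OF x] K(3) by linarith
    then have "norm (Y 0 x - \<beta> * f x) \<le> b * (25 * c\<^sup>2 / z ^ 3)"
      using zg(3) by (simp add: field_simps power2_eq_square power3_eq_cube)
    moreover have "norm (Y 0 x - \<beta> * f x) = b * norm (Y 0 x / \<beta> - f x)"
      using \<beta>0 unfolding b_def norm_mult[symmetric] by (simp add: right_diff_distrib)
    ultimately have "b * norm (Y 0 x / \<beta> - f x) \<le> b * (25 * c\<^sup>2 / z ^ 3)" by (simp only:)
    then show ?thesis using bp by (rule mult_left_le_imp_le)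
  qed
  have e2: "norm (B x / \<beta> - 2 * ?k * f x) \<le> 10 * c\<^sup>2 / z" if x: "x \<in> {0..1}" for x
  proof -
    have "b * norm (B x / \<beta> - 2 * ?k * f x) = norm (E x)"
      using \<beta>0 unfolding b_def norm_mult[symmetric] E_def by (simp add: right_diff_distrib mult_ac)
    also have "\<dots> \<le> b * (10 * c\<^sup>2 / z)" using xE(2)[OF x] K(2) by (simp add: mult_ac)
    finally show ?thesis using bp by (rule mult_left_le_imp_le)
  qed
  have e3: "norm (B1 1 / \<beta> - 2 * ?k * f1 1) \<le> 10 * c\<^sup>2"
  proof -
    have "b * norm (B1 1 / \<beta> - 2 * ?k * f1 1) = norm (E1 1)"
      using \<beta>0 unfolding b_def norm_mult[symmetric] E1_def by (simp add: right_diff_distrib mult_ac)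
    also have "\<dots> \<le> b * (10 * c\<^sup>2)"
    proof -
      have "norm (E1 1) \<le> (c / 2 * M + c / 4 * b) + (c * M + 4 * c\<^sup>2 * b + c / 2 * norm (E xE))" 
        by (rule order_trans[OF osc(2) add_right_mono[OF E10]]) simp_all
      moreover have "c * M \<le> c * (3 * b)" "c * norm (E xE) \<le> c * b" using K c1 by (auto intro: mult_left_mono)
      moreover have "c * b \<le> c\<^sup>2 * b" "0 \<le> c\<^sup>2 * b" using c_le_square bp by auto
      moreover have "m0 \<le> b * (10 * c\<^sup>2)"
        if "m0 \<le> (c / 2 * M + c / 4 * b) + (c * M + 4 * c\<^sup>2 * b + c / 2 * norm (E xE))" "c * M \<le> c * (3 * b)"
          "c * norm (E xE) \<le> c * b" "c * b \<le> c\<^sup>2 * b" "0 \<le> c\<^sup>2 * b" for m0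
        using that by (simp add: algebra_simps)
      ultimately show ?thesis by blast
    qed
    finally show ?thesis using bp by (rule mult_left_le_imp_le)
  qed
  \<comment> \<open>All coefficients and comparison functions are real, so real parts of the
    normalised solution obey the same equations and keep the error bounds.\<close>
  have Re_le: "\<bar>Re w - s\<bar> \<le> e" if "norm (w - of_real s) \<le> e" for w s e
    using order_trans[OF abs_Re_le_cmod that] by simp
  show ?thesis
  proof (rule that[of "\<lambda>x. Re (B x / \<beta>)" "\<lambda>x. Re (B1 x / \<beta>)" "\<lambda>x. Re (Y 0 x / \<beta>)"])
    have lin: "bounded_linear (\<lambda>w. Re (w / \<beta>))"
      by (intro bounded_linear_compose[OF bounded_linear_Re bounded_linear_divide])
    show "AC_with_deriv 0 1 (\<lambda>x. Re (B x / \<beta>)) (\<lambda>x. Re (B1 x / \<beta>))" by (rule AC_linear[OF aB lin])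
    show "AC_with_deriv 0 1 (\<lambda>x. Re (B1 x / \<beta>)) (\<lambda>x. V x * Re (Y 0 x / \<beta>) - (z\<^sup>2 + p x / 2) * Re (B x / \<beta>))"
    proof (rule AC_cong[OF AC_linear[OF aB1 lin]])
      fix x :: real
      have "(of_real (V x) * Y 0 x - (?k + P x / 2) * B x) / \<beta> = of_real (V x) * (Y 0 x / \<beta>) - of_real (z\<^sup>2 + p x / 2) * (B x / \<beta>)"
        by (simp add: diff_divide_distrib P_def)
      then show "Re ((of_real (V x) * Y 0 x - (?k + P x / 2) * B x) / \<beta>) = V x * Re (Y 0 x / \<beta>) - (z\<^sup>2 + p x / 2) * Re (B x / \<beta>)"
        by (simp only: minus_complex.sel Re_of_real_mult)
    qed simp
    show "continuous_on {0..1} (\<lambda>x. Re (Y 0 x / \<beta>))" by (rule AC_continuous[OF AC_linear[OF AC(1) lin]])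
    show "Re (B 1 / \<beta>) = 0" using bc by (simp add: B_def)
    have "B 0 / \<beta> = of_real (2 * z\<^sup>2 * aw z 0)" using kz a0 \<beta>0 unfolding \<beta>_def by (auto simp: field_simps)
    then show "Re (B 0 / \<beta>) = 2 * z\<^sup>2 * aw z 0" by (simp only: Re_complex_of_real)
    have "B1 0 / \<beta> = of_real (- (p1 0 / 2)) * (Y 0 0 / \<beta>)" using bc by (simp add: B1_def)
    then show "Re (B1 0 / \<beta>) = - (p1 0 / 2) * Re (Y 0 0 / \<beta>)" by (simp only: Re_of_real_mult)
    show "\<bar>Re (Y 0 x / \<beta>) - fw z x\<bar> \<le> 25 * c\<^sup>2 / z ^ 3" if "x \<in> {0..1}" for x
      using Re_le e1[OF that] unfolding f_def by blast
    show "\<bar>Re (B x / \<beta>) - 2 * z\<^sup>2 * fw z x\<bar> \<le> 10 * c\<^sup>2 / z" if "x \<in> {0..1}" for x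
      by (rule Re_le) (use e2[OF that] in \<open>simp add: f_def\<close>)
    show "\<bar>Re (B1 1 / \<beta>) - 2 * z\<^sup>2 * fdw z 1\<bar> \<le> 10 * c\<^sup>2"
      by (rule Re_le) (use e3 in \<open>simp add: f1_def\<close>)
    show "\<bar>fw z 1\<bar> \<le> 25 * c\<^sup>2 / z ^ 3" using e1[of 1] bc by (simp add: f_def)
  qed
qed

end
end

context quartic_bounded
begin

context
  fixes z :: real
  assumes z: "100 * c ^ 3 \<le> z"
begin

lemma error_terms: "c ^ 3 / z ^ 3 \<le> c ^ 4 / z\<^sup>2 / 100" "c ^ 4 / z ^ 3 \<le> c ^ 4 / z\<^sup>2 / 100"
  "c ^ 3 / z\<^sup>2 \<le> c ^ 4 / z\<^sup>2" "c\<^sup>2 / z\<^sup>2 \<le> c ^ 4 / z\<^sup>2"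
proof -
  note zg = z_ge[OF z]
  have pw: "c ^ 3 \<le> c ^ 4" "c\<^sup>2 \<le> c ^ 4" using c1 by (auto intro: power_increasing)
  show "c ^ 3 / z\<^sup>2 \<le> c ^ 4 / z\<^sup>2" "c\<^sup>2 / z\<^sup>2 \<le> c ^ 4 / z\<^sup>2" using pw by (auto intro: divide_right_mono)
  have "1 / z \<le> 1 / 100" using zg by simp
  then have "c ^ 4 / z\<^sup>2 * (1 / z) \<le> c ^ 4 / z\<^sup>2 * (1 / 100)" by (intro mult_left_mono) (use c1 in auto)
  then show *: "c ^ 4 / z ^ 3 \<le> c ^ 4 / z\<^sup>2 / 100" by (simp add: power2_eq_square power3_eq_cube)
  have "c ^ 3 / z ^ 3 \<le> c ^ 4 / z ^ 3" using pw zg(3) by (auto intro: divide_right_mono)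
  with * show "c ^ 3 / z ^ 3 \<le> c ^ 4 / z\<^sup>2 / 100" by linarith
qed

text \<open>The Wronskian \<open>Wr\<close> of \<open>B\<close> with the Liouville--Green function
  \<open>f\<close> has derivative \<open>(V y - Vwkb B) f\<close>, which becomes
  \<open>W cos\<^sup>2 \<theta>\<close> after inserting \<open>f\<close> for \<open>y\<close> and
  \<open>2 z\<^sup>2 f\<close> for \<open>B\<close>. At 1 it equals \<open>B1 f\<close>, about
  \<open>2 z\<^sup>2 f' f\<close>, that is \<open>- z\<^sup>3 sin (2 \<theta>)\<close>. At 0 the
  terms \<open>- p' / 2\<close> and \<open>p' / 4\<close> combine to
  \<open>- p' / 4\<close>.\<close>

lemma wkb_phase_equation:
  assumes Y: "eigsol (of_real z ^ 4) Y"
  shows "\<bar>cos (Th z 1)\<bar> \<le> 29 * c\<^sup>2 / z ^ 3"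
    and "\<bar>z ^ 3 * sin (2 * Th z 1) - p1 0 / 4 + Jint (\<lambda>x. W x * (cos (Th z x))\<^sup>2) 1\<bar> \<le> 20 * c ^ 4 / z\<^sup>2"
proof -
  note zg = z_ge[OF z]
  obtain y B B1 :: "real \<Rightarrow> real" where
    aB: "AC_with_deriv 0 1 B B1" and aB1: "AC_with_deriv 0 1 B1 (\<lambda>x. V x * y x - (z\<^sup>2 + p x / 2) * B x)" and y: "continuous_on {0..1} y"
    and B0: "B 0 = 2 * z\<^sup>2 * aw z 0" and B10: "B1 0 = - (p1 0 / 2) * y 0" and B1_0: "B 1 = 0"
    and e1: "\<And>x. x \<in> {0..1} \<Longrightarrow> \<bar>y x - fw z x\<bar> \<le> 25 * c\<^sup>2 / z ^ 3"
    and e2: "\<And>x. x \<in> {0..1} \<Longrightarrow> \<bar>B x - 2 * z\<^sup>2 * fw z x\<bar> \<le> 10 * c\<^sup>2 / z"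
    and e3: "\<bar>B1 1 - 2 * z\<^sup>2 * fdw z 1\<bar> \<le> 10 * c\<^sup>2"
    and e4: "\<bar>fw z 1\<bar> \<le> 25 * c\<^sup>2 / z ^ 3"
    by (rule eigsol_wkb[OF z Y]) blast
  define s where "s = c ^ 4 / z\<^sup>2"
  note et = error_terms[folded s_def]
  have s0: "0 \<le> s" by (simp add: s_def)
  have aw1: "7 / 8 \<le> aw z 1" using aw_bounds[OF z, of 1] by simp
  have "7 / 8 * \<bar>cos (Th z 1)\<bar> \<le> aw z 1 * \<bar>cos (Th z 1)\<bar>" using aw1 by (intro mult_right_mono) auto
  also have "\<dots> = \<bar>fw z 1\<bar>" using aw1 by (simp add: fw_def abs_mult)
  finally have "7 / 8 * \<bar>cos (Th z 1)\<bar> \<le> 25 * (c\<^sup>2 / z ^ 3)" using e4 by simp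
  moreover have "0 \<le> c\<^sup>2 / z ^ 3" using zg(3) by simp
  ultimately have "\<bar>cos (Th z 1)\<bar> \<le> 29 * (c\<^sup>2 / z ^ 3)" by linarith
  then show "\<bar>cos (Th z 1)\<bar> \<le> 29 * c\<^sup>2 / z ^ 3" by simp
  define Wr where "Wr x = B1 x * fw z x - B x * fdw z x" for x
  have aWr: "AC_with_deriv 0 1 Wr (\<lambda>x. V x * y x * fw z x - Vwkb z x * B x * fw z x)"
    unfolding Wr_def[abs_def]
    by (rule AC_cong[OF AC_diff[OF AC_mult[OF aB1 fw_AC[OF z]] AC_mult[OF aB fdw_AC[OF z]]]]) (simp_all add: algebra_simps)
  have cW: "continuous_on {0..1} (\<lambda>x. W x * (cos (Th z x))\<^sup>2)"
    by (intro continuous_on_mult continuous_on_power continuous_on_cos AC_continuous[OF W_AC] AC_continuous[OF Th_AC[OF z]])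
  define h where "h x = V x * y x * fw z x - Vwkb z x * B x * fw z x - W x * (cos (Th z x))\<^sup>2" for x
  have aD: "AC_with_deriv 0 1 (\<lambda>x. Wr x - Jint (\<lambda>x. W x * (cos (Th z x))\<^sup>2) x) h"
    unfolding h_def[abs_def] by (rule AC_diff[OF aWr Jint_AC[OF absolutely_integrable_continuous_real[OF cW]]])
  have h_bound: "norm (h x) \<le> 11 * s" if x: "x \<in> {0..1}" for x
  proof -
    note b = bounds[OF x] and f2 = fw_bound[OF z x] and vb = Vwkb_bounds[OF z x]
    have eq: "h x = V x * (y x - fw z x) * fw z x - Vwkb z x * (B x - 2 * z\<^sup>2 * fw z x) * fw z x
      + (V x - 2 * z\<^sup>2 * Vwkb z x - W x) * (fw z x)\<^sup>2 + W x * (((aw z x)\<^sup>2 - 1) * (cos (Th z x))\<^sup>2)"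
      unfolding h_def fw_def by (simp add: algebra_simps power2_eq_square)
    have "\<bar>V x * (y x - fw z x) * fw z x\<bar> \<le> c * (25 * c\<^sup>2 / z ^ 3) * 2"
      unfolding abs_mult using b e1[OF x] f2 c1 zg(3) by (intro mult_mono) auto
    also have "\<dots> = 50 * (c ^ 3 / z ^ 3)" by (simp add: power2_eq_square power3_eq_cube)
    also have "\<dots> \<le> s" using et(1) s0 by linarith
    finally have 1: "\<bar>V x * (y x - fw z x) * fw z x\<bar> \<le> s" .
    have "\<bar>Vwkb z x * (B x - 2 * z\<^sup>2 * fw z x) * fw z x\<bar> \<le> (c\<^sup>2 / z\<^sup>2) * (10 * c\<^sup>2 / z) * 2"
      unfolding abs_mult using vb(3) e2[OF x] f2 c1 zg(3) by (intro mult_mono) auto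
    also have "\<dots> = 20 * (c ^ 4 / z ^ 3)" by (simp add: power2_eq_square power3_eq_cube power4_eq_xxxx)
    also have "\<dots> \<le> s" using et(2) s0 by linarith
    finally have 2: "\<bar>Vwkb z x * (B x - 2 * z\<^sup>2 * fw z x) * fw z x\<bar> \<le> s" .
    have "(fw z x)\<^sup>2 \<le> 2\<^sup>2" using power_mono[OF f2, of 2] by simp
    then have "\<bar>(V x - 2 * z\<^sup>2 * Vwkb z x - W x) * (fw z x)\<^sup>2\<bar> \<le> (2 * c ^ 3 / z\<^sup>2) * 4"
      unfolding abs_mult using vb(1) c1 by (intro mult_mono) auto
    also have "\<dots> = 8 * (c ^ 3 / z\<^sup>2)" by simp
    also have "\<dots> \<le> 8 * s" using et(3) by linarith
    finally have 3: "\<bar>(V x - 2 * z\<^sup>2 * Vwkb z x - W x) * (fw z x)\<^sup>2\<bar> \<le> 8 * s" .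
    have "(aw z x)\<^sup>2 - 1 = uw z x * (uw z x - 2)" by (simp add: aw_def power2_eq_square algebra_simps)
    then have "\<bar>(aw z x)\<^sup>2 - 1\<bar> \<le> (c / (8 * z\<^sup>2)) * 3"
      using uw_bound[OF z x] uw_small[OF z x] c1 by (simp only: abs_mult) (intro mult_mono; auto)
    then have "\<bar>W x * (((aw z x)\<^sup>2 - 1) * (cos (Th z x))\<^sup>2)\<bar> \<le> c * (((c / (8 * z\<^sup>2)) * 3) * 1)"
      unfolding abs_mult using b c1 by (intro mult_mono) (auto simp: abs_square_le_1)
    also have "\<dots> = 3 / 8 * (c\<^sup>2 / z\<^sup>2)" by (simp add: power2_eq_square)
    also have "\<dots> \<le> s" using et(4) s0 by linarith
    finally have 4: "\<bar>W x * (((aw z x)\<^sup>2 - 1) * (cos (Th z x))\<^sup>2)\<bar> \<le> s" .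
    have tri: "\<bar>a1 - a2 + a3 + a4\<bar> \<le> 11 * s" if "\<bar>a1\<bar> \<le> s" "\<bar>a2\<bar> \<le> s" "\<bar>a3\<bar> \<le> 8 * s" "\<bar>a4\<bar> \<le> s" for a1 a2 a3 a4
      using that by linarith
    show ?thesis unfolding eq real_norm_def by (rule tri[OF 1 2 3 4])
  qed
  have Jh: "\<bar>Jint h 1\<bar> \<le> 11 * s"
    using norm_Jint_le_const[OF AC_integrable[OF aD] h_bound, of 1] by simp
  define J where "J = Jint (\<lambda>x. W x * (cos (Th z x))\<^sup>2) 1"
  have bal: "Wr 1 - J = Wr 0 + Jint h 1" using AC_eq_Jint[OF aD, of 1] by (simp add: J_def)
  have c3: "c * (c\<^sup>2 / z ^ 3) = c ^ 3 / z ^ 3" by (simp add: power2_eq_square power3_eq_cube)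
  have z0: "z \<noteq> 0" using zg(3) by simp
  have start: "\<bar>Wr 0 + p1 0 / 4\<bar> \<le> s"
  proof -
    define a where "a = aw z 0"
    have "Wr 0 + p1 0 / 4 = p1 0 * ((1 - a) * (1 + 2 * a) / 4 - (y 0 - a) * a / 2)"
      using z0 unfolding Wr_def B10 B0 wkb_at_0[OF z] a_def[symmetric] by (simp add: field_simps)
    moreover have "\<bar>(1 - a) * (1 + 2 * a) / 4 - (y 0 - a) * a / 2\<bar> \<le> c / (8 * z\<^sup>2) + 25 * c\<^sup>2 / z ^ 3"
    proof -
      have ab: "7 / 8 \<le> a" "a \<le> 9 / 8" using aw_bounds[OF z, of 0] by (auto simp: a_def)
      have "\<bar>1 - a\<bar> \<le> c / (8 * z\<^sup>2)" using uw_bound[OF z, of 0] by (simp add: a_def aw_def)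
      then have "\<bar>(1 - a) * (1 + 2 * a)\<bar> \<le> c / (8 * z\<^sup>2) * 4" unfolding abs_mult using ab c1 by (intro mult_mono) auto
      moreover have "\<bar>(y 0 - a) * a\<bar> \<le> 25 * c\<^sup>2 / z ^ 3 * 2"
        unfolding abs_mult using e1[of 0] ab zg(3) by (intro mult_mono) (auto simp: a_def wkb_at_0[OF z])
      moreover have "\<bar>m / 4 - n / 2\<bar> \<le> v + w" if "\<bar>m\<bar> \<le> v * 4" "\<bar>n\<bar> \<le> w * 2" for m n v w :: real using that by linarith
      ultimately show ?thesis by blast
    qed
    ultimately have "\<bar>Wr 0 + p1 0 / 4\<bar> \<le> c * (c / (8 * z\<^sup>2) + 25 * c\<^sup>2 / z ^ 3)"
      using bounds[of 0] c1 by (simp only: abs_mult) (intro mult_mono; auto)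
    also have "\<dots> = 1 / 8 * (c\<^sup>2 / z\<^sup>2) + 25 * (c ^ 3 / z ^ 3)" by (simp add: distrib_left power2_eq_square power3_eq_cube)
    also have "\<dots> \<le> s" using et(1,4) s0 by linarith
    finally show ?thesis .
  qed
  have "Wr 1 + z ^ 3 * sin (2 * Th z 1) = (B1 1 - 2 * z\<^sup>2 * fdw z 1) * fw z 1 - p1 1 / 4 * cos (Th z 1) * fw z 1"
  proof -
    have "aw z 1 \<noteq> 0" using aw1 by auto
    then have "2 * z\<^sup>2 * fdw z 1 * fw z 1 = - (p1 1 / 4) * cos (Th z 1) * fw z 1 - z ^ 3 * sin (2 * Th z 1)"
      using z0 unfolding fdw_def fw_def sin_double by (simp add: field_simps power2_eq_square power3_eq_cube)
    then show ?thesis unfolding Wr_def B1_0 by (simp add: algebra_simps)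
  qed
  moreover have "\<bar>(B1 1 - 2 * z\<^sup>2 * fdw z 1) * fw z 1\<bar> \<le> 5 / 2 * s"
  proof -
    have "\<bar>(B1 1 - 2 * z\<^sup>2 * fdw z 1) * fw z 1\<bar> \<le> 10 * c\<^sup>2 * (25 * c\<^sup>2 / z ^ 3)"
      unfolding abs_mult using e3 e4 by (intro mult_mono) auto
    also have "\<dots> = 250 * (c ^ 4 / z ^ 3)" by (simp add: power2_eq_square power4_eq_xxxx)
    finally show ?thesis using et(2) by linarith
  qed
  moreover have "\<bar>p1 1 / 4 * cos (Th z 1) * fw z 1\<bar> \<le> s"
  proof -
    have "\<bar>p1 1 / 4 * cos (Th z 1) * fw z 1\<bar> \<le> c / 4 * 1 * (25 * c\<^sup>2 / z ^ 3)"
      unfolding abs_mult using e4 bounds[of 1] c1 by (intro mult_mono) auto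
    also have "\<dots> = 25 / 4 * (c ^ 3 / z ^ 3)" by (simp add: power2_eq_square power3_eq_cube)
    finally show ?thesis using et(1) s0 by linarith
  qed
  ultimately have "\<bar>Wr 1 + z ^ 3 * sin (2 * Th z 1)\<bar> \<le> 7 / 2 * s" by linarith
  moreover have "\<bar>t - p' + J\<bar> \<le> 20 * s" if "\<bar>Wr 1 + t\<bar> \<le> 7 / 2 * s" "\<bar>Wr 0 + p'\<bar> \<le> s" for t p'
    using that bal Jh s0 by linarith
  ultimately have "\<bar>z ^ 3 * sin (2 * Th z 1) - p1 0 / 4 + J\<bar> \<le> 20 * s" using start by blast
  then show "\<bar>z ^ 3 * sin (2 * Th z 1) - p1 0 / 4 + Jint (\<lambda>x. W x * (cos (Th z x))\<^sup>2) 1\<bar> \<le> 20 * c ^ 4 / z\<^sup>2"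
    by (simp add: J_def s_def)
qed

end
end

section \<open>Inverting the phase relation\<close>

lemma abs_mult_le: "\<bar>a\<bar> \<le> A \<Longrightarrow> \<bar>b\<bar> \<le> B \<Longrightarrow> \<bar>a * b :: real\<bar> \<le> A * B"
  unfolding abs_mult by (intro mult_mono) auto

lemma abs_power_le: "\<bar>a\<bar> \<le> A \<Longrightarrow> \<bar>a ^ n :: real\<bar> \<le> A ^ n"
  unfolding power_abs by (intro power_mono) auto

text \<open>Here \<open>v + d\<close> is the phase, \<open>v\<close> the free value and
  \<open>d\<close> the defect. The phase relation gives
  \<open>z ^ 4 = T ^ 4 - 4 s T\<^sup>2 + 2 s\<^sup>2 - 4 t\<close> for \<open>T = v + d\<close>,
  then \<open>T ^ 4 - 4 s T\<^sup>2\<close> differs from \<open>v ^ 4 - 4 s v\<^sup>2\<close> by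
  \<open>4 z\<^sup>3 d\<close>, and the last quantity is \<open>S\<close>, each up to
  \<open>O(z\<^sup>-\<^sup>2)\<close>.\<close>

lemma fourth_power_expansion:
  fixes z v d s t S C :: real
  assumes C: "1 \<le> C" and z: "1 \<le> z" and v: "\<bar>z * (v - z)\<bar> \<le> C" and d: "\<bar>z ^ 3 * d\<bar> \<le> C"
    and T: "\<bar>z ^ 5 * (v + d - (z + s / z + t / z ^ 3))\<bar> \<le> C" and s: "\<bar>s\<bar> \<le> C" and t: "\<bar>t\<bar> \<le> C"
    and S: "\<bar>z\<^sup>2 * (2 * z ^ 3 * d - S / 2)\<bar> \<le> C"
  shows "\<bar>z ^ 4 - (v ^ 4 + S - 4 * s * v\<^sup>2 + 2 * s\<^sup>2 - 4 * t)\<bar> \<le> 400 * C ^ 4 / z\<^sup>2"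
proof -
  have z0: "z \<noteq> 0" using z by simp
  \<comment> \<open>The small parameter. Subject to the relation \<open>r * z\<^sup>2 = 1\<close>,
    and with all quantities rescaled to be bounded by \<open>C\<close>, the expansions are
    polynomial identities whose remainders are explicit multiples of \<open>r\<close>.\<close>
  define r where "r = 1 / z\<^sup>2"
  have "1 \<le> z\<^sup>2" using z by (simp add: one_le_power)
  then have "1 / z\<^sup>2 \<le> 1 / 1" by (intro divide_left_mono) auto
  then have r: "0 \<le> r" "r \<le> 1" "\<bar>r\<bar> \<le> 1" unfolding r_def by simp_all
  have rz: "r * z\<^sup>2 = 1" using z0 by (simp add: r_def)
  have pw: "C \<le> C ^ 4" "C\<^sup>2 \<le> C ^ 4" "C ^ 3 \<le> C ^ 4" using C power_increasing[of 1 4 C] by (auto intro: power_increasing)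
  define \<eta> D e G where "\<eta> = z * (v - z)" and "D = z ^ 3 * d" and "e = z ^ 5 * (v + d - (z + s / z + t / z ^ 3))"
    and "G = z\<^sup>2 * (2 * z ^ 3 * d - S / 2)"
  note b = v[folded \<eta>_def] d[folded D_def] T[folded e_def] s t S[folded G_def]
  define x where "x = s + t * r + e * r\<^sup>2"
  have r2: "\<bar>r\<^sup>2\<bar> \<le> 1" using abs_power_le[OF r(3), of 2] by simp
  have tr: "\<bar>t * r\<bar> \<le> C" "\<bar>e * r\<bar> \<le> C" "\<bar>e * r\<^sup>2\<bar> \<le> C" "\<bar>\<eta> * r\<bar> \<le> C"
    using abs_mult_le[OF b(5) r(3)] abs_mult_le[OF b(3) r(3)] abs_mult_le[OF b(3) r2] abs_mult_le[OF b(1) r(3)] by simp_all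
  have x: "\<bar>x\<bar> \<le> 3 * C" unfolding x_def using b(4) tr(1,3) by linarith
  have Tx: "v + d = z + x * (r * z)"
  proof -
    have "z ^ 5 * (v + d) = z ^ 5 * (z + x * (r * z))"
      unfolding x_def r_def e_def using z0 by (simp add: field_simps eval_nat_numeral)
    then show ?thesis using z0 by simp
  qed
  have T2: "(v + d)\<^sup>2 = z\<^sup>2 + 2 * x + x\<^sup>2 * r" unfolding Tx using rz by algebra
  have xz: "x * z\<^sup>2 = s * z\<^sup>2 + t + e * r" unfolding x_def using rz by algebra
  define A where "A = 4 * e + 2 * ((t + e * r) * (3 * x - s)) + 4 * x ^ 3 + x ^ 4 * r - 4 * (s * x\<^sup>2)"
  have A: "(v + d) ^ 4 - 4 * s * (v + d)\<^sup>2 + 2 * s\<^sup>2 - 4 * t - z ^ 4 = r * A"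
  proof -
    have "(v + d) ^ 4 = (z\<^sup>2 + 2 * x + x\<^sup>2 * r)\<^sup>2" unfolding T2[symmetric] by simp
    moreover have "(z\<^sup>2 + 2 * x + x\<^sup>2 * r)\<^sup>2 = z ^ 4 + 4 * (s * z\<^sup>2 + t + e * r) + 4 * x\<^sup>2 + 2 * x\<^sup>2 + 4 * x ^ 3 * r + x ^ 4 * r\<^sup>2"
      using rz xz by algebra
    moreover have "x = s + r * (t + e * r)" by (simp add: x_def algebra_simps power2_eq_square)
    ultimately show ?thesis unfolding A_def T2 by algebra
  qed
  have "\<bar>(t + e * r) * (3 * x - s)\<bar> \<le> (2 * C) * (10 * C)"
  proof (rule abs_mult_le)
    show "\<bar>t + e * r\<bar> \<le> 2 * C" using b(5) tr(2) by linarith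
    show "\<bar>3 * x - s\<bar> \<le> 10 * C" using x b(4) C by linarith
  qed
  moreover have "\<bar>x ^ 3\<bar> \<le> 27 * C ^ 3" "\<bar>x\<^sup>2\<bar> \<le> 9 * C\<^sup>2" "\<bar>x ^ 4\<bar> \<le> 81 * C ^ 4"
    using abs_power_le[OF x, of 3] abs_power_le[OF x, of 2] abs_power_le[OF x, of 4] by (simp_all add: power_mult_distrib)
  moreover from this have "\<bar>x ^ 4 * r\<bar> \<le> 81 * C ^ 4" "\<bar>s * x\<^sup>2\<bar> \<le> 9 * C ^ 3"
    using abs_mult_le[OF _ r(3), of "x ^ 4" "81 * C ^ 4"] abs_mult_le[OF b(4), of "x\<^sup>2" "9 * C\<^sup>2"] by (simp_all add: power3_eq_cube power2_eq_square)
  moreover have "\<bar>4 * e + 2 * m1 + 4 * m2 + m3 - 4 * m4\<bar> \<le> 300 * C ^ 4"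
    if "\<bar>m1\<bar> \<le> 20 * C\<^sup>2" "\<bar>m2\<bar> \<le> 27 * C ^ 3" "\<bar>m3\<bar> \<le> 81 * C ^ 4" "\<bar>m4\<bar> \<le> 9 * C ^ 3" for m1 m2 m3 m4
    using that b(3) pw by linarith
  ultimately have Ab: "\<bar>A\<bar> \<le> 300 * C ^ 4" unfolding A_def by (simp add: power2_eq_square)
  define q where "q = 1 + \<eta> * r"
  have vq: "v = z * q" and dD: "d = D * r\<^sup>2 * z"
    using z0 unfolding q_def \<eta>_def D_def r_def by (simp_all add: field_simps eval_nat_numeral)
  define B where "B = 4 * (D * (3 * \<eta> + 3 * (\<eta>\<^sup>2 * r) + \<eta> ^ 3 * r\<^sup>2)) + 6 * (D\<^sup>2 * (q\<^sup>2 * r)) + 4 * (D ^ 3 * (q * r ^ 3)) + D ^ 4 * r ^ 5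
    - 4 * (s * (2 * (D * q) + D\<^sup>2 * r\<^sup>2))"
  have B: "(v + d) ^ 4 - 4 * s * (v + d)\<^sup>2 = v ^ 4 - 4 * s * v\<^sup>2 + 4 * (z ^ 3 * d) + r * B"
  proof -
    have 1: "4 * (v ^ 3 - z ^ 3) * d = r * (4 * (D * (3 * \<eta> + 3 * (\<eta>\<^sup>2 * r) + \<eta> ^ 3 * r\<^sup>2)))"
      unfolding vq dD q_def using rz by algebra
    have 2: "6 * v\<^sup>2 * d\<^sup>2 = r * (6 * (D\<^sup>2 * (q\<^sup>2 * r)))" unfolding vq dD using rz by algebra
    have 3: "4 * v * d ^ 3 = r * (4 * (D ^ 3 * (q * r ^ 3)))" unfolding vq dD using rz by algebra
    have 4: "d ^ 4 = r * (D ^ 4 * r ^ 5)" unfolding dD using rz by algebra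
    have 5: "4 * s * (2 * v * d + d\<^sup>2) = r * (4 * (s * (2 * (D * q) + D\<^sup>2 * r\<^sup>2)))" unfolding vq dD using rz by algebra
    have "(v + d) ^ 4 - 4 * s * (v + d)\<^sup>2 = v ^ 4 - 4 * s * v\<^sup>2 + 4 * (z ^ 3 * d) + 4 * (v ^ 3 - z ^ 3) * d + 6 * v\<^sup>2 * d\<^sup>2 + 4 * v * d ^ 3 + d ^ 4
      - 4 * s * (2 * v * d + d\<^sup>2)" by algebra
    then show ?thesis unfolding 1 2 3 4 5 B_def by algebra
  qed
  have q: "\<bar>q\<bar> \<le> 2 * C" using tr(4) C unfolding q_def by linarith
  have rn: "\<bar>r ^ n\<bar> \<le> 1" for n using abs_power_le[OF r(3), of n] by simp
  have Dn: "\<bar>D ^ n\<bar> \<le> C ^ n" and \<eta>n: "\<bar>\<eta> ^ n\<bar> \<le> C ^ n" for n using abs_power_le b by blast+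
  have "\<bar>\<eta>\<^sup>2 * r\<bar> \<le> C\<^sup>2" "\<bar>\<eta> ^ 3 * r\<^sup>2\<bar> \<le> C ^ 3" using abs_mult_le[OF \<eta>n r(3), of 2] abs_mult_le[OF \<eta>n rn, of 3 2] by simp_all
  moreover have "C \<le> C ^ 3" "C\<^sup>2 \<le> C ^ 3" using C power_increasing[of 1 3 C] by (auto intro: power_increasing)
  ultimately have "\<bar>3 * \<eta> + 3 * (\<eta>\<^sup>2 * r) + \<eta> ^ 3 * r\<^sup>2\<bar> \<le> 7 * C ^ 3" using b(1) by linarith
  from abs_mult_le[OF b(2) this] have b1: "\<bar>D * (3 * \<eta> + 3 * (\<eta>\<^sup>2 * r) + \<eta> ^ 3 * r\<^sup>2)\<bar> \<le> 7 * C ^ 4"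
    by (simp add: power3_eq_cube power4_eq_xxxx)
  have b2: "\<bar>D\<^sup>2 * (q\<^sup>2 * r)\<bar> \<le> 4 * C ^ 4"
    using abs_mult_le[OF Dn[of 2] abs_mult_le[OF abs_power_le[OF q, of 2] r(3)]] by (simp add: power2_eq_square power4_eq_xxxx)
  have b3: "\<bar>D ^ 3 * (q * r ^ 3)\<bar> \<le> 2 * C ^ 4"
    using abs_mult_le[OF Dn[of 3] abs_mult_le[OF q rn[of 3]]] by (simp add: power3_eq_cube power4_eq_xxxx)
  have b4: "\<bar>D ^ 4 * r ^ 5\<bar> \<le> C ^ 4" using abs_mult_le[OF Dn[of 4] rn[of 5]] by simp
  have "\<bar>D * q\<bar> \<le> C * (2 * C)" "\<bar>D\<^sup>2 * r\<^sup>2\<bar> \<le> C\<^sup>2 * 1" by (rule abs_mult_le[OF b(2) q] abs_mult_le[OF Dn[of 2] rn[of 2]])+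
  moreover have "C * (2 * C) = 2 * C\<^sup>2" by (simp add: power2_eq_square)
  ultimately have "\<bar>2 * (D * q) + D\<^sup>2 * r\<^sup>2\<bar> \<le> 5 * C\<^sup>2" using zero_le_power2[of C] by linarith
  from abs_mult_le[OF b(4) this] have b5: "\<bar>s * (2 * (D * q) + D\<^sup>2 * r\<^sup>2)\<bar> \<le> 5 * C ^ 3" by (simp add: power3_eq_cube power2_eq_square)
  have "\<bar>B\<bar> \<le> 98 * C ^ 4" unfolding B_def using b1 b2 b3 b4 b5 pw by linarith
  moreover have "z ^ 4 - (v ^ 4 + S - 4 * s * v\<^sup>2 + 2 * s\<^sup>2 - 4 * t) = r * (B - A + 2 * G)"
  proof -
    have "r * (2 * G) = 4 * (z ^ 3 * d) - S" unfolding G_def using z0 by (simp add: r_def)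
    with A B show ?thesis by algebra
  qed
  moreover have "\<bar>B - A + 2 * G\<bar> \<le> 400 * C ^ 4" if "\<bar>B\<bar> \<le> 98 * C ^ 4" using that Ab b(6) pw by linarith
  ultimately show ?thesis using abs_mult_le[OF _ r(3)] r by (simp add: abs_mult r_def divide_right_mono)
qed

lemma Jint_linear3:
  fixes f g h :: "real \<Rightarrow> real"
  assumes "f absolutely_integrable_on {0..1}" "g absolutely_integrable_on {0..1}" "h absolutely_integrable_on {0..1}"
  shows "Jint (\<lambda>x. f x + a * g x + b * h x) 1 = Jint f 1 + a * Jint g 1 + b * Jint h 1"
  using AC_eq_Jint[OF AC_add[OF AC_add[OF Jint_AC[OF assms(1)] AC_cmult[OF Jint_AC[OF assms(2)], of a]] AC_cmult[OF Jint_AC[OF assms(3)], of b]], of 1]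
  by simp

section \<open>Fourier coefficients at the free frequencies\<close>

lemma AC_linear_phase:
  fixes v :: real
  shows "AC_with_deriv 0 1 (\<lambda>x. cos (v * x)) (\<lambda>x. - sin (v * x) * v)" "AC_with_deriv 0 1 (\<lambda>x. sin (v * x)) (\<lambda>x. cos (v * x) * v)"
    "AC_with_deriv 0 1 (\<lambda>x. v * x) (\<lambda>x. v)"
proof -
  show v: "AC_with_deriv 0 1 (\<lambda>x. v * x) (\<lambda>x. v)"
  proof (rule AC_of_has_derivative)
    show "((\<lambda>x. v * x) has_vector_derivative v) (at x within {0..1})" for x
      unfolding has_real_derivative_iff_has_vector_derivative[symmetric] by (auto intro!: derivative_eq_intros)
  qed (rule continuous_on_const)
  show "AC_with_deriv 0 1 (\<lambda>x. cos (v * x)) (\<lambda>x. - sin (v * x) * v)" "AC_with_deriv 0 1 (\<lambda>x. sin (v * x)) (\<lambda>x. cos (v * x) * v)"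
    by (rule AC_cos_sin[OF v continuous_on_const])+
qed

lemma double_nu: "sin (2 * nu n) = 0" "cos (2 * nu n) = - 1"
  by (simp_all add: sin_double cos_double cos_nu sin_nu_sq)

text \<open>The frequency \<open>2 * nu n\<close> is an odd multiple of \<open>pi\<close>, so the
  cosine has opposite signs at the two ends and the boundary values of \<open>f\<close> add up,
  while those with the sine vanish.\<close>

lemma integration_by_parts_nu:
  assumes f: "AC_with_deriv 0 1 f f1"
  shows "Jint (\<lambda>x. f1 x * cos (2 * nu n * x)) 1 = - f 1 - f 0 + 2 * nu n * Jint (\<lambda>x. f x * sin (2 * nu n * x)) 1"
    and "Jint (\<lambda>x. f1 x * sin (2 * nu n * x)) 1 = - (2 * nu n * Jint (\<lambda>x. f x * cos (2 * nu n * x)) 1)"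
proof -
  note L = AC_linear_phase[of "2 * nu n"]
  have i: "(\<lambda>x. f x * sin (2 * nu n * x)) absolutely_integrable_on {0..1}" "(\<lambda>x. f x * cos (2 * nu n * x)) absolutely_integrable_on {0..1}"
    by (intro absolutely_integrable_continuous_real continuous_on_mult AC_continuous[OF f] AC_continuous[OF L(1)] AC_continuous[OF L(2)])+
  have "AC_with_deriv 0 1 (\<lambda>x. f x * cos (2 * nu n * x) + 2 * nu n * Jint (\<lambda>x. f x * sin (2 * nu n * x)) x) (\<lambda>x. f1 x * cos (2 * nu n * x))"
    by (rule AC_cong[OF AC_add[OF AC_mult[OF f L(1)] AC_cmult[OF Jint_AC[OF i(1)], of "2 * nu n"]]]) (auto simp: algebra_simps)
  from AC_eq_Jint[OF this, of 1] show "Jint (\<lambda>x. f1 x * cos (2 * nu n * x)) 1 = - f 1 - f 0 + 2 * nu n * Jint (\<lambda>x. f x * sin (2 * nu n * x)) 1"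
    by (simp add: double_nu)
  have "AC_with_deriv 0 1 (\<lambda>x. f x * sin (2 * nu n * x) + (- (2 * nu n)) * Jint (\<lambda>x. f x * cos (2 * nu n * x)) x) (\<lambda>x. f1 x * sin (2 * nu n * x))"
    by (rule AC_cong[OF AC_add[OF AC_mult[OF f L(2)] AC_cmult[OF Jint_AC[OF i(2)], of "- (2 * nu n)"]]]) (auto simp: algebra_simps)
  from AC_eq_Jint[OF this, of 1] show "Jint (\<lambda>x. f1 x * sin (2 * nu n * x)) 1 = - (2 * nu n * Jint (\<lambda>x. f x * cos (2 * nu n * x)) 1)"
    by (simp add: double_nu)
qed

lemma norm_sq_Jint: "norm_sq f = Jint (\<lambda>x. (f x)\<^sup>2) 1"
  by (simp add: norm_sq_def Jint_def)

context quartic_bounded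
begin

lemma c_powers: "c \<le> c ^ 4" "c\<^sup>2 \<le> c ^ 4" "c ^ 3 \<le> c ^ 4" "1 \<le> c ^ 4"
  using c1 power_increasing[of 1 4 c] by (auto intro: power_increasing one_le_power)

lemma pp_int: "(\<lambda>x. (p x)\<^sup>2) absolutely_integrable_on {0..1}" and p2_int: "p2 absolutely_integrable_on {0..1}"
  by (intro absolutely_integrable_continuous_real continuous_on_power AC_continuous[OF p_AC] AC_continuous[OF p2_AC])+

lemma means_bound: "\<bar>fourier0 p\<bar> \<le> c" "\<bar>norm_sq p\<bar> \<le> c\<^sup>2"
proof -
  show "\<bar>fourier0 p\<bar> \<le> c"
    using norm_Jint_le_const[OF p_int, of c 1] bounds by (simp add: fourier0_Jint)
  have "norm ((p x)\<^sup>2) \<le> c\<^sup>2" if "x \<in> {0..1}" for x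
    using abs_power_le[of "p x" c 2] bounds[OF that] by simp
  from norm_Jint_le_const[OF pp_int this, of 1] show "\<bar>norm_sq p\<bar> \<le> c\<^sup>2"
    by (simp add: norm_sq_Jint)
qed

lemma mean_W: "Jint W 1 = fourier0 q + norm_sq p / 16"
proof -
  have "Jint W 1 = Jint (\<lambda>x. q x + (- (1 / 4)) * p2 x + (1 / 16) * (p x)\<^sup>2) 1"
    by (rule arg_cong[where f = "\<lambda>F. Jint F 1"]) (auto simp: W_def)
  also have "\<dots> = fourier0 q - Jint p2 1 / 4 + norm_sq p / 16"
    unfolding Jint_linear3[OF q_int p2_int pp_int] fourier0_Jint norm_sq_Jint by simp
  also have "Jint p2 1 = 0" using AC_eq_Jint[OF p1_AC, of 1] p1_per by simp
  finally show ?thesis by simp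
qed

text \<open>Two integrations by parts turn the part \<open>- p'' / 4\<close> of \<open>W\<close>
  into \<open>(nu n)\<^sup>2\<close> times the coefficient of \<open>p\<close>, plus the boundary
  term \<open>(p'(0) + p'(1)) / 4 = p'(0) / 2\<close>. The same operation on
  \<open>p\<^sup>2\<close> shows that its coefficient is
  \<open>O((nu n)\<^sup>-\<^sup>2)\<close>.\<close>

lemma fourier_W:
  "\<bar>Jint (\<lambda>x. W x * cos (2 * nu n * x)) 1 - (fourier_c q n + p1 0 / 2 + (nu n)\<^sup>2 * fourier_c p n)\<bar> \<le> c\<^sup>2 / (8 * (nu n)\<^sup>2)"
proof -
  define v where "v = nu n"
  have v0: "0 < v" unfolding v_def by (rule nu_pos)
  note parts = integration_by_parts_nu[where n = n, folded v_def]
  have cc: "continuous_on {0..1} (\<lambda>x. cos (2 * v * x))" by (rule AC_continuous[OF AC_linear_phase(1)])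
  define I where "I f = Jint (\<lambda>x. f x * cos (2 * v * x)) 1" for f
  have int: "(\<lambda>x. f x * cos (2 * v * x)) absolutely_integrable_on {0..1}" if "f absolutely_integrable_on {0..1}" for f
    using absolutely_integrable_mult_continuous[OF that cc] .
  have "I p2 = - p1 1 - p1 0 + 2 * v * (- (2 * v * I p))" unfolding I_def parts(1)[OF p1_AC] parts(2)[OF p_AC] ..
  then have I2: "I p2 = - 2 * p1 0 - 4 * v\<^sup>2 * I p" using p1_per by (simp add: power2_eq_square)
  have pp: "AC_with_deriv 0 1 (\<lambda>x. p x * p x) (\<lambda>x. 2 * (p x * p1 x))"
    by (rule AC_cong[OF AC_mult[OF p_AC p_AC]]) simp_all
  have pp1: "AC_with_deriv 0 1 (\<lambda>x. 2 * (p x * p1 x)) (\<lambda>x. 2 * (p1 x * p1 x + p x * p2 x))"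
    by (intro AC_cmult AC_mult p_AC p1_AC)
  have Ipp: "I (\<lambda>x. 2 * (p1 x * p1 x + p x * p2 x)) = - (2 * (p 1 * p1 1)) - 2 * (p 0 * p1 0) + 2 * v * (- (2 * v * I (\<lambda>x. p x * p x)))"
    unfolding I_def parts(1)[OF pp1] parts(2)[OF pp] ..
  have prod: "\<bar>a * b\<bar> \<le> c\<^sup>2" if "\<bar>a\<bar> \<le> c" "\<bar>b\<bar> \<le> c" for a b
    using abs_mult_le[OF that] by (simp add: power2_eq_square)
  have "\<bar>I (\<lambda>x. 2 * (p1 x * p1 x + p x * p2 x))\<bar> \<le> 4 * c\<^sup>2"
    unfolding I_def real_norm_def[symmetric]
  proof (rule norm_Jint_le_const[OF int[OF AC_integrable[OF pp1]]])
    fix x :: real assume x: "x \<in> {0..1}"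
    have "\<bar>p1 x * p1 x\<bar> \<le> c\<^sup>2" "\<bar>p x * p2 x\<bar> \<le> c\<^sup>2" using prod bounds[OF x] by blast+
    moreover have "\<bar>2 * (a + b)\<bar> \<le> 4 * k" if "\<bar>a\<bar> \<le> k" "\<bar>b\<bar> \<le> k" for a b k :: real
    proof -
      have "\<bar>a + b\<bar> \<le> 2 * k" using that by linarith
      from abs_mult_le[OF _ this, of 2 2] show ?thesis by simp
    qed
    ultimately have "\<bar>2 * (p1 x * p1 x + p x * p2 x)\<bar> \<le> 4 * c\<^sup>2" by blast
    from abs_mult_le[OF this abs_cos_le_one[of "2 * v * x"]]
    show "norm (2 * (p1 x * p1 x + p x * p2 x) * cos (2 * v * x)) \<le> 4 * c\<^sup>2" by simp
  qed simp
  moreover have "\<bar>p 1 * p1 1\<bar> \<le> c\<^sup>2" "\<bar>p 0 * p1 0\<bar> \<le> c\<^sup>2" using prod bounds[of 1] bounds[of 0] by simp_all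
  moreover have "2 * v * (- (2 * v * I (\<lambda>x. p x * p x))) = - (4 * v\<^sup>2 * I (\<lambda>x. p x * p x))" by (simp add: power2_eq_square)
  moreover note Ipp
  moreover have "\<bar>Y\<bar> \<le> 8 * k" if "\<bar>a\<bar> \<le> 4 * k" "\<bar>m\<bar> \<le> k" "\<bar>m'\<bar> \<le> k" "X = - Y" "a = - (2 * m) - 2 * m' + X" for a m m' k X Y :: real
    using that by linarith
  ultimately have "\<bar>4 * v\<^sup>2 * I (\<lambda>x. p x * p x)\<bar> \<le> 8 * c\<^sup>2" by blast
  then have "4 * v\<^sup>2 * \<bar>I (\<lambda>x. p x * p x)\<bar> \<le> 8 * c\<^sup>2" by (simp add: abs_mult)
  then have Ib: "\<bar>I (\<lambda>x. p x * p x)\<bar> / 16 \<le> c\<^sup>2 / (8 * v\<^sup>2)" using v0 by (simp add: field_simps)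
  have "I W = Jint (\<lambda>x. q x * cos (2 * v * x) + (- (1 / 4)) * (p2 x * cos (2 * v * x)) + (1 / 16) * (p x * p x * cos (2 * v * x))) 1"
    unfolding I_def by (rule arg_cong[where f = "\<lambda>F. Jint F 1"]) (auto simp: W_def algebra_simps power2_eq_square)
  also have "\<dots> = I q + (- (1 / 4)) * I p2 + (1 / 16) * I (\<lambda>x. p x * p x)"
    unfolding I_def by (rule Jint_linear3; intro int q_int p2_int; use pp_int in \<open>simp add: power2_eq_square\<close>)
  also have "\<dots> = I q + p1 0 / 2 + v\<^sup>2 * I p + I (\<lambda>x. p x * p x) / 16" unfolding I2 by (simp add: field_simps)
  finally have "I W - (I q + p1 0 / 2 + v\<^sup>2 * I p) = I (\<lambda>x. p x * p x) / 16" by simp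
  then show ?thesis using Ib by (simp add: I_def fourier_c_Jint v_def)
qed

context
  fixes z :: real
  assumes z: "100 * c ^ 3 \<le> z"
begin

lemma Th_close:
  assumes x: "x \<in> {0..1}"
  shows "\<bar>z / (aw z x)\<^sup>2 - z\<bar> \<le> c / z" "\<bar>Th z x - z * x\<bar> \<le> c / z"
proof -
  note zg = z_ge[OF z]
  have der: "\<bar>z / (aw z x)\<^sup>2 - z\<bar> \<le> c / z" if x: "x \<in> {0..1}" for x
  proof -
    have "\<bar>1 / (aw z x)\<^sup>2 - 1\<bar> \<le> 3 * (c / (8 * z\<^sup>2))"
      using inverse_power_expansions(3)[OF uw_small[OF z x]] uw_bound[OF z x] unfolding aw_def by linarith
    then have "z * \<bar>1 / (aw z x)\<^sup>2 - 1\<bar> \<le> z * (3 * (c / (8 * z\<^sup>2)))" using zg(3) by (intro mult_left_mono) auto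
    also have "\<dots> = 3 / 8 * (c / z)" using zg(3) by (simp add: power2_eq_square)
    also have "\<dots> \<le> 1 * (c / z)" using zg(3) c1 by (intro mult_right_mono) auto
    also have "z * \<bar>1 / (aw z x)\<^sup>2 - 1\<bar> = \<bar>z * (1 / (aw z x)\<^sup>2 - 1)\<bar>" using zg(3) by (simp add: abs_mult)
    finally show ?thesis by (simp add: right_diff_distrib)
  qed
  from der[OF x] show "\<bar>z / (aw z x)\<^sup>2 - z\<bar> \<le> c / z" .
  have A: "AC_with_deriv 0 1 (\<lambda>x. Th z x - z * x) (\<lambda>x. z / (aw z x)\<^sup>2 - z)"
    by (rule AC_diff[OF Th_AC[OF z] AC_linear_phase(3)])
  have "\<bar>Jint (\<lambda>x. z / (aw z x)\<^sup>2 - z) x\<bar> \<le> c / z"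
    using norm_Jint_le_const[OF AC_integrable[OF A] _ x, of "c / z"] der by simp
  then show "\<bar>Th z x - z * x\<bar> \<le> c / z" using AC_eq_Jint[OF A x] by (simp add: wkb_at_0[OF z])
qed

text \<open>The phase derivative is \<open>z / (1 - u)\<^sup>2 = z (1 + 2 u + 3 u\<^sup>2 +
  O(u\<^sup>3))\<close> with \<open>u = p / (8 z\<^sup>2)\<close>; its second and third terms are
  \<open>p / (4 z)\<close> and \<open>3 p\<^sup>2 / (64 z\<^sup>3)\<close>.\<close>

lemma Th_end: "\<bar>z ^ 5 * (Th z 1 - (z + (fourier0 p / 4) / z + (3 * norm_sq p / 64) / z ^ 3))\<bar> \<le> c ^ 3"
proof -
  note zg = z_ge[OF z]
  have A: "AC_with_deriv 0 1 (\<lambda>x. Th z x - (z * x + 1 / (4 * z) * Jint p x + 3 / (64 * z ^ 3) * Jint (\<lambda>x. (p x)\<^sup>2) x))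
      (\<lambda>x. z / (aw z x)\<^sup>2 - (z + 1 / (4 * z) * p x + 3 / (64 * z ^ 3) * (p x)\<^sup>2))"
    by (intro AC_diff Th_AC[OF z] AC_add AC_linear_phase(3) AC_cmult Jint_AC p_int pp_int)
  have "\<bar>Jint (\<lambda>x. z / (aw z x)\<^sup>2 - (z + 1 / (4 * z) * p x + 3 / (64 * z ^ 3) * (p x)\<^sup>2)) 1\<bar> \<le> c ^ 3 / z ^ 5"
    unfolding real_norm_def[symmetric]
  proof (rule norm_Jint_le_const[OF AC_integrable[OF A]])
    fix x :: real assume x: "x \<in> {0..1}"
    define u where "u = uw z x"
    have "p x = 8 * z\<^sup>2 * u" using zg(3) by (simp add: u_def uw_def)
    then have "1 / (4 * z) * p x = z * (2 * u)" "3 / (64 * z ^ 3) * (p x)\<^sup>2 = z * (3 * u\<^sup>2)"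
      using zg(3) by (simp_all add: power2_eq_square power3_eq_cube)
    then have eq: "z / (aw z x)\<^sup>2 - (z + 1 / (4 * z) * p x + 3 / (64 * z ^ 3) * (p x)\<^sup>2) = z * (1 / (1 - u)\<^sup>2 - 1 - 2 * u - 3 * u\<^sup>2)"
      by (simp add: aw_def u_def right_diff_distrib)
    have "\<bar>1 / (1 - u)\<^sup>2 - 1 - 2 * u - 3 * u\<^sup>2\<bar> \<le> 8 * \<bar>u\<bar> ^ 3"
      unfolding u_def by (rule inverse_power_expansions(2)[OF uw_small[OF z x]])
    also have "\<dots> \<le> 8 * (c / (8 * z\<^sup>2)) ^ 3"
      using uw_bound[OF z x] unfolding u_def by (intro mult_left_mono power_mono) auto
    finally have "z * \<bar>1 / (1 - u)\<^sup>2 - 1 - 2 * u - 3 * u\<^sup>2\<bar> \<le> z * (8 * (c / (8 * z\<^sup>2)) ^ 3)"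
      using zg(3) by (intro mult_left_mono) auto
    also have "\<dots> = 1 / 64 * (c ^ 3 / z ^ 5)" using zg(3) by (simp add: power_divide power_mult_distrib eval_nat_numeral)
    also have "\<dots> \<le> 1 * (c ^ 3 / z ^ 5)" using zg(3) c1 by (intro mult_right_mono) auto
    finally show "norm (z / (aw z x)\<^sup>2 - (z + 1 / (4 * z) * p x + 3 / (64 * z ^ 3) * (p x)\<^sup>2)) \<le> c ^ 3 / z ^ 5"
      unfolding eq real_norm_def abs_mult using zg(3) by simp
  qed simp
  moreover have "Jint (\<lambda>x. z / (aw z x)\<^sup>2 - (z + 1 / (4 * z) * p x + 3 / (64 * z ^ 3) * (p x)\<^sup>2)) 1
    = Th z 1 - (z + (fourier0 p / 4) / z + (3 * norm_sq p / 64) / z ^ 3)"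
    using AC_eq_Jint[OF A, of 1] by (simp add: wkb_at_0[OF z] fourier0_Jint norm_sq_Jint)
  ultimately have "\<bar>Th z 1 - (z + (fourier0 p / 4) / z + (3 * norm_sq p / 64) / z ^ 3)\<bar> \<le> c ^ 3 / z ^ 5" by (simp only:)
  then have "z ^ 5 * \<bar>Th z 1 - (z + (fourier0 p / 4) / z + (3 * norm_sq p / 64) / z ^ 3)\<bar> \<le> z ^ 5 * (c ^ 3 / z ^ 5)"
    using zg(3) by (intro mult_left_mono) auto
  moreover have "z ^ 5 * (c ^ 3 / z ^ 5) = c ^ 3" using zg(3) by simp
  moreover have "\<bar>z ^ 5\<bar> = z ^ 5" using zg(3) by simp
  ultimately show ?thesis by (simp only: abs_mult)
qed

context
  fixes Y n
  assumes Y: "eigsol (of_real z ^ 4) Y" and near: "\<bar>z - nu n\<bar> < pi / 4"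
begin

text \<open>At 1 the cosine of the phase is, up to sign, the sine of the defect \<open>d\<close>.
  The location of \<open>z\<close> keeps \<open>d\<close> within \<open>pi / 2\<close> of 0, so
  smallness of the sine gives smallness of \<open>d\<close>, with 90 rounding up
  \<open>3 * 29\<close>. The second bound adds the distance between phase and
  \<open>z\<close>.\<close>

lemma phase_defect: "\<bar>Th z 1 - nu n\<bar> \<le> 90 * c\<^sup>2 / z ^ 3" "\<bar>z - nu n\<bar> \<le> 2 * c / z"
proof -
  note zg = z_ge[OF z]
  define d where "d = Th z 1 - nu n"
  have T: "\<bar>Th z 1 - z\<bar> \<le> c / z" using Th_close(2)[of 1] by simp
  have "c / z \<le> 1 / 100" using zg by (simp add: field_simps)
  then have "\<bar>d\<bar> \<le> pi / 2" using near T pi_gt3 unfolding d_def by linarith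
  from abs_sin_lower[OF this] have "\<bar>d\<bar> \<le> 3 * \<bar>sin d\<bar>" by simp
  also have "\<bar>sin d\<bar> = \<bar>cos (Th z 1)\<bar>"
  proof -
    have "cos (Th z 1) = cos (nu n + d)" by (simp add: d_def)
    also have "\<dots> = - (sin (nu n) * sin d)" by (simp add: cos_add cos_nu)
    finally show ?thesis using sin_nu_sq[of n] by (auto simp: abs_mult power2_eq_1_iff)
  qed
  also have "\<bar>cos (Th z 1)\<bar> \<le> 29 * c\<^sup>2 / z ^ 3" by (rule wkb_phase_equation(1)[OF z Y])
  finally have d: "\<bar>d\<bar> \<le> 87 * (c\<^sup>2 / z ^ 3)" by simp
  have pos: "0 \<le> c\<^sup>2 / z ^ 3" using zg(3) by simp
  have "\<bar>d\<bar> \<le> 90 * (c\<^sup>2 / z ^ 3)" using d pos by linarith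
  then show "\<bar>Th z 1 - nu n\<bar> \<le> 90 * c\<^sup>2 / z ^ 3" by (simp add: d_def)
  have "87 * (c\<^sup>2 / z ^ 3) \<le> c / z"
  proof -
    have "87 * c \<le> z * z" using mult_mono[of 1 z "87 * c" z] zg c1 by simp
    then have "87 * c * c \<le> z * z * c" using c1 by (intro mult_right_mono) auto
    then show ?thesis using zg(3) by (simp add: field_simps power2_eq_square power3_eq_cube)
  qed
  then have "\<bar>z - nu n\<bar> \<le> c / z + c / z" using d T unfolding d_def by linarith
  then show "\<bar>z - nu n\<bar> \<le> 2 * c / z" by simp
qed

lemma nu_z: "z / 2 \<le> nu n" "nu n \<le> 2 * z"
proof -
  have "\<bar>z - nu n\<bar> < 1" using near pi_less_4 by linarith
  then have "z - nu n < 1" "nu n - z < 1" by (simp_all only: abs_less_iff minus_diff_eq)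
  then show "z / 2 \<le> nu n" "nu n \<le> 2 * z" using z_ge(1)[OF z] by linarith+
qed

text \<open>Replacing the phase by \<open>nu n * x\<close> gains two powers of \<open>z\<close>: the
  two phases differ by \<open>O(1/z)\<close>, and integrating the derivative of
  \<open>W * \<Delta>\<close> gains another \<open>1/z\<close> because \<open>W1\<close> is
  integrable.\<close>

lemma oscillating_W: "\<bar>Jint (\<lambda>x. W x * cos (2 * Th z x)) 1 - Jint (\<lambda>x. W x * cos (2 * nu n * x)) 1\<bar> \<le> 18 * c\<^sup>2 / z\<^sup>2"
proof -
  note zg = z_ge[OF z]
  define v where "v = nu n"
  note zv = phase_defect(2)[folded v_def] and vz = nu_z[folded v_def]
  have T2: "AC_with_deriv 0 1 (\<lambda>x. 2 * Th z x) (\<lambda>x. 2 * (z / (aw z x)\<^sup>2))" by (rule AC_cmult[OF Th_AC[OF z]])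
  have cT2: "continuous_on {0..1} (\<lambda>x. 2 * (z / (aw z x)\<^sup>2))"
    by (intro continuous_on_mult continuous_on_const Th_deriv_continuous[OF z])
  note T2s = AC_cos_sin[OF T2 cT2] and Ls = AC_linear_phase[of "2 * v"]
  have i1: "(\<lambda>x. W x * cos (2 * Th z x)) absolutely_integrable_on {0..1}"
    and i2: "(\<lambda>x. W x * cos (2 * v * x)) absolutely_integrable_on {0..1}"
    by (intro absolutely_integrable_continuous_real continuous_on_mult AC_continuous[OF W_AC] AC_continuous[OF T2s(1)] AC_continuous[OF Ls(1)])+
  define \<Delta> where "\<Delta> x = sin (2 * Th z x) - sin (2 * v * x)" for x
  define g where "g x = W1 x * \<Delta> x + W x * (cos (2 * Th z x) * (2 * (z / (aw z x)\<^sup>2) - 2 * v))" for x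
  have aG: "AC_with_deriv 0 1 (\<lambda>x. W x * \<Delta> x - 2 * v * (Jint (\<lambda>x. W x * cos (2 * Th z x)) x - Jint (\<lambda>x. W x * cos (2 * v * x)) x)) g"
    unfolding \<Delta>_def
    by (rule AC_cong[OF AC_diff[OF AC_mult[OF W_AC AC_diff[OF T2s(2) Ls(2)]] AC_cmult[OF AC_diff[OF Jint_AC[OF i1] Jint_AC[OF i2]], of "2 * v"]]])
      (simp_all add: g_def \<Delta>_def algebra_simps)
  have \<Delta>: "\<bar>\<Delta> x\<bar> \<le> 6 * c / z" if x: "x \<in> {0..1}" for x
  proof -
    have "\<bar>\<Delta> x\<bar> \<le> \<bar>2 * Th z x - 2 * v * x\<bar>"
      using abs_cos_diff_le[of "2 * Th z x - pi / 2" "2 * v * x - pi / 2"] by (simp add: \<Delta>_def cos_diff)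
    moreover have "\<bar>(z - v) * x\<bar> \<le> 2 * c / z * 1" using zv x by (intro abs_mult_le) auto
    moreover have "2 * Th z x - 2 * v * x = 2 * (Th z x - z * x) + 2 * ((z - v) * x)" by (simp add: algebra_simps)
    moreover note Th_close(2)[OF x]
    moreover have "\<bar>m\<bar> \<le> 2 * e1 + 2 * e2" if "\<bar>m\<bar> \<le> \<bar>w\<bar>" "\<bar>b\<bar> \<le> e2" "w = 2 * a + 2 * b" "\<bar>a\<bar> \<le> e1" for m w a b e1 e2 :: real
      using that by linarith
    ultimately have "\<bar>\<Delta> x\<bar> \<le> 2 * (c / z) + 2 * (2 * c / z * 1)" by blast
    then show ?thesis by simp
  qed
  have W1i: "(\<lambda>x. \<bar>W1 x\<bar>) absolutely_integrable_on {0..1}"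
    using absolutely_integrable_norm[OF AC_integrable[OF W_AC]] by (simp add: o_def)
  define h where "h x = 6 * c / z * \<bar>W1 x\<bar> + 6 * c\<^sup>2 / z" for x
  have aH: "AC_with_deriv 0 1 (\<lambda>x. 6 * c / z * Jint (\<lambda>x. \<bar>W1 x\<bar>) x + 6 * c\<^sup>2 / z * x) h"
    unfolding h_def[abs_def] by (intro AC_add AC_cmult Jint_AC W1i AC_linear_phase(3))
  have "norm (Jint g 1) \<le> Jint h 1"
  proof (rule norm_Jint_le[OF AC_integrable[OF aG] AC_integrable[OF aH]])
    fix x :: real assume x: "x \<in> {0..1}"
    have "\<bar>W1 x * \<Delta> x\<bar> \<le> \<bar>W1 x\<bar> * (6 * c / z)" using \<Delta>[OF x] by (intro abs_mult_le) auto
    moreover have "\<bar>2 * (z / (aw z x)\<^sup>2) - 2 * v\<bar> \<le> 6 * c / z"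
    proof -
      have "6 * c / z = 2 * (c / z) + 2 * (2 * c / z)" by simp
      then show ?thesis using Th_close(1)[OF x] zv by linarith
    qed
    then have "\<bar>W x * (cos (2 * Th z x) * (2 * (z / (aw z x)\<^sup>2) - 2 * v))\<bar> \<le> c * (1 * (6 * c / z))"
      using bounds[OF x] by (intro abs_mult_le) auto
    ultimately show "norm (g x) \<le> h x" unfolding g_def h_def
      using abs_triangle_ineq[of "W1 x * \<Delta> x" "W x * (cos (2 * Th z x) * (2 * (z / (aw z x)\<^sup>2) - 2 * v))"]
      by (simp add: power2_eq_square mult_ac)
  qed simp
  moreover have "Jint h 1 \<le> 12 * c\<^sup>2 / z"
  proof -
    have "Jint h 1 = 6 * c / z * Jint (\<lambda>x. \<bar>W1 x\<bar>) 1 + 6 * c\<^sup>2 / z" using AC_eq_Jint[OF aH, of 1] by simp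
    also have "\<dots> \<le> 6 * c / z * c + 6 * c\<^sup>2 / z" using W1_bound c1 zg(3) by (intro add_right_mono mult_left_mono) auto
    finally show ?thesis by (simp add: power2_eq_square)
  qed
  moreover have "\<bar>W 1 * \<Delta> 1\<bar> \<le> c * (6 * c / z)" using bounds[of 1] \<Delta>[of 1] by (intro abs_mult_le) auto
  moreover have "c * (6 * c / z) = 6 * c\<^sup>2 / z" by (simp add: power2_eq_square)
  moreover have "12 * c\<^sup>2 / z + 6 * c\<^sup>2 / z = 18 * c\<^sup>2 / z" by simp
  moreover define X where "X = Jint (\<lambda>x. W x * cos (2 * Th z x)) 1 - Jint (\<lambda>x. W x * cos (2 * v * x)) 1"
  have "W 1 * \<Delta> 1 - 2 * v * X = Jint g 1"
    using AC_eq_Jint[OF aG, of 1] by (simp add: X_def \<Delta>_def wkb_at_0[OF z])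
  ultimately have "\<bar>2 * v * X\<bar> \<le> 18 * c\<^sup>2 / z" unfolding real_norm_def by linarith
  moreover have "z * \<bar>X\<bar> \<le> 2 * v * \<bar>X\<bar>" using vz by (intro mult_right_mono) auto
  ultimately have "z * \<bar>X\<bar> \<le> 18 * c\<^sup>2 / z" using vz zg(3) by (simp add: abs_mult)
  then show ?thesis using zg(3) by (simp add: X_def v_def field_simps power2_eq_square)
qed

lemma phase_defect_expansion:
  "\<bar>z\<^sup>2 * (2 * z ^ 3 * (Th z 1 - nu n) - (fourier0 q + norm_sq p / 16 + fourier_c q n + (nu n)\<^sup>2 * fourier_c p n) / 2)\<bar> \<le> 50 * c ^ 4"
proof -
  note zg = z_ge[OF z]
  define d where "d = Th z 1 - nu n"
  define S where "S = fourier0 q + norm_sq p / 16 + fourier_c q n + (nu n)\<^sup>2 * fourier_c p n"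
  define s where "s = c ^ 4 / z\<^sup>2"
  have s0: "0 \<le> s" by (simp add: s_def)
  have s2: "c\<^sup>2 / z\<^sup>2 \<le> s" unfolding s_def by (rule error_terms(4)[OF z])
  have T2: "2 * Th z 1 = 2 * nu n + 2 * d" by (simp add: d_def)
  have sin2: "sin (2 * Th z 1) = - sin (2 * d)" unfolding T2 sin_add by (simp add: double_nu)
  have "Jint (\<lambda>x. W x * (cos (Th z x))\<^sup>2) 1 = Jint (\<lambda>x. 0 + (1 / 2) * W x + (1 / 2) * (W x * cos (2 * Th z x))) 1"
    by (rule arg_cong[where f = "\<lambda>F. Jint F 1"]) (auto simp: cos_double_cos algebra_simps)
  also have "\<dots> = Jint W 1 / 2 + Jint (\<lambda>x. W x * cos (2 * Th z x)) 1 / 2"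
  proof (subst Jint_linear3)
    show "(\<lambda>x. W x * cos (2 * Th z x)) absolutely_integrable_on {0..1}"
      by (intro absolutely_integrable_continuous_real continuous_on_mult continuous_on_cos continuous_on_const AC_continuous[OF W_AC] AC_continuous[OF Th_AC[OF z]])
    show "W absolutely_integrable_on {0..1}" by (rule absolutely_integrable_continuous_real[OF AC_continuous[OF W_AC]])
  qed (simp_all add: Jint_def)
  finally have J: "Jint (\<lambda>x. W x * (cos (Th z x))\<^sup>2) 1 = (fourier0 q + norm_sq p / 16) / 2 + Jint (\<lambda>x. W x * cos (2 * Th z x)) 1 / 2"
    unfolding mean_W .
  have "c\<^sup>2 / (8 * (nu n)\<^sup>2) \<le> c\<^sup>2 / z\<^sup>2"
  proof (rule divide_left_mono)
    have "(z / 2)\<^sup>2 \<le> (nu n)\<^sup>2" using nu_z(1) zg(3) by (intro power_mono) auto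
    then have "z\<^sup>2 \<le> 4 * (nu n)\<^sup>2" by (simp add: power_divide)
    then show "z\<^sup>2 \<le> 8 * (nu n)\<^sup>2" using zero_le_power2[of "nu n"] by linarith
  qed (use zg(3) nu_pos[of n] in auto)
  then have "c\<^sup>2 / (8 * (nu n)\<^sup>2) \<le> s" using s2 by linarith
  note fW = order_trans[OF fourier_W[of n] this]
  have oW: "\<bar>Jint (\<lambda>x. W x * cos (2 * Th z x)) 1 - Jint (\<lambda>x. W x * cos (2 * nu n * x)) 1\<bar> \<le> 18 * s"
    using oscillating_W s2 by simp
  have "20 * c ^ 4 / z\<^sup>2 = 20 * s" by (simp add: s_def)
  then have "\<bar>z ^ 3 * (- sin (2 * d)) - p1 0 / 4 + ((fourier0 q + norm_sq p / 16) / 2 + Jint (\<lambda>x. W x * cos (2 * Th z x)) 1 / 2)\<bar> \<le> 20 * s"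
    using wkb_phase_equation(2)[OF z Y] unfolding sin2 J by simp
  \<comment> \<open>The boundary term \<open>p1 0 / 4\<close> of the phase equation cancels half of
    the \<open>p1 0 / 2\<close> in the Fourier coefficient of \<open>W\<close>. The errors add up to
    \<open>20 + 18 / 2 + 1 / 2 < 30\<close>.\<close>
  moreover have "\<bar>X - S / 2\<bar> \<le> 30 * s" if "\<bar>- X - p1 0 / 4 + ((fourier0 q + norm_sq p / 16) / 2 + a / 2)\<bar> \<le> 20 * s"
     "\<bar>a - b\<bar> \<le> 18 * s" "\<bar>b - (fourier_c q n + p1 0 / 2 + (nu n)\<^sup>2 * fourier_c p n)\<bar> \<le> s" for X a b
    using that s0 unfolding S_def by (simp add: abs_le_iff field_simps)
  ultimately have main: "\<bar>z ^ 3 * sin (2 * d) - S / 2\<bar> \<le> 30 * s" using oW fW by (simp only: mult_minus_right)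
  have d: "\<bar>d\<bar> \<le> 90 * c\<^sup>2 / z ^ 3" unfolding d_def by (rule phase_defect(1))
  \<comment> \<open>Linearising the sine is cheap: the defect is
    \<open>O(z\<^sup>-\<^sup>3)\<close>, so the cubic remainder, even after multiplication by
    \<open>z\<^sup>3\<close>, is \<open>O(z\<^sup>-\<^sup>6)\<close>.\<close>
  have "\<bar>sin (2 * d) - 2 * d\<bar> \<le> \<bar>2 * d\<bar> ^ 3 / 6" by (rule abs_sin_minus_self_le)
  also have "\<dots> \<le> (180 * c\<^sup>2 / z ^ 3) ^ 3 / 6" using d by (intro divide_right_mono power_mono) auto
  finally have "z ^ 3 * \<bar>sin (2 * d) - 2 * d\<bar> \<le> z ^ 3 * ((180 * c\<^sup>2 / z ^ 3) ^ 3 / 6)" using zg(3) by (intro mult_left_mono) auto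
  also have "\<dots> = 972000 * (c ^ 6 / z ^ 6)" using zg(3) by (simp add: power_divide power_mult_distrib eval_nat_numeral)
  also have "\<dots> \<le> 1 * s"
  proof -
    have "10000 * c ^ 6 \<le> z\<^sup>2" using power_mono[OF z, of 2] c1 by (simp add: power_mult_distrib power_mult[symmetric])
    moreover have "10000 \<le> z\<^sup>2" using power_mono[OF zg(1), of 2] by simp
    then have "10000 * z\<^sup>2 \<le> z\<^sup>2 * z\<^sup>2" by (intro mult_right_mono) auto
    ultimately have "972000 * c ^ 6 \<le> z\<^sup>2 * z\<^sup>2" by (smt (verit) zero_le_power2)
    also have "\<dots> \<le> c ^ 4 * (z\<^sup>2 * z\<^sup>2)" using c_powers(4) mult_right_mono[of 1 "c ^ 4" "z\<^sup>2 * z\<^sup>2"] by simp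
    finally show ?thesis using zg(3) by (simp add: s_def field_simps eval_nat_numeral)
  qed
  also have "z ^ 3 * \<bar>sin (2 * d) - 2 * d\<bar> = \<bar>z ^ 3 * (sin (2 * d) - 2 * d)\<bar>" using zg(3) by (simp add: abs_mult)
  finally have "\<bar>z ^ 3 * sin (2 * d) - 2 * z ^ 3 * d\<bar> \<le> s" by (simp add: right_diff_distrib mult_ac)
  with main have "\<bar>2 * z ^ 3 * d - S / 2\<bar> \<le> 31 * s" by linarith
  then have "z\<^sup>2 * \<bar>2 * z ^ 3 * d - S / 2\<bar> \<le> z\<^sup>2 * (31 * s)" by (intro mult_left_mono) auto
  also have "z\<^sup>2 * (31 * s) = 31 * c ^ 4" using zg(3) by (simp add: s_def)
  finally have "\<bar>z\<^sup>2 * (2 * z ^ 3 * d - S / 2)\<bar> \<le> 31 * c ^ 4" by (simp add: abs_mult)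
  also have "31 * c ^ 4 \<le> 50 * c ^ 4" using c_powers(4) by linarith
  finally show ?thesis unfolding d_def S_def .
qed

lemma eigenvalue_expansion:
  "\<bar>z ^ 4 - ((nu n) ^ 4 + (nu n)\<^sup>2 * (fourier_c p n - fourier0 p) + ((fourier0 p)\<^sup>2 - norm_sq p) / 8 + fourier0 q + fourier_c q n)\<bar>
    \<le> 400 * (90 * c ^ 4) ^ 4 / z\<^sup>2"
proof -
  note zg = z_ge[OF z]
  define S where "S = fourier0 q + norm_sq p / 16 + fourier_c q n + (nu n)\<^sup>2 * fourier_c p n"
  note cp = c_powers
  have "\<bar>z ^ 4 - ((nu n) ^ 4 + S - 4 * (fourier0 p / 4) * (nu n)\<^sup>2 + 2 * (fourier0 p / 4)\<^sup>2 - 4 * (3 * norm_sq p / 64))\<bar> \<le> 400 * (90 * c ^ 4) ^ 4 / z\<^sup>2"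
  proof (rule fourth_power_expansion[where d = "Th z 1 - nu n"])
    show "1 \<le> 90 * c ^ 4" using cp(4) by linarith
    show "1 \<le> z" using zg(1) by simp
    have "z * \<bar>z - nu n\<bar> \<le> z * (2 * c / z)" using phase_defect(2) zg(3) by (intro mult_left_mono) auto
    then have "z * \<bar>z - nu n\<bar> \<le> 2 * c" using zg(3) by simp
    then have "\<bar>z * (nu n - z)\<bar> \<le> 2 * c" using zg(3) by (simp add: abs_mult abs_minus_commute)
    then show "\<bar>z * (nu n - z)\<bar> \<le> 90 * c ^ 4" using cp by linarith
    have "z ^ 3 * \<bar>Th z 1 - nu n\<bar> \<le> z ^ 3 * (90 * c\<^sup>2 / z ^ 3)" using phase_defect(1) zg(3) by (intro mult_left_mono) auto
    then have "z ^ 3 * \<bar>Th z 1 - nu n\<bar> \<le> 90 * c\<^sup>2" using zg(3) by simp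
    then have "\<bar>z ^ 3 * (Th z 1 - nu n)\<bar> \<le> 90 * c\<^sup>2" using zg(3) by (simp add: abs_mult)
    then show "\<bar>z ^ 3 * (Th z 1 - nu n)\<bar> \<le> 90 * c ^ 4" using cp by linarith
    have "nu n + (Th z 1 - nu n) = Th z 1" by simp
    then show "\<bar>z ^ 5 * (nu n + (Th z 1 - nu n) - (z + fourier0 p / 4 / z + 3 * norm_sq p / 64 / z ^ 3))\<bar> \<le> 90 * c ^ 4"
      using order_trans[OF Th_end, of "90 * c ^ 4"] cp by simp
    show "\<bar>fourier0 p / 4\<bar> \<le> 90 * c ^ 4" using means_bound(1) cp by linarith
    have "3 * norm_sq p / 64 = 3 / 64 * norm_sq p" by simp
    then show "\<bar>3 * norm_sq p / 64\<bar> \<le> 90 * c ^ 4" using means_bound(2) cp by linarith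
    show "\<bar>z\<^sup>2 * (2 * z ^ 3 * (Th z 1 - nu n) - S / 2)\<bar> \<le> 90 * c ^ 4"
      unfolding S_def by (rule order_trans[OF phase_defect_expansion]) (use cp in simp)
  qed
  \<comment> \<open>The origin of the constant term: the inversion contributes
    \<open>p0\<^sup>2 / 8 - 3 norm_sq p / 16\<close> and the mean of \<open>W\<close> contributes
    \<open>norm_sq p / 16\<close>, together \<open>(p0\<^sup>2 - norm_sq p) / 8\<close>.\<close>
  moreover have "(nu n) ^ 4 + S - 4 * (fourier0 p / 4) * (nu n)\<^sup>2 + 2 * (fourier0 p / 4)\<^sup>2 - 4 * (3 * norm_sq p / 64)
    = (nu n) ^ 4 + (nu n)\<^sup>2 * (fourier_c p n - fourier0 p) + ((fourier0 p)\<^sup>2 - norm_sq p) / 8 + fourier0 q + fourier_c q n"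
    by (simp add: S_def power2_eq_square field_simps)
  ultimately show ?thesis by simp
qed

end
end

lemma asymptotics_bounded:
  "(\<lambda>n. mu p q n - of_real ((pi / 2 + pi * real n) ^ 4
             + (pi / 2 + pi * real n)\<^sup>2 * (fourier_c p n - fourier0 p)
             + ((fourier0 p)\<^sup>2 - norm_sq p) / 8 + fourier0 q + fourier_c q n))
          \<in> O(\<lambda>n. 1 / (of_nat n)\<^sup>2)"
proof (rule bigoI)
  define K where "K = 400 * (90 * c ^ 4) ^ 4"
  have K0: "0 \<le> K" by (simp add: K_def)
  show "\<forall>\<^sub>F n in sequentially. norm (mu p q n - of_real ((pi / 2 + pi * real n) ^ 4
             + (pi / 2 + pi * real n)\<^sup>2 * (fourier_c p n - fourier0 p)
             + ((fourier0 p)\<^sup>2 - norm_sq p) / 8 + fourier0 q + fourier_c q n)) \<le> 4 * K * norm (1 / (of_nat n :: complex)\<^sup>2)"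
    using eigenvalue_parameter[of "100 * c ^ 3"] eventually_gt_at_top[of 0]
  proof eventually_elim
    case (elim n)
    then obtain z Y where z: "100 * c ^ 3 \<le> z" "nu n \<le> 2 * z" "\<bar>z - nu n\<bar> < pi / 4" "mu p q n = of_real (z ^ 4)" "eigsol (of_real z ^ 4) Y"
      by blast
    define m where "m = (nu n) ^ 4 + (nu n)\<^sup>2 * (fourier_c p n - fourier0 p) + ((fourier0 p)\<^sup>2 - norm_sq p) / 8 + fourier0 q + fourier_c q n"
    have n0: "0 < real n" using elim(2) by simp
    have "\<bar>z ^ 4 - m\<bar> \<le> K / z\<^sup>2" unfolding K_def m_def by (rule eigenvalue_expansion[OF z(1,5,3)])
    also have "\<dots> \<le> K / (real n / 2)\<^sup>2"
    proof (rule divide_left_mono[OF _ K0])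
      have "real n / 2 \<le> z" using z(2) nu_ge[of n] by linarith
      then show "(real n / 2)\<^sup>2 \<le> z\<^sup>2" using n0 by (intro power_mono) auto
      show "0 < z\<^sup>2 * (real n / 2)\<^sup>2" using n0 \<open>real n / 2 \<le> z\<close> by simp
    qed
    also have "\<dots> = 4 * K * norm (1 / (of_nat n :: complex)\<^sup>2)" by (simp add: norm_divide norm_power power_divide)
    finally have "norm (complex_of_real (z ^ 4 - m)) \<le> 4 * K * norm (1 / (of_nat n :: complex)\<^sup>2)" by (simp only: norm_of_real)
    then show ?case unfolding z(4) m_def nu_def by (simp only: of_real_diff)
  qed
qed

end

section \<open>Removal of the uniform bound\<close>

context quartic_smooth
begin

lemma bounded_instance: obtains c where "quartic_bounded p q p1 p2 p3 q1 c"
proof -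
  obtain a0 where a0: "\<And>x. x \<in> {0..1} \<Longrightarrow> norm (p x) \<le> a0" by (rule continuous_on_unit_interval_bound[OF AC_continuous[OF p_AC]]) blast
  obtain a1 where a1: "\<And>x. x \<in> {0..1} \<Longrightarrow> norm (p1 x) \<le> a1" by (rule continuous_on_unit_interval_bound[OF AC_continuous[OF p1_AC]]) blast
  obtain a2 where a2: "\<And>x. x \<in> {0..1} \<Longrightarrow> norm (p2 x) \<le> a2" by (rule continuous_on_unit_interval_bound[OF AC_continuous[OF p2_AC]]) blast
  obtain a3 where a3: "\<And>x. x \<in> {0..1} \<Longrightarrow> norm (V x) \<le> a3" by (rule continuous_on_unit_interval_bound[OF V_continuous]) blast
  obtain a4 where a4: "\<And>x. x \<in> {0..1} \<Longrightarrow> norm (W x) \<le> a4" by (rule continuous_on_unit_interval_bound[OF AC_continuous[OF W_AC]]) blast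
  define c where "c = Max {1, a0, a1, a2, a3, a4, Jint (\<lambda>x. \<bar>W1 x\<bar>) 1}"
  have c: "1 \<le> c" "a0 \<le> c" "a1 \<le> c" "a2 \<le> c" "a3 \<le> c" "a4 \<le> c" "Jint (\<lambda>x. \<bar>W1 x\<bar>) 1 \<le> c"
    unfolding c_def by (rule Max_ge; simp)+
  show ?thesis
  proof (rule that[of c], unfold_locales)
    fix x :: real assume x: "x \<in> {0..1}"
    show "\<bar>p x\<bar> \<le> c \<and> \<bar>p1 x\<bar> \<le> c \<and> \<bar>p2 x\<bar> \<le> c \<and> \<bar>V x\<bar> \<le> c \<and> \<bar>W x\<bar> \<le> c"
      using a0[OF x] a1[OF x] a2[OF x] a3[OF x] a4[OF x] c unfolding real_norm_def by linarith
  qed (fact c)+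
qed

lemma asymptotics_smooth:
  "(\<lambda>n. mu p q n - of_real ((pi / 2 + pi * real n) ^ 4
             + (pi / 2 + pi * real n)\<^sup>2 * (fourier_c p n - fourier0 p)
             + ((fourier0 p)\<^sup>2 - norm_sq p) / 8 + fourier0 q + fourier_c q n))
          \<in> O(\<lambda>n. 1 / (of_nat n)\<^sup>2)"
  by (rule bounded_instance) (rule quartic_bounded.asymptotics_bounded)

end

theorem theorem1:
  fixes p q :: "real \<Rightarrow> real"
  assumes "deriv_in_L1_torus 0 p" and "deriv_in_L1_torus 0 q"
  shows "(\<forall>\<^sub>F n in sequentially.
            H_eigenvalue p q (mu p q n) \<and> mu p q n \<in> \<real> \<and> alg_mult p q (mu p q n) = 1)
    \<and> (\<lambda>n. mu p q n - of_real ((pi / 2 + pi * real n) ^ 4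
             + (pi / 2 + pi * real n)\<^sup>2 * (fourier_c p n - fourier0 p)))
          \<in> O(\<lambda>n. of_nat n)
    \<and> (deriv_in_L1_torus 3 p \<and> deriv_in_L1_torus 1 q \<longrightarrow>
        (\<lambda>n. mu p q n - of_real ((pi / 2 + pi * real n) ^ 4
             + (pi / 2 + pi * real n)\<^sup>2 * (fourier_c p n - fourier0 p)
             + ((fourier0 p)\<^sup>2 - norm_sq p) / 8 + fourier0 q + fourier_c q n))
          \<in> O(\<lambda>n. 1 / (of_nat n)\<^sup>2))"
  proof -
  have p: "p absolutely_integrable_on {0..1}" and q: "q absolutely_integrable_on {0..1}"
    using assms unfolding deriv_in_L1_torus_def by auto
  interpret quartic p q by unfold_locales fact+
  have 1: "\<forall>\<^sub>F n in sequentially. H_eigenvalue p q (mu p q n) \<and> mu p q n \<in> \<real> \<and> alg_mult p q (mu p q n) = 1"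
    using mu_location by (rule eventually_mono) (metis Reals_of_real)
  have 3: "(\<lambda>n. mu p q n - of_real ((pi / 2 + pi * real n) ^ 4
             + (pi / 2 + pi * real n)\<^sup>2 * (fourier_c p n - fourier0 p)
             + ((fourier0 p)\<^sup>2 - norm_sq p) / 8 + fourier0 q + fourier_c q n))
          \<in> O(\<lambda>n. 1 / (of_nat n)\<^sup>2)" if smooth: "deriv_in_L1_torus 3 p \<and> deriv_in_L1_torus 1 q"
  proof -
    \<comment> \<open>Absolute continuity is available on every interval; its instance on
      \<open>{0..1}\<close> is taken, and periodicity of \<open>g 1\<close> at 0 supplies the equal
      end values.\<close>
    obtain g where g: "g 0 = p" "\<And>j x. j \<le> 3 \<Longrightarrow> g j (x + 1) = g j x" "\<And>j. j < 3 \<Longrightarrow> AC_with_deriv 0 1 (g j) (g (Suc j))"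
      using smooth unfolding deriv_in_L1_torus_def by (metis zero_le_one)
    obtain h where h: "h 0 = q" "AC_with_deriv 0 1 (h 0) (h (Suc 0))"
      using smooth unfolding deriv_in_L1_torus_def by (metis zero_le_one zero_less_one)
    interpret quartic_smooth p q "g 1" "g 2" "g 3" "h 1"
    proof unfold_locales
      show "AC_with_deriv 0 1 p (g 1)" "AC_with_deriv 0 1 (g 1) (g 2)" "AC_with_deriv 0 1 (g 2) (g 3)"
        using g(3)[of 0] g(3)[of 1] g(3)[of 2] g(1) by (simp_all add: eval_nat_numeral)
      show "AC_with_deriv 0 1 q (h 1)" using h by simp
      show "g 1 1 = g 1 0" using g(2)[of 1 0] by simp
    qed
    show ?thesis by (rule asymptotics_smooth)
  qed
  from 1 asymptotics_L1 3 show ?thesis by blast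
qed

end
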